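(* Let $m_1,m_2,m_3>0$ and let $Q:\mathbb{C}\times\mathbb{C}\to\mathbb{C}$ be one of the functions specified in (1)--(4) below. For $\varphi=(\varphi_1,\varphi_2,\varphi_3)$ consider the initial value problem for $u=(u_1,u_2,u_3)$, a $\mathbb{C}^3$-valued function of $(t,x)$: $$ \begin{cases} \left(i\partial_t+\frac{1}{2m_1}\partial_x^2\right)u_1=0,\\[2pt] \left(i\partial_t+\frac{1}{2m_2}\partial_x^2\right)u_2=u_1^2,\\[2pt] \left(i\partial_t+\frac{1}{2m_3}\partial_x^2\right)u_3=(\partial_x u_3)^2+Q(u_1,u_2)\,\dfrac{\exp(2m_3u_3)}{2m_3}, \end{cases} \qquad t>0,\ x\in\mathbb{R}, $$ $$ u_j(0,x)=\varphi_j(x),\quad x\in\mathbb{R},\ j=1,2,3. \tag{P} $$ (1) Let $Q(u_1,u_2)=u_2^2$ and assume $m_1:m_2:m_3=1:2:4$. Then, for any $\varepsilon\in(0,1]$ and $s\ge 1$, there exists $\varphi\in H^s(\mathbb{R})$ with $\|\varphi\|_{H^s}=\varepsilon$ such that the corresponding solution $u$ of (P) satisfies $$\lim_{t\to T_\varepsilon-0}\|u(t,\cdot)\|_{H^s}=\infty$$ with some $T_\varepsilon\in(\kappa\varepsilon^{-4},K\varepsilon^{-4})$, where $\kappa$ and $K$ are positive constants not depending on $\varepsilon$. (2) Let $Q(u_1,u_2)=u_1u_2$ and assume $m_1:m_2:m_3=1:2:3$. Then, for any $\varepsilon\in(0,1]$ and $s\ge 1$, there exists $\varphi\in H^s(\mathbb{R})$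 with $\|\varphi\|_{H^s}=\varepsilon$ such that the corresponding solution $u$ of (P) satisfies $$\lim_{t\to T_\varepsilon-0}\|u(t,\cdot)\|_{H^s}=\infty$$ with some $T_\varepsilon\in(\kappa\varepsilon^{-6},K\varepsilon^{-6})$, where $\kappa$ and $K$ are positive constants not depending on $\varepsilon$. (3) Let $Q(u_1,u_2)=\overline{u_1}u_2$ and assume $m_1:m_2:m_3=1:2:1$. Then, for any $\varepsilon\in(0,1]$ and $s\ge 1$, there exists $\varphi\in H^s(\mathbb{R})$ with $\|\varphi\|_{H^s}=\varepsilon$ such that the corresponding solution $u$ of (P) satisfies $$\lim_{t\to T_\varepsilon-0}\|u(t,\cdot)\|_{H^s}=\infty$$ with some $T_\varepsilon\in(\kappa\varepsilon^{-6},K\varepsilon^{-6})$, where $\kappa$ and $K$ are positive constants not depending on $\varepsilon$. (4) Let $Q(u_1,u_2)=|u_2|u_2$ and assume $m_1:m_2:m_3=1:2:2$. Then, for any $\varepsilon\in(0,1]$, there exists $\varphi\in H^1(\mathbb{R})$ with $\|\varphi\|_{H^1}=\varepsilon$ such that the corresponding solution $u$ of (P) satisfies $$\lim_{t\to T_\varepsilon-0}\|u(t,\cdot)\|_{H^1}=\infty$$ with some $T_\varepsilon\in(\kappa\varepsilon^{-4},K\varepsilon^{-4})$, where $\kappa$ and $K$ are positive constants not depending on $\varepsilon$.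
   Context: $H^s(\mathbb{R})=\{\psi:\ \partial_x^k\psi\in L^2(\mathbb{R})\text{ for all integers }0\le k\le s\}$, with norm $\|\psi\|_{H^s}=\sum_{0\le k\le s}\|\partial_x^k\psi\|_{L^2}$ ($k$ ranging over integers). The same notation is used for $\mathbb{C}^3$-valued functions, with the $L^2$ norm of $\mathbb{C}^3$-valued functions. The constants $\kappa$, $K$ may depend on $s$ and on the masses $m_j$ (and on the case), but not on $\varepsilon$. "The corresponding solution" is the solution $u\in C([0,T_\varepsilon);H^s(\mathbb{R}))$ of the initial value problem with initial data $\varphi$ (with $s=1$ in part (4)), the equations being understood in the sense of distributions; in particular $\|u(t,\cdot)\|_{H^s}<\infty$ for $0\le t<T_\varepsilon$. *)

theory Defs
  imports "HOL-Analysis.Analysis"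
begin

text \<open>Since all iterated directional derivatives are required to be differentiable, on a
  finite-dimensional space \<open>\<forall>n. higher_differentiable n f\<close> is \<open>C\<^sup>\<infinity>\<close> smoothness.\<close>

primrec higher_differentiable ::
  "nat \<Rightarrow> ('a::real_normed_vector \<Rightarrow> 'b::real_normed_vector) \<Rightarrow> bool" where
  "higher_differentiable 0 f \<longleftrightarrow> continuous_on UNIV f"
| "higher_differentiable (Suc n) f \<longleftrightarrow>
     (\<forall>x. f differentiable at x) \<and>
     (\<forall>v. higher_differentiable n (\<lambda>x. frechet_derivative f (at x) v))"

definition test_function :: "'a::euclidean_space set \<Rightarrow> ('a \<Rightarrow> real) \<Rightarrow> bool" where
  "test_function \<Omega> \<psi> \<longleftrightarrow>
     (\<forall>n. higher_differentiable n \<psi>) \<and>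
     (\<exists>C. compact C \<and> C \<subseteq> \<Omega> \<and> (\<forall>x. x \<notin> C \<longrightarrow> \<psi> x = 0))"

definition locally_integrable :: "(real \<Rightarrow> 'a::euclidean_space) \<Rightarrow> bool" where
  "locally_integrable f \<longleftrightarrow> (\<forall>C. compact C \<longrightarrow> set_integrable lborel C f)"

definition square_integrable :: "(real \<Rightarrow> 'a::euclidean_space) \<Rightarrow> bool" where
  "square_integrable f \<longleftrightarrow>
     f \<in> borel_measurable lborel \<and> integrable lborel (\<lambda>x. (norm (f x))\<^sup>2)"

definition L2_norm :: "(real \<Rightarrow> 'a::euclidean_space) \<Rightarrow> real" where
  "L2_norm f = sqrt (\<integral>x. (norm (f x))\<^sup>2 \<partial>lborel)"

definition has_weak_deriv ::
  "nat \<Rightarrow> (real \<Rightarrow> 'a::euclidean_space) \<Rightarrow> (real \<Rightarrow> 'a) \<Rightarrow> bool" where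
  "has_weak_deriv k f g \<longleftrightarrow>
     locally_integrable f \<and> locally_integrable g \<and>
     (\<forall>\<eta>. test_function UNIV \<eta> \<longrightarrow>
        (\<integral>x. (deriv ^^ k) \<eta> x *\<^sub>R f x \<partial>lborel) = (-1) ^ k *\<^sub>R (\<integral>x. \<eta> x *\<^sub>R g x \<partial>lborel))"

text \<open>The choice is determined up to a null set.\<close>

definition weak_deriv :: "nat \<Rightarrow> (real \<Rightarrow> 'a::euclidean_space) \<Rightarrow> real \<Rightarrow> 'a" where
  "weak_deriv k f = (SOME g. has_weak_deriv k f g)"

text \<open>The order \<open>s\<close> is real; only derivatives of integer order \<open>k \<le> s\<close> enter.
  Elements are functions, not classes modulo null sets.\<close>

definition sobolev_space :: "real \<Rightarrow> (real \<Rightarrow> 'a::euclidean_space) set" where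
  "sobolev_space s =
     {f. \<forall>k::nat. real k \<le> s \<longrightarrow> (\<exists>g. has_weak_deriv k f g \<and> square_integrable g)}"

definition sobolev_norm :: "real \<Rightarrow> (real \<Rightarrow> 'a::euclidean_space) \<Rightarrow> real" where
  "sobolev_norm s f = (\<Sum>k | real k \<le> s. L2_norm (weak_deriv k f))"

definition continuous_into_sobolev ::
  "real \<Rightarrow> real \<Rightarrow> (real \<Rightarrow> real \<Rightarrow> 'a::euclidean_space) \<Rightarrow> bool" where
  "continuous_into_sobolev s T u \<longleftrightarrow>
     (\<forall>t\<in>{0..<T}. u t \<in> sobolev_space s \<and>
        ((\<lambda>r. sobolev_norm s (\<lambda>x. u r x - u t x)) \<longlongrightarrow> 0) (at t within {0..<T}))"

text \<open>\<open>(\<i> \<partial>\<^sub>t + \<partial>\<^sub>x\<^sup>2 / (2 m)) v = F\<close> in the sense of distributions on \<open>(0,T) \<times> \<real>\<close>.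
  Integrals are iterated so that the condition depends on each \<open>v t\<close> and \<open>F t\<close> only
  up to a null set.\<close>

definition schrodinger_distributional ::
  "real \<Rightarrow> real \<Rightarrow> (real \<Rightarrow> real \<Rightarrow> complex) \<Rightarrow> (real \<Rightarrow> real \<Rightarrow> complex) \<Rightarrow> bool" where
  "schrodinger_distributional m T v F \<longleftrightarrow>
     (\<forall>\<psi>. test_function ({0<..<T} \<times> UNIV) \<psi> \<longrightarrow>
        (\<integral>t. (\<integral>x. v t x *
            (- \<i> * of_real (deriv (\<lambda>r. \<psi> (r, x)) t)
             + of_real (1 / (2 * m) * (deriv ^^ 2) (\<lambda>y. \<psi> (t, y)) x)) \<partial>lborel) \<partial>lborel)
        = (\<integral>t. (\<integral>x. F t x * of_real (\<psi> (t, x)) \<partial>lborel) \<partial>lborel))"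

definition is_solution ::
  "real \<Rightarrow> real \<Rightarrow> real \<Rightarrow> (complex \<Rightarrow> complex \<Rightarrow> complex) \<Rightarrow> real \<Rightarrow>
   (real \<Rightarrow> complex ^ 3) \<Rightarrow> real \<Rightarrow> (real \<Rightarrow> real \<Rightarrow> complex ^ 3) \<Rightarrow> bool" where
  "is_solution m1 m2 m3 Q s \<phi> T u \<longleftrightarrow>
     continuous_into_sobolev s T u \<and>
     (AE x in lborel. u 0 x = \<phi> x) \<and>
     schrodinger_distributional m1 T (\<lambda>t x. u t x $ 1) (\<lambda>t x. 0) \<and>
     schrodinger_distributional m2 T (\<lambda>t x. u t x $ 2) (\<lambda>t x. (u t x $ 1)\<^sup>2) \<and>
     schrodinger_distributional m3 T (\<lambda>t x. u t x $ 3)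
       (\<lambda>t x. (weak_deriv 1 (\<lambda>y. u t y $ 3) x)\<^sup>2
          + Q (u t x $ 1) (u t x $ 2) * (exp (of_real (2 * m3) * u t x $ 3) / of_real (2 * m3)))"

text \<open>Uniqueness is part of what it means to be \<^emph>\<open>the\<close> solution on \<open>[0,T)\<close>.\<close>

definition is_the_solution ::
  "real \<Rightarrow> real \<Rightarrow> real \<Rightarrow> (complex \<Rightarrow> complex \<Rightarrow> complex) \<Rightarrow> real \<Rightarrow>
   (real \<Rightarrow> complex ^ 3) \<Rightarrow> real \<Rightarrow> (real \<Rightarrow> real \<Rightarrow> complex ^ 3) \<Rightarrow> bool" where
  "is_the_solution m1 m2 m3 Q s \<phi> T u \<longleftrightarrow>
     is_solution m1 m2 m3 Q s \<phi> T u \<and>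
     (\<forall>v. is_solution m1 m2 m3 Q s \<phi> T v \<longrightarrow>
        (\<forall>t\<in>{0..<T}. AE x in lborel. v t x = u t x))"

end

theory Submission
 imports Defs "HOL-Computational_Algebra.Polynomial"
begin

text \<open>With \<open>z = 1 + \<i> t\<close>, the first two equations are solved by the Gaussians
  \<open>u\<^sub>1 = a z\<^sup>-\<^sup>1\<^sup>/\<^sup>2 exp (- m x\<^sup>2 / (2 z))\<close> and \<open>u\<^sub>2 = - 2 a\<^sup>2 (1 - z\<^sup>-\<^sup>1\<^sup>/\<^sup>2) exp (- m x\<^sup>2 / z)\<close>, and the mass
  ratios turn \<open>Q u\<^sub>1 u\<^sub>2\<close> into a multiple \<open>\<Lambda> a\<close> of a Gaussian in \<open>x\<close>, up to a factor depending on \<open>t\<close>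
  only. The Cole-Hopf substitution \<open>w = exp (- 2 m\<^sub>3 u\<^sub>3)\<close> linearises the third equation, so that
  \<open>w = 1 + \<Lambda> a G\<close> with an explicit Duhamel integral \<open>G\<close>. Now \<open>\<bar>G\<bar>\<close> is at most of order
  \<open>t\<^bsup>1 - e\<^esup>\<close> (\<open>e = 0\<close> or \<open>e = 1/2\<close>) and attains this order at \<open>x = 0\<close>, so \<open>sup\<^sub>x \<bar>G\<bar>\<close> first reaches
  \<open>1 / \<bar>\<Lambda> a\<bar>\<close> at a time of the stated size; the phase of \<open>a\<close> is chosen such that \<open>w\<close>
  vanishes at that time at a maximum point of \<open>\<bar>G\<bar>\<close>. There \<open>u\<^sub>3 = - ln w / (2 m\<^sub>3)\<close> is unbounded, hence
  so is the Sobolev norm. Uniqueness follows because \<open>exp (- 2 m\<^sub>3 u\<^sub>3) - 1\<close> of any solution in \<open>H\<^sup>1\<close>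
  is a weak solution of the linear equation, for which mass conservation applies.\<close>

section \<open>Smooth functions\<close>

text \<open>The mass ratios act as a resonance. A source exp (- \<mu> x^2 / (2 \<zeta>)) released at
  time \<tau> evolves freely by adding \<i> (t - \<tau>) to \<zeta>. In all four cases \<zeta>
  behaves like \<i> \<tau>, hence the sum like \<i> t: the contributions of all \<tau> arrive at x =
  0 with nearly equal phases and add up instead of cancelling. The exponent e is the decay of the
  source amplitude: the amplitude of u_2 tends to - 2 a^2 and costs nothing, while a factor u_1
  costs t^(-1/2). As \<Lambda> a has modulus r^k for r = \<bar>a\<bar>, reaching 1 takes a time of
  order r^(- k / (1 - e)). Strictly before this time \<Lambda> a G stays in a disc of radius less
  than 1, so the principal logarithm of w is smooth and the solution lies in every H^s at once; only
  the normalisation of the datum depends on s. The delicate side is uniqueness. A competing solution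
  is merely continuous in time with values in H^1 and solves the system in the sense of
  distributions, so neither the Cole-Hopf chain rule nor mass conservation applies to it directly.
  Both rest on the fact that squared L^2 increments over a time step are of smaller order than the
  step.\<close>

lemma hd_continuous: "higher_differentiable n f ==> continuous_on UNIV f"
 by (cases n) (auto intro!: continuous_at_imp_continuous_on differentiable_imp_continuous_within)

text \<open>\<open>frechet_derivative\<close> is a choice. By uniqueness of derivatives any explicit
  family \<open>f'\<close> may replace it, so later inductions never meet the choice
  operator.\<close>

lemma hd_SucI:
 assumes "!!x. (f has_derivative f' x) (at x)" "!!v. higher_differentiable n (%x. f' x v)"
 shows "higher_differentiable (Suc n) f"
proof -
 have "frechet_derivative f (at x) = f' x" for x using frechet_derivative_at[OF assms(1)] by simp
 then show ?thesis using assms by (auto simp: differentiable_def)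
qed

lemma hd_SucE:
 assumes "higher_differentiable (Suc n) f"
 obtains f' where "\<forall>x. (f has_derivative f' x) (at x)" "\<forall>v. higher_differentiable n (%x. f' x v)"
 using assms by (intro that[of "%x. frechet_derivative f (at x)"]) (auto simp: frechet_derivative_works)

declare higher_differentiable.simps(2) [simp del]

lemma hd_Suc_imp: "higher_differentiable (Suc n) f ==> higher_differentiable n f"
proof (induction n arbitrary: f)
 case 0 then show ?case by (metis hd_continuous higher_differentiable.simps(1))
next
 case (Suc n)
 obtain f' where "\<forall>x. (f has_derivative f' x) (at x)" "\<forall>v. higher_differentiable (Suc n) (%x. f' x v)"
  by (rule hd_SucE[OF Suc.prems])
 then show ?case by (intro hd_SucI) (auto intro: Suc.IH)
qed

lemma hd_const: "higher_differentiable n (%x. c)"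
proof (induction n arbitrary: c)
 case (Suc n) show ?case by (rule hd_SucI[where f'="%x v. 0"]) (auto intro: Suc)
qed simp

lemma hd_add:
 "higher_differentiable n f ==> higher_differentiable n g ==> higher_differentiable n (%x. f x + g x)"
proof (induction n arbitrary: f g)
 case 0 then show ?case by (auto intro: continuous_on_add)
next
 case (Suc n)
 obtain f' where f: "\<forall>x. (f has_derivative f' x) (at x)" "\<forall>v. higher_differentiable n (%x. f' x v)"
  by (rule hd_SucE[OF Suc.prems(1)])
 obtain g' where g: "\<forall>x. (g has_derivative g' x) (at x)" "\<forall>v. higher_differentiable n (%x. g' x v)"
  by (rule hd_SucE[OF Suc.prems(2)])
 show ?case by (rule hd_SucI[OF has_derivative_add[OF f(1)[rule_format] g(1)[rule_format]]]) (intro Suc.IH f[rule_format] g[rule_format])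
qed

lemma hd_mult:
 fixes f g :: "'a::real_normed_vector => real"
 shows "higher_differentiable n f ==> higher_differentiable n g ==> higher_differentiable n (%x. f x * g x)"
proof (induction n arbitrary: f g)
 case 0 then show ?case by (auto intro: continuous_on_mult)
next
 case (Suc n)
 obtain f' where f: "\<forall>x. (f has_derivative f' x) (at x)" "\<forall>v. higher_differentiable n (%x. f' x v)"
  by (rule hd_SucE[OF Suc.prems(1)])
 obtain g' where g: "\<forall>x. (g has_derivative g' x) (at x)" "\<forall>v. higher_differentiable n (%x. g' x v)"
  by (rule hd_SucE[OF Suc.prems(2)])
 show ?case by (rule hd_SucI[OF has_derivative_mult[OF f(1)[rule_format] g(1)[rule_format]]])
   (intro hd_add Suc.IH f[rule_format] g[rule_format] hd_Suc_imp[OF Suc.prems(1)] hd_Suc_imp[OF Suc.prems(2)])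
qed

lemma hd_affine:
 assumes L: "bounded_linear L"
 shows "higher_differentiable n f ==> higher_differentiable n (%x. f (L x + c))"
proof (induction n arbitrary: f)
 case 0
 have "continuous_on UNIV L" using L by (simp add: linear_continuous_on)
 then show ?case using 0 by (auto intro!: continuous_intros continuous_on_compose2[of UNIV f UNIV "%x. L x + c"])
next
 case (Suc n)
 obtain f' where f: "\<forall>x. (f has_derivative f' x) (at x)" "\<forall>v. higher_differentiable n (%x. f' x v)"
  by (rule hd_SucE[OF Suc.prems(1)])
 have d: "((%x. L x + c) has_derivative L) (at x)" for x
  using has_derivative_add_const[OF bounded_linear_imp_has_derivative[OF L]] .
 have "((%x. f (L x + c)) has_derivative (%v. f' (L x + c) (L v))) (at x)" for x
  by (rule has_derivative_compose[OF d f(1)[rule_format]])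
 then show ?case by (rule hd_SucI) (rule Suc.IH[OF f(2)[rule_format]])
qed

lemma hd_real:
 fixes f :: "real => real"
 assumes "!!x. (f has_real_derivative f' x) (at x)" "higher_differentiable n f'"
 shows "higher_differentiable (Suc n) f" by (rule hd_SucI[OF assms(1)[unfolded has_field_derivative_def]]) (intro hd_mult assms hd_const)

lemma hd_linear: "bounded_linear L ==> higher_differentiable n L"
proof (cases n)
 case (Suc m)
 assume "bounded_linear L"
 then show ?thesis unfolding Suc by (intro hd_SucI[where f'="%x. L"] hd_const bounded_linear_imp_has_derivative)
qed (auto intro: linear_continuous_on)

section \<open>A smooth function that is flat at the origin\<close>

lemma poly_times_exp_tendsto_0: "((%x::real. poly P x * exp (- x)) \<longlongrightarrow> 0) at_top"
proof -
 have "((%x::real. \<Sum>i\<le>degree P. coeff P i * (x ^ i / exp x)) \<longlongrightarrow> (\<Sum>i\<le>degree P. coeff P i * 0)) at_top"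
  by (intro tendsto_sum tendsto_mult tendsto_const tendsto_power_div_exp_0)
 then show ?thesis by (simp add: poly_altdef sum_distrib_right sum_divide_distrib exp_minus field_simps)
qed

text \<open>The classical exp (- 1 / x), extended by 0. The polynomial in 1 / x is carried along
  because it makes the class closed under differentiation.\<close>

definition flat_exp :: "real poly => real => real" where
 "flat_exp P x = (if x > 0 then poly P (1 / x) * exp (- 1 / x) else 0)"

text \<open>With y = 1 / x one has d/dx = - y^2 d/dy, and P(y) exp (- y) has y-derivative (P' - P)
  exp (- y). The polynomial \<open>[:0,0,1:]\<close> is y^2.\<close>

lemma flat_exp_deriv:
 "(flat_exp P has_real_derivative flat_exp ([:0,0,1:] * (P - pderiv P)) x) (at x)"
proof -
 consider "x > 0" | "x < 0" | "x = 0" by linarith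
 then show ?thesis
 proof cases
  case 1
  have "((%x. poly P (1 / x) * exp (- 1 / x)) has_real_derivative
    flat_exp ([:0,0,1:] * (P - pderiv P)) x) (at x)" using 1 by (auto intro!: derivative_eq_intros poly_DERIV[THEN DERIV_chain2]
     simp: flat_exp_def field_simps power2_eq_square)
  then show ?thesis by (rule has_field_derivative_transform_within_open[of _ _ _ "{0<..}"])
    (use 1 in \<open>auto simp: flat_exp_def\<close>)
 next
  case 2
  have "((%x. 0) has_real_derivative flat_exp ([:0,0,1:] * (P - pderiv P)) x) (at x)" using 2 by (simp add: flat_exp_def)
  then show ?thesis by (rule has_field_derivative_transform_within_open[of _ _ _ "{..<0}"])
    (use 2 in \<open>auto simp: flat_exp_def\<close>)
 next
  case 3
  \<comment> \<open>The right difference quotient at 0 is y P(y) exp (- y) with y = 1 / h tending to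
    infinity.\<close>
  have "((%h::real. poly ([:0,1:] * P) (inverse h) * exp (- inverse h)) \<longlongrightarrow> 0) (at_right 0)"
   by (rule filterlim_compose[OF poly_times_exp_tendsto_0 filterlim_inverse_at_top_right])
  then have r: "((%h. flat_exp P h / h) \<longlongrightarrow> 0) (at_right 0)" by (rule Lim_transform_eventually)
    (auto simp: flat_exp_def eventually_at_filter field_simps)
  have l: "((%h. flat_exp P h / h) \<longlongrightarrow> 0) (at_left 0)" by (rule Lim_transform_eventually[OF tendsto_const])
    (auto simp: flat_exp_def eventually_at_filter)
  have "((%h. flat_exp P h / h) \<longlongrightarrow> 0) (at 0)" using filterlim_split_at[OF l r] .
  then show ?thesis using 3 by (simp add: DERIV_def flat_exp_def)
 qed
qed

lemma hd_flat_exp: "higher_differentiable n (flat_exp P)"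
proof (induction n arbitrary: P)
 case 0
 then show ?case using DERIV_isCont[OF flat_exp_deriv] by (auto intro: continuous_at_imp_continuous_on)
qed (blast intro: hd_real flat_exp_deriv)

section \<open>Antiderivatives, and test functions supported in a given interval\<close>

lemma continuous_antiderivative:
 fixes f :: "real => 'a::banach"
 assumes "continuous_on UNIV f"
 obtains F where "!!x. (F has_vector_derivative f x) (at x)" "F 0 = 0"
proof -
 \<comment> \<open>One of the two intervals is empty or a point, so this is the oriented integral
   from 0 to x.\<close>
 define F where "F x = integral {0..x} f - integral {x..0} f" for x
 have "(F has_vector_derivative f x) (at x)" for x
 proof -
  define N where "N = \<bar>x\<bar> + 1"
  have c: "continuous_on {-N..N} f" using assms continuous_on_subset by blast
  have "((%u. integral {-N..u} f - integral {-N..0} f) has_vector_derivative f x - 0) (at x within {-N..N})"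
   by (intro has_vector_derivative_diff integral_has_vector_derivative c has_vector_derivative_const)
    (auto simp: N_def)
  then have "((%u. integral {-N..u} f - integral {-N..0} f) has_vector_derivative f x) (at x)"
   using at_within_interior[of x "{-N..N}"] by (simp add: N_def abs_if split: if_splits)
  then show ?thesis
  proof (rule has_vector_derivative_transform_within_open[where S="{-N<..<N}"])
   fix u assume u: "u \<in> {-N<..<N}"
   have i: "f integrable_on {a..b}" for a b using assms by (blast intro: integrable_continuous_interval continuous_on_subset)
   show "integral {-N..u} f - integral {-N..0} f = F u"
   proof (cases "u \<ge> 0")
    case True
    have "integral {-N..0} f + integral {0..u} f = integral {-N..u} f"
     by (rule Henstock_Kurzweil_Integration.integral_combine) (use True i in \<open>auto simp: N_def\<close>)
    from this[symmetric] show ?thesis using True by (cases "u = 0") (simp_all add: F_def)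
   next
    case False
    have "integral {-N..u} f + integral {u..0} f = integral {-N..0} f"
     by (rule Henstock_Kurzweil_Integration.integral_combine) (use False u i in \<open>auto simp: N_def\<close>)
    from this[symmetric] show ?thesis using False by (simp add: F_def)
   qed
  qed (auto simp: N_def)
 qed
 then show ?thesis using that[of F] by (auto simp: F_def)
qed

text \<open>The supporting interval is explicit data, because primitives and cutoffs have to stay
  inside the same interval. For a > b only the zero function qualifies.\<close>

definition test_on :: "real => real => (real => real) => bool" where
 "test_on a b \<eta> \<longleftrightarrow> (\<forall>n. higher_differentiable n \<eta>) \<and> (\<forall>x. x \<notin> {a..b} \<longrightarrow> \<eta> x = 0)"

lemma test_on_imp_test_function: "test_on a b \<eta> ==> {a..b} \<subseteq> \<Omega> ==> test_function \<Omega> \<eta>"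
 unfolding test_on_def test_function_def by (blast intro: compact_Icc)

lemma test_function_imp_test_on:
 assumes "test_function UNIV \<eta>"
 obtains R where "R > 0" "test_on (-R) R \<eta>"
proof -
 obtain C where C: "compact C" "!!x. x \<notin> C ==> \<eta> x = 0" using assms by (auto simp: test_function_def)
 then obtain R where R: "R > 0" "!!x. x \<in> C ==> norm x \<le> R" using compact_imp_bounded bounded_pos[of C] by blast
 have "test_on (-R) R \<eta>" unfolding test_on_def
 proof (intro conjI allI impI)
  show "higher_differentiable n \<eta>" for n using assms by (simp add: test_function_def)
  show "\<eta> x = 0" if "x \<notin> {-R..R}" for x using C(2)[of x] R(2)[of x] that by (cases "x \<in> C") (auto simp: abs_le_iff)
 qed
 then show ?thesis using R(1) that by blast
qed

lemma test_onD: "test_on a b \<eta> ==> higher_differentiable n \<eta>" "test_on a b \<eta> ==> x \<notin> {a..b} ==> \<eta> x = 0"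
 by (auto simp: test_on_def)

lemma test_on_continuous: "test_on a b \<eta> ==> continuous_on S \<eta>" using hd_continuous continuous_on_subset test_onD(1) by blast

lemma zero_outside_Icc_imp_deriv_zero:
 assumes "!!x. x \<notin> {a..b} ==> f x = (0::'a::real_normed_vector)" "x \<notin> {a..b}"
  "(f has_vector_derivative D) (at x)"
 shows "D = 0"
proof -
 have "((%x. 0) has_vector_derivative D) (at x)" by (rule has_vector_derivative_transform_within_open[OF assms(3), of "- {a..b}"])
   (use assms in auto)
 then show ?thesis using has_vector_derivative_const vector_derivative_unique_at by blast
qed

lemma test_on_deriv:
 assumes "test_on a b \<eta>"
 shows "(\<eta> has_real_derivative deriv \<eta> x) (at x)" "test_on a b (deriv \<eta>)"
proof -
 \<comment> \<open>Each order n yields its own derivative function; uniqueness identifies all of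
   them with \<open>deriv \<eta>\<close>, which is therefore smooth.\<close>
 have D: "\<exists>\<eta>'. (\<forall>x. (\<eta> has_real_derivative \<eta>' x) (at x)) \<and> higher_differentiable n \<eta>'" for n
 proof -
  obtain f' where f: "\<forall>x. (\<eta> has_derivative f' x) (at x)" "\<forall>v. higher_differentiable n (%x. f' x v)"
   by (rule hd_SucE[OF test_onD(1)[OF assms]])
  have "(\<eta> has_real_derivative f' x 1) (at x)" for x
  proof -
   have d: "(\<eta> has_derivative f' x) (at x)" using f(1) by blast
   have "f' x v = f' x 1 * v" for v using linear_cmul[OF has_derivative_linear[OF d], of v 1] by simp
   then have "f' x = (*) (f' x 1)" by (intro ext)
   with d have "(\<eta> has_derivative (*) (f' x 1)) (at x)" by (rule back_subst)
   then show ?thesis unfolding has_field_derivative_def .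
  qed
  then show ?thesis using f(2) by (intro exI[of _ "%x. f' x 1"]) simp
 qed
 have eq: "\<eta>' = deriv \<eta>" if "\<forall>x. (\<eta> has_real_derivative \<eta>' x) (at x)" for \<eta>'
  using that by (intro ext) (metis DERIV_imp_deriv)
 show 1: "(\<eta> has_real_derivative deriv \<eta> x) (at x)" for x using D[of 0] eq by blast
 have "higher_differentiable n (deriv \<eta>)" for n using D[of n] eq by blast
 moreover have "deriv \<eta> x = 0" if "x \<notin> {a..b}" for x using zero_outside_Icc_imp_deriv_zero[of a b \<eta> x] assms that 1
  by (auto simp: test_on_def has_real_derivative_iff_has_vector_derivative)
 ultimately show "test_on a b (deriv \<eta>)" by (auto simp: test_on_def)
qed

lemma test_on_deriv_pow: "test_on a b \<eta> ==> test_on a b ((deriv ^^ k) \<eta>)" by (induction k) (auto intro: test_on_deriv)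

lemma smooth_bump:
 "\<exists>\<rho>. test_on 0 1 \<rho> \<and> (\<forall>x. \<rho> x \<ge> 0) \<and> integral {0..1} \<rho> = 1"
proof -
 \<comment> \<open>Flat at both ends and positive exactly on the open unit interval; division by the
   integral gives unit mass.\<close>
 define r where "r x = flat_exp 1 x * flat_exp 1 (1 - x)" for x
 have hd: "higher_differentiable n r" for n
  unfolding r_def using hd_affine[OF bounded_linear_minus[OF bounded_linear_ident] hd_flat_exp, of n 1 1]
  by (intro hd_mult hd_flat_exp) simp
 have c: "continuous_on {0..1} r" using hd_continuous[OF hd] continuous_on_subset by blast
 have nn: "r x \<ge> 0" for x by (auto simp: r_def flat_exp_def)
 have "integral {0..1} r \<noteq> 0"
 proof
  assume "integral {0..1} r = 0"
  then have "r (1/2) = 0" using integral_eq_0_iff[OF c] nn by auto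
  then show False by (simp add: r_def flat_exp_def)
 qed
 moreover have "integral {0..1} r \<ge> 0" by (simp add: integral_nonneg nn integrable_continuous_interval c)
 ultimately have p: "integral {0..1} r > 0" by simp
 show ?thesis by (rule exI[of _ "%x. inverse (integral {0..1} r) * r x"])
   (use p nn in \<open>auto simp: test_on_def r_def[symmetric] intro!: hd_mult hd_const hd, auto simp: r_def flat_exp_def\<close>)
qed

text \<open>The primitive that vanishes at a also vanishes at b because the mean is zero, and it is
  constant on either side, so the support does not grow.\<close>

lemma test_on_primitive:
 assumes "test_on a b \<eta>" "integral {a..b} \<eta> = 0"
 obtains \<zeta> where "test_on a b \<zeta>" "!!x. (\<zeta> has_real_derivative \<eta> x) (at x)"
proof -
 obtain F where F: "!!x. (F has_vector_derivative \<eta> x) (at x)"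
  using continuous_antiderivative[OF test_on_continuous[OF assms(1)]] by blast
 define \<zeta> where "\<zeta> x = F x - F a" for x
 have D: "(\<zeta> has_real_derivative \<eta> x) (at x)" for x
  unfolding \<zeta>_def using F by (auto intro!: derivative_eq_intros simp: has_real_derivative_iff_has_vector_derivative)
 have I: "(\<eta> has_integral \<zeta> d - \<zeta> c) {c..d}" if "c \<le> d" for c d by (rule fundamental_theorem_of_calculus[OF that])
   (use D in \<open>auto simp: has_real_derivative_iff_has_vector_derivative intro: has_vector_derivative_at_within\<close>)
 have "\<zeta> x = 0" if x: "x \<notin> {a..b}" for x
 proof -
  have z: "\<zeta> d = \<zeta> c" if "c \<le> d" "!!x. c < x ==> x < d ==> x \<notin> {a..b}" for c d
  proof -
   have "((%x. 0) has_integral \<zeta> d - \<zeta> c) {c..d}" by (rule has_integral_spike[OF _ _ I[OF that(1)], of "{c,d}"])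
     (use that assms in \<open>auto simp: test_on_def\<close>)
   then show ?thesis using has_integral_unique has_integral_0 by fastforce
  qed
  have za: "\<zeta> a = 0" by (simp add: \<zeta>_def)
  show ?thesis
  proof (cases "x < a")
   case True then show ?thesis using z[of x a] za by auto
  next
   case False
   with x have "b < x" by auto
   moreover have "\<zeta> b = 0"
   proof (cases "a \<le> b")
    case True
    show ?thesis using I[OF True] assms(2) za by (simp add: integral_unique)
   next
    case 2: False then show ?thesis using z[of b a] za by auto
   qed
   ultimately show ?thesis using z[of b x] by auto
  qed
 qed
 then have "test_on a b \<zeta>" unfolding test_on_def using hd_real[OF D] hd_Suc_imp test_onD(1)[OF assms(1)] by blast
 then show ?thesis using D that by blast
qed

lemma smooth_step:
 "\<exists>S :: real => real. (\<forall>n. higher_differentiable n S) \<and> (\<forall>x\<le>0. S x = 0) \<and> (\<forall>x\<ge>1. S x = 1) \<and>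
  (\<forall>x. 0 \<le> S x \<and> S x \<le> 1)"
proof -
 obtain \<rho> :: "real => real" where "test_on 0 1 \<rho> \<and> (\<forall>x. \<rho> x \<ge> 0) \<and> integral {0..1} \<rho> = 1"
  using smooth_bump by blast
 then have \<rho>: "test_on 0 1 \<rho>" "!!x. \<rho> x \<ge> 0" "integral {0..1} \<rho> = 1" by auto
 obtain S where S: "!!x. (S has_vector_derivative \<rho> x) (at x)" "S 0 = 0"
  using continuous_antiderivative[OF test_on_continuous[OF \<rho>(1)]] by blast
 have D: "(S has_real_derivative \<rho> x) (at x)" for x using S by (simp add: has_real_derivative_iff_has_vector_derivative)
 have mono: "S x \<le> S y" if "x \<le> y" for x y by (rule DERIV_nonneg_imp_nondecreasing[OF that]) (use D \<rho> in blast)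
 have "(\<rho> has_integral S 1 - S 0) {0..1}" by (rule fundamental_theorem_of_calculus) (auto intro: S has_vector_derivative_at_within)
 then have S1: "S 1 = 1" using \<rho>(3) S(2) integral_unique by force
 have le0: "S x = 0" if "x \<le> 0" for x
 proof (rule ccontr)
  assume "S x \<noteq> 0"
  then have "x < 0" using that S(2) by (cases "x = 0") auto
  then obtain z where "x < z" "z < 0" "S 0 - S x = (0 - x) * \<rho> z" using MVT2[of x 0 S \<rho>] D by auto
  then show False using \<rho>(1) \<open>S x \<noteq> 0\<close> S by (auto simp: test_on_def)
 qed
 have ge1: "S x = 1" if "x \<ge> 1" for x
 proof (rule ccontr)
  assume "S x \<noteq> 1"
  then have "x > 1" using that S1 by (cases "x = 1") auto
  then obtain z where "1 < z" "z < x" "S x - S 1 = (x - 1) * \<rho> z" using MVT2[of 1 x S \<rho>] D by auto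
  then show False using \<rho>(1) \<open>S x \<noteq> 1\<close> S1 by (auto simp: test_on_def)
 qed
 have hd: "higher_differentiable n S" for n using hd_real[OF D] hd_Suc_imp test_onD(1)[OF \<rho>(1)] by blast
 have "0 \<le> S x \<and> S x \<le> 1" for x
  using mono[of 0 x] mono[of x 0] mono[of 1 x] mono[of x 1] le0[of x] ge1[of x] S1 S(2) by linarith
 then show ?thesis using hd le0 ge1 by blast
qed

lemma smooth_cutoffs:
 "\<exists>cut :: nat => real => real. (\<forall>n. test_on a b (cut n)) \<and> (\<forall>n x. 0 \<le> cut n x \<and> cut n x \<le> 1) \<and>
  (\<forall>x. (%n. cut n x) \<longlonglongrightarrow> indicator {a<..<b} x)"
proof -
 obtain S :: "real => real" where S: "!!n. higher_differentiable n S" "!!x. x \<le> 0 ==> S x = 0"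
  "!!x. x \<ge> 1 ==> S x = 1" "!!x. 0 \<le> S x \<and> S x \<le> 1" using smooth_step by metis
 \<comment> \<open>Inside the interval both arguments eventually exceed 1; at and beyond an endpoint
   one of them is at most 0. Hence the limit is the indicator of the open interval, even at the
   endpoints.\<close>
 define cut where "cut n x = S (real n * (x - a)) * S (real n * (b - x))" for n :: nat and x
 have "higher_differentiable k (cut n)" for k n
 proof -
  have "(%x. S (real n * x + (- real n * a))) = (%x. S (real n * (x - a)))"
   "(%x. S ((- real n) * x + (real n * b))) = (%x. S (real n * (b - x)))" by (auto simp: algebra_simps)
  then show ?thesis unfolding cut_def using hd_affine[OF bounded_linear_mult_right S(1), of k "real n" "- real n * a"]
    hd_affine[OF bounded_linear_mult_right S(1), of k "- real n" "real n * b"] by (intro hd_mult) simp_all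
 qed
 moreover have "cut n x = 0" if "x \<notin> {a<..<b}" for n x
 proof -
  have "x \<le> a \<or> x \<ge> b" using that by auto
  then show ?thesis unfolding cut_def using S(2) by (auto simp: mult_nonneg_nonpos)
 qed
 moreover have "0 \<le> cut n x \<and> cut n x \<le> 1" for n x unfolding cut_def using S(4) by (auto intro: mult_le_one)
 moreover have "(%n. cut n x) \<longlonglongrightarrow> indicator {a<..<b} x" for x
 proof (cases "x \<in> {a<..<b}")
  case True
  obtain n0 :: nat where n0: "real n0 \<ge> 1 / (x - a)" "real n0 \<ge> 1 / (b - x)"
   using real_arch_simple[of "max (1 / (x - a)) (1 / (b - x))"] by auto
  have "cut n x = 1" if "n \<ge> n0" for n
  proof -
   have "real n \<ge> 1 / (x - a)" "real n \<ge> 1 / (b - x)" using n0 that by linarith+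
   then show ?thesis using True S(3) by (auto simp: cut_def field_simps)
  qed
  then show ?thesis using True by (intro tendsto_eventually) (auto simp: eventually_sequentially)
 next
  case False
  then show ?thesis using calculation(2) by simp
 qed
 ultimately show ?thesis unfolding test_on_def by (intro exI[of _ cut]) auto
qed

section \<open>Test functions of two variables\<close>

lemma hd_tensor:
 fixes a b :: "real => real"
 assumes "higher_differentiable n a" "higher_differentiable n b"
 shows "higher_differentiable n (%p. a (fst p) * b (snd p))"
 using hd_affine[OF bounded_linear_fst assms(1), of 0] hd_affine[OF bounded_linear_snd assms(2), of 0] by (intro hd_mult) simp_all

lemma test_function_tensor:
 assumes "test_on l r a" "test_on c d b" "{l..r} \<subseteq> {0<..<T}"
 shows "test_function ({0<..<T} \<times> UNIV) (%(t, x). a t * b x)"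
proof -
 have "compact ({l..r} \<times> {c..d})" by (intro compact_Times compact_Icc)
 moreover have "{l..r} \<times> {c..d} \<subseteq> {0<..<T} \<times> UNIV" using assms by auto
 moreover have "(case p of (t, x) => a t * b x) = 0" if "p \<notin> {l..r} \<times> {c..d}" for p
  using that assms by (auto simp: test_on_def split: prod.splits)
 moreover have "higher_differentiable n (%(t, x). a t * b x)" for n
  using hd_tensor[OF test_onD(1)[OF assms(1)] test_onD(1)[OF assms(2)]] by (simp add: case_prod_beta')
 ultimately show ?thesis unfolding test_function_def by blast
qed

text \<open>The partial derivatives are the directional derivatives along (1, 0) and (0, 1), hence
  jointly regular with one order less.\<close>

lemma hd_partials:
 fixes \<psi> :: "real \<times> real => real"
 assumes "higher_differentiable (Suc n) \<psi>"
 obtains \<psi>t \<psi>x where "!!t x. ((%r. \<psi> (r, x)) has_real_derivative \<psi>t (t, x)) (at t)"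
  "!!t x. ((%y. \<psi> (t, y)) has_real_derivative \<psi>x (t, x)) (at x)"
  "higher_differentiable n \<psi>t" "higher_differentiable n \<psi>x"
proof -
 obtain f' where f: "\<forall>x. (\<psi> has_derivative f' x) (at x)" "\<forall>v. higher_differentiable n (%x. f' x v)"
  by (rule hd_SucE[OF assms])
 have lin: "linear (f' p)" for p using f(1)[rule_format] has_derivative_linear by blast
 have 1: "((%r. \<psi> (r, x)) has_real_derivative f' (t, x) (1, 0)) (at t)" for t x
 proof -
  have d: "((%r. \<psi> (r, x)) has_derivative (%h. f' (t, x) (h, 0))) (at t)"
   by (rule has_derivative_compose[where f="%r. (r, x)" and g=\<psi> and f'="%h. (h, 0)" and g'="f' (t, x)"])
    (intro has_derivative_Pair has_derivative_ident has_derivative_const f(1)[rule_format])+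
  have eq: "f' (t, x) (h, 0) = f' (t, x) (1, 0) * h" for h
   using linear_cmul[OF lin[of "(t, x)"], of h "(1, 0)"] by (simp add: mult.commute[of h])
  have "(%h. f' (t, x) (h, 0)) = (*) (f' (t, x) (1, 0))" by (rule ext) (rule eq)
  then show ?thesis unfolding has_field_derivative_def using d by metis
 qed
 have 2: "((%r. \<psi> (t, r)) has_real_derivative f' (t, x) (0, 1)) (at x)" for t x
 proof -
  have d: "((%r. \<psi> (t, r)) has_derivative (%h. f' (t, x) (0, h))) (at x)"
   by (rule has_derivative_compose[where f="%r. (t, r)" and g=\<psi> and f'="%h. (0, h)" and g'="f' (t, x)"])
    (intro has_derivative_Pair has_derivative_ident has_derivative_const f(1)[rule_format])+
  have eq: "f' (t, x) (0, h) = f' (t, x) (0, 1) * h" for h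
   using linear_cmul[OF lin[of "(t, x)"], of h "(0, 1)"] by (simp add: mult.commute[of h])
  have "(%h. f' (t, x) (0, h)) = (*) (f' (t, x) (0, 1))" by (rule ext) (rule eq)
  then show ?thesis unfolding has_field_derivative_def using d by metis
 qed
 show ?thesis by (rule that[of "%p. f' p (1, 0)" "%p. f' p (0, 1)"]) (use 1 2 f in auto)
qed

section \<open>Square integrable functions\<close>

lemma L2D:
 assumes "square_integrable f"
 shows "f \<in> borel_measurable lborel" "integrable lborel (%x. (norm (f x))\<^sup>2)"
 using assms by (auto simp: square_integrable_def)

lemma L2_dominated:
 assumes "f \<in> borel_measurable lborel" "square_integrable g" "AE x in lborel. norm (f x) \<le> C * norm (g x)"
 shows "square_integrable f"
proof -
 have "integrable lborel (%x. C\<^sup>2 * (norm (g x))\<^sup>2)" using L2D[OF assms(2)] by simp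
 then have "integrable lborel (%x. (norm (f x))\<^sup>2)"
 proof (rule Bochner_Integration.integrable_bound)
  show "AE x in lborel. norm ((norm (f x))\<^sup>2) \<le> norm (C\<^sup>2 * (norm (g x))\<^sup>2)" using assms(3)
  proof eventually_elim
   case (elim x)
   then show ?case using power_mono[OF elim norm_ge_zero, of 2] by (simp add: power_mult_distrib)
  qed
 qed (use assms(1) in measurable)
 then show ?thesis using assms by (simp add: square_integrable_def)
qed

lemma L2_norm_nonneg [simp]: "L2_norm f \<ge> 0" by (simp add: L2_norm_def)

lemma L2_norm_square: "(L2_norm f)\<^sup>2 = (LINT x|lborel. (norm (f x))\<^sup>2)" by (simp add: L2_norm_def)

lemma L2_norm_mono:
 assumes "f \<in> borel_measurable lborel" "square_integrable g" "AE x in lborel. norm (f x) \<le> norm (g x)"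
 shows "L2_norm f \<le> L2_norm g"
proof -
 have "square_integrable f" using L2_dominated[of f g 1] assms by simp
 then show ?thesis unfolding L2_norm_def real_sqrt_le_iff using L2D[of f] L2D[OF assms(2)] assms(3)
  by (intro integral_mono_AE) auto
qed

lemma L2_norm_cong_AE:
 assumes "AE x in lborel. norm (f x) = norm (g x)" "f \<in> borel_measurable lborel" "g \<in> borel_measurable lborel"
 shows "L2_norm f = L2_norm g" unfolding L2_norm_def using assms by (intro arg_cong[of _ _ sqrt] integral_cong_AE) auto

lemma L2_norm_scale:
 assumes "!!x. norm (f x) = c * norm (g x)" "c \<ge> 0"
 shows "L2_norm f = c * L2_norm g" unfolding L2_norm_def assms(1) power_mult_distrib using assms(2) by (simp add: real_sqrt_mult)

lemma L2_norm_indicator: "a \<le> b ==> L2_norm (indicator {a..b} :: real => real) = sqrt (b - a)"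
proof -
 assume "a \<le> b"
 have "(%x. (norm (indicator {a..b} x :: real))\<^sup>2) = indicator {a..b}" by (auto split: split_indicator)
 then show ?thesis using \<open>a \<le> b\<close> unfolding L2_norm_def by simp
qed

lemma L2_Cauchy_Schwarz:
 fixes f :: "real => 'a::euclidean_space" and g :: "real => 'b::euclidean_space"
 assumes "square_integrable f" "square_integrable g"
 shows "integrable lborel (%x. norm (f x) * norm (g x))"
  and "(LINT x|lborel. norm (f x) * norm (g x)) \<le> L2_norm f * L2_norm g"
proof -
 note [measurable] = L2D(1)[OF assms(1)] L2D(1)[OF assms(2)]
 have "integrable lborel (%x. (norm (f x))\<^sup>2 + (norm (g x))\<^sup>2)"
  by (intro Bochner_Integration.integrable_add L2D(2) assms)
 then show i: "integrable lborel (%x. norm (f x) * norm (g x))"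
 proof (rule Bochner_Integration.integrable_bound)
  show "AE x in lborel. norm (norm (f x) * norm (g x)) \<le> norm ((norm (f x))\<^sup>2 + (norm (g x))\<^sup>2)"
  proof (intro AE_I2)
   fix x
   have "2 * (norm (f x) * norm (g x)) \<le> (norm (f x))\<^sup>2 + (norm (g x))\<^sup>2"
    using sum_squares_bound[of "norm (f x)" "norm (g x)"] by simp
   moreover have "0 \<le> norm (f x) * norm (g x)" by simp
   ultimately show "norm (norm (f x) * norm (g x)) \<le> norm ((norm (f x))\<^sup>2 + (norm (g x))\<^sup>2)"
    unfolding real_norm_def by linarith
  qed
 qed measurable
 let ?M = "LINT x|lborel. norm (f x) * norm (g x)"
 have "(\<integral>\<^sup>+x. ennreal (norm (f x)) * ennreal (norm (g x)) \<partial>lborel)\<^sup>2 \<le>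
  (\<integral>\<^sup>+x. ennreal (norm (f x)) ^ 2 \<partial>lborel) * (\<integral>\<^sup>+x. ennreal (norm (g x)) ^ 2 \<partial>lborel)"
  by (rule Cauchy_Schwarz_nn_integral) measurable
 also have "(%x. ennreal (norm (f x)) * ennreal (norm (g x))) = (%x. ennreal (norm (f x) * norm (g x)))"
  by (simp add: ennreal_mult)
 also have "(\<integral>\<^sup>+x. ennreal (norm (f x) * norm (g x)) \<partial>lborel) = ennreal ?M"
  by (rule nn_integral_eq_integral[OF i]) simp
 also have "(\<integral>\<^sup>+x. ennreal (norm (f x)) ^ 2 \<partial>lborel) = ennreal ((L2_norm f)\<^sup>2)"
  unfolding L2_norm_square using nn_integral_eq_integral[OF L2D(2)[OF assms(1)]] by (simp add: ennreal_power)
 also have "(\<integral>\<^sup>+x. ennreal (norm (g x)) ^ 2 \<partial>lborel) = ennreal ((L2_norm g)\<^sup>2)"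
  unfolding L2_norm_square using nn_integral_eq_integral[OF L2D(2)[OF assms(2)]] by (simp add: ennreal_power)
 finally have "ennreal (?M\<^sup>2) \<le> ennreal ((L2_norm f * L2_norm g)\<^sup>2)"
  by (simp add: ennreal_power ennreal_mult power_mult_distrib)
 then have "?M\<^sup>2 \<le> (L2_norm f * L2_norm g)\<^sup>2" by (subst (asm) ennreal_le_iff) auto
 then show "?M \<le> L2_norm f * L2_norm g" by (rule power2_le_imp_le) simp
qed

lemma L2_add:
 assumes "square_integrable f" "square_integrable g"
 shows "square_integrable (%x. f x + g x)"
proof -
 note [measurable] = L2D(1)[OF assms(1)] L2D(1)[OF assms(2)]
 have "integrable lborel (%x. 2 * ((norm (f x))\<^sup>2 + (norm (g x))\<^sup>2))"
  by (intro integrable_mult_right Bochner_Integration.integrable_add L2D(2) assms)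
 then have "integrable lborel (%x. (norm (f x + g x))\<^sup>2)"
 proof (rule Bochner_Integration.integrable_bound)
  show "AE x in lborel. norm ((norm (f x + g x))\<^sup>2) \<le> norm (2 * ((norm (f x))\<^sup>2 + (norm (g x))\<^sup>2))"
  proof (intro AE_I2)
   fix x
   have "(norm (f x + g x))\<^sup>2 \<le> (norm (f x) + norm (g x))\<^sup>2" by (intro power_mono norm_triangle_ineq) simp
   also have "... \<le> 2 * ((norm (f x))\<^sup>2 + (norm (g x))\<^sup>2)"
    using sum_squares_bound[of "norm (f x)" "norm (g x)"] by (simp add: power2_sum)
   finally show "norm ((norm (f x + g x))\<^sup>2) \<le> norm (2 * ((norm (f x))\<^sup>2 + (norm (g x))\<^sup>2))" by simp
  qed
 qed measurable
 then show ?thesis by (simp add: square_integrable_def)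
qed

lemma L2_bounded_linear:
 assumes "bounded_linear L" "square_integrable f"
 shows "square_integrable (%x. L (f x))"
proof -
 obtain K where "!!x. norm (L x) \<le> norm x * K" using bounded_linear.bounded[OF assms(1)] by blast
 moreover have "(%x. L (f x)) \<in> borel_measurable lborel"
  using measurable_compose[OF L2D(1)[OF assms(2)], of L borel]
   borel_measurable_continuous_onI[OF linear_continuous_on[OF assms(1)]] by simp
 ultimately show ?thesis by (intro L2_dominated[OF _ assms(2), of _ K]) (auto simp: mult.commute)
qed

lemma L2_diff:
 "square_integrable f ==> square_integrable g ==> square_integrable (%x. f x - g x)"
 using L2_add[of f "%x. - g x"]
  L2_bounded_linear[OF bounded_linear_minus[OF bounded_linear_ident], of g] by simp

lemma L2_norm_triangle:
 assumes "square_integrable f" "square_integrable g"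
 shows "L2_norm (%x. f x + g x) \<le> L2_norm f + L2_norm g"
proof (rule power2_le_imp_le)
 note i = L2D(2)[OF assms(1)] L2D(2)[OF assms(2)] L2_Cauchy_Schwarz(1)[OF assms]
 have "(L2_norm (%x. f x + g x))\<^sup>2 \<le> (LINT x|lborel. (norm (f x))\<^sup>2 + (norm (g x))\<^sup>2 + 2 * (norm (f x) * norm (g x)))"
  unfolding L2_norm_square
 proof (rule integral_mono)
  show "integrable lborel (%x. (norm (f x + g x))\<^sup>2)" using L2D(2)[OF L2_add[OF assms]] .
  show "integrable lborel (%x. (norm (f x))\<^sup>2 + (norm (g x))\<^sup>2 + 2 * (norm (f x) * norm (g x)))"
   using i by (intro Bochner_Integration.integrable_add integrable_mult_right)
  fix x
  have "(norm (f x + g x))\<^sup>2 \<le> (norm (f x) + norm (g x))\<^sup>2" by (intro power_mono norm_triangle_ineq) simp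
  then show "(norm (f x + g x))\<^sup>2 \<le> (norm (f x))\<^sup>2 + (norm (g x))\<^sup>2 + 2 * (norm (f x) * norm (g x))"
   by (simp add: power2_sum)
 qed
 also have "... = (L2_norm f)\<^sup>2 + (L2_norm g)\<^sup>2 + 2 * (LINT x|lborel. norm (f x) * norm (g x))"
  using i by (simp add: L2_norm_square)
 also have "... \<le> (L2_norm f)\<^sup>2 + (L2_norm g)\<^sup>2 + 2 * (L2_norm f * L2_norm g)"
  using L2_Cauchy_Schwarz(2)[OF assms] by simp
 finally show "(L2_norm (%x. f x + g x))\<^sup>2 \<le> (L2_norm f + L2_norm g)\<^sup>2" by (simp add: power2_sum)
qed simp

lemma L2_norm_minus: "L2_norm (%x. g x - f x) = L2_norm (%x. f x - g x)" by (simp add: L2_norm_def norm_minus_commute)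

lemma L2_norm_triangle_diff:
 assumes "square_integrable f" "square_integrable g" "square_integrable h"
 shows "L2_norm (%x. f x - h x) \<le> L2_norm (%x. f x - g x) + L2_norm (%x. g x - h x)"
 using L2_norm_triangle[OF L2_diff[OF assms(1,2)] L2_diff[OF assms(2,3)]] by simp

lemma L2_norm_le_add:
 assumes "square_integrable f" "square_integrable g"
 shows "L2_norm f \<le> L2_norm g + L2_norm (%x. f x - g x)"
 using L2_norm_triangle[OF assms(2) L2_diff[OF assms]] by simp

lemma L2_dominated_convergence:
 fixes w :: "real => real"
 assumes "square_integrable w" "!!n. f n \<in> borel_measurable lborel"
  "!!n. AE x in lborel. norm (f n x) \<le> w x" "AE x in lborel. (%n. f n x) \<longlonglongrightarrow> 0"
 shows "(%n. L2_norm (f n)) \<longlonglongrightarrow> 0"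
proof -
 have "(%n. LINT x|lborel. (norm (f n x))\<^sup>2) \<longlonglongrightarrow> (\<integral>x. 0 \<partial>(lborel :: real measure))"
 proof (rule integral_dominated_convergence[where w="%x. (norm (w x))\<^sup>2"])
  show "AE x in lborel. (%n. (norm (f n x))\<^sup>2) \<longlonglongrightarrow> 0" using assms(4)
  proof eventually_elim
   case (elim x)
   then show ?case using tendsto_power[OF tendsto_norm_zero[OF elim], of 2] by simp
  qed
  show "AE x in lborel. norm ((norm (f n x))\<^sup>2) \<le> (norm (w x))\<^sup>2" for n
   using assms(3)[of n] by eventually_elim (auto intro!: power_mono)
 qed (use assms L2D in measurable)
 then show ?thesis unfolding L2_norm_def using tendsto_real_sqrt by fastforce
qed

lemma AE_not_negligible: "negligible N ==> AE x in lborel. x \<notin> N"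
 using AE_not_in[of N lebesgue] by (simp add: negligible_iff_null_sets AE_completion_iff)

lemma continuous_support_integral:
 fixes f :: "real => 'a::euclidean_space"
 assumes "continuous_on UNIV f" "!!x. x \<notin> {a..b} ==> f x = 0"
 shows "integrable lborel f" "(LINT x|lborel. f x) = integral {a..b} f"
proof -
 have s: "set_integrable lborel {a..b} f" unfolding set_integrable_def
  by (rule borel_integrable_compact) (auto intro: continuous_on_subset[OF assms(1)])
 moreover have e: "(%x. indicator {a..b} x *\<^sub>R f x) = f" using assms by (force split: split_indicator)
 ultimately show "integrable lborel f" by (simp add: set_integrable_def)
 show "(LINT x|lborel. f x) = integral {a..b} f" using set_borel_integral_eq_integral(2)[OF s] e by (simp add: set_lebesgue_integral_def)
qed

lemma continuous_support_square_integrable: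
 fixes f :: "real => 'a::euclidean_space"
 assumes "continuous_on UNIV f" "!!x. x \<notin> {a..b} ==> f x = 0"
 shows "square_integrable f" unfolding square_integrable_def
 using assms by (auto intro!: continuous_support_integral(1)[of _ a b] continuous_intros
   borel_measurable_continuous_onI)

lemma test_on_square_integrable: "test_on a b \<eta> ==> square_integrable \<eta>"
 by (rule continuous_support_square_integrable[of _ a b]) (auto intro: test_on_continuous test_onD)

lemma integral_deriv_support:
 fixes h :: "real => 'a::euclidean_space"
 assumes "!!x. (h has_vector_derivative h' x) (at x)" "continuous_on UNIV h'" "!!x. x \<notin> {a..b} ==> h x = 0"
 shows "(LINT x|lborel. h' x) = 0"
proof (cases "a \<le> b")
 case True
 have z: "h' x = 0" if "x \<notin> {a..b}" for x using zero_outside_Icc_imp_deriv_zero[OF assms(3) that assms(1)] .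
 \<comment> \<open>The interval is enlarged by 1 on each side so that \<open>h\<close> vanishes at
   both ends directly by hypothesis.\<close>
 have "(LINT x|lborel. h' x) = integral {a-1..b+1} h'" by (rule continuous_support_integral) (use assms z in auto)
 moreover have "(h' has_integral h (b+1) - h (a-1)) {a-1..b+1}"
  by (rule fundamental_theorem_of_calculus) (use True assms(1) in \<open>auto intro: has_vector_derivative_at_within\<close>)
 ultimately show ?thesis using assms(3)[of "b+1"] assms(3)[of "a-1"] by (simp add: integral_unique)
next
 case False
 then have "h' x = 0" for x using zero_outside_Icc_imp_deriv_zero[of a b h x, OF assms(3) _ assms(1)] by auto
 then show ?thesis by simp
qed

section \<open>Weak derivatives\<close>

lemma locally_integrable_Icc: "locally_integrable f ==> set_integrable lborel {a..b} f" by (simp add: locally_integrable_def)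

lemma locally_integrable_measurable:
 assumes "locally_integrable f"
 shows "f \<in> borel_measurable lborel"
proof (rule borel_measurable_LIMSEQ_metric)
 show "(%x. indicator {- real n..real n} x *\<^sub>R f x) \<in> borel_measurable lborel" for n
  using locally_integrable_Icc[OF assms] by (auto simp: set_integrable_def)
 fix x
 obtain N :: nat where N: "\<bar>x\<bar> \<le> real N" using real_arch_simple by blast
 have "indicator {- real n..real n} x *\<^sub>R f x = f x" if "n \<ge> N" for n
 proof -
  have "real N \<le> real n" using that by simp
  then have "x \<in> {- real n..real n}" using N by auto
  then show ?thesis by simp
 qed
 then show "(%n. indicator {- real n..real n} x *\<^sub>R f x) \<longlonglongrightarrow> f x"
  by (intro tendsto_eventually) (auto simp: eventually_sequentially)
qed

section \<open>Integrals against test functions and the fundamental lemma of the calculus of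
  variations\<close>

lemma integrable_bounded_support:
 fixes f :: "real => 'a::euclidean_space"
 assumes "set_integrable lborel {a..b} f" "f \<in> borel_measurable lborel" "\<eta> \<in> borel_measurable lborel"
  "!!x. \<bar>\<eta> x\<bar> \<le> C" "!!x. x \<notin> {a..b} ==> \<eta> x = 0"
 shows "integrable lborel (%x. \<eta> x *\<^sub>R f x)"
proof -
 have "integrable lborel (%x. C *\<^sub>R (indicator {a..b} x *\<^sub>R f x))"
  using assms(1) unfolding set_integrable_def by (rule integrable_scaleR_right)
 then show ?thesis
 proof (rule Bochner_Integration.integrable_bound)
  have "norm (\<eta> x *\<^sub>R f x) \<le> norm (C *\<^sub>R (indicator {a..b} x *\<^sub>R f x))" for x
   using assms(4)[of x] assms(5)[of x] by (cases "x \<in> {a..b}") (auto intro!: mult_right_mono)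
  then show "AE x in lborel. norm (\<eta> x *\<^sub>R f x) \<le> norm (C *\<^sub>R (indicator {a..b} x *\<^sub>R f x))" by simp
 qed (use assms in measurable)
qed

lemma test_on_bounded:
 assumes "test_on a b \<eta>"
 shows "\<exists>C. \<forall>x. \<bar>\<eta> x\<bar> \<le> C"
proof -
 have "bounded (\<eta> ` {a..b})" by (intro compact_imp_bounded compact_continuous_image test_on_continuous[OF assms] compact_Icc)
 then obtain B where "!!x. x \<in> {a..b} ==> \<bar>\<eta> x\<bar> \<le> B" by (force simp: bounded_iff)
 then have "\<bar>\<eta> x\<bar> \<le> max B 0" for x using test_onD(2)[OF assms, of x] by (cases "x \<in> {a..b}") force+
 then show ?thesis by blast
qed

lemma test_on_measurable: "test_on a b \<eta> ==> \<eta> \<in> borel_measurable lborel"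
 using borel_measurable_continuous_onI[OF test_on_continuous] by simp

lemma test_on_integrable:
 fixes f :: "real => 'a::euclidean_space"
 assumes "test_on a b \<eta>" "set_integrable lborel {a..b} f" "f \<in> borel_measurable lborel"
 shows "integrable lborel (%x. \<eta> x *\<^sub>R f x)"
 using integrable_bounded_support[OF assms(2,3) test_on_measurable[OF assms(1)]]
  test_on_bounded[OF assms(1)] test_onD(2)[OF assms(1)] by blast

text \<open>Cutoffs converge to indicators of intervals, so dominated convergence makes the integral
  of \<open>f\<close> over every subinterval vanish. Lebesgue differentiation then gives the values
  almost everywhere.\<close>

lemma fundamental_lemma_local:
 fixes f :: "real => 'a::euclidean_space"
 assumes k: "set_integrable lborel {a..b} f" "f \<in> borel_measurable lborel"
  and z: "!!\<eta>. test_on a b \<eta> ==> (LINT x|lborel. \<eta> x *\<^sub>R f x) = 0"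
 shows "AE x in lborel. x \<in> {a..b} \<longrightarrow> f x = 0"
proof -
 define g where "g x = indicator {a..b} x *\<^sub>R f x" for x
 have g: "integrable lborel g" using k by (simp add: g_def[abs_def] set_integrable_def)
 have 1: "(LINT x|lborel. indicator {c<..<d} x *\<^sub>R f x) = 0" if "a \<le> c" "d \<le> b" for c d
 proof -
  obtain cu :: "nat => real => real" where cu: "\<forall>n. test_on c d (cu n)" "\<forall>n x. 0 \<le> cu n x \<and> cu n x \<le> 1"
   "\<forall>x. (%n. cu n x) \<longlonglongrightarrow> indicator {c<..<d} x" using smooth_cutoffs[of c d] by blast
  have t: "test_on a b (cu n)" for n using cu(1) that unfolding test_on_def by auto
  have "(%n. LINT x|lborel. cu n x *\<^sub>R f x) \<longlonglongrightarrow> (LINT x|lborel. indicator {c<..<d} x *\<^sub>R f x)"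
  proof (rule integral_dominated_convergence[where w="%x. norm (g x)"])
   show "(%x. indicator {c<..<d} x *\<^sub>R f x) \<in> borel_measurable lborel" using k(2) by measurable
   show "(%x. cu n x *\<^sub>R f x) \<in> borel_measurable lborel" for n using k(2) test_on_measurable[OF t[of n]] by measurable
   show "integrable lborel (%x. norm (g x))" using g by simp
   show "AE x in lborel. (%n. cu n x *\<^sub>R f x) \<longlonglongrightarrow> indicator {c<..<d} x *\<^sub>R f x"
    using cu(3) by (auto intro!: tendsto_scaleR)
   show "AE x in lborel. norm (cu n x *\<^sub>R f x) \<le> norm (g x)" for n
   proof (intro AE_I2)
    fix x
    show "norm (cu n x *\<^sub>R f x) \<le> norm (g x)"
    proof (cases "x \<in> {a..b}")
     case True
     then show ?thesis using cu(2)[rule_format, of n x] by (auto simp: g_def intro: mult_left_le_one_le)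
    qed (use test_onD(2)[OF t] in \<open>auto simp: g_def\<close>)
   qed
  qed
  then show ?thesis using z[OF t] by (simp add: LIMSEQ_const_iff)
 qed
 \<comment> \<open>An arbitrary interval is intersected with [a, b]; only the four endpoints, a null
   set, distinguish the closed from the open version.\<close>
 have 2: "integral (cbox c d) g = 0" for c d
 proof -
  have "(LINT x|lborel. indicator {c..d} x *\<^sub>R g x) = (LINT x|lborel. indicator {max a c<..<min b d} x *\<^sub>R f x)"
  proof (rule integral_cong_AE)
   have "AE x in lborel. x \<notin> {a,b,c,d}" by (intro AE_not_negligible) simp
   then show "AE x in lborel. indicator {c..d} x *\<^sub>R g x = indicator {max a c<..<min b d} x *\<^sub>R f x"
    by eventually_elim (auto simp: g_def split: split_indicator)
  qed (use k(2) g in measurable)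
  also have "... = 0" by (rule 1) auto
  finally have "(LINT x:{c..d}|lborel. g x) = 0" by (simp add: set_lebesgue_integral_def)
  moreover have "set_integrable lborel {c..d} g" unfolding set_integrable_def by (rule integrable_mult_indicator[OF _ g]) simp
  ultimately show ?thesis using set_borel_integral_eq_integral(2)[of "{c..d}" g] by simp
 qed
 have "g integrable_on cbox c d" for c d using integrable_on_subcbox[of g UNIV c d] has_integral_integral_lborel[OF g]
   integrable_on_def integrable_on_subinterval subset_UNIV by blast
 then obtain N where N: "negligible N" "!!x e. x \<notin> N ==> 0 < e ==>
   \<exists>d>0. \<forall>h. 0 < h \<and> h < d \<longrightarrow> norm (integral (cbox x (x + h *\<^sub>R One)) g /\<^sub>R h ^ DIM(real) - g x) < e"
  by (rule integrable_ccontinuous_explicit) blast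
 have "g x = 0" if "x \<notin> N" for x
 proof (rule ccontr)
  assume "g x \<noteq> 0"
  then have "norm (g x) > 0" by simp
  from N(2)[OF that this] obtain d where d: "d > 0" "\<forall>h. 0 < h \<and> h < d \<longrightarrow>
    norm (integral (cbox x (x + h *\<^sub>R One)) g /\<^sub>R h ^ DIM(real) - g x) < norm (g x)" by blast
  show False using d(1) d(2)[rule_format, of "d/2"] unfolding 2 by simp
 qed
 then have "AE x in lborel. g x = 0" using AE_not_negligible[OF N(1)] by (auto elim: AE_mp)
 then show ?thesis by eventually_elim (auto simp: g_def)
qed

lemma AE_Icc_all:
 assumes "!!n::nat. AE x in lborel. x \<in> {- real n..real n} \<longrightarrow> P x"
 shows "AE x in lborel. P x"
proof -
 have "AE x in lborel. \<forall>n::nat. x \<in> {- real n..real n} \<longrightarrow> P x" unfolding AE_all_countable using assms by blast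
 then show ?thesis
 proof eventually_elim
  case (elim x)
  obtain N :: nat where "\<bar>x\<bar> \<le> N" using real_arch_simple by blast
  then show ?case using elim[rule_format, of N] by (simp add: abs_le_iff)
 qed
qed

lemma fundamental_lemma:
 fixes f :: "real => 'a::euclidean_space"
 assumes f: "locally_integrable f"
  and z: "!!\<eta>. test_function UNIV \<eta> ==> (LINT x|lborel. \<eta> x *\<^sub>R f x) = 0"
 shows "AE x in lborel. f x = 0"
proof (rule AE_Icc_all, rule fundamental_lemma_local)
 show "f \<in> borel_measurable lborel" using f by (rule locally_integrable_measurable)
qed (use f z in \<open>auto intro: locally_integrable_Icc test_on_imp_test_function\<close>)

lemma unit_bump:
 assumes ab: "(a::real) < b"
 shows "\<exists>\<rho>. test_on a b \<rho> \<and> (LINT x|lborel. \<rho> x) = 1"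
proof -
 obtain \<rho>0 :: "real => real" where "test_on 0 1 \<rho>0 \<and> (\<forall>x. \<rho>0 x \<ge> 0) \<and> integral {0..1} \<rho>0 = 1"
  using smooth_bump by blast
 then have \<rho>0: "test_on 0 1 \<rho>0" "integral {0..1} \<rho>0 = 1" by auto
 define \<rho> where "\<rho> x = (1 / (b - a)) * \<rho>0 (1 / (b - a) * x + (- a / (b - a)))" for x
 have tr: "test_on a b \<rho>"
 proof -
  have "higher_differentiable n \<rho>" for n unfolding \<rho>_def
   by (intro hd_mult hd_const hd_affine[OF bounded_linear_mult_right] test_onD(1)[OF \<rho>0(1)])
  moreover have "\<rho> x = 0" if "x \<notin> {a..b}" for x
  proof -
   have "1 / (b - a) * x + (- a / (b - a)) = (x - a) / (b - a)" by (simp add: diff_divide_distrib)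
   moreover have "(x - a) / (b - a) \<notin> {0..1}" using that ab by (auto simp: field_simps)
   ultimately show ?thesis using test_onD(2)[OF \<rho>0(1)] by (simp add: \<rho>_def)
  qed
  ultimately show ?thesis by (simp add: test_on_def)
 qed
 have ir: "(LINT x|lborel. \<rho> x) = 1"
 proof -
  have "(LINT x|lborel. \<rho> x) = (1 / (b - a)) * (LINT x|lborel. \<rho>0 ((- a / (b - a)) + (1 / (b - a)) * x))"
   unfolding \<rho>_def by (simp add: add.commute)
  also have "... = (LINT x|lborel. \<rho>0 x)" using lborel_integral_real_affine[of "1 / (b - a)" \<rho>0 "- a / (b - a)"] ab by simp
  also have "... = 1" using continuous_support_integral(2)[of \<rho>0 0 1] \<rho>0 test_on_continuous test_onD(2) by auto
  finally show ?thesis .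
 qed
 show ?thesis using tr ir by blast
qed

text \<open>Subtracting from \<eta> its mean times a unit bump \<rho> leaves a function of mean
  zero, which is the derivative of a test function. Hence \<open>f - c\<close> is orthogonal to
  every \<eta>, where c is the \<rho>-weighted mean of \<open>f\<close>, and the fundamental lemma
  applies.\<close>

lemma du_Bois_Reymond:
 fixes f :: "real => 'a::euclidean_space"
 assumes ab: "a < b" and k: "set_integrable lborel {a..b} f" "f \<in> borel_measurable lborel"
  and z: "!!\<eta>. test_on a b \<eta> ==> (LINT x|lborel. deriv \<eta> x *\<^sub>R f x) = 0"
 obtains c where "AE x in lborel. x \<in> {a..b} \<longrightarrow> f x = c"
proof -
 obtain \<rho> where tr: "test_on a b \<rho>" and ir: "(LINT x|lborel. \<rho> x) = 1" using unit_bump[OF ab] by blast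
 define c where "c = (LINT x|lborel. \<rho> x *\<^sub>R f x)"
 have ts: "integrable lborel \<eta>" "(LINT x|lborel. \<eta> x) = integral {a..b} \<eta>" if "test_on a b \<eta>" for \<eta>
  using continuous_support_integral[of \<eta> a b] that test_on_continuous test_onD(2) by auto
 have "AE x in lborel. x \<in> {a..b} \<longrightarrow> f x - c = 0"
 proof (rule fundamental_lemma_local)
  have "set_integrable lborel {a..b} (%x. c)" by (simp add: set_integrable_def borel_integrable_compact)
  then show "set_integrable lborel {a..b} (%x. f x - c)" using k by (intro set_integral_diff)
  show "(%x. f x - c) \<in> borel_measurable lborel" using k by measurable
  fix \<eta> assume \<eta>: "test_on a b \<eta>"
  define I where "I = (LINT x|lborel. \<eta> x)"
  have t2: "test_on a b (%x. \<eta> x + (- I) * \<rho> x)" unfolding test_on_def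
   by (intro conjI allI impI hd_add hd_mult hd_const test_onD(1)[OF \<eta>] test_onD(1)[OF tr])
    (simp add: test_onD(2)[OF \<eta>] test_onD(2)[OF tr])
  have "integral {a..b} (%x. \<eta> x + (- I) * \<rho> x) = (LINT x|lborel. \<eta> x + (- I) * \<rho> x)"
   using ts(2)[OF t2] by simp
  also have "... = I + (- I) * (LINT x|lborel. \<rho> x)" using ts(1)[OF \<eta>] ts(1)[OF tr] by (simp add: I_def)
  finally have "integral {a..b} (%x. \<eta> x + (- I) * \<rho> x) = 0" by (simp add: ir)
  then obtain \<zeta> where \<zeta>: "test_on a b \<zeta>" "!!x. (\<zeta> has_real_derivative \<eta> x + (- I) * \<rho> x) (at x)"
   using test_on_primitive[OF t2] by metis
  have "(LINT x|lborel. (\<eta> x + (- I) * \<rho> x) *\<^sub>R f x) = 0" using z[OF \<zeta>(1)] DERIV_imp_deriv[OF \<zeta>(2)] by simp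
  moreover have "(LINT x|lborel. (\<eta> x + (- I) * \<rho> x) *\<^sub>R f x) = (LINT x|lborel. \<eta> x *\<^sub>R f x) - I *\<^sub>R c"
  proof -
   have "(%x. (\<eta> x + (- I) * \<rho> x) *\<^sub>R f x) = (%x. \<eta> x *\<^sub>R f x - I *\<^sub>R (\<rho> x *\<^sub>R f x))"
    by (auto simp: algebra_simps)
   then show ?thesis using Bochner_Integration.integral_diff[OF test_on_integrable[OF \<eta> k]
      integrable_scaleR_right[OF test_on_integrable[OF tr k], of I]] by (simp only: c_def integral_scaleR_right)
  qed
  moreover have "(LINT x|lborel. \<eta> x *\<^sub>R (f x - c)) = (LINT x|lborel. \<eta> x *\<^sub>R f x) - I *\<^sub>R c"
   using test_on_integrable[OF \<eta> k] ts(1)[OF \<eta>] by (simp add: scaleR_diff_right I_def)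
  ultimately show "(LINT x|lborel. \<eta> x *\<^sub>R (f x - c)) = 0" by simp
 qed
 then show ?thesis using that[of c] by simp
qed

section \<open>Calculus of weak derivatives\<close>

lemma L2_imp_locally_integrable:
 fixes f :: "real => 'a::euclidean_space"
 assumes "square_integrable f"
 shows "locally_integrable f" unfolding locally_integrable_def set_integrable_def
proof (intro allI impI)
 fix C :: "real set" assume C: "compact C"
 note [measurable] = L2D(1)[OF assms] borel_compact[OF C]
 have "integrable lborel (%x. indicator C x + (norm (f x))\<^sup>2 :: real)"
  using L2D(2)[OF assms] emeasure_bounded_finite[OF compact_imp_bounded[OF C]]
  by (intro Bochner_Integration.integrable_add integrable_real_indicator) auto
 then show "integrable lborel (%x. indicator C x *\<^sub>R f x)"
 proof (rule Bochner_Integration.integrable_bound)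
  show "AE x in lborel. norm (indicator C x *\<^sub>R f x) \<le> norm (indicator C x + (norm (f x))\<^sup>2 :: real)"
  proof (intro AE_I2)
   fix x
   have "2 * norm (f x) \<le> (norm (f x))\<^sup>2 + 1" using sum_squares_bound[of "norm (f x)" 1] by simp
   then have "norm (f x) \<le> 1 + (norm (f x))\<^sup>2" using norm_ge_zero[of "f x"] by linarith
   then show "norm (indicator C x *\<^sub>R f x) \<le> norm (indicator C x + (norm (f x))\<^sup>2 :: real)"
    by (auto split: split_indicator)
  qed
 qed measurable
qed

lemma has_weak_derivD:
 assumes "has_weak_deriv k f g"
 shows "locally_integrable f" "locally_integrable g"
  "test_function UNIV \<eta> ==> (LINT x|lborel. (deriv ^^ k) \<eta> x *\<^sub>R f x) = (-1) ^ k *\<^sub>R (LINT x|lborel. \<eta> x *\<^sub>R g x)"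
 using assms by (auto simp: has_weak_deriv_def)

lemma test_integrable_loc:
 "test_on a b \<eta> ==> locally_integrable f ==> integrable lborel (%x. \<eta> x *\<^sub>R f x)"
 by (rule test_on_integrable[OF _ locally_integrable_Icc locally_integrable_measurable])

lemma has_weak_deriv_unique:
 assumes "has_weak_deriv k f g" "has_weak_deriv k f h"
 shows "AE x in lborel. g x = h x"
proof -
 note l = has_weak_derivD(2)[OF assms(1)] has_weak_derivD(2)[OF assms(2)]
 have "AE x in lborel. g x - h x = 0"
 proof (rule fundamental_lemma)
  show "locally_integrable (%x. g x - h x)" using l by (simp add: locally_integrable_def)
  fix \<eta> :: "real => real" assume t: "test_function UNIV \<eta>"
  obtain R where R: "test_on (-R) R \<eta>" using test_function_imp_test_on[OF t] by blast
  have "(-1) ^ k *\<^sub>R (LINT x|lborel. \<eta> x *\<^sub>R g x) = ((-1) ^ k :: real) *\<^sub>R (LINT x|lborel. \<eta> x *\<^sub>R h x)"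
   using has_weak_derivD(3)[OF assms(1) t] has_weak_derivD(3)[OF assms(2) t] by simp
  then have "(LINT x|lborel. \<eta> x *\<^sub>R g x) = (LINT x|lborel. \<eta> x *\<^sub>R h x)" by simp
  then show "(LINT x|lborel. \<eta> x *\<^sub>R (g x - h x)) = 0"
   using test_integrable_loc[OF R l(1)] test_integrable_loc[OF R l(2)] by (simp add: scaleR_diff_right)
 qed
 then show ?thesis by simp
qed

text \<open>Uniqueness up to null sets makes the choice in \<open>weak_deriv\<close> harmless: every
  explicit candidate agrees with it almost everywhere.\<close>

lemma weak_deriv_AE:
 assumes "has_weak_deriv k f g"
 shows "has_weak_deriv k f (weak_deriv k f)" "AE x in lborel. weak_deriv k f x = g x"
proof -
 show 1: "has_weak_deriv k f (weak_deriv k f)" unfolding weak_deriv_def by (rule someI[of _ g]) (rule assms)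
 show "AE x in lborel. weak_deriv k f x = g x" by (rule has_weak_deriv_unique[OF 1 assms])
qed

lemma has_weak_deriv_bounded_linear:
 assumes L: "bounded_linear L" and w: "has_weak_deriv k f g"
 shows "has_weak_deriv k (%x. L (f x)) (%x. L (g x))"
proof -
 interpret bounded_linear L by fact
 have li: "locally_integrable (%x. L (f x))" if "locally_integrable f" for f unfolding locally_integrable_def set_integrable_def
 proof (intro allI impI)
  fix C :: "real set" assume "compact C"
  then have "integrable lborel (%x. indicator C x *\<^sub>R f x)"
   using that by (simp add: locally_integrable_def set_integrable_def)
  from integrable_bounded_linear[OF L this] show "integrable lborel (%x. indicator C x *\<^sub>R L (f x))" by (simp add: scale)
 qed
 show ?thesis unfolding has_weak_deriv_def
 proof (intro conjI allI impI)
  fix \<eta> :: "real => real" assume t: "test_function UNIV \<eta>"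
  obtain R where R: "test_on (-R) R \<eta>" using test_function_imp_test_on[OF t] by blast
  note i = test_integrable_loc[OF test_on_deriv_pow[OF R] has_weak_derivD(1)[OF w]]
    test_integrable_loc[OF R has_weak_derivD(2)[OF w]]
  have "(LINT x|lborel. (deriv ^^ k) \<eta> x *\<^sub>R L (f x)) = L (LINT x|lborel. (deriv ^^ k) \<eta> x *\<^sub>R f x)"
   using integral_bounded_linear[OF L i(1)] by (simp add: scale)
  also have "... = (-1) ^ k *\<^sub>R L (LINT x|lborel. \<eta> x *\<^sub>R g x)" using has_weak_derivD(3)[OF w t] by (simp add: scale)
  also have "... = (-1) ^ k *\<^sub>R (LINT x|lborel. \<eta> x *\<^sub>R L (g x))"
   using integral_bounded_linear[OF L i(2)] by (simp add: scale)
  finally show "(LINT x|lborel. (deriv ^^ k) \<eta> x *\<^sub>R L (f x)) = (-1) ^ k *\<^sub>R (LINT x|lborel. \<eta> x *\<^sub>R L (g x))" .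
 qed (use li has_weak_derivD[OF w] in auto)
qed

lemma has_weak_deriv_diff:
 assumes "has_weak_deriv k f g" "has_weak_deriv k f2 g2"
 shows "has_weak_deriv k (%x. f x - f2 x) (%x. g x - g2 x)" unfolding has_weak_deriv_def
proof (intro conjI allI impI)
 note l = has_weak_derivD(1,2)[OF assms(1)] has_weak_derivD(1,2)[OF assms(2)]
 show "locally_integrable (%x. f x - f2 x)" "locally_integrable (%x. g x - g2 x)"
  using l by (simp_all add: locally_integrable_def)
 fix \<eta> :: "real => real" assume t: "test_function UNIV \<eta>"
 obtain R where R: "test_on (-R) R \<eta>" using test_function_imp_test_on[OF t] by blast
 note i = test_integrable_loc[OF test_on_deriv_pow[OF R] l(1), of k]
  test_integrable_loc[OF test_on_deriv_pow[OF R] l(3), of k]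
  test_integrable_loc[OF R l(2)] test_integrable_loc[OF R l(4)]
 show "(LINT x|lborel. (deriv ^^ k) \<eta> x *\<^sub>R (f x - f2 x)) = (-1) ^ k *\<^sub>R (LINT x|lborel. \<eta> x *\<^sub>R (g x - g2 x))"
  using i has_weak_derivD(3)[OF assms(1) t] has_weak_derivD(3)[OF assms(2) t] by (simp add: scaleR_diff_right)
qed

lemma continuous_imp_locally_integrable:
 "continuous_on UNIV f ==> locally_integrable f" unfolding locally_integrable_def set_integrable_def
 using borel_integrable_compact continuous_on_subset by blast

lemma has_weak_deriv_0: "locally_integrable f ==> has_weak_deriv 0 f f" by (simp add: has_weak_deriv_def)

text \<open>One derivative is moved onto the test function and only the last step is a classical
  integration by parts. In this way a chain of classical derivatives becomes a chain of weak
  ones.\<close>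

lemma has_weak_deriv_Suc:
 assumes w: "has_weak_deriv k f g" and g: "!!x. (g has_vector_derivative h x) (at x)" "continuous_on UNIV h"
 shows "has_weak_deriv (Suc k) f h" unfolding has_weak_deriv_def
proof (intro conjI allI impI)
 show "locally_integrable f" using w by (rule has_weak_derivD)
 show "locally_integrable h" using g(2) by (rule continuous_imp_locally_integrable)
 have cg: "continuous_on UNIV g" using g(1) has_vector_derivative_continuous continuous_at_imp_continuous_on by blast
 fix \<eta> :: "real => real" assume t: "test_function UNIV \<eta>"
 obtain R where R: "test_on (-R) R \<eta>" using test_function_imp_test_on[OF t] by blast
 have t': "test_function UNIV (deriv \<eta>)" by (rule test_on_imp_test_function[OF test_on_deriv(2)[OF R]]) simp
 have "(LINT x|lborel. \<eta> x *\<^sub>R h x + deriv \<eta> x *\<^sub>R g x) = 0"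
 proof (rule integral_deriv_support[where h="%x. \<eta> x *\<^sub>R g x" and a="-R" and b=R])
  show "((%x. \<eta> x *\<^sub>R g x) has_vector_derivative \<eta> x *\<^sub>R h x + deriv \<eta> x *\<^sub>R g x) (at x)" for x
   by (rule has_vector_derivative_scaleR[OF test_on_deriv(1)[OF R] g(1)])
  show "continuous_on UNIV (%x. \<eta> x *\<^sub>R h x + deriv \<eta> x *\<^sub>R g x)"
   using test_on_continuous[OF R] test_on_continuous[OF test_on_deriv(2)[OF R]] g(2) cg by (intro continuous_intros)
 qed (use test_onD(2)[OF R] in auto)
 moreover have "integrable lborel (%x. \<eta> x *\<^sub>R h x)" "integrable lborel (%x. deriv \<eta> x *\<^sub>R g x)"
  by (rule test_integrable_loc[OF R continuous_imp_locally_integrable[OF g(2)]])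
   (rule test_integrable_loc[OF test_on_deriv(2)[OF R] continuous_imp_locally_integrable[OF cg]])
 ultimately have "(LINT x|lborel. \<eta> x *\<^sub>R h x) + (LINT x|lborel. deriv \<eta> x *\<^sub>R g x) = 0"
  using Bochner_Integration.integral_add by metis
 then have "(LINT x|lborel. deriv \<eta> x *\<^sub>R g x) = - (LINT x|lborel. \<eta> x *\<^sub>R h x)" unfolding add_eq_0_iff .
 then show "(LINT x|lborel. (deriv ^^ Suc k) \<eta> x *\<^sub>R f x) = (-1) ^ Suc k *\<^sub>R (LINT x|lborel. \<eta> x *\<^sub>R h x)"
  using has_weak_derivD(3)[OF w t'] unfolding funpow_Suc_right o_apply by simp
qed

section \<open>Density of test functions\<close>

lemma L2_indicator: "square_integrable (indicator {a..b} :: real => real)"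
proof -
 have "(%x. (norm (indicator {a..b} x :: real))\<^sup>2) = indicator {a..b}" by (auto split: split_indicator)
 then show ?thesis by (simp add: square_integrable_def emeasure_lborel_Icc_eq)
qed

lemma L2_bounded_Icc:
 fixes f :: "real => 'a::euclidean_space"
 assumes "f \<in> borel_measurable lborel" "!!x. norm (f x) \<le> C * indicator {a..b} x"
 shows "square_integrable f" by (rule L2_dominated[OF assms(1) L2_indicator[of a b], of C])
  (use assms(2) in auto)

lemma hd_real_polynomial: "real_polynomial_function P ==> higher_differentiable n P"
 by (induction rule: real_polynomial_function.induct) (auto intro: hd_linear hd_const hd_add hd_mult)

text \<open>Functions that can be approximated form an L^2-closed set \<open>A\<close>. It is
  enlarged from smooth functions restricted to [a, b] (by cutoffs) to continuous ones (Weierstrass),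
  to bounded measurable ones (almost everywhere limits of continuous functions) and to all of L^2
  (truncation of values).\<close>

lemma test_dense_L2:
 fixes p :: "real => real"
 assumes p: "square_integrable p" "!!x. x \<notin> {a..b} ==> p x = 0" and "e > 0"
 shows "\<exists>g. test_on a b g \<and> L2_norm (%x. g x - p x) < e"
proof -
 define A where "A p \<longleftrightarrow> (\<forall>e>0. \<exists>g. test_on a b g \<and> L2_norm (%x. g x - p x) < e)" for p :: "real => real"
 have lim: "A p" if p: "square_integrable p" and q: "!!n. square_integrable (q n)" "!!n. A (q n)"
  and l: "(%n. L2_norm (%x. q n x - p x)) \<longlonglongrightarrow> 0" for p and q :: "nat => real => real"
  unfolding A_def
 proof (intro allI impI)
  fix e :: real assume "e > 0"
  then have "\<forall>\<^sub>F n in sequentially. L2_norm (%x. q n x - p x) < e / 2"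
   using order_tendstoD(2)[OF l, of "e/2"] by simp
  then obtain n where n: "L2_norm (%x. q n x - p x) < e / 2" by (auto simp: eventually_sequentially)
  obtain g where g: "test_on a b g" "L2_norm (%x. g x - q n x) < e / 2"
   using q(2)[of n] \<open>e > 0\<close> unfolding A_def by (meson half_gt_zero)
  have "L2_norm (%x. g x - p x) < e"
   using L2_norm_triangle_diff[OF test_on_square_integrable[OF g(1)] q(1)[of n] p] g n by linarith
  then show "\<exists>g. test_on a b g \<and> L2_norm (%x. g x - p x) < e" using g by blast
 qed
 let ?I = "indicator {a..b} :: real => real"
 have P: "A (%x. ?I x * P x)" if hd: "!!n. higher_differentiable n P" for P :: "real => real" unfolding A_def
 proof (intro allI impI)
  fix e :: real assume "e > 0"
  have cP: "continuous_on UNIV P" using hd hd_continuous by blast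
  have "bounded (P ` {a..b})" by (intro compact_imp_bounded compact_continuous_image compact_Icc) (rule continuous_on_subset[OF cP], simp)
  then obtain B where B: "\<forall>x\<in>{a..b}. \<bar>P x\<bar> \<le> B" by (auto simp: bounded_iff)
  obtain cu :: "nat => real => real" where cu: "\<forall>n. test_on a b (cu n)" "\<forall>n x. 0 \<le> cu n x \<and> cu n x \<le> 1"
   "\<forall>x. (%n. cu n x) \<longlonglongrightarrow> indicator {a<..<b} x" using smooth_cutoffs[of a b] by blast
  have t: "test_on a b (%x. cu n x * P x)" for n using cu(1) hd unfolding test_on_def by (auto intro: hd_mult)
  have mP: "P \<in> borel_measurable lborel" using borel_measurable_continuous_onI[OF cP] by simp
  have "(%n. L2_norm (%x. cu n x * P x - ?I x * P x)) \<longlonglongrightarrow> 0"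
  proof (rule L2_dominated_convergence[where w="%x. B * ?I x"])
   show "square_integrable (%x. B * ?I x)"
    using L2_bounded_linear[OF bounded_linear_mult_right L2_indicator] .
   show "(%x. cu n x * P x - ?I x * P x) \<in> borel_measurable lborel" for n
    using mP test_on_measurable[OF cu(1)[rule_format, of n]] by measurable
   have "norm (cu n x * P x - ?I x * P x) \<le> B * ?I x" for n x
   proof (cases "x \<in> {a..b}")
    case True
    have "\<bar>cu n x - 1\<bar> * \<bar>P x\<bar> \<le> 1 * B" using cu(2)[rule_format, of n x] B True by (intro mult_mono) auto
    then show ?thesis using True by (simp add: left_diff_distrib[symmetric] abs_mult del: left_diff_distrib)
     (simp add: left_diff_distrib abs_mult[symmetric])
   qed (use cu(1) in \<open>auto simp: test_on_def\<close>)
   then show "AE x in lborel. norm (cu n x * P x - ?I x * P x) \<le> B * ?I x" for n by simp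
   have "AE x in lborel. x \<notin> {a, b}" by (intro AE_not_negligible) simp
   then show "AE x in lborel. (%n. cu n x * P x - ?I x * P x) \<longlonglongrightarrow> 0"
   proof eventually_elim
    case (elim x)
    then have "?I x = indicator {a<..<b} x" by (auto split: split_indicator)
    then have "(%n. cu n x) \<longlonglongrightarrow> ?I x" using cu(3) by simp
    then have "(%n. cu n x * P x - ?I x * P x) \<longlonglongrightarrow> ?I x * P x - ?I x * P x" by (intro tendsto_intros)
    then show ?case by simp
   qed
  qed
  from order_tendstoD(2)[OF this \<open>e > 0\<close>] show "\<exists>g. test_on a b g \<and> L2_norm (%x. g x - ?I x * P x) < e"
   using t by (auto simp: eventually_sequentially)
 qed
 have sI: "square_integrable (%x. ?I x * f x)" if c: "continuous_on UNIV f" for f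
 proof -
  have "bounded (f ` {a..b})" by (intro compact_imp_bounded compact_continuous_image compact_Icc) (rule continuous_on_subset[OF c], simp)
  then obtain B where B: "\<forall>x\<in>{a..b}. \<bar>f x\<bar> \<le> B" by (auto simp: bounded_iff)
  show ?thesis by (rule L2_bounded_Icc[of _ B a b])
    (use borel_measurable_continuous_onI[OF c] B in \<open>auto split: split_indicator\<close>)
 qed
 have C: "A (%x. ?I x * f x)" if c: "continuous_on UNIV f" for f
 proof -
  have "\<exists>g. real_polynomial_function g \<and> (\<forall>x\<in>{a..b}. \<bar>f x - g x\<bar> < inverse (real (Suc n)))" for n
   by (rule Stone_Weierstrass_real_polynomial_function[of "{a..b}" f "inverse (real (Suc n))"]) (use c continuous_on_subset in auto)
  then obtain g where g: "!!n. real_polynomial_function (g n)"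
   "!!n x. x \<in> {a..b} ==> \<bar>f x - g n x\<bar> < inverse (real (Suc n))" by metis
  have cg: "continuous_on UNIV (g n)" for n using hd_continuous hd_real_polynomial g(1) by blast
  show ?thesis
  proof (rule lim[where q="%n x. ?I x * g n x"])
   show "A (%x. ?I x * g n x)" for n by (rule P) (rule hd_real_polynomial[OF g(1)])
   have e1: "L2_norm (%x. ?I x * g n x - ?I x * f x) \<le> inverse (real (Suc n)) * L2_norm ?I" for n
   proof -
    have "L2_norm (%x. ?I x * g n x - ?I x * f x) \<le> L2_norm (%x. inverse (real (Suc n)) * ?I x)"
    proof (rule L2_norm_mono)
     show "(%x. ?I x * g n x - ?I x * f x) \<in> borel_measurable lborel"
      using L2D(1)[OF sI[OF c]] L2D(1)[OF sI[OF cg[of n]]] by measurable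
     show "square_integrable (%x. inverse (real (Suc n)) * ?I x)"
      using L2_bounded_linear[OF bounded_linear_mult_right L2_indicator] .
     have "norm (?I x * g n x - ?I x * f x) \<le> norm (inverse (real (Suc n)) * ?I x)" for x
     proof (cases "x \<in> {a..b}")
      case True
      then show ?thesis using g(2)[OF True, of n] by (simp add: abs_minus_commute)
     qed simp
     then show "AE x in lborel. norm (?I x * g n x - ?I x * f x) \<le> norm (inverse (real (Suc n)) * ?I x)" by simp
    qed
    also have "... = inverse (real (Suc n)) * L2_norm ?I" by (rule L2_norm_scale) auto
    finally show ?thesis .
   qed
   have e2: "(%n. inverse (real (Suc n)) * L2_norm ?I) \<longlonglongrightarrow> 0"
    by (rule tendsto_mult_left_zero[OF LIMSEQ_inverse_real_of_nat])
   show "(%n. L2_norm (%x. ?I x * g n x - ?I x * f x)) \<longlonglongrightarrow> 0"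
    by (rule Lim_null_comparison[OF always_eventually e2])
     (unfold real_norm_def abs_of_nonneg[OF L2_norm_nonneg], rule allI, rule e1)
  qed (rule sI, rule c, rule sI, rule cg)
 qed
 have B: "A q" if q: "q \<in> borel_measurable lborel" "!!x. \<bar>q x\<bar> \<le> M" "!!x. x \<notin> {a..b} ==> q x = 0" for q M
 proof -
  have "q measurable_on UNIV" using q(1) by (intro lebesgue_measurable_imp_measurable_on) (auto intro: measurable_completion)
  then obtain N and g :: "nat => real => real" where Ng: "negligible N \<and> (\<forall>n. continuous_on UNIV (g n)) \<and>
   (\<forall>x. x \<notin> N \<longrightarrow> (%n. g n x) \<longlonglongrightarrow> (if x \<in> UNIV then q x else 0))"
   unfolding measurable_on_def by blast
  then have N: "negligible N" and g: "!!n. continuous_on UNIV (g n)"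
   "!!x. x \<notin> N ==> (%n. g n x) \<longlonglongrightarrow> q x" by auto
  \<comment> \<open>Clamping to the bound M of \<open>q\<close> supplies the dominating function and
    does not change the limit, since \<open>q\<close> itself already lies within the bound.\<close>
  define h where "h n x = max (- M) (min M (g n x))" for n :: nat and x
  have M: "0 \<le> M" using q(2)[of 0] by linarith
  have ch: "continuous_on UNIV (h n)" for n unfolding h_def using g(1) by (intro continuous_intros)
  have bh: "\<bar>h n x\<bar> \<le> M" for n x using M by (auto simp: h_def)
  have sq: "square_integrable q" by (rule L2_bounded_Icc[of _ M a b]) (use q in \<open>auto split: split_indicator\<close>)
  show ?thesis
  proof (rule lim[where q="%n x. ?I x * h n x"])
   show "(%n. L2_norm (%x. ?I x * h n x - q x)) \<longlonglongrightarrow> 0"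
   proof (rule L2_dominated_convergence[where w="%x. (2 * M) * ?I x"])
    show "square_integrable (%x. (2 * M) * ?I x)"
     using L2_bounded_linear[OF bounded_linear_mult_right L2_indicator] .
    show "(%x. ?I x * h n x - q x) \<in> borel_measurable lborel" for n
     using q(1) L2D(1)[OF sI[OF ch[of n]]] by measurable
    have "norm (?I x * h n x - q x) \<le> (2 * M) * ?I x" for n x
     using bh[of n x] q(2)[of x] q(3)[of x] by (auto split: split_indicator)
    then show "AE x in lborel. norm (?I x * h n x - q x) \<le> (2 * M) * ?I x" for n by simp
    show "AE x in lborel. (%n. ?I x * h n x - q x) \<longlonglongrightarrow> 0" using AE_not_negligible[OF N]
    proof eventually_elim
     case (elim x)
     have "(%n. h n x) \<longlonglongrightarrow> max (- M) (min M (q x))" unfolding h_def by (intro tendsto_intros g(2) elim)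
     also have "max (- M) (min M (q x)) = q x" using q(2)[of x] by auto
     finally have "(%n. ?I x * h n x - q x) \<longlonglongrightarrow> ?I x * q x - q x" by (intro tendsto_intros)
     then show ?case using q(3)[of x] by (cases "x \<in> {a..b}") auto
    qed
   qed
  qed (rule sq, rule sI, rule ch, rule C, rule ch)
 qed
 have "A p"
 proof (rule lim[where q="%n x. max (- real n) (min (real n) (p x))"])
  note m = L2D(1)[OF p(1)]
  have le: "\<bar>max (- real n) (min (real n) (p x))\<bar> \<le> \<bar>p x\<bar>" for n x by auto
  have m': "(%x. max (- real n) (min (real n) (p x))) \<in> borel_measurable lborel" for n using m by measurable
  show "square_integrable (%x. max (- real n) (min (real n) (p x)))" for n
   using m' by (rule L2_dominated[OF _ p(1), of _ 1]) (use le in auto)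
  show "A (%x. max (- real n) (min (real n) (p x)))" for n by (rule B[of _ "real n"]) (use m' p(2) in auto)
  show "(%n. L2_norm (%x. max (- real n) (min (real n) (p x)) - p x)) \<longlonglongrightarrow> 0"
  proof (rule L2_dominated_convergence[where w="%x. \<bar>p x\<bar>"])
   show "square_integrable (%x. \<bar>p x\<bar>)" by (rule L2_dominated[OF _ p(1), of _ 1]) (use m in auto)
   show "(%x. max (- real n) (min (real n) (p x)) - p x) \<in> borel_measurable lborel" for n using m by measurable
   show "AE x in lborel. norm (max (- real n) (min (real n) (p x)) - p x) \<le> \<bar>p x\<bar>" for n by (intro AE_I2) auto
   show "AE x in lborel. (%n. max (- real n) (min (real n) (p x)) - p x) \<longlonglongrightarrow> 0"
   proof (intro AE_I2 tendsto_eventually)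
    fix x
    obtain N :: nat where N: "\<bar>p x\<bar> \<le> real N" using real_arch_simple by blast
    have "max (- real n) (min (real n) (p x)) - p x = 0" if "n \<ge> N" for n
    proof -
     have "real N \<le> real n" using that by simp
     then show ?thesis using N by linarith
    qed
    then show "\<forall>\<^sub>F n in sequentially. max (- real n) (min (real n) (p x)) - p x = 0"
     by (auto simp: eventually_sequentially)
   qed
  qed
 qed (rule p(1))
 then show ?thesis using \<open>e > 0\<close> by (simp add: A_def)
qed

lemma L2_Complex:
 "square_integrable f ==> square_integrable g ==> square_integrable (%x. Complex (f x) (g x))"
 using L2_add[of "%x. complex_of_real (f x)" "%x. \<i> * complex_of_real (g x)"]
  L2_bounded_linear[OF bounded_linear_of_real, of f]
  L2_bounded_linear[OF bounded_linear_compose[OF bounded_linear_mult_right bounded_linear_of_real], of g \<i>]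
 by (simp add: Complex_eq)

lemma L2_norm_Complex_le:
 assumes "square_integrable f" "square_integrable g"
 shows "L2_norm (%x. Complex (f x) (g x)) \<le> L2_norm f + L2_norm g"
proof -
 have "L2_norm (%x. complex_of_real (f x) + \<i> * complex_of_real (g x)) \<le>
   L2_norm (%x. complex_of_real (f x)) + L2_norm (%x. \<i> * complex_of_real (g x))"
  by (intro L2_norm_triangle L2_bounded_linear[OF bounded_linear_of_real]
   L2_bounded_linear[OF bounded_linear_compose[OF bounded_linear_mult_right bounded_linear_of_real]] assms)
 moreover have "L2_norm (%x. complex_of_real (f x)) = L2_norm f" "L2_norm (%x. \<i> * complex_of_real (g x)) = L2_norm g"
  by (simp_all add: L2_norm_def norm_mult)
 ultimately show ?thesis by (simp add: Complex_eq)
qed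

lemma L2_Re_Im:
 "square_integrable f ==> square_integrable (%x. Re (f x))"
 "square_integrable f ==> square_integrable (%x. Im (f x))"
 by (rule L2_bounded_linear[OF bounded_linear_Re] L2_bounded_linear[OF bounded_linear_Im], assumption)+

lemma test_dense_L2_complex:
 fixes p :: "real => complex"
 assumes p: "square_integrable p" "!!x. x \<notin> {a..b} ==> p x = 0" and "e > 0"
 shows "\<exists>g h. test_on a b g \<and> test_on a b h \<and> L2_norm (%x. Complex (g x) (h x) - p x) < e"
proof -
 obtain g where g: "test_on a b g" "L2_norm (%x. g x - Re (p x)) < e / 2"
  using test_dense_L2[OF L2_Re_Im(1)[OF p(1)], of a b "e/2"] p(2) \<open>e > 0\<close> by auto
 obtain h where h: "test_on a b h" "L2_norm (%x. h x - Im (p x)) < e / 2"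
  using test_dense_L2[OF L2_Re_Im(2)[OF p(1)], of a b "e/2"] p(2) \<open>e > 0\<close> by auto
 have "(%x. Complex (g x) (h x) - p x) = (%x. Complex (g x - Re (p x)) (h x - Im (p x)))" by (auto simp: complex_eq_iff)
 then have "L2_norm (%x. Complex (g x) (h x) - p x) \<le> L2_norm (%x. g x - Re (p x)) + L2_norm (%x. h x - Im (p x))"
  using L2_norm_Complex_le[of "%x. g x - Re (p x)" "%x. h x - Im (p x)"]
   L2_diff test_on_square_integrable[OF g(1)] test_on_square_integrable[OF h(1)]
   L2_Re_Im[OF p(1)] by auto
 then show ?thesis using g h by (intro exI[of _ g] exI[of _ h]) auto
qed

section \<open>Absolutely continuous functions\<close>

text \<open>Absolute continuity with square integrable derivative, stated as the fundamental theorem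
  of calculus. The derivative \<open>p\<close> is a second argument because it is only determined up
  to a null set.\<close>

definition primitive_L2 :: "(real => complex) => (real => complex) => bool" where
 "primitive_L2 f p \<longleftrightarrow> continuous_on UNIV f \<and> square_integrable p \<and>
   (\<forall>a b. a \<le> b \<longrightarrow> f b - f a = (LINT x:{a..b}|lborel. p x))"

lemma primitive_L2D:
 assumes "primitive_L2 f p"
 shows "continuous_on UNIV f" "square_integrable p" "a \<le> b ==> f b - f a = (LINT x:{a..b}|lborel. p x)"
 using assms by (auto simp: primitive_L2_def)

lemma continuous_on_UNIV_measurable: "continuous_on UNIV f ==> f \<in> borel_measurable lborel"
 for f :: "real => 'a::euclidean_space" using borel_measurable_continuous_onI by auto

lemma L2_set_integrable:
 fixes f :: "real => 'a::euclidean_space"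
 shows "square_integrable f ==> set_integrable lborel {a..b} f" by (intro locally_integrable_Icc L2_imp_locally_integrable)

lemma set_integral_norm_L2_le:
 fixes f :: "real => 'a::euclidean_space"
 assumes "square_integrable f" "a \<le> b"
 shows "(LINT x:{a..b}|lborel. norm (f x)) \<le> sqrt (b - a) * L2_norm f"
 using L2_Cauchy_Schwarz(2)[OF L2_indicator[of a b] assms(1)] assms(2)
 by (simp add: set_lebesgue_integral_def L2_norm_indicator)

lemma bounded_on_Icc:
 fixes f :: "real => 'a::real_normed_vector"
 assumes "continuous_on UNIV f"
 shows "\<exists>B\<ge>0. \<forall>x\<in>{a..b}. norm (f x) \<le> B"
proof -
 have "bounded (f ` {a..b})"
  by (intro compact_imp_bounded compact_continuous_image compact_Icc) (rule continuous_on_subset[OF assms], simp)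
 then obtain B where "\<forall>x\<in>{a..b}. norm (f x) \<le> B" by (auto simp: bounded_iff)
 then have "\<forall>x\<in>{a..b}. norm (f x) \<le> max B 0" by (meson max.coboundedI1)
 then show ?thesis by (intro exI[of _ "max B 0"]) simp
qed

lemma set_integrable_continuous_mult:
 fixes g p :: "real => complex"
 assumes c: "continuous_on UNIV g" and p: "set_integrable lborel {a..b} p"
 shows "set_integrable lborel {a..b} (%x. g x * p x)"
proof -
 obtain B where B: "B \<ge> 0" "\<forall>x\<in>{a..b}. norm (g x) \<le> B" using bounded_on_Icc[OF c] by blast
 have m: "(%x. indicator {a..b} x *\<^sub>R p x) \<in> borel_measurable lborel" using p by (auto simp: set_integrable_def)
 have e: "(%x. indicator {a..b} x *\<^sub>R (g x * p x)) = (%x. g x * (indicator {a..b} x *\<^sub>R p x))"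
  by (auto split: split_indicator)
 show ?thesis unfolding set_integrable_def
 proof (rule Bochner_Integration.integrable_bound)
  show "integrable lborel (%x. B *\<^sub>R (indicator {a..b} x *\<^sub>R p x))"
   using p unfolding set_integrable_def by (rule integrable_scaleR_right)
  show "(%x. indicator {a..b} x *\<^sub>R (g x * p x)) \<in> borel_measurable lborel"
   unfolding e using m continuous_on_UNIV_measurable[OF c] by measurable
  show "AE x in lborel. norm (indicator {a..b} x *\<^sub>R (g x * p x)) \<le> norm (B *\<^sub>R (indicator {a..b} x *\<^sub>R p x))"
   using B by (auto split: split_indicator simp: norm_mult intro!: mult_right_mono)
 qed
qed

text \<open>On [a, b] the derivative \<open>p\<close> is approximated in L^2 by smooth functions
  q_n. Their primitives u_n, started at f a, converge uniformly to \<open>f\<close>; the identity is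
  classical for u_n and passes to the limit.\<close>

lemma primitive_L2_chain:
 assumes f: "primitive_L2 f p" and D: "!!z. (\<Phi> has_field_derivative \<Phi>' z) (at z)" "continuous_on UNIV \<Phi>'"
  and ab: "a \<le> b"
 shows "\<Phi> (f b) - \<Phi> (f a) = (LINT x:{a..b}|lborel. \<Phi>' (f x) * p x)"
proof -
 note cf = primitive_L2D(1)[OF f] and sp = primitive_L2D(2)[OF f]
 define p1 where "p1 x = indicator {a..b} x *\<^sub>R p x" for x
 have sp1: "square_integrable p1" unfolding p1_def[abs_def] by (rule L2_dominated[OF _ sp, of _ 1])
   (use L2D(1)[OF sp] in \<open>auto split: split_indicator\<close>)
 have "\<exists>g h. test_on a b g \<and> test_on a b h \<and> L2_norm (%x. Complex (g x) (h x) - p1 x) < inverse (real (Suc n))" for n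
  by (rule test_dense_L2_complex[OF sp1]) (auto simp: p1_def)
 then obtain g h where gh: "!!n. test_on a b (g n)" "!!n. test_on a b (h n)"
  "!!n. L2_norm (%x. Complex (g n x) (h n x) - p1 x) < inverse (real (Suc n))" by metis
 define q where "q n x = Complex (g n x) (h n x)" for n x
 have cq: "continuous_on UNIV (q n)" for n
  unfolding q_def Complex_eq by (intro continuous_intros test_on_continuous[OF gh(1)] test_on_continuous[OF gh(2)])
 have sq: "square_integrable (q n)" for n unfolding q_def using gh test_on_square_integrable L2_Complex by blast
 \<comment> \<open>By Cauchy-Schwarz on [a, b] this bounds the distance of u_n from \<open>f\<close>
   uniformly in x.\<close>
 define \<delta> where "\<delta> n = sqrt (b - a) * L2_norm (%x. q n x - p1 x)" for n
 have \<delta>0: "\<delta> \<longlonglongrightarrow> 0"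
 proof -
  have "(%n. L2_norm (%x. q n x - p1 x)) \<longlonglongrightarrow> 0"
   by (rule tendsto_sandwich[OF _ _ tendsto_const LIMSEQ_inverse_real_of_nat])
    (use gh(3)[THEN less_imp_le] in \<open>auto simp: q_def\<close>)
  then show ?thesis unfolding \<delta>_def using tendsto_mult_right_zero by blast
 qed
 have "\<exists>F. \<forall>x. (F has_vector_derivative q n x) (at x)" for n using continuous_antiderivative[OF cq[of n]] by metis
 then obtain F where F: "!!n x. (F n has_vector_derivative q n x) (at x)" by metis
 define u where "u n x = f a + (F n x - F n a)" for n x
 have u: "(u n has_vector_derivative q n x) (at x)" for n x unfolding u_def using F by (auto intro!: derivative_eq_intros)
 have cu: "continuous_on UNIV (u n)" for n by (intro continuous_at_imp_continuous_on ballI has_vector_derivative_continuous[OF u])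
 have iq: "set_integrable lborel {c..d} (q n)" for n c d using sq L2_set_integrable by blast
 have uq: "u n x - u n a = (LINT y:{a..x}|lborel. q n y)" if "a \<le> x" for n x
 proof -
  have "(q n has_integral u n x - u n a) {a..x}"
   by (rule fundamental_theorem_of_calculus[OF that]) (rule has_vector_derivative_at_within[OF u])
  then show ?thesis using set_borel_integral_eq_integral(2)[OF iq] by (simp add: integral_unique)
 qed
 have sd: "square_integrable (%x. q n x - p1 x)" for n using sq sp1 L2_diff by blast
 have un: "norm (u n x - f x) \<le> \<delta> n" if x: "x \<in> {a..b}" for n x
 proof -
  have "u n x - f x = (LINT y:{a..x}|lborel. q n y) - (LINT y:{a..x}|lborel. p y)"
   using uq[of x n] primitive_L2D(3)[OF f, of a x] x by (simp add: u_def algebra_simps)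
  also have "... = (LINT y:{a..x}|lborel. q n y - p y)"
   using iq L2_set_integrable[OF sp] by (simp add: set_integral_diff(2))
  also have "norm ... \<le> (LINT y:{a..x}|lborel. norm (q n y - p y))"
   using set_integral_norm_bound[OF set_integral_diff(1)[OF iq L2_set_integrable[OF sp]]] .
  also have "... = (LINT y:{a..x}|lborel. norm (q n y - p1 y))" using x by (intro set_lebesgue_integral_cong) (auto simp: p1_def)
  also have "... \<le> sqrt (x - a) * L2_norm (%x. q n x - p1 x)" using x by (intro set_integral_norm_L2_le sd) auto
  also have "... \<le> \<delta> n" unfolding \<delta>_def using x by (intro mult_right_mono) auto
  finally show ?thesis .
 qed
 have ulim: "(%n. u n x) \<longlonglongrightarrow> f x" if "x \<in> {a..b}" for x
  by (rule LIM_zero_cancel, rule Lim_null_comparison[OF always_eventually \<delta>0], rule allI, rule un[OF that])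
 obtain B where B: "\<forall>x\<in>{a..b}. norm (f x) \<le> B" using bounded_on_Icc[OF cf] by blast
 \<comment> \<open>With this bound all u_n and \<open>f\<close> stay in one ball of radius B + M, on
   which \<Phi>' is bounded by compactness.\<close>
 obtain M where "\<forall>n. norm (\<delta> n) \<le> M" using convergent_imp_Bseq[OF convergentI[OF \<delta>0]] by (auto simp: Bseq_def)
 then have M: "\<delta> n \<le> M" for n using abs_le_D1 by auto
 have "bounded (\<Phi>' ` cball 0 (B + M))"
  using D(2) by (intro compact_imp_bounded compact_continuous_image compact_cball) (rule continuous_on_subset, auto)
 then obtain C where C: "\<forall>z\<in>cball 0 (B + M). norm (\<Phi>' z) \<le> C" by (auto simp: bounded_iff)
 have uB: "norm (u n x) \<le> B + M" "norm (f x) \<le> B + M" if x: "x \<in> {a..b}" for n x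
 proof -
  have "0 \<le> \<delta> n" using un[OF x, of n] norm_ge_zero order_trans by blast
  then show "norm (f x) \<le> B + M" using B x M[of n] by force
  show "norm (u n x) \<le> B + M" using norm_triangle_ineq[of "f x" "u n x - f x"] un[OF x, of n] B x M[of n] by force
 qed
 have c\<Phi>: "continuous_on UNIV (%x. \<Phi>' (v x))" if "continuous_on UNIV v" for v :: "real => complex"
  using continuous_on_compose2[OF D(2) that] by simp
 have isCont: "isCont \<Phi>' z" "isCont \<Phi> z" for z using D by (auto simp: continuous_on_eq_continuous_at intro: DERIV_isCont)
 define J where "J n = (LINT x:{a..b}|lborel. \<Phi>' (u n x) * q n x)" for n
 have J: "J n = \<Phi> (u n b) - \<Phi> (u n a)" for n
 proof -
  have "((%x. \<Phi> (u n x)) has_vector_derivative (q n x * \<Phi>' (u n x))) (at x within {a..b})" for x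
   using field_vector_diff_chain_at[OF u D(1)] by (auto simp: o_def intro: has_vector_derivative_at_within)
  then have "((%x. q n x * \<Phi>' (u n x)) has_integral \<Phi> (u n b) - \<Phi> (u n a)) {a..b}"
   using ab by (intro fundamental_theorem_of_calculus)
  then show ?thesis unfolding J_def using set_borel_integral_eq_integral(2)[OF set_integrable_continuous_mult[OF c\<Phi>[OF cu] iq]]
   by (simp add: integral_unique mult.commute)
 qed
 have l1: "J \<longlonglongrightarrow> \<Phi> (f b) - \<Phi> (f a)"
  unfolding J using ab by (intro tendsto_diff isCont_tendsto_compose[OF isCont(2)] ulim) auto
 have ip: "set_integrable lborel {a..b} (%x. v x * p x)" if "continuous_on UNIV v" for v
  by (rule set_integrable_continuous_mult[OF that L2_set_integrable[OF sp]])
 have i1: "set_integrable lborel {a..b} (%x. \<Phi>' (u n x) * (q n x - p x))" for n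
  by (rule set_integrable_continuous_mult[OF c\<Phi>[OF cu] set_integral_diff(1)[OF iq L2_set_integrable[OF sp]]])
 have i2: "set_integrable lborel {a..b} (%x. (\<Phi>' (u n x) - \<Phi>' (f x)) * p x)" for n
  by (intro ip continuous_intros c\<Phi> cu cf)
 \<comment> \<open>The first term is small because q_n - p is small in L^2, the second by dominated
   convergence, as \<Phi>' is continuous.\<close>
 have dec: "J n - (LINT x:{a..b}|lborel. \<Phi>' (f x) * p x) =
   (LINT x:{a..b}|lborel. \<Phi>' (u n x) * (q n x - p x)) + (LINT x:{a..b}|lborel. (\<Phi>' (u n x) - \<Phi>' (f x)) * p x)" for n
 proof -
  have "J n - (LINT x:{a..b}|lborel. \<Phi>' (f x) * p x) = (LINT x:{a..b}|lborel. \<Phi>' (u n x) * q n x - \<Phi>' (f x) * p x)"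
   unfolding J_def by (rule set_integral_diff(2)[symmetric]) (intro set_integrable_continuous_mult c\<Phi> cu iq ip cf)+
  also have "(%x. \<Phi>' (u n x) * q n x - \<Phi>' (f x) * p x) =
    (%x. \<Phi>' (u n x) * (q n x - p x) + (\<Phi>' (u n x) - \<Phi>' (f x)) * p x)" by (auto simp: algebra_simps)
  also have "(LINT x:{a..b}|lborel. \<Phi>' (u n x) * (q n x - p x) + (\<Phi>' (u n x) - \<Phi>' (f x)) * p x) =
    (LINT x:{a..b}|lborel. \<Phi>' (u n x) * (q n x - p x)) + (LINT x:{a..b}|lborel. (\<Phi>' (u n x) - \<Phi>' (f x)) * p x)"
   by (rule set_integral_add(2)[OF i1 i2])
  finally show ?thesis .
 qed
 have t1: "(%n. LINT x:{a..b}|lborel. \<Phi>' (u n x) * (q n x - p x)) \<longlonglongrightarrow> 0"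
 proof (rule tendsto_0_le[OF \<delta>0, of _ "max C 0"], rule always_eventually, rule allI)
  fix n
  have "norm (LINT x:{a..b}|lborel. \<Phi>' (u n x) * (q n x - p x)) \<le> (LINT x:{a..b}|lborel. norm (\<Phi>' (u n x) * (q n x - p x)))"
   by (rule set_integral_norm_bound[OF i1])
  also have "... \<le> (LINT x:{a..b}|lborel. max C 0 * norm (q n x - p1 x))"
  proof (rule set_integral_mono)
   show "set_integrable lborel {a..b} (%x. norm (\<Phi>' (u n x) * (q n x - p x)))" using i1 by (rule set_integrable_norm)
   show "set_integrable lborel {a..b} (%x. max C 0 * norm (q n x - p1 x))"
    by (intro set_integrable_mult_right set_integrable_norm L2_set_integrable sd)
   fix x assume x: "x \<in> {a..b}"
   then have "u n x \<in> cball 0 (B + M)" using uB(1)[OF x, of n] by simp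
   then have "norm (\<Phi>' (u n x)) \<le> max C 0" using C by (meson max.coboundedI1)
   then show "norm (\<Phi>' (u n x) * (q n x - p x)) \<le> max C 0 * norm (q n x - p1 x)"
    using x by (auto simp: norm_mult p1_def intro!: mult_right_mono)
  qed
  also have "... = max C 0 * (LINT x:{a..b}|lborel. norm (q n x - p1 x))" by (rule set_integral_mult_right)
  also have "... \<le> max C 0 * \<delta> n" unfolding \<delta>_def using ab by (intro mult_left_mono set_integral_norm_L2_le sd) auto
  also have "... \<le> norm (\<delta> n) * max C 0" unfolding mult.commute[of "max C 0"] by (intro mult_right_mono) auto
  finally show "norm (LINT x:{a..b}|lborel. \<Phi>' (u n x) * (q n x - p x)) \<le> norm (\<delta> n) * max C 0" .
 qed
 have t2: "(%n. LINT x:{a..b}|lborel. (\<Phi>' (u n x) - \<Phi>' (f x)) * p x) \<longlonglongrightarrow> 0"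
 proof -
  have "(%n. LINT x|lborel. indicator {a..b} x *\<^sub>R ((\<Phi>' (u n x) - \<Phi>' (f x)) * p x)) \<longlonglongrightarrow> (\<integral>x. 0 \<partial>(lborel::real measure))"
  proof (rule integral_dominated_convergence[where w="%x. 2 * C * norm (indicator {a..b} x *\<^sub>R p x)"])
   show "integrable lborel (%x. 2 * C * norm (indicator {a..b} x *\<^sub>R p x))"
    using L2_set_integrable[OF sp, of a b] unfolding set_integrable_def by (intro integrable_mult_right integrable_norm)
   show "(%x. indicator {a..b} x *\<^sub>R ((\<Phi>' (u n x) - \<Phi>' (f x)) * p x)) \<in> borel_measurable lborel" for n
    using i2[of n] by (auto simp: set_integrable_def)
   show "AE x in lborel. norm (indicator {a..b} x *\<^sub>R ((\<Phi>' (u n x) - \<Phi>' (f x)) * p x)) \<le> 2 * C * norm (indicator {a..b} x *\<^sub>R p x)" for n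
   proof (intro AE_I2)
    fix x
    show "norm (indicator {a..b} x *\<^sub>R ((\<Phi>' (u n x) - \<Phi>' (f x)) * p x)) \<le> 2 * C * norm (indicator {a..b} x *\<^sub>R p x)"
    proof (cases "x \<in> {a..b}")
     case True
     have "norm (\<Phi>' (u n x)) \<le> C" "norm (\<Phi>' (f x)) \<le> C" using C uB(1)[OF True, of n] uB(2)[OF True] by auto
     then have "norm (\<Phi>' (u n x) - \<Phi>' (f x)) \<le> 2 * C" using norm_triangle_ineq4[of "\<Phi>' (u n x)" "\<Phi>' (f x)"] by linarith
     then show ?thesis using True by (simp add: norm_mult mult_right_mono)
    qed simp
   qed
   show "AE x in lborel. (%n. indicator {a..b} x *\<^sub>R ((\<Phi>' (u n x) - \<Phi>' (f x)) * p x)) \<longlonglongrightarrow> 0"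
   proof (intro AE_I2)
    fix x
    show "(%n. indicator {a..b} x *\<^sub>R ((\<Phi>' (u n x) - \<Phi>' (f x)) * p x)) \<longlonglongrightarrow> 0"
    proof (cases "x \<in> {a..b}")
     case True
     have "(%n. (\<Phi>' (u n x) - \<Phi>' (f x)) * p x) \<longlonglongrightarrow> (\<Phi>' (f x) - \<Phi>' (f x)) * p x"
      by (intro tendsto_intros isCont_tendsto_compose[OF isCont(1) ulim[OF True]])
     then show ?thesis using True by simp
    qed simp
   qed
  qed simp
  then show ?thesis by (simp add: set_lebesgue_integral_def)
 qed
 have "(%n. J n - (LINT x:{a..b}|lborel. \<Phi>' (f x) * p x)) \<longlonglongrightarrow> 0 + 0"
  unfolding dec by (rule tendsto_add[OF t1 t2])
 then have "J \<longlonglongrightarrow> (LINT x:{a..b}|lborel. \<Phi>' (f x) * p x)" by (simp add: LIM_zero_iff)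
 then show ?thesis using l1 LIMSEQ_unique by blast
qed

lemma primitive_L2_add:
 assumes "primitive_L2 f p" "primitive_L2 g q"
 shows "primitive_L2 (%x. f x + g x) (%x. p x + q x)" unfolding primitive_L2_def
proof (intro conjI allI impI)
 fix a b :: real assume "a \<le> b"
 then show "f b + g b - (f a + g a) = (LINT x:{a..b}|lborel. p x + q x)"
  using primitive_L2D(3)[OF assms(1), of a b] primitive_L2D(3)[OF assms(2), of a b]
   primitive_L2D(2)[OF assms(1)] primitive_L2D(2)[OF assms(2)]
  by (subst set_integral_add(2)) (auto intro: L2_set_integrable simp: algebra_simps)
qed (use primitive_L2D[OF assms(1)] primitive_L2D[OF assms(2)] in \<open>auto intro: continuous_intros L2_add\<close>)

lemma primitive_L2_bounded_linear:
 assumes "bounded_linear L" "primitive_L2 f p"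
 shows "primitive_L2 (%x. L (f x)) (%x. L (p x))" unfolding primitive_L2_def
proof (intro conjI allI impI)
 interpret bounded_linear L by fact
 show "continuous_on UNIV (%x. L (f x))" by (intro continuous_on primitive_L2D(1)[OF assms(2)])
 show "square_integrable (%x. L (p x))" by (rule L2_bounded_linear[OF assms(1) primitive_L2D(2)[OF assms(2)]])
 fix a b :: real assume ab: "a \<le> b"
 have "L (f b) - L (f a) = L (LINT x:{a..b}|lborel. p x)" using primitive_L2D(3)[OF assms(2) ab] by (simp add: diff[symmetric])
 also have "... = (LINT x:{a..b}|lborel. L (p x))"
  using integral_bounded_linear[OF assms(1), of lborel "%x. indicator {a..b} x *\<^sub>R p x"]
   L2_set_integrable[OF primitive_L2D(2)[OF assms(2)], of a b]
  by (simp add: set_lebesgue_integral_def set_integrable_def scale)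
 finally show "L (f b) - L (f a) = (LINT x:{a..b}|lborel. L (p x))" .
qed

text \<open>Polarisation: 4 f g = (f + g)^2 - (f - g)^2, so the product rule follows from the chain
  rule for the square.\<close>

lemma primitive_L2_product:
 assumes f: "primitive_L2 f p" and g: "primitive_L2 g q" and ab: "a \<le> b"
 shows "f b * g b - f a * g a = (LINT x:{a..b}|lborel. p x * g x + f x * q x)"
proof -
 have D: "((%z. z\<^sup>2) has_field_derivative 2 * z) (at z)" for z :: complex by (auto intro!: derivative_eq_intros)
 have g': "primitive_L2 (%x. - g x) (%x. - q x)"
  by (rule primitive_L2_bounded_linear[OF bounded_linear_minus[OF bounded_linear_ident] g])
 note pl = primitive_L2_add[OF f g] and mi = primitive_L2_add[OF f g']
 have e1: "(f b + g b)\<^sup>2 - (f a + g a)\<^sup>2 = (LINT x:{a..b}|lborel. 2 * (f x + g x) * (p x + q x))"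
  by (rule primitive_L2_chain[OF pl D _ ab]) (intro continuous_intros)
 have e2: "(f b + - g b)\<^sup>2 - (f a + - g a)\<^sup>2 = (LINT x:{a..b}|lborel. 2 * (f x + - g x) * (p x + - q x))"
  by (rule primitive_L2_chain[OF mi D _ ab]) (intro continuous_intros)
 have e3: "(LINT x:{a..b}|lborel. 2 * (f x + g x) * (p x + q x)) - (LINT x:{a..b}|lborel. 2 * (f x + - g x) * (p x + - q x))
   = (LINT x:{a..b}|lborel. 2 * (f x + g x) * (p x + q x) - 2 * (f x + - g x) * (p x + - q x))"
  by (rule set_integral_diff(2)[symmetric]; intro set_integrable_continuous_mult continuous_intros
    L2_set_integrable primitive_L2D(1)[OF f] primitive_L2D(1)[OF g] primitive_L2D(2)[OF pl] primitive_L2D(2)[OF mi])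
 have e4: "(%x. 2 * (f x + g x) * (p x + q x) - 2 * (f x + - g x) * (p x + - q x)) = (%x. 4 * (p x * g x + f x * q x))"
  by (auto simp: algebra_simps)
 have e5: "(LINT x:{a..b}|lborel. 4 * (p x * g x + f x * q x)) = 4 * (LINT x:{a..b}|lborel. p x * g x + f x * q x)"
  by (rule set_integral_mult_right)
 have e6: "(f b + g b)\<^sup>2 - (f a + g a)\<^sup>2 - ((f b + - g b)\<^sup>2 - (f a + - g a)\<^sup>2) = 4 * (LINT x:{a..b}|lborel. p x * g x + f x * q x)"
  by (simp only: e1 e2 e3 e4 e5)
 have e7: "(f b + g b)\<^sup>2 - (f a + g a)\<^sup>2 - ((f b + - g b)\<^sup>2 - (f a + - g a)\<^sup>2) = 4 * (f b * g b - f a * g a)"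
  by (simp add: power2_eq_square algebra_simps)
 have "4 * (f b * g b - f a * g a) = 4 * (LINT x:{a..b}|lborel. p x * g x + f x * q x)" using e6 unfolding e7 .
 then show ?thesis unfolding mult_cancel_left by simp
qed

section \<open>The space \<open>H\<^sup>1\<close>\<close>

definition H1 :: "(real => complex) => (real => complex) => bool" where
 "H1 f p \<longleftrightarrow> primitive_L2 f p \<and> square_integrable f"

lemma H1D:
 assumes "H1 f p"
 shows "primitive_L2 f p" "square_integrable f" "square_integrable p" "continuous_on UNIV f"
  "f \<in> borel_measurable lborel" "p \<in> borel_measurable lborel"
proof -
 have p: "primitive_L2 f p" and f: "square_integrable f" using assms by (auto simp: H1_def)
 show "primitive_L2 f p" "square_integrable f" "square_integrable p" "continuous_on UNIV f"
  "f \<in> borel_measurable lborel" "p \<in> borel_measurable lborel"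
  by (rule p f primitive_L2D[OF p] L2D(1)[OF f] L2D(1)[OF primitive_L2D(2)[OF p]])+
qed

lemma set_integral_norm_mono_set:
 fixes p :: "real => complex"
 assumes "set_integrable lborel {a..b} p" "{c..d} \<subseteq> {a..b}"
 shows "(LINT x:{c..d}|lborel. norm (p x)) \<le> (LINT x:{a..b}|lborel. norm (p x))" unfolding set_lebesgue_integral_def
proof (rule integral_mono)
 have "set_integrable lborel {c..d} p" by (rule set_integrable_subset[OF assms(1) _ assms(2)]) simp
 then show "integrable lborel (%x. indicator {c..d} x *\<^sub>R norm (p x))"
  using set_integrable_norm[of lborel "{c..d}" p] by (simp add: set_integrable_def)
 show "integrable lborel (%x. indicator {a..b} x *\<^sub>R norm (p x))"
  using set_integrable_norm[OF assms(1)] by (simp add: set_integrable_def)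
 show "indicator {c..d} x *\<^sub>R norm (p x) \<le> indicator {a..b} x *\<^sub>R norm (p x)" for x
  using assms(2) by (auto split: split_indicator)
qed

lemma primitive_L2_increment:
 assumes "primitive_L2 f p" "x \<in> {a..b}" "y \<in> {a..b}"
 shows "norm (f y - f x) \<le> sqrt (b - a) * L2_norm p"
proof -
 note sp = primitive_L2D(2)[OF assms(1)]
 have *: "norm (f y - f x) \<le> sqrt (b - a) * L2_norm p" if "x \<le> y" "x \<in> {a..b}" "y \<in> {a..b}" for x y
 proof -
  have "norm (f y - f x) \<le> (LINT z:{x..y}|lborel. norm (p z))" unfolding primitive_L2D(3)[OF assms(1) that(1)]
   by (rule set_integral_norm_bound[OF L2_set_integrable[OF sp]])
  also have "... \<le> (LINT z:{a..b}|lborel. norm (p z))"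
   by (rule set_integral_norm_mono_set[OF L2_set_integrable[OF sp]]) (use that in auto)
  also have "... \<le> sqrt (b - a) * L2_norm p" by (rule set_integral_norm_L2_le[OF sp]) (use that in auto)
  finally show ?thesis .
 qed
 show ?thesis
 proof (cases "x \<le> y")
  case False
  then show ?thesis using *[of y x] assms by (simp add: norm_minus_commute)
 qed (use * assms in auto)
qed

text \<open>On the interval [x, x + 1] the function varies by at most \<open>L2_norm p\<close>;
  averaging over this interval of length 1 bounds the remaining value by
  \<open>L2_norm f\<close>.\<close>

lemma H1_sup:
 assumes "H1 f p"
 shows "norm (f x) \<le> L2_norm f + L2_norm p"
proof -
 let ?I = "{x..x+1}"
 have "(LINT y:?I|lborel. norm (f x) - L2_norm p) \<le> (LINT y:?I|lborel. norm (f y))"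
 proof (rule set_integral_mono)
  show "set_integrable lborel ?I (%y. norm (f x) - L2_norm p)" by (simp add: set_integrable_def borel_integrable_compact)
  show "set_integrable lborel ?I (%y. norm (f y))"
   by (intro set_integrable_norm L2_set_integrable H1D(2)[OF assms])
  fix y assume y: "y \<in> ?I"
  have "norm (f y - f x) \<le> sqrt (x + 1 - x) * L2_norm p" by (rule primitive_L2_increment[OF H1D(1)[OF assms]]) (use y in auto)
  then show "norm (f x) - L2_norm p \<le> norm (f y)" using norm_triangle_ineq2[of "f x" "f y"] by (simp add: norm_minus_commute)
 qed
 also have "(LINT y:?I|lborel. norm (f x) - L2_norm p) = norm (f x) - L2_norm p" by (simp add: set_lebesgue_integral_def)
 also have "(LINT y:?I|lborel. norm (f y)) \<le> sqrt (x + 1 - x) * L2_norm f" by (rule set_integral_norm_L2_le[OF H1D(2)[OF assms]]) simp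
 finally show ?thesis by simp
qed

lemma H1_add: "H1 f p ==> H1 g q ==> H1 (%x. f x + g x) (%x. p x + q x)"
 by (simp add: H1_def primitive_L2_add L2_add)

lemma H1_bounded_linear: "bounded_linear L ==> H1 f p ==> H1 (%x. L (f x)) (%x. L (p x))"
 by (simp add: H1_def primitive_L2_bounded_linear L2_bounded_linear)

lemma H1_diff: "H1 f p ==> H1 g q ==> H1 (%x. f x - g x) (%x. p x - q x)"
 using H1_add[of f p "%x. - g x" "%x. - q x"] H1_bounded_linear[OF bounded_linear_minus[OF bounded_linear_ident]] by simp

lemma L2_bounded_mult:
 fixes f g :: "real => complex"
 assumes "square_integrable f" "g \<in> borel_measurable lborel" "!!x. norm (g x) \<le> C"
 shows "square_integrable (%x. g x * f x)" by (rule L2_dominated[OF _ assms(1), of _ C])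
  (use assms(2,3) L2D(1)[OF assms(1)] in \<open>auto simp: norm_mult intro!: mult_right_mono AE_I2\<close>)

lemma L2_norm_bounded_mult:
 fixes f g :: "real => complex"
 assumes "square_integrable f" "g \<in> borel_measurable lborel" "!!x. norm (g x) \<le> C"
 shows "L2_norm (%x. g x * f x) \<le> C * L2_norm f"
proof -
 have C: "0 \<le> C" using assms(3)[of 0] norm_ge_zero order_trans by blast
 have "L2_norm (%x. g x * f x) \<le> L2_norm (%x. complex_of_real C * f x)"
 proof (rule L2_norm_mono)
  show "square_integrable (%x. complex_of_real C * f x)"
   by (rule L2_bounded_linear[OF bounded_linear_mult_right assms(1)])
  show "(%x. g x * f x) \<in> borel_measurable lborel" using L2D(1)[OF L2_bounded_mult[OF assms]] .
  show "AE x in lborel. norm (g x * f x) \<le> norm (complex_of_real C * f x)"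
   using assms(3) C by (auto simp: norm_mult intro!: mult_right_mono)
 qed
 also have "... = C * L2_norm f" by (rule L2_norm_scale) (use C in \<open>auto simp: norm_mult\<close>)
 finally show ?thesis .
qed

lemma H1_mult:
 assumes f: "H1 f p" and g: "H1 g q"
 shows "H1 (%x. f x * g x) (%x. p x * g x + f x * q x)" unfolding H1_def primitive_L2_def
proof (intro conjI allI impI)
 show "continuous_on UNIV (%x. f x * g x)" by (intro continuous_intros H1D(4)[OF f] H1D(4)[OF g])
 have "square_integrable (%x. g x * p x)" "square_integrable (%x. f x * q x)"
  by (rule L2_bounded_mult[OF H1D(3)[OF f] H1D(5)[OF g] H1_sup[OF g]])
   (rule L2_bounded_mult[OF H1D(3)[OF g] H1D(5)[OF f] H1_sup[OF f]])
 then show "square_integrable (%x. p x * g x + f x * q x)" using L2_add by (simp add: mult.commute)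
 show "square_integrable (%x. f x * g x)" by (rule L2_bounded_mult[OF H1D(2)[OF g] H1D(5)[OF f] H1_sup[OF f]])
qed (rule primitive_L2_product[OF H1D(1)[OF f] H1D(1)[OF g]])

lemma norm_exp_minus_1_le: "norm (exp z - 1) \<le> exp (norm z) * norm (z::complex)"
proof -
 have "norm (exp z - 1) \<le> exp \<bar>Re z\<bar> * norm z" using Taylor_exp[of z 0] by simp
 also have "... \<le> exp (norm z) * norm z" by (intro mult_right_mono) (auto simp: abs_Re_le_cmod)
 finally show ?thesis .
qed

lemma norm_exp_minus_1_minus_le: "norm (exp z - 1 - z) \<le> exp (norm z) * (norm (z::complex))\<^sup>2"
proof -
 have "norm (exp z - 1 - z) \<le> exp \<bar>Re z\<bar> * (norm z)\<^sup>2"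
  using Taylor_exp[of z 1] by (simp add: power2_eq_square algebra_simps)
 also have "... \<le> exp (norm z) * (norm z)\<^sup>2" by (intro mult_right_mono) (auto simp: abs_Re_le_cmod)
 finally show ?thesis .
qed

text \<open>The constant 1 has to be subtracted for square integrability. As \<open>f\<close> is
  bounded, exp (c f) - 1 is dominated by a multiple of \<open>f\<close>, and the derivative by a
  multiple of \<open>p\<close>.\<close>

lemma H1_exp:
 assumes f: "H1 f p"
 shows "H1 (%x. exp (c * f x) - 1) (%x. c * exp (c * f x) * p x)" unfolding H1_def primitive_L2_def
proof (intro conjI allI impI)
 define B where "B = norm c * (L2_norm f + L2_norm p)"
 have B: "norm (c * f x) \<le> B" for x unfolding B_def norm_mult by (intro mult_left_mono H1_sup[OF f]) simp
 have m: "(%x. exp (c * f x)) \<in> borel_measurable lborel"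
  by (intro continuous_on_UNIV_measurable continuous_intros H1D(4)[OF f])
 have eB: "norm (exp (c * f x)) \<le> exp B" for x using norm_exp[of "c * f x"] B[of x] by (meson exp_le_cancel_iff order_trans)
 show "continuous_on UNIV (%x. exp (c * f x) - 1)" by (intro continuous_intros H1D(4)[OF f])
 have "norm (c * exp (c * f x)) \<le> norm c * exp B" for x unfolding norm_mult by (intro mult_left_mono eB) simp
 then show "square_integrable (%x. c * exp (c * f x) * p x)"
  using L2_bounded_mult[OF H1D(3)[OF f], of "%x. c * exp (c * f x)"] m by auto
 show "square_integrable (%x. exp (c * f x) - 1)"
 proof (rule L2_dominated[OF _ H1D(2)[OF f], of _ "exp B * norm c"])
  show "(%x. exp (c * f x) - 1) \<in> borel_measurable lborel" using m by measurable
  have "norm (exp (c * f x) - 1) \<le> exp B * norm c * norm (f x)" for x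
  proof -
   have "norm (exp (c * f x) - 1) \<le> exp (norm (c * f x)) * norm (c * f x)" by (rule norm_exp_minus_1_le)
   also have "... \<le> exp B * norm (c * f x)" using B[of x] by (intro mult_right_mono) auto
   finally show ?thesis by (simp add: norm_mult mult.assoc)
  qed
  then show "AE x in lborel. norm (exp (c * f x) - 1) \<le> exp B * norm c * norm (f x)" by simp
 qed
 fix a b :: real assume "a \<le> b"
 moreover have "((%z. exp (c * z)) has_field_derivative c * exp (c * z)) (at z)" for z by (auto intro!: derivative_eq_intros)
 moreover have "continuous_on UNIV (%z. c * exp (c * z))" by (intro continuous_intros)
 ultimately show "exp (c * f b) - 1 - (exp (c * f a) - 1) = (LINT x:{a..b}|lborel. c * exp (c * f x) * p x)"
  using primitive_L2_chain[OF H1D(1)[OF f], of "%z. exp (c * z)" "%z. c * exp (c * z)" a b] by simp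
qed

lemma primitive_L2_classical:
 fixes f :: "real => complex"
 assumes "!!x. (f has_vector_derivative q x) (at x)" "square_integrable q"
 shows "primitive_L2 f q" unfolding primitive_L2_def
proof (intro conjI allI impI)
 show "continuous_on UNIV f" by (intro continuous_at_imp_continuous_on ballI has_vector_derivative_continuous[OF assms(1)])
 fix a b :: real assume "a \<le> b"
 then have "(q has_integral f b - f a) {a..b}"
  by (rule fundamental_theorem_of_calculus) (rule has_vector_derivative_at_within[OF assms(1)])
 then show "f b - f a = (LINT x:{a..b}|lborel. q x)"
  using set_borel_integral_eq_integral(2)[OF L2_set_integrable[OF assms(2)]] by (simp add: integral_unique)
qed (rule assms(2))

lemma H1_test:
 assumes "test_on a b g" "test_on c d h"
 shows "H1 (%x. Complex (g x) (h x)) (%x. Complex (deriv g x) (deriv h x))" unfolding H1_def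
proof
 have "((%x. complex_of_real (g x) + \<i> * complex_of_real (h x)) has_vector_derivative
   complex_of_real (deriv g x) + \<i> * complex_of_real (deriv h x)) (at x)" for x
  using test_on_deriv(1)[OF assms(1), of x] test_on_deriv(1)[OF assms(2), of x]
  by (auto intro!: derivative_eq_intros has_vector_derivative_of_real
    simp: has_real_derivative_iff_has_vector_derivative)
 then show "primitive_L2 (%x. Complex (g x) (h x)) (%x. Complex (deriv g x) (deriv h x))"
  by (intro primitive_L2_classical L2_Complex
    test_on_square_integrable[OF test_on_deriv(2)[OF assms(1)]]
    test_on_square_integrable[OF test_on_deriv(2)[OF assms(2)]]) (simp add: Complex_eq)
qed (intro L2_Complex test_on_square_integrable[OF assms(1)] test_on_square_integrable[OF assms(2)])

lemma test_on_zero: "test_on a b (%x. 0)" by (simp add: test_on_def hd_const)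

lemma H1_test_real:
 assumes "test_on a b g"
 shows "H1 (%x. of_real (g x)) (%x. of_real (deriv g x))" using H1_test[OF assms test_on_zero] by (simp add: Complex_eq)

section \<open>Sobolev functions and their continuous representatives\<close>

lemma primitive_L2_exists:
 assumes "square_integrable p"
 shows "\<exists>P. primitive_L2 P p"
proof -
 have i: "p integrable_on {a..b}" for a b by (rule set_borel_integral_eq_integral(1)[OF L2_set_integrable[OF assms]])
 define P where "P x = integral {0..x} p - integral {x..0} p" for x
 have c: "integral {a..b} p + integral {b..c} p = integral {a..c} p" if "a \<le> b" "b \<le> c" for a b c
  by (rule Henstock_Kurzweil_Integration.integral_combine[OF that i])
 have z: "integral {a..b} p = 0" if "b \<le> a" for a b using that by (cases "a = b") auto
 have P: "P b - P a = integral {a..b} p" if "a \<le> b" for a b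
 proof -
  consider "0 \<le> a" | "a \<le> 0" "0 \<le> b" | "b \<le> 0" by linarith
  then show ?thesis
  proof cases
   case 1
   then show ?thesis using c[of 0 a b] that by (simp add: P_def z algebra_simps)
  next
   case 2
   then show ?thesis using c[of a 0 b] by (simp add: P_def z algebra_simps)
  next
   case 3
   then show ?thesis using c[of a b 0] that by (simp add: P_def z algebra_simps)
  qed
 qed
 have "isCont P x" for x
 proof -
  define N where "N = \<bar>x\<bar> + 1"
  have "continuous_on {-N..N} (%x. P (-N) + integral {-N..x} p)" by (intro continuous_intros indefinite_integral_continuous_1 i)
  then have "continuous_on {-N..N} P"
  proof (rule continuous_on_cong[THEN iffD1, rotated -1])
   show "P (-N) + integral {-N..y} p = P y" if "y \<in> {-N..N}" for y using P[of "-N" y] that by (simp add: algebra_simps)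
  qed simp
  then have "continuous_on {-N<..<N} P" by (rule continuous_on_subset) auto
  then have "\<forall>y\<in>{-N<..<N}. isCont P y" by (simp add: continuous_on_eq_continuous_at)
  then show ?thesis by (rule bspec) (auto simp: N_def)
 qed
 then have "continuous_on UNIV P" by (simp add: continuous_at_imp_continuous_on)
 then show ?thesis
  unfolding primitive_L2_def using P assms set_borel_integral_eq_integral(2)[OF L2_set_integrable[OF assms]]
  by (intro exI[of _ P]) auto
qed

lemma sobolev_space_weak_deriv:
 assumes "f \<in> sobolev_space s" "real k \<le> s"
 shows "has_weak_deriv k f (weak_deriv k f)" "square_integrable (weak_deriv k f)"
proof -
 obtain g where g: "has_weak_deriv k f g" "square_integrable g" using assms by (auto simp: sobolev_space_def)
 show 1: "has_weak_deriv k f (weak_deriv k f)" using weak_deriv_AE(1)[OF g(1)] .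
 show "square_integrable (weak_deriv k f)"
 proof (rule L2_dominated[OF _ g(2), of _ 1])
  show "weak_deriv k f \<in> borel_measurable lborel" by (rule locally_integrable_measurable[OF has_weak_derivD(2)[OF 1]])
  show "AE x in lborel. norm (weak_deriv k f x) \<le> 1 * norm (g x)" using weak_deriv_AE(2)[OF g(1)] by eventually_elim simp
 qed
qed

lemma weak_deriv_0_AE:
 assumes "locally_integrable f"
 shows "AE x in lborel. weak_deriv 0 f x = f x" using weak_deriv_AE(2)[OF has_weak_deriv_0[OF assms]] .

lemma sobolev_space_square_integrable:
 assumes "f \<in> sobolev_space s" "s \<ge> 0"
 shows "square_integrable f" "locally_integrable f"
proof -
 have k: "real 0 \<le> s" using assms by simp
 show l: "locally_integrable f" by (rule has_weak_derivD(1)[OF sobolev_space_weak_deriv(1)[OF assms(1) k]])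
 show "square_integrable f"
 proof (rule L2_dominated[OF _ sobolev_space_weak_deriv(2)[OF assms(1) k], of _ 1])
  show "f \<in> borel_measurable lborel" by (rule locally_integrable_measurable[OF l])
  show "AE x in lborel. norm (f x) \<le> 1 * norm (weak_deriv 0 f x)" using weak_deriv_0_AE[OF l] by eventually_elim simp
 qed
qed

lemma AE_Icc_ex:
 assumes "AE x in lborel. x \<in> {a..b} \<longrightarrow> P x" "(a::real) < b"
 shows "\<exists>x. P x"
proof (rule ccontr)
 assume "\<nexists>x. P x"
 then have ae: "AE x in lborel. x \<notin> {a..b}" using assms(1) by simp
 have "{a..b} \<in> sets lborel" by simp
 from AE_iff_null_sets[OF this] ae have "{a..b} \<in> null_sets lborel" by blast
 then show False using assms(2) by (simp add: null_sets_def)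
qed

text \<open>If P is a primitive of the weak derivative, then f - P has weak derivative zero and is
  constant by du Bois-Reymond, so P plus this constant is the continuous representative.\<close>

lemma H1_of_sobolev:
 fixes f :: "real => complex"
 assumes f: "f \<in> sobolev_space s" "1 \<le> s"
 shows "\<exists>g. H1 g (weak_deriv 1 f) \<and> (AE x in lborel. f x = g x)"
proof -
 define p where "p = weak_deriv 1 f"
 have k: "real 1 \<le> s" using f by simp
 have w: "has_weak_deriv 1 f p" and sp: "square_integrable p" using sobolev_space_weak_deriv[OF f(1) k] by (auto simp: p_def)
 have sf: "square_integrable f" "locally_integrable f" using sobolev_space_square_integrable[OF f(1)] f(2) by auto
 obtain P where P: "primitive_L2 P p" using primitive_L2_exists[OF sp] by blast
 have lP: "locally_integrable P" by (rule continuous_imp_locally_integrable[OF primitive_L2D(1)[OF P]])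
 have lp: "locally_integrable p" by (rule L2_imp_locally_integrable[OF sp])
 have z: "(LINT x|lborel. deriv \<eta> x *\<^sub>R (f x - P x)) = 0" if \<eta>: "test_on a b \<eta>" "a < b" for a b \<eta>
 proof -
  have t: "test_function UNIV \<eta>" by (rule test_on_imp_test_function[OF \<eta>(1)]) simp
  have 1: "(LINT x|lborel. deriv \<eta> x *\<^sub>R f x) = - (LINT x|lborel. \<eta> x *\<^sub>R p x)"
   using has_weak_derivD(3)[OF w t] by simp
  have "0 = (LINT x:{a-1..b+1}|lborel. of_real (deriv \<eta> x) * P x + of_real (\<eta> x) * p x)"
   using primitive_L2_product[OF H1D(1)[OF H1_test_real[OF \<eta>(1)]] P, of "a-1" "b+1"] \<eta>(2)
    test_onD(2)[OF \<eta>(1)] by simp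
  also have "... = (LINT x|lborel. deriv \<eta> x *\<^sub>R P x + \<eta> x *\<^sub>R p x)" unfolding set_lebesgue_integral_def
   by (intro Bochner_Integration.integral_cong refl)
    (use test_onD(2)[OF \<eta>(1)] test_onD(2)[OF test_on_deriv(2)[OF \<eta>(1)]] in \<open>auto simp: scaleR_conv_of_real split: split_indicator\<close>)
  also have "... = (LINT x|lborel. deriv \<eta> x *\<^sub>R P x) + (LINT x|lborel. \<eta> x *\<^sub>R p x)"
   by (rule Bochner_Integration.integral_add test_integrable_loc[OF test_on_deriv(2)[OF \<eta>(1)] lP] test_integrable_loc[OF \<eta>(1) lp])+
  finally have "(LINT x|lborel. deriv \<eta> x *\<^sub>R P x) = - (LINT x|lborel. \<eta> x *\<^sub>R p x)"
   by (simp add: add_eq_0_iff2 eq_commute[of 0])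
  then show ?thesis unfolding scaleR_diff_right
   using 1 Bochner_Integration.integral_diff[OF test_integrable_loc[OF test_on_deriv(2)[OF \<eta>(1)] sf(2)]
     test_integrable_loc[OF test_on_deriv(2)[OF \<eta>(1)] lP]] by simp
 qed
 have "\<exists>c. AE x in lborel. x \<in> {- real (Suc n)..real (Suc n)} \<longrightarrow> f x - P x = c" for n
 proof -
  have "set_integrable lborel {- real (Suc n)..real (Suc n)} (%x. f x - P x)"
   by (intro set_integral_diff locally_integrable_Icc sf lP)
  moreover have "(%x. f x - P x) \<in> borel_measurable lborel"
   using locally_integrable_measurable[OF sf(2)] locally_integrable_measurable[OF lP] by measurable
  ultimately show ?thesis
   using du_Bois_Reymond[of "- real (Suc n)" "real (Suc n)" "%x. f x - P x"] z[of "- real (Suc n)" "real (Suc n)"]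
   by (metis neg_less_pos of_nat_0_less_iff zero_less_Suc)
 qed
 then obtain c where c: "!!n. AE x in lborel. x \<in> {- real (Suc n)..real (Suc n)} \<longrightarrow> f x - P x = c n" by metis
 \<comment> \<open>The constants were obtained on the intervals [- n - 1, n + 1] separately; they
   agree because all of these contain [- 1, 1].\<close>
 have c0: "c n = c 0" for n
 proof -
  have "AE x in lborel. x \<in> {- 1..1} \<longrightarrow> f x - P x = c n \<and> f x - P x = c 0"
   using c[of n] c[of 0] by eventually_elim auto
  from AE_Icc_ex[OF this] show ?thesis by auto
 qed
 have "AE x in lborel. f x - P x = c 0"
 proof (rule AE_Icc_all)
  fix n :: nat
  show "AE x in lborel. x \<in> {- real n..real n} \<longrightarrow> f x - P x = c 0"
   using c[of n] unfolding c0[of n] by eventually_elim auto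
 qed
 then have ae: "AE x in lborel. f x = P x + c 0" by eventually_elim (auto simp: algebra_simps)
 have "H1 (%x. P x + c 0) p" unfolding H1_def
 proof
  show "primitive_L2 (%x. P x + c 0) p" using P unfolding primitive_L2_def by (auto intro: continuous_intros)
  show "square_integrable (%x. P x + c 0)"
  proof (rule L2_dominated[OF _ sf(1), of _ 1])
   show "(%x. P x + c 0) \<in> borel_measurable lborel" using locally_integrable_measurable[OF lP] by measurable
   show "AE x in lborel. norm (P x + c 0) \<le> 1 * norm (f x)" using ae by eventually_elim simp
  qed
 qed
 then show ?thesis using ae p_def by blast
qed

section \<open>Density of smooth compactly supported functions in \<open>H1\<close>\<close>

lemma smooth_plateau:
 "\<exists>\<theta>. test_on (-2) 2 \<theta> \<and> (\<forall>x\<in>{-1..1}. \<theta> x = 1) \<and> (\<forall>x. 0 \<le> \<theta> x \<and> \<theta> x \<le> 1)"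
proof -
 obtain S :: "real => real" where "(\<forall>n. higher_differentiable n S) \<and> (\<forall>x\<le>0. S x = 0) \<and> (\<forall>x\<ge>1. S x = 1) \<and>
  (\<forall>x. 0 \<le> S x \<and> S x \<le> 1)" using smooth_step by blast
 then have S: "!!n. higher_differentiable n S" "!!x. x \<le> 0 ==> S x = 0" "!!x. x \<ge> 1 ==> S x = 1"
  "!!x. 0 \<le> S x \<and> S x \<le> 1" by auto
 have "higher_differentiable n (%x. S (x + 2) * S (- x + 2))" for n
  by (intro hd_mult hd_affine[OF bounded_linear_ident] hd_affine[OF bounded_linear_minus[OF bounded_linear_ident]] S)
 moreover have "S (x + 2) * S (- x + 2) = 0" if "x \<notin> {-2..2}" for x using that S(2)[of "x + 2"] S(2)[of "-x + 2"] by auto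
 ultimately show ?thesis using S by (intro exI[of _ "%x. S (x + 2) * S (- x + 2)"]) (auto simp: test_on_def intro: mult_le_one)
qed

text \<open>The derivative is approximated first. A multiple of a unit bump restores mean zero, so
  that the primitive has compact support again. This correction is small since \<open>p\<close> has
  mean zero, and the primitive is then close to \<phi> uniformly, hence in L^2 of the bounded
  interval.\<close>

lemma H1_dense_compact_support:
 assumes \<phi>: "H1 \<phi> p" and R: "R > 0" and z: "!!x. x \<notin> {-R..R} ==> \<phi> x = 0" "!!x. x \<notin> {-R..R} ==> p x = 0"
  and e: "e > 0"
 shows "\<exists>g h. test_on (-R) R g \<and> test_on (-R) R h \<and> L2_norm (%x. Complex (g x) (h x) - \<phi> x) < e \<and>
  L2_norm (%x. Complex (deriv g x) (deriv h x) - p x) < e"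
proof -
 obtain \<rho> where \<rho>: "test_on (-R) R \<rho>" "(LINT x|lborel. \<rho> x) = 1" using unit_bump[of "-R" R] R by auto
 \<comment> \<open>\<open>M1\<close> is the loss caused by the mean correction in the derivative.
   \<open>M2\<close> is the further loss for the function itself: a factor for the uniform bound on
   an interval of length 2 R + 2, and sqrt (2 R) for its L^2 norm.\<close>
 define M1 where "M1 = 1 + sqrt (2 * R) * L2_norm \<rho>"
 define M2 where "M2 = sqrt (2 * R) * (sqrt (2 * R + 2) * M1)"
 have M: "M1 > 0" "M2 \<ge> 0" using R by (auto simp: M1_def M2_def add_pos_nonneg)
 define \<delta> where "\<delta> = e / (M1 + M2 + 1)"
 have \<delta>: "\<delta> > 0" "M1 * \<delta> < e" "M2 * \<delta> < e" using e M by (auto simp: \<delta>_def field_simps add_pos_nonneg add_nonneg_pos)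
 note sp = H1D(3)[OF \<phi>]
 obtain g h where gh: "test_on (-R) R g" "test_on (-R) R h" "L2_norm (%x. Complex (g x) (h x) - p x) < \<delta>"
  using test_dense_L2_complex[of p "-R" R \<delta>, OF sp z(2) \<delta>(1)] by blast
 have ts: "integrable lborel \<eta>" "(LINT x|lborel. \<eta> x) = integral {-R..R} \<eta>" if "test_on (-R) R \<eta>" for \<eta>
  using continuous_support_integral[of \<eta> "-R" R] that test_on_continuous test_onD(2) by auto
 define a where "a = (LINT x|lborel. g x)"
 define b where "b = (LINT x|lborel. h x)"
 have prim: "\<exists>\<zeta>. test_on (-R) R \<zeta> \<and> (\<forall>x. (\<zeta> has_real_derivative \<eta> x + (- (LINT x|lborel. \<eta> x)) * \<rho> x) (at x))"
  if \<eta>: "test_on (-R) R \<eta>" for \<eta>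
 proof -
  let ?I = "LINT x|lborel. \<eta> x"
  have t2: "test_on (-R) R (%x. \<eta> x + (- ?I) * \<rho> x)" unfolding test_on_def
   by (intro conjI allI impI hd_add hd_mult hd_const test_onD(1)[OF \<eta>] test_onD(1)[OF \<rho>(1)])
    (simp add: test_onD(2)[OF \<eta>] test_onD(2)[OF \<rho>(1)])
  have "integral {-R..R} (%x. \<eta> x + (- ?I) * \<rho> x) = (LINT x|lborel. \<eta> x + (- ?I) * \<rho> x)"
   using ts(2)[OF t2] by simp
  also have "... = ?I + (- ?I) * (LINT x|lborel. \<rho> x)" using ts(1)[OF \<eta>] ts(1)[OF \<rho>(1)] by simp
  finally have "integral {-R..R} (%x. \<eta> x + (- ?I) * \<rho> x) = 0" by (simp add: \<rho>(2))
  then show ?thesis using test_on_primitive[OF t2] by metis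
 qed
 obtain \<zeta>1 where \<zeta>1: "test_on (-R) R \<zeta>1" "\<forall>x. (\<zeta>1 has_real_derivative g x + (- a) * \<rho> x) (at x)"
  using prim[OF gh(1)] a_def by blast
 obtain \<zeta>2 where \<zeta>2: "test_on (-R) R \<zeta>2" "\<forall>x. (\<zeta>2 has_real_derivative h x + (- b) * \<rho> x) (at x)"
  using prim[OF gh(2)] b_def by blast
 have d: "deriv \<zeta>1 x = g x + (- a) * \<rho> x" "deriv \<zeta>2 x = h x + (- b) * \<rho> x" for x
  using DERIV_imp_deriv \<zeta>1(2) \<zeta>2(2) by blast+
 define Q where "Q x = Complex (deriv \<zeta>1 x) (deriv \<zeta>2 x)" for x
 define Z where "Z x = Complex (\<zeta>1 x) (\<zeta>2 x)" for x
 have HZ: "H1 Z Q" unfolding Z_def Q_def using H1_test[OF \<zeta>1(1) \<zeta>2(1)] .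
 let ?G = "%x. Complex (g x) (h x)"
 have sG: "square_integrable ?G"
  by (intro L2_Complex test_on_square_integrable[OF gh(1)] test_on_square_integrable[OF gh(2)])
 have sGp: "square_integrable (%x. ?G x - p x)" by (rule L2_diff[OF sG sp])
 \<comment> \<open>The mean of \<open>p\<close> is an increment of \<phi> between two points outside
   its support, hence zero; so the mean of the approximation is the mean of its error.\<close>
 have mean: "norm (Complex a b) \<le> sqrt (2 * R) * \<delta>"
 proof -
  have full: "(LINT x:{-R-1..R+1}|lborel. f x) = (LINT x|lborel. f x)"
   if "!!x. x \<notin> {-R..R} ==> f x = 0" for f :: "real => complex" unfolding set_lebesgue_integral_def
   by (intro Bochner_Integration.integral_cong refl) (use that in \<open>force split: split_indicator\<close>)
  have "0 = (LINT x:{-R-1..R+1}|lborel. p x)"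
   using primitive_L2D(3)[OF H1D(1)[OF \<phi>], of "-R-1" "R+1"] R z(1)[of "R+1"] z(1)[of "-R-1"] by simp
  also have "... = (LINT x|lborel. p x)" by (rule full[OF z(2)])
  finally have p0: "(LINT x|lborel. p x) = 0" by simp
  have ip: "integrable lborel p"
  proof -
   have "(%x. indicator {-R..R} x *\<^sub>R p x) = p" using z(2) by (force split: split_indicator)
   then show ?thesis using L2_set_integrable[OF sp, of "-R" R] by (simp add: set_integrable_def)
  qed
  have iG: "integrable lborel ?G" "(LINT x|lborel. ?G x) = Complex a b"
   using ts(1)[OF gh(1)] ts(1)[OF gh(2)] by (simp_all add: Complex_eq a_def b_def)
  have "Complex a b = (LINT x|lborel. ?G x - p x)" using iG ip p0 by simp
  also have "... = (LINT x:{-R..R}|lborel. ?G x - p x)" unfolding set_lebesgue_integral_def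
   by (intro Bochner_Integration.integral_cong refl)
    (use z(2) test_onD(2)[OF gh(1)] test_onD(2)[OF gh(2)] in \<open>auto split: split_indicator simp: Complex_eq\<close>)
  also have "norm ... \<le> (LINT x:{-R..R}|lborel. norm (?G x - p x))"
   by (rule set_integral_norm_bound[OF L2_set_integrable[OF sGp]])
  also have "... \<le> sqrt (R - (-R)) * L2_norm (%x. ?G x - p x)" by (rule set_integral_norm_L2_le[OF sGp]) (use R in simp)
  also have "... \<le> sqrt (2 * R) * \<delta>" using gh(3) R by (auto intro!: mult_mono less_imp_le)
  finally show ?thesis .
 qed
 have sQp: "square_integrable (%x. Q x - p x)" by (rule L2_diff[OF H1D(3)[OF HZ] sp])
 have L1: "L2_norm (%x. Q x - p x) \<le> M1 * \<delta>"
 proof -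
  have s\<rho>: "square_integrable (%x. Complex a b * of_real (\<rho> x))"
   by (intro L2_bounded_linear[OF bounded_linear_compose[OF bounded_linear_mult_right bounded_linear_of_real]]
     test_on_square_integrable[OF \<rho>(1)])
  have e: "(%x. Q x - p x) = (%x. (?G x - p x) + - (Complex a b * of_real (\<rho> x)))"
   by (auto simp: Q_def d complex_eq_iff)
  have "L2_norm (%x. Q x - p x) \<le> L2_norm (%x. ?G x - p x) + L2_norm (%x. - (Complex a b * of_real (\<rho> x)))"
   unfolding e by (rule L2_norm_triangle[OF sGp L2_bounded_linear[OF bounded_linear_minus[OF bounded_linear_ident] s\<rho>]])
  also have "L2_norm (%x. - (Complex a b * of_real (\<rho> x))) = norm (Complex a b) * L2_norm \<rho>"
   by (rule L2_norm_scale) (auto simp: norm_mult)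
  also have "L2_norm (%x. ?G x - p x) + norm (Complex a b) * L2_norm \<rho> \<le> \<delta> + (sqrt (2 * R) * \<delta>) * L2_norm \<rho>"
   by (intro add_mono mult_right_mono mean) (use gh(3) in auto)
  also have "... = M1 * \<delta>" by (simp add: M1_def algebra_simps)
  finally show ?thesis .
 qed
 have sup: "norm (Z x - \<phi> x) \<le> sqrt (2 * R + 2) * (M1 * \<delta>) * indicator {-R..R} x" for x
 proof (cases "x \<in> {-R..R}")
  case True
  have "norm ((Z x - \<phi> x) - (Z (-R-1) - \<phi> (-R-1))) \<le> sqrt (R + 1 - (-R-1)) * L2_norm (%x. Q x - p x)"
   by (rule primitive_L2_increment[OF H1D(1)[OF H1_diff[OF HZ \<phi>]]]) (use True R in auto)
  moreover have "Z (-R-1) = 0" "\<phi> (-R-1) = 0"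
   using z(1)[of "-R-1"] test_onD(2)[OF \<zeta>1(1), of "-R-1"] test_onD(2)[OF \<zeta>2(1), of "-R-1"] by (auto simp: Z_def Complex_eq)
  ultimately have 1: "norm (Z x - \<phi> x) \<le> sqrt (R + 1 - (-R-1)) * L2_norm (%x. Q x - p x)" by (simp only: diff_zero)
  have 2: "sqrt (R + 1 - (-R-1)) * L2_norm (%x. Q x - p x) \<le> sqrt (2 * R + 2) * (M1 * \<delta>)"
   using L1 R by (intro mult_mono) (auto simp: algebra_simps)
  show ?thesis using order_trans[OF 1 2] True by simp
 next
  case False
  then show ?thesis using z(1) test_onD(2)[OF \<zeta>1(1)] test_onD(2)[OF \<zeta>2(1)] by (simp add: Z_def Complex_eq)
 qed
 have "L2_norm (%x. Z x - \<phi> x) \<le> L2_norm (%x. sqrt (2 * R + 2) * (M1 * \<delta>) * indicator {-R..R} x)"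
 proof (rule L2_norm_mono)
  show "square_integrable (%x. sqrt (2 * R + 2) * (M1 * \<delta>) * indicator {-R..R} x)"
   by (rule L2_bounded_linear[OF bounded_linear_mult_right L2_indicator])
  show "(%x. Z x - \<phi> x) \<in> borel_measurable lborel" using H1D(5)[OF H1_diff[OF HZ \<phi>]] .
  show "AE x in lborel. norm (Z x - \<phi> x) \<le> norm (sqrt (2 * R + 2) * (M1 * \<delta>) * indicator {-R..R} x)"
  proof (rule AE_I2)
   fix x
   show "norm (Z x - \<phi> x) \<le> norm (sqrt (2 * R + 2) * (M1 * \<delta>) * indicator {-R..R} x)"
    using sup[of x] unfolding real_norm_def by (rule order_trans[OF _ abs_ge_self])
  qed
 qed
 also have "... = (sqrt (2 * R + 2) * (M1 * \<delta>)) * L2_norm (indicator {-R..R} :: real => real)"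
  by (rule L2_norm_scale) (use M \<delta> R in \<open>auto simp: abs_mult\<close>)
 also have "... = M2 * \<delta>" using R by (simp add: L2_norm_indicator M2_def algebra_simps)
 finally have "L2_norm (%x. Z x - \<phi> x) < e" using \<delta> by simp
 moreover have "L2_norm (%x. Q x - p x) < e" using L1 \<delta> by simp
 ultimately show ?thesis using \<zeta>1(1) \<zeta>2(1) unfolding Z_def Q_def by blast
qed

text \<open>Multiplication by the plateau function stretched by n + 1 reduces to compact support:
  the cutoff tends to 1 boundedly and its derivative is of order 1 / n.\<close>

lemma H1_dense:
 assumes \<phi>: "H1 \<phi> p" and e: "e > 0"
 shows "\<exists>R g h. test_on (-R) R g \<and> test_on (-R) R h \<and> L2_norm (%x. Complex (g x) (h x) - \<phi> x) < e \<and>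
  L2_norm (%x. Complex (deriv g x) (deriv h x) - p x) < e"
proof -
 obtain \<theta> where "test_on (-2) 2 \<theta> \<and> (\<forall>x\<in>{-1..1}. \<theta> x = 1) \<and> (\<forall>x. 0 \<le> \<theta> x \<and> \<theta> x \<le> 1)"
  using smooth_plateau by blast
 then have \<theta>: "test_on (-2) 2 \<theta>" "!!x. x \<in> {-1..1} ==> \<theta> x = 1" "!!x. 0 \<le> \<theta> x \<and> \<theta> x \<le> 1" by auto
 obtain C where C: "\<forall>x. \<bar>deriv \<theta> x\<bar> \<le> C" using test_on_bounded[OF test_on_deriv(2)[OF \<theta>(1)]] by blast
 have C0: "C \<ge> 0" using C[rule_format, of 0] by linarith
 define c where "c n x = \<theta> (x / real (Suc n))" for n x
 have dc: "(c n has_real_derivative deriv \<theta> (x / real (Suc n)) / real (Suc n)) (at x)" for n x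
  unfolding c_def by (rule DERIV_chain2[OF test_on_deriv(1)[OF \<theta>(1)], THEN DERIV_cong]) (auto intro!: derivative_eq_intros)
 have deriv_c: "deriv (c n) x = deriv \<theta> (x / real (Suc n)) / real (Suc n)" for n x by (rule DERIV_imp_deriv[OF dc])
 have tc: "test_on (- (2 * real (Suc n))) (2 * real (Suc n)) (c n)" for n
 proof -
  have "higher_differentiable k (%x. \<theta> (inverse (real (Suc n)) * x + 0))" for k
   by (rule hd_affine[OF bounded_linear_mult_right test_onD(1)[OF \<theta>(1)]])
  then have "higher_differentiable k (c n)" for k by (simp add: c_def[abs_def] divide_inverse mult.commute)
  moreover have "c n x = 0" if "x \<notin> {- (2 * real (Suc n))..2 * real (Suc n)}" for x
  proof -
   have "x / real (Suc n) \<notin> {-2..2}" using that by (auto simp: field_simps)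
   then show ?thesis using test_onD(2)[OF \<theta>(1)] by (simp add: c_def)
  qed
  ultimately show ?thesis by (simp add: test_on_def)
 qed
 have Hc: "H1 (%x. of_real (c n x)) (%x. of_real (deriv (c n) x))" for n by (rule H1_test_real[OF tc])
 define f where "f n x = of_real (c n x) * \<phi> x" for n x
 define q where "q n x = of_real (deriv (c n) x) * \<phi> x + of_real (c n x) * p x" for n x
 have Hf: "H1 (f n) (q n)" for n unfolding f_def q_def by (rule H1_mult[OF Hc \<phi>])
 have cb: "\<bar>c n x\<bar> \<le> 1" "\<bar>c n x - 1\<bar> \<le> 1" for n x using \<theta>(3)[of "x / real (Suc n)"] by (auto simp: c_def)
 have db: "\<bar>deriv (c n) x\<bar> \<le> C / real (Suc n)" "\<bar>deriv (c n) x\<bar> \<le> C" for n x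
 proof -
  show 1: "\<bar>deriv (c n) x\<bar> \<le> C / real (Suc n)" unfolding deriv_c using C by (auto simp: abs_divide intro!: divide_right_mono)
  have "C / real (Suc n) \<le> C / 1" using C0 by (intro divide_left_mono) auto
  then show "\<bar>deriv (c n) x\<bar> \<le> C" using 1 by simp
 qed
 have clim: "(%n. c n x) \<longlonglongrightarrow> 1" for x
 proof (rule tendsto_eventually)
  obtain N :: nat where N: "\<bar>x\<bar> \<le> real N" using real_arch_simple by blast
  have "c n x = 1" if "n \<ge> N" for n
  proof -
   have "\<bar>x\<bar> \<le> real (Suc n)" using N that by simp
   then have "x / real (Suc n) \<in> {-1..1}" by (auto simp: field_simps abs_le_iff)
   then show ?thesis using \<theta>(2) by (simp add: c_def)
  qed
  then show "\<forall>\<^sub>F n in sequentially. c n x = 1" by (auto simp: eventually_sequentially)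
 qed
 have dlim: "(%n. deriv (c n) x) \<longlonglongrightarrow> 0" for x
 proof (rule Lim_null_comparison[OF always_eventually])
  show "\<forall>n. norm (deriv (c n) x) \<le> C * inverse (real (Suc n))" using db(1) by (simp add: divide_inverse)
  show "(%n. C * inverse (real (Suc n))) \<longlonglongrightarrow> 0" by (rule tendsto_mult_right_zero[OF LIMSEQ_inverse_real_of_nat])
 qed
 have sn: "square_integrable (%x. norm (F x))" if "square_integrable F" for F :: "real => complex"
  by (rule L2_dominated[OF _ that, of _ 1]) (use L2D(1)[OF that] in auto)
 have t1: "(%n. L2_norm (%x. f n x - \<phi> x)) \<longlonglongrightarrow> 0"
 proof (rule L2_dominated_convergence[OF sn[OF H1D(2)[OF \<phi>]]])
  show "(%x. f n x - \<phi> x) \<in> borel_measurable lborel" for n using H1D(5)[OF H1_diff[OF Hf \<phi>]] .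
  have "norm (f n x - \<phi> x) \<le> norm (\<phi> x)" for n x
  proof -
   have "f n x - \<phi> x = of_real (c n x - 1) * \<phi> x" by (simp add: f_def algebra_simps)
   then have "norm (f n x - \<phi> x) = \<bar>c n x - 1\<bar> * norm (\<phi> x)" by (simp only: norm_mult norm_of_real)
   also have "... \<le> 1 * norm (\<phi> x)" by (intro mult_right_mono cb) simp
   finally show ?thesis by simp
  qed
  then show "AE x in lborel. norm (f n x - \<phi> x) \<le> norm (\<phi> x)" for n by simp
  have "(%n. f n x - \<phi> x) \<longlonglongrightarrow> of_real 1 * \<phi> x - \<phi> x" for x
   unfolding f_def by (intro tendsto_intros clim)
  then show "AE x in lborel. (%n. f n x - \<phi> x) \<longlonglongrightarrow> 0" by simp
 qed
 have t2: "(%n. L2_norm (%x. q n x - p x)) \<longlonglongrightarrow> 0"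
 proof (rule L2_dominated_convergence[where w="%x. C * norm (\<phi> x) + norm (p x)"])
  show "square_integrable (%x. C * norm (\<phi> x) + norm (p x))" by (intro L2_add sn H1D(3)[OF \<phi>]
     L2_bounded_linear[OF bounded_linear_mult_right] H1D(2)[OF \<phi>])
  show "(%x. q n x - p x) \<in> borel_measurable lborel" for n using H1D(6)[OF H1_diff[OF Hf \<phi>]] .
  have "norm (q n x - p x) \<le> C * norm (\<phi> x) + norm (p x)" for n x
  proof -
   have "q n x - p x = of_real (deriv (c n) x) * \<phi> x + of_real (c n x - 1) * p x" by (simp add: q_def algebra_simps)
   then have "norm (q n x - p x) \<le> \<bar>deriv (c n) x\<bar> * norm (\<phi> x) + \<bar>c n x - 1\<bar> * norm (p x)"
    using norm_triangle_ineq[of "of_real (deriv (c n) x) * \<phi> x" "of_real (c n x - 1) * p x"] by (simp only: norm_mult norm_of_real)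
   also have "... \<le> C * norm (\<phi> x) + 1 * norm (p x)" by (intro add_mono mult_right_mono cb db) auto
   finally show ?thesis by simp
  qed
  then show "AE x in lborel. norm (q n x - p x) \<le> C * norm (\<phi> x) + norm (p x)" for n by simp
  have "(%n. q n x - p x) \<longlonglongrightarrow> of_real 0 * \<phi> x + of_real 1 * p x - p x" for x
   unfolding q_def by (intro tendsto_intros clim dlim)
  then show "AE x in lborel. (%n. q n x - p x) \<longlonglongrightarrow> 0" by simp
 qed
 have "\<forall>\<^sub>F n in sequentially. L2_norm (%x. f n x - \<phi> x) < e / 2 \<and> L2_norm (%x. q n x - p x) < e / 2"
  using order_tendstoD(2)[OF t1, of "e/2"] order_tendstoD(2)[OF t2, of "e/2"] e by (simp add: eventually_conj)
 then obtain n where n: "L2_norm (%x. f n x - \<phi> x) < e / 2" "L2_norm (%x. q n x - p x) < e / 2"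
  by (auto simp: eventually_sequentially)
 define R where "R = 2 * real (Suc n)"
 have zf: "f n x = 0" "q n x = 0" if "x \<notin> {-R..R}" for x
  using that test_onD(2)[OF tc, of x n] test_onD(2)[OF test_on_deriv(2)[OF tc], of x n] by (auto simp: R_def f_def q_def)
 obtain g h where gh: "test_on (-R) R g" "test_on (-R) R h" "L2_norm (%x. Complex (g x) (h x) - f n x) < e / 2"
  "L2_norm (%x. Complex (deriv g x) (deriv h x) - q n x) < e / 2"
  using H1_dense_compact_support[OF Hf[of n], of R "e/2"] zf e by (auto simp: R_def)
 note Hgh = H1_test[OF gh(1,2)]
 have "L2_norm (%x. Complex (g x) (h x) - \<phi> x) < e"
  using L2_norm_triangle_diff[OF H1D(2)[OF Hgh] H1D(2)[OF Hf[of n]] H1D(2)[OF \<phi>]] gh(3) n(1) by linarith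
 moreover have "L2_norm (%x. Complex (deriv g x) (deriv h x) - p x) < e"
  using L2_norm_triangle_diff[OF H1D(3)[OF Hgh] H1D(3)[OF Hf[of n]] H1D(3)[OF \<phi>]] gh(4) n(2) by linarith
 ultimately show ?thesis using gh(1,2) by blast
qed

section \<open>Weak solutions of the Schroedinger equation\<close>

definition L2_path :: "real => (real => real => 'a::euclidean_space) => bool" where
 "L2_path T v \<longleftrightarrow> (\<forall>t\<in>{0..<T}. square_integrable (v t) \<and>
   ((%r. L2_norm (%x. v r x - v t x)) \<longlongrightarrow> 0) (at t within {0..<T}))"

text \<open>The natural space for the right-hand sides: the squared derivative of an H^1 function is
  in general only integrable. It can be paired with H^1 functions since these are bounded.\<close>

definition L1_path :: "real => (real => real => complex) => bool" where
 "L1_path T F \<longleftrightarrow> (\<forall>t\<in>{0..<T}. integrable lborel (F t) \<and>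
   ((%r. LINT x|lborel. norm (F r x - F t x)) \<longlongrightarrow> 0) (at t within {0..<T}))"

text \<open>Continuity in time with values in H^1, with each v t its continuous representative and p
  t the spatial derivative kept as separate data.\<close>

definition H1_path :: "real => (real => real => complex) => (real => real => complex) => bool" where
 "H1_path T v p \<longleftrightarrow> (\<forall>t\<in>{0..<T}. H1 (v t) (p t)) \<and> L2_path T v \<and> L2_path T p"

lemma L2_pathD:
 assumes "L2_path T v" "t \<in> {0..<T}"
 shows "square_integrable (v t)" "((%r. L2_norm (%x. v r x - v t x)) \<longlongrightarrow> 0) (at t within {0..<T})"
 using assms by (auto simp: L2_path_def)

lemma L1_pathD:
 assumes "L1_path T F" "t \<in> {0..<T}"
 shows "integrable lborel (F t)" "((%r. LINT x|lborel. norm (F r x - F t x)) \<longlongrightarrow> 0) (at t within {0..<T})"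
 using assms by (auto simp: L1_path_def)

lemma H1_pathD:
 assumes "H1_path T v p"
 shows "t \<in> {0..<T} ==> H1 (v t) (p t)" "L2_path T v" "L2_path T p" using assms by (auto simp: H1_path_def)

lemma tendsto_dominated_within:
 fixes f :: "real => 'a::real_normed_vector" and g :: "real => real"
 assumes "(g \<longlongrightarrow> 0) (at t within S)" "!!r. r \<in> S ==> norm (f r - l) \<le> g r"
 shows "(f \<longlongrightarrow> l) (at t within S)" by (rule LIM_zero_cancel, rule Lim_null_comparison[OF _ assms(1)])
  (use assms(2) in \<open>auto simp: eventually_at_filter\<close>)

lemma integrable_L2_mult:
 fixes f g :: "real => complex"
 assumes "square_integrable f" "square_integrable g"
 shows "integrable lborel (%x. f x * g x)" using L2_Cauchy_Schwarz(1)[OF assms] by (rule Bochner_Integration.integrable_bound)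
  (use L2D(1)[OF assms(1)] L2D(1)[OF assms(2)] in \<open>auto simp: norm_mult\<close>)

lemma norm_integral_L2_mult_le:
 fixes f g :: "real => complex"
 assumes "square_integrable f" "square_integrable g"
 shows "norm (LINT x|lborel. f x * g x) \<le> L2_norm f * L2_norm g"
proof -
 have "norm (LINT x|lborel. f x * g x) \<le> (LINT x|lborel. norm (f x * g x))" by (rule integral_norm_bound)
 then show ?thesis using L2_Cauchy_Schwarz(2)[OF assms] by (simp add: norm_mult)
qed

lemma integrable_bounded_mult:
 fixes f g :: "real => complex"
 assumes "integrable lborel f" "g \<in> borel_measurable lborel" "!!x. norm (g x) \<le> C"
 shows "integrable lborel (%x. f x * g x)"
proof (rule Bochner_Integration.integrable_bound)
 show "integrable lborel (%x. C * norm (f x))" using assms(1) by simp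
 have C: "0 \<le> C" using assms(3)[of 0] norm_ge_zero order_trans by blast
 have "norm (f x * g x) \<le> norm (C * norm (f x))" for x
 proof -
  have "norm (f x * g x) \<le> norm (f x) * C" unfolding norm_mult by (intro mult_left_mono assms) simp
  also have "... = norm (C * norm (f x))" using C by (simp add: abs_mult)
  finally show ?thesis .
 qed
 then show "AE x in lborel. norm (f x * g x) \<le> norm (C * norm (f x))" by simp
 show "(%x. f x * g x) \<in> borel_measurable lborel" using assms borel_measurable_integrable by measurable
qed

lemma norm_integral_bounded_mult_le:
 fixes f g :: "real => complex"
 assumes "integrable lborel f" "g \<in> borel_measurable lborel" "!!x. norm (g x) \<le> C"
 shows "norm (LINT x|lborel. f x * g x) \<le> (LINT x|lborel. norm (f x)) * C"
proof -
 have "norm (LINT x|lborel. f x * g x) \<le> (LINT x|lborel. norm (f x) * C)"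
 proof (rule Bochner_Integration.integral_norm_bound_integral[OF integrable_bounded_mult[OF assms]])
  show "integrable lborel (%x. norm (f x) * C)" using assms(1) by simp
  show "norm (f x * g x) \<le> norm (f x) * C" for x unfolding norm_mult by (intro mult_left_mono assms) simp
 qed
 then show ?thesis by simp
qed

lemma L2_path_pairing_continuous:
 fixes v :: "real => real => complex"
 assumes "L2_path T v" "square_integrable \<phi>"
 shows "continuous_on {0..<T} (%t. LINT x|lborel. v t x * \<phi> x)" unfolding continuous_on_def
proof
 fix t assume t: "t \<in> {0..<T}"
 show "((%t. LINT x|lborel. v t x * \<phi> x) \<longlongrightarrow> (LINT x|lborel. v t x * \<phi> x)) (at t within {0..<T})"
 proof (rule tendsto_dominated_within)
  show "((%r. L2_norm (%x. v r x - v t x) * L2_norm \<phi>) \<longlongrightarrow> 0) (at t within {0..<T})"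
   by (rule tendsto_mult_left_zero[OF L2_pathD(2)[OF assms(1) t]])
  fix r assume r: "r \<in> {0..<T}"
  note s = L2_pathD(1)[OF assms(1) r] L2_pathD(1)[OF assms(1) t]
  have "(LINT x|lborel. v r x * \<phi> x) - (LINT x|lborel. v t x * \<phi> x) = (LINT x|lborel. (v r x - v t x) * \<phi> x)"
   using integrable_L2_mult[OF s(1) assms(2)] integrable_L2_mult[OF s(2) assms(2)] by (simp add: left_diff_distrib)
  then show "norm ((LINT x|lborel. v r x * \<phi> x) - (LINT x|lborel. v t x * \<phi> x)) \<le> L2_norm (%x. v r x - v t x) * L2_norm \<phi>"
   using norm_integral_L2_mult_le[OF L2_diff[OF s] assms(2)] by simp
 qed
qed

lemma L1_path_pairing_continuous:
 assumes "L1_path T F" "\<phi> \<in> borel_measurable lborel" "!!x. norm (\<phi> x) \<le> C"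
 shows "continuous_on {0..<T} (%t. LINT x|lborel. F t x * \<phi> x)" unfolding continuous_on_def
proof
 fix t assume t: "t \<in> {0..<T}"
 show "((%t. LINT x|lborel. F t x * \<phi> x) \<longlongrightarrow> (LINT x|lborel. F t x * \<phi> x)) (at t within {0..<T})"
 proof (rule tendsto_dominated_within)
  show "((%r. (LINT x|lborel. norm (F r x - F t x)) * C) \<longlongrightarrow> 0) (at t within {0..<T})"
   by (rule tendsto_mult_left_zero[OF L1_pathD(2)[OF assms(1) t]])
  fix r assume r: "r \<in> {0..<T}"
  note s = L1_pathD(1)[OF assms(1) r] L1_pathD(1)[OF assms(1) t]
  have "(LINT x|lborel. F r x * \<phi> x) - (LINT x|lborel. F t x * \<phi> x) = (LINT x|lborel. (F r x - F t x) * \<phi> x)"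
   unfolding left_diff_distrib by (rule Bochner_Integration.integral_diff[symmetric] integrable_bounded_mult[OF _ assms(2,3)] s)+
  then show "norm ((LINT x|lborel. F r x * \<phi> x) - (LINT x|lborel. F t x * \<phi> x)) \<le> (LINT x|lborel. norm (F r x - F t x)) * C"
   using norm_integral_bounded_mult_le[OF Bochner_Integration.integrable_diff[OF s] assms(2,3)] by simp
 qed
qed

lemma L2_path_norm_continuous:
 assumes "L2_path T v"
 shows "continuous_on {0..<T} (%t. L2_norm (v t))" unfolding continuous_on_def
proof
 fix t assume t: "t \<in> {0..<T}"
 show "((%t. L2_norm (v t)) \<longlongrightarrow> L2_norm (v t)) (at t within {0..<T})"
 proof (rule tendsto_dominated_within[OF L2_pathD(2)[OF assms t]])
  fix r assume r: "r \<in> {0..<T}"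
  show "norm (L2_norm (v r) - L2_norm (v t)) \<le> L2_norm (%x. v r x - v t x)"
   using L2_norm_le_add[OF L2_pathD(1)[OF assms r] L2_pathD(1)[OF assms t]]
    L2_norm_le_add[OF L2_pathD(1)[OF assms t] L2_pathD(1)[OF assms r]] L2_norm_minus[of "v t" "v r"] by simp
 qed
qed

lemma L1_path_norm_continuous:
 assumes "L1_path T F"
 shows "continuous_on {0..<T} (%t. LINT x|lborel. norm (F t x))" unfolding continuous_on_def
proof
 fix t assume t: "t \<in> {0..<T}"
 show "((%t. LINT x|lborel. norm (F t x)) \<longlongrightarrow> (LINT x|lborel. norm (F t x))) (at t within {0..<T})"
 proof (rule tendsto_dominated_within[OF L1_pathD(2)[OF assms t]])
  fix r assume r: "r \<in> {0..<T}"
  note s = L1_pathD(1)[OF assms r] L1_pathD(1)[OF assms t]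
  have "(LINT x|lborel. norm (F r x)) - (LINT x|lborel. norm (F t x)) = (LINT x|lborel. norm (F r x) - norm (F t x))" using s by simp
  also have "norm ... \<le> (LINT x|lborel. norm (F r x - F t x))"
   using s by (intro Bochner_Integration.integral_norm_bound_integral) (auto intro: norm_triangle_ineq3)
  finally show "norm ((LINT x|lborel. norm (F r x)) - (LINT x|lborel. norm (F t x))) \<le> (LINT x|lborel. norm (F r x - F t x))" .
 qed
qed

text \<open>The right-hand side of \<open>\<partial>\<^sub>t v = - \<i> (- \<partial>\<^sub>x\<^sup>2 v / (2 m) + F)\<close> tested with \<open>\<phi>\<close>, where \<open>p = \<partial>\<^sub>x v\<close> and \<open>q = \<partial>\<^sub>x \<phi>\<close>.\<close>

definition schroedinger_form ::
 "real => (real => complex) => (real => complex) => (real => complex) => (real => complex) => complex" where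
 "schroedinger_form m p F \<phi> q = - \<i> * ((1 / (2 * m)) *\<^sub>R (LINT x|lborel. p x * q x) + (LINT x|lborel. F x * \<phi> x))"

definition weak_solution ::
 "real => real => (real => real => complex) => (real => real => complex) => (real => real => complex) => bool" where
 "weak_solution m T v p F \<longleftrightarrow> (\<forall>\<phi> q. H1 \<phi> q \<longrightarrow> (\<forall>t\<in>{0..<T}.
   ((%r. LINT x|lborel. v r x * \<phi> x) has_vector_derivative schroedinger_form m (p t) (F t) \<phi> q) (at t within {0..<T})))"

lemma schroedinger_form_continuous:
 assumes "L2_path T p" "L1_path T F" "H1 \<phi> q"
 shows "continuous_on {0..<T} (%t. schroedinger_form m (p t) (F t) \<phi> q)" unfolding schroedinger_form_def
 by (intro continuous_intros L2_path_pairing_continuous[OF assms(1) H1D(3)[OF assms(3)]]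
   L1_path_pairing_continuous[OF assms(2) H1D(5)[OF assms(3)] H1_sup[OF assms(3)]])

lemma schroedinger_form_bound:
 assumes "square_integrable p" "integrable lborel F" "H1 \<phi> q" "m > 0"
 shows "norm (schroedinger_form m p F \<phi> q) \<le>
  (L2_norm p / (2 * m) + (LINT x|lborel. norm (F x))) * (L2_norm \<phi> + L2_norm q)"
proof -
 have "norm (schroedinger_form m p F \<phi> q) \<le> norm ((1 / (2 * m)) *\<^sub>R (LINT x|lborel. p x * q x)) + norm (LINT x|lborel. F x * \<phi> x)"
  unfolding schroedinger_form_def norm_mult norm_minus_cancel norm_ii mult_1 by (rule norm_triangle_ineq)
 also have "norm ((1 / (2 * m)) *\<^sub>R (LINT x|lborel. p x * q x)) \<le> (1 / (2 * m)) * (L2_norm p * L2_norm q)"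
  using norm_integral_L2_mult_le[OF assms(1) H1D(3)[OF assms(3)]] assms(4) by (simp add: divide_right_mono)
 also have "norm (LINT x|lborel. F x * \<phi> x) \<le> (LINT x|lborel. norm (F x)) * (L2_norm \<phi> + L2_norm q)"
  by (rule norm_integral_bounded_mult_le[OF assms(2) H1D(5)[OF assms(3)] H1_sup[OF assms(3)]])
 also have "(1 / (2 * m)) * (L2_norm p * L2_norm q) \<le> (L2_norm p / (2 * m)) * (L2_norm \<phi> + L2_norm q)"
  using assms(4) by (simp add: field_simps)
 finally show ?thesis by (simp add: algebra_simps)
qed

lemma path_bounds:
 assumes "L2_path T p" "L1_path T F" "\<tau> < T"
 shows "\<exists>B\<ge>0. \<forall>t\<in>{0..\<tau>}. L2_norm (p t) / (2 * m) + (LINT x|lborel. norm (F t x)) \<le> B"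
proof -
 have "continuous_on {0..<T} (%t. L2_norm (p t) / (2 * m) + (LINT x|lborel. norm (F t x)))"
  unfolding divide_inverse by (intro continuous_intros L2_path_norm_continuous L1_path_norm_continuous assms)
 then have "bounded ((%t. L2_norm (p t) / (2 * m) + (LINT x|lborel. norm (F t x))) ` {0..\<tau>})"
  by (intro compact_imp_bounded compact_continuous_image compact_Icc)
   (rule continuous_on_subset, use assms(3) in auto)
 then obtain B where B: "\<forall>t\<in>{0..\<tau>}. norm (L2_norm (p t) / (2 * m) + (LINT x|lborel. norm (F t x))) \<le> B"
  by (auto simp: bounded_iff)
 show ?thesis
 proof (intro exI[of _ "max B 0"] conjI ballI)
  fix t assume "t \<in> {0..\<tau>}"
  then show "L2_norm (p t) / (2 * m) + (LINT x|lborel. norm (F t x)) \<le> max B 0" using B by force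
 qed simp
qed

section \<open>From distributional to weak solutions\<close>

lemma continuous_AE_const:
 fixes f :: "real => complex"
 assumes "continuous_on UNIV f" "AE x in lborel. x \<in> {a..b} \<longrightarrow> f x = c" "x \<in> {a<..<b}"
 shows "f x = c"
proof (rule ccontr)
 assume "f x \<noteq> c"
 have "open ({x. f x \<noteq> c} \<inter> {a<..<b})"
 proof (rule open_Int)
  have e: "{x. f x \<noteq> c} = f -` (- {c})" by auto
  show "open {x. f x \<noteq> c}" unfolding e by (rule open_vimage[OF _ assms(1)]) (simp add: open_Compl)
 qed simp
 moreover have "x \<in> {x. f x \<noteq> c} \<inter> {a<..<b}" using \<open>f x \<noteq> c\<close> assms by simp
 ultimately obtain d where d: "d > 0" "cball x d \<subseteq> {x. f x \<noteq> c} \<inter> {a<..<b}" using open_contains_cball by blast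
 have "AE y in lborel. y \<in> {x - d..x + d} \<longrightarrow> False" using assms(2)
 proof eventually_elim
  case (elim y)
  have "{x - d..x + d} = cball x d" by (simp add: cball_eq_atLeastAtMost)
  then show ?case using elim d by fastforce
 qed
 then show False using AE_Icc_ex[of "x - d" "x + d" "%_. False"] d by auto
qed

text \<open>Against a primitive G of J, the difference I - G has weak derivative zero on inner
  intervals, so du Bois-Reymond makes it constant there and I is differentiable with derivative
  J.\<close>

lemma weak_time_derivative:
 fixes I J :: "real => complex"
 assumes I: "continuous_on {0..<T} I" and J: "continuous_on {0..<T} J"
  and eq: "!!l r a. test_on l r a ==> {l..r} \<subseteq> {0<..<T} ==>
   (LINT t|lborel. deriv a t *\<^sub>R I t) = - (LINT t|lborel. a t *\<^sub>R J t)"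
  and t: "t \<in> {0..<T}"
 shows "(I has_vector_derivative J t) (at t within {0..<T})" "(J has_integral I t - I 0) {0..t}"
proof -
 have int: "(I has_vector_derivative J t) (at t)" if t: "t \<in> {0<..<T}" for t
 proof -
  define l where "l = t / 2"
  define r where "r = (t + T) / 2"
  have lr: "0 < l" "l < t" "t < r" "r < T" using t by (auto simp: l_def r_def)
  \<comment> \<open>Clamping the time to [l, r] extends I and J continuously to the whole line
    without changing them where the test functions live.\<close>
  define cl where "cl s = max l (min r s)" for s
  have ccl: "continuous_on UNIV cl" unfolding cl_def by (intro continuous_intros)
  have clr: "cl s \<in> {0..<T}" for s using lr by (auto simp: cl_def)
  have cl_id: "cl s = s" if "s \<in> {l..r}" for s using that by (auto simp: cl_def)
  define Ic where "Ic s = I (cl s)" for s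
  define Jc where "Jc s = J (cl s)" for s
  have cI: "continuous_on UNIV Ic" and cJ: "continuous_on UNIV Jc" unfolding Ic_def Jc_def using clr
   by (auto intro!: continuous_on_compose2[OF I ccl] continuous_on_compose2[OF J ccl])
  have "\<exists>G. \<forall>s. (G has_vector_derivative Jc s) (at s)" using continuous_antiderivative[OF cJ] by metis
  then obtain G where G: "!!s. (G has_vector_derivative Jc s) (at s)" by blast
  have cG: "continuous_on UNIV G" by (intro continuous_at_imp_continuous_on ballI has_vector_derivative_continuous[OF G])
  have li: "locally_integrable Ic" "locally_integrable Jc" "locally_integrable G" by (rule continuous_imp_locally_integrable, fact)+
  have cIG: "continuous_on UNIV (%s. Ic s - G s)" by (intro continuous_intros cI cG)
  have z: "(LINT s|lborel. deriv a s *\<^sub>R (Ic s - G s)) = 0" if a: "test_on l r a" for a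
  proof -
   have "(LINT s|lborel. deriv a s *\<^sub>R Ic s) = (LINT s|lborel. deriv a s *\<^sub>R I s)"
    using test_onD(2)[OF test_on_deriv(2)[OF a]] cl_id by (intro Bochner_Integration.integral_cong refl) (metis Ic_def scaleR_zero_left)
   also have "... = - (LINT s|lborel. a s *\<^sub>R J s)" by (rule eq[OF a]) (use lr in auto)
   also have "(LINT s|lborel. a s *\<^sub>R J s) = (LINT s|lborel. a s *\<^sub>R Jc s)" using test_onD(2)[OF a] cl_id
    by (intro Bochner_Integration.integral_cong refl) (metis Jc_def scaleR_zero_left)
   finally have 1: "(LINT s|lborel. deriv a s *\<^sub>R Ic s) = - (LINT s|lborel. a s *\<^sub>R Jc s)" .
   have "test_function UNIV a" by (rule test_on_imp_test_function[OF a]) simp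
   from has_weak_derivD(3)[OF has_weak_deriv_Suc[OF has_weak_deriv_0[OF li(3)] G cJ] this]
   have 2: "(LINT s|lborel. deriv a s *\<^sub>R G s) = - (LINT s|lborel. a s *\<^sub>R Jc s)" by simp
   show ?thesis unfolding scaleR_diff_right
    using 1 2 Bochner_Integration.integral_diff[OF test_integrable_loc[OF test_on_deriv(2)[OF a] li(1)]
      test_integrable_loc[OF test_on_deriv(2)[OF a] li(3)]] by simp
  qed
  have si: "set_integrable lborel {l..r} (%s. Ic s - G s)" by (intro locally_integrable_Icc continuous_imp_locally_integrable cIG)
  have "l < r" using lr by simp
  then obtain c where c: "AE s in lborel. s \<in> {l..r} \<longrightarrow> Ic s - G s = c"
   by (rule du_Bois_Reymond[OF _ si continuous_on_UNIV_measurable[OF cIG] z])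
  have "Ic s - G s = c" if "s \<in> {l<..<r}" for s using continuous_AE_const[OF cIG c that] .
  then have e: "G s + c = I s" if "s \<in> {l<..<r}" for s using that cl_id[of s] by (force simp: Ic_def algebra_simps)
  have "((%s. G s + c) has_vector_derivative Jc t) (at t)" using G[of t] by (auto intro!: derivative_eq_intros)
  then have "(I has_vector_derivative Jc t) (at t)"
   by (rule has_vector_derivative_transform_within_open[of _ _ _ "{l<..<r}"]) (use lr e in auto)
  then show ?thesis using cl_id[of t] lr by (simp add: Jc_def)
 qed
 have h: "(J has_integral I t - I 0) {0..t}" if "t \<in> {0..<T}" for t by (rule fundamental_theorem_of_calculus_interior)
   (use that int in \<open>auto intro: continuous_on_subset[OF I]\<close>)
 show "(J has_integral I t - I 0) {0..t}" by (rule h[OF t])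
 \<comment> \<open>Test functions vanish near 0, so t = 0 is reached only through the integrated
   identity, which extends there by continuity and is then differentiated from the right.\<close>
 show "(I has_vector_derivative J t) (at t within {0..<T})"
 proof -
  define \<tau> where "\<tau> = (t + T) / 2"
  have \<tau>: "t < \<tau>" "\<tau> < T" using t by (auto simp: \<tau>_def)
  have "((%s. integral {0..s} J) has_vector_derivative J t) (at t within {0..\<tau>})"
   by (rule integral_has_vector_derivative) (use t \<tau> in \<open>auto intro: continuous_on_subset[OF J]\<close>)
  then have "((%s. I 0 + integral {0..s} J) has_vector_derivative J t) (at t within {0..\<tau>})"
   using has_vector_derivative_add[OF has_vector_derivative_const] by fastforce
  then have 1: "(I has_vector_derivative J t) (at t within {0..\<tau>})" by (rule has_vector_derivative_transform[rotated -1])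
    (use t \<tau> h in \<open>force simp: integral_unique\<close>)+
  have "at t within {0..\<tau>} = at t within {0..<T}" by (rule at_within_nhd[of _ "{..<\<tau>}"]) (use \<tau> in auto)
  then show ?thesis using 1 by simp
 qed
qed

lemma integral_full_support:
 fixes f :: "real => complex"
 assumes "!!x. x \<notin> {a..b} ==> f x = 0"
 shows "(LINT x:{a-1..b+1}|lborel. f x) = (LINT x|lborel. f x)" unfolding set_lebesgue_integral_def
 by (intro Bochner_Integration.integral_cong refl) (use assms in \<open>force split: split_indicator\<close>)

lemma H1_test_by_parts:
 assumes v: "H1 v p" and b: "test_on c d b"
 shows "(LINT x|lborel. v x * of_real (deriv b x)) = - (LINT x|lborel. p x * of_real (b x))"
proof (cases "c \<le> d")
 case True
 have z: "b x = 0" "deriv b x = 0" if "x \<notin> {c..d}" for x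
  using test_onD(2)[OF b that] test_onD(2)[OF test_on_deriv(2)[OF b] that] by auto
 note H = H1_test_real[OF b]
 have "0 = (LINT x:{c-1..d+1}|lborel. p x * of_real (b x) + v x * of_real (deriv b x))"
  using primitive_L2_product[OF H1D(1)[OF v] H1D(1)[OF H], of "c-1" "d+1"] z True by simp
 also have "... = (LINT x|lborel. p x * of_real (b x) + v x * of_real (deriv b x))" by (rule integral_full_support) (use z in auto)
 also have "... = (LINT x|lborel. p x * of_real (b x)) + (LINT x|lborel. v x * of_real (deriv b x))"
  by (intro Bochner_Integration.integral_add integrable_L2_mult H1D(2)[OF v] H1D(3)[OF v] H1D(2)[OF H] H1D(3)[OF H])
 finally show ?thesis by (simp add: eq_neg_iff_add_eq_0 add.commute)
next
 case False
 then have "b x = 0" "deriv b x = 0" for x using test_onD(2)[OF b, of x] test_onD(2)[OF test_on_deriv(2)[OF b], of x] by auto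
 then show ?thesis by simp
qed

text \<open>Testing with products a(t) b(x) separates the variables: the pairing with
  \<open>b\<close> has a continuous distributional derivative in time. The given \<open>u\<close>
  and \<open>G\<close> may be replaced by \<open>v\<close> and \<open>F\<close>, since each inner
  integral sees them only up to a null set.\<close>

lemma distributional_test_identity:
 assumes d: "schrodinger_distributional m T u G" and m: "m > 0"
  and v: "H1_path T v p" and F: "L1_path T F"
  and uv: "!!t. t \<in> {0..<T} ==> AE x in lborel. u t x = v t x" "!!t. t \<in> {0..<T} ==> u t \<in> borel_measurable lborel"
  and GF: "!!t. t \<in> {0..<T} ==> AE x in lborel. G t x = F t x" "!!t. t \<in> {0..<T} ==> G t \<in> borel_measurable lborel"
  and b: "test_on c d b" and t: "t \<in> {0..<T}"
 shows "(((%t. schroedinger_form m (p t) (F t) (%x. of_real (b x)) (%x. of_real (deriv b x)))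
  has_integral (LINT x|lborel. v t x * of_real (b x)) - (LINT x|lborel. v 0 x * of_real (b x))) {0..t})"
proof -
 define I where "I t = (LINT x|lborel. v t x * of_real (b x))" for t
 define J where "J t = schroedinger_form m (p t) (F t) (%x. of_real (b x)) (%x. of_real (deriv b x))" for t
 note H = H1_test_real[OF b] and H' = H1_test_real[OF test_on_deriv(2)[OF b]]
 have cI: "continuous_on {0..<T} I" unfolding I_def by (rule L2_path_pairing_continuous[OF H1_pathD(2)[OF v] H1D(2)[OF H]])
 have cJ: "continuous_on {0..<T} J" unfolding J_def by (rule schroedinger_form_continuous[OF H1_pathD(3)[OF v] F H])
 have "(LINT t|lborel. deriv a t *\<^sub>R I t) = - (LINT t|lborel. a t *\<^sub>R J t)"
  if a: "test_on l r a" and lr: "{l..r} \<subseteq> {0<..<T}" for l r a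
 proof -
  let ?\<psi> = "%(t, x). a t * b x"
  have "(LINT t|lborel. (LINT x|lborel. u t x * (- \<i> * of_real (deriv (%r. ?\<psi> (r, x)) t)
       + of_real (1 / (2 * m) * (deriv ^^ 2) (%y. ?\<psi> (t, y)) x))))
    = (LINT t|lborel. (LINT x|lborel. G t x * of_real (?\<psi> (t, x))))"
   using d test_function_tensor[OF a b lr] unfolding schrodinger_distributional_def by blast
  also have "(%t. LINT x|lborel. G t x * of_real (?\<psi> (t, x))) = (%t. a t *\<^sub>R (LINT x|lborel. F t x * of_real (b x)))"
  proof
   fix t
   show "(LINT x|lborel. G t x * of_real (?\<psi> (t, x))) = a t *\<^sub>R (LINT x|lborel. F t x * of_real (b x))"
   proof (cases "t \<in> {l..r}")
    case True
    then have t: "t \<in> {0..<T}" using lr by auto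
    have "(LINT x|lborel. G t x * of_real (?\<psi> (t, x))) = (LINT x|lborel. a t *\<^sub>R (F t x * of_real (b x)))"
    proof (rule integral_cong_AE)
     show "AE x in lborel. G t x * of_real (?\<psi> (t, x)) = a t *\<^sub>R (F t x * of_real (b x))"
      using GF(1)[OF t] by eventually_elim (simp add: scaleR_conv_of_real)
    qed (use GF(2)[OF t] L1_pathD(1)[OF F t] H1D(5)[OF H] in \<open>simp_all, measurable\<close>)
    then show ?thesis by simp
   qed (use test_onD(2)[OF a] in simp)
  qed
  also have "(%t. LINT x|lborel. u t x * (- \<i> * of_real (deriv (%r. ?\<psi> (r, x)) t)
       + of_real (1 / (2 * m) * (deriv ^^ 2) (%y. ?\<psi> (t, y)) x))) =
    (%t. - \<i> * (deriv a t *\<^sub>R I t) - (1 / (2 * m)) *\<^sub>R (a t *\<^sub>R (LINT x|lborel. p t x * of_real (deriv b x))))"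
  proof
   fix t
   have da: "deriv (%r. ?\<psi> (r, x)) t = deriv a t * b x" for x
    by (rule DERIV_imp_deriv) (auto intro!: derivative_eq_intros test_on_deriv(1)[OF a])
   have db: "(deriv ^^ 2) (%y. ?\<psi> (t, y)) x = a t * deriv (deriv b) x" for x
   proof -
    have "deriv (%y. a t * b y) = (%y. a t * deriv b y)"
     by (intro ext DERIV_imp_deriv) (auto intro!: derivative_eq_intros test_on_deriv(1)[OF b])
    moreover have "deriv (%y. a t * deriv b y) x = a t * deriv (deriv b) x"
     by (rule DERIV_imp_deriv) (auto intro!: derivative_eq_intros test_on_deriv(1)[OF test_on_deriv(2)[OF b]])
    ultimately show ?thesis by (simp add: numeral_2_eq_2)
   qed
   show "(LINT x|lborel. u t x * (- \<i> * of_real (deriv (%r. ?\<psi> (r, x)) t)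
       + of_real (1 / (2 * m) * (deriv ^^ 2) (%y. ?\<psi> (t, y)) x))) =
     - \<i> * (deriv a t *\<^sub>R I t) - (1 / (2 * m)) *\<^sub>R (a t *\<^sub>R (LINT x|lborel. p t x * of_real (deriv b x)))"
   proof (cases "t \<in> {l..r}")
    case True
    then have t: "t \<in> {0..<T}" using lr by auto
    note Hv = H1_pathD(1)[OF v t]
    have i1: "integrable lborel (%x. v t x * of_real (b x))" by (rule integrable_L2_mult[OF H1D(2)[OF Hv] H1D(2)[OF H]])
    have i2: "integrable lborel (%x. v t x * of_real (deriv (deriv b) x))" by (rule integrable_L2_mult[OF H1D(2)[OF Hv] H1D(3)[OF H']])
    have "(LINT x|lborel. u t x * (- \<i> * of_real (deriv (%r. ?\<psi> (r, x)) t)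
       + of_real (1 / (2 * m) * (deriv ^^ 2) (%y. ?\<psi> (t, y)) x))) =
      (LINT x|lborel. (- \<i> * of_real (deriv a t)) * (v t x * of_real (b x)) + (of_real (1 / (2 * m) * a t)) * (v t x * of_real (deriv (deriv b) x)))"
    proof (rule integral_cong_AE)
     show "AE x in lborel. u t x * (- \<i> * of_real (deriv (%r. ?\<psi> (r, x)) t)
       + of_real (1 / (2 * m) * (deriv ^^ 2) (%y. ?\<psi> (t, y)) x)) =
       (- \<i> * of_real (deriv a t)) * (v t x * of_real (b x)) + (of_real (1 / (2 * m) * a t)) * (v t x * of_real (deriv (deriv b) x))"
      using uv(1)[OF t] unfolding da db by eventually_elim (simp add: algebra_simps)
     show "(%x. u t x * (- \<i> * of_real (deriv (%r. ?\<psi> (r, x)) t)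
       + of_real (1 / (2 * m) * (deriv ^^ 2) (%y. ?\<psi> (t, y)) x))) \<in> borel_measurable lborel"
      unfolding da db using uv(2)[OF t] test_on_measurable[OF b] test_on_measurable[OF test_on_deriv(2)[OF test_on_deriv(2)[OF b]]]
      by measurable
    qed (use borel_measurable_integrable[OF i1] borel_measurable_integrable[OF i2] in measurable)
    also have "... = (- \<i> * of_real (deriv a t)) * I t + (of_real (1 / (2 * m) * a t)) * (LINT x|lborel. v t x * of_real (deriv (deriv b) x))"
     unfolding I_def using i1 i2 by simp
    also have "(LINT x|lborel. v t x * of_real (deriv (deriv b) x)) = - (LINT x|lborel. p t x * of_real (deriv b x))"
     by (rule H1_test_by_parts[OF Hv test_on_deriv(2)[OF b]])
    finally show ?thesis by (simp add: scaleR_conv_of_real algebra_simps)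
   next
    case False
    then show ?thesis unfolding da db using test_onD(2)[OF a False] test_onD(2)[OF test_on_deriv(2)[OF a] False] by simp
   qed
  qed
  finally have e: "(LINT t|lborel. - \<i> * (deriv a t *\<^sub>R I t) - (1 / (2 * m)) *\<^sub>R (a t *\<^sub>R (LINT x|lborel. p t x * of_real (deriv b x)))) =
    (LINT t|lborel. a t *\<^sub>R (LINT x|lborel. F t x * of_real (b x)))" .
  \<comment> \<open>\<open>K\<close> is continuous on [0, T) only; it is cut to the compact support
    [l, r] of the test function before integrating.\<close>
  have ai: "integrable lborel (%t. \<eta> t *\<^sub>R K t)" if \<eta>: "test_on l r \<eta>" and K: "continuous_on {0..<T} K" for \<eta> and K :: "real => complex"
  proof -
   have "set_integrable lborel {l..r} K" unfolding set_integrable_def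
    by (rule borel_integrable_compact) (use lr in \<open>auto intro!: continuous_on_subset[OF K]\<close>)
   then have s: "integrable lborel (%t. indicator {l..r} t *\<^sub>R K t)" by (simp add: set_integrable_def)
   have "set_integrable lborel {l..r} (%t. indicator {l..r} t *\<^sub>R K t)"
    unfolding set_integrable_def using s by (rule integrable_mult_indicator[rotated]) simp
   then have "integrable lborel (%t. \<eta> t *\<^sub>R (indicator {l..r} t *\<^sub>R K t))"
    by (rule test_on_integrable[OF \<eta> _ borel_measurable_integrable[OF s]])
   moreover have "(%t. \<eta> t *\<^sub>R (indicator {l..r} t *\<^sub>R K t)) = (%t. \<eta> t *\<^sub>R K t)"
    using test_onD(2)[OF \<eta>] by (force split: split_indicator)
   ultimately show ?thesis by simp
  qed
  have cP: "continuous_on {0..<T} (%t. LINT x|lborel. p t x * of_real (deriv b x))"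
   by (rule L2_path_pairing_continuous[OF H1_pathD(3)[OF v] H1D(3)[OF H]])
  have cF: "continuous_on {0..<T} (%t. LINT x|lborel. F t x * of_real (b x))"
   by (rule L1_path_pairing_continuous[OF F H1D(5)[OF H] H1_sup[OF H]])
  note i1 = ai[OF test_on_deriv(2)[OF a] cI] and i2 = ai[OF a cP] and i3 = ai[OF a cF]
  let ?A = "LINT t|lborel. deriv a t *\<^sub>R I t"
  let ?B = "LINT t|lborel. a t *\<^sub>R (LINT x|lborel. p t x * of_real (deriv b x))"
  let ?C = "LINT t|lborel. a t *\<^sub>R (LINT x|lborel. F t x * of_real (b x))"
  have "- \<i> * ?A - (1 / (2 * m)) *\<^sub>R ?B = ?C"
   using e Bochner_Integration.integral_diff[OF integrable_mult_right[OF i1, of "- \<i>"] integrable_scaleR_right[OF i2, of "1 / (2 * m)"]]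
   by (simp only: integral_mult_right_zero integral_scaleR_right)
  then have "\<i> * (- \<i> * ?A) = \<i> * ((1 / (2 * m)) *\<^sub>R ?B + ?C)" by (simp add: algebra_simps)
  then have A: "?A = \<i> * ((1 / (2 * m)) *\<^sub>R ?B + ?C)" by simp
  have "(%t. a t *\<^sub>R J t) = (%t. - \<i> * ((1 / (2 * m)) *\<^sub>R (a t *\<^sub>R (LINT x|lborel. p t x * of_real (deriv b x))) +
    a t *\<^sub>R (LINT x|lborel. F t x * of_real (b x))))"
   by (auto simp: J_def schroedinger_form_def scaleR_conv_of_real algebra_simps)
  then have "(LINT t|lborel. a t *\<^sub>R J t) = - \<i> * ((1 / (2 * m)) *\<^sub>R ?B + ?C)"
   using Bochner_Integration.integral_add[OF integrable_scaleR_right[OF i2, of "1 / (2 * m)"] i3]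
   by (simp only: integral_mult_right_zero integral_scaleR_right)
  then show ?thesis using A by simp
 qed
 from weak_time_derivative(2)[OF cI cJ this t] show ?thesis by (simp add: I_def J_def)
qed

lemma schroedinger_form_diff:
 assumes "square_integrable p" "integrable lborel F" "H1 \<phi> q" "H1 \<phi>2 q2"
 shows "schroedinger_form m p F (%x. \<phi> x - \<phi>2 x) (%x. q x - q2 x) =
  schroedinger_form m p F \<phi> q - schroedinger_form m p F \<phi>2 q2"
 unfolding schroedinger_form_def right_diff_distrib[where 'a=complex, of "p _"] right_diff_distrib[where 'a=complex, of "F _"]
 using integrable_L2_mult[OF assms(1) H1D(3)[OF assms(3)]] integrable_L2_mult[OF assms(1) H1D(3)[OF assms(4)]]
  integrable_bounded_mult[OF assms(2) H1D(5)[OF assms(3)] H1_sup[OF assms(3)]]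
  integrable_bounded_mult[OF assms(2) H1D(5)[OF assms(4)] H1_sup[OF assms(4)]] by (simp add: algebra_simps)

text \<open>The identity for real test functions extends to complex ones by linearity and to H^1 by
  density. The limit is taken in the time-integrated form, where the errors are controlled;
  differentiation in time comes afterwards.\<close>

lemma distributional_imp_weak_solution:
 assumes d: "schrodinger_distributional m T u G" and m: "m > 0"
  and v: "H1_path T v p" and F: "L1_path T F"
  and uv: "!!t. t \<in> {0..<T} ==> AE x in lborel. u t x = v t x" "!!t. t \<in> {0..<T} ==> u t \<in> borel_measurable lborel"
  and GF: "!!t. t \<in> {0..<T} ==> AE x in lborel. G t x = F t x" "!!t. t \<in> {0..<T} ==> G t \<in> borel_measurable lborel"
 shows "weak_solution m T v p F" unfolding weak_solution_def
proof (intro allI impI ballI)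
 fix \<phi> q t assume H: "H1 \<phi> q" and t: "t \<in> {0..<T}"
 define I where "I \<phi> t = (LINT x|lborel. v t x * \<phi> x)" for \<phi> t
 define J where "J \<phi> q t = schroedinger_form m (p t) (F t) \<phi> q" for \<phi> q t
 have cJ: "continuous_on {0..<T} (J \<phi> q)" if "H1 \<phi> q" for \<phi> q
  unfolding J_def by (rule schroedinger_form_continuous[OF H1_pathD(3)[OF v] F that])
 have test: "(J (%x. Complex (g x) (h x)) (%x. Complex (deriv g x) (deriv h x)) has_integral
   I (%x. Complex (g x) (h x)) t - I (%x. Complex (g x) (h x)) 0) {0..t}"
  if g: "test_on l r g" and h: "test_on l r h" and t: "t \<in> {0..<T}" for l r g h t
 proof -
  note Hg = H1_test_real[OF g] and Hh = H1_test_real[OF h]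
  have T0: "0 \<in> {0..<T}" using t by auto
  have eI: "I (%x. Complex (g x) (h x)) s = I (%x. of_real (g x)) s + \<i> * I (%x. of_real (h x)) s" if s: "s \<in> {0..<T}" for s
  proof -
   have "(%x. v s x * Complex (g x) (h x)) = (%x. v s x * of_real (g x) + \<i> * (v s x * of_real (h x)))"
    by (simp add: Complex_eq algebra_simps)
   then show ?thesis using integrable_L2_mult[OF L2_pathD(1)[OF H1_pathD(2)[OF v] s] H1D(2)[OF Hg]]
     integrable_L2_mult[OF L2_pathD(1)[OF H1_pathD(2)[OF v] s] H1D(2)[OF Hh]] by (simp add: I_def)
  qed
  have eJ: "J (%x. Complex (g x) (h x)) (%x. Complex (deriv g x) (deriv h x)) s =
    J (%x. of_real (g x)) (%x. of_real (deriv g x)) s + \<i> * J (%x. of_real (h x)) (%x. of_real (deriv h x)) s"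
   if s: "s \<in> {0..<T}" for s
  proof -
   have "(%x. p s x * Complex (deriv g x) (deriv h x)) = (%x. p s x * of_real (deriv g x) + \<i> * (p s x * of_real (deriv h x)))"
    "(%x. F s x * Complex (g x) (h x)) = (%x. F s x * of_real (g x) + \<i> * (F s x * of_real (h x)))"
    by (simp_all add: Complex_eq algebra_simps)
   then show ?thesis using integrable_L2_mult[OF L2_pathD(1)[OF H1_pathD(3)[OF v] s] H1D(3)[OF Hg]]
     integrable_L2_mult[OF L2_pathD(1)[OF H1_pathD(3)[OF v] s] H1D(3)[OF Hh]]
     integrable_bounded_mult[OF L1_pathD(1)[OF F s] H1D(5)[OF Hg] H1_sup[OF Hg]]
     integrable_bounded_mult[OF L1_pathD(1)[OF F s] H1D(5)[OF Hh] H1_sup[OF Hh]]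
    by (simp add: J_def schroedinger_form_def scaleR_conv_of_real algebra_simps)
  qed
  have ig: "(J (%x. of_real (g x)) (%x. of_real (deriv g x)) has_integral I (%x. of_real (g x)) t - I (%x. of_real (g x)) 0) {0..t}"
   unfolding I_def J_def by (rule distributional_test_identity[OF d m v F uv GF g t])
  have ih: "(J (%x. of_real (h x)) (%x. of_real (deriv h x)) has_integral I (%x. of_real (h x)) t - I (%x. of_real (h x)) 0) {0..t}"
   unfolding I_def J_def by (rule distributional_test_identity[OF d m v F uv GF h t])
  have "((%s. J (%x. of_real (g x)) (%x. of_real (deriv g x)) s + \<i> * J (%x. of_real (h x)) (%x. of_real (deriv h x)) s) has_integral
    (I (%x. of_real (g x)) t - I (%x. of_real (g x)) 0) + \<i> * (I (%x. of_real (h x)) t - I (%x. of_real (h x)) 0)) {0..t}"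
   by (intro has_integral_add ig has_integral_mult_right ih)
  then have "((%s. J (%x. of_real (g x)) (%x. of_real (deriv g x)) s + \<i> * J (%x. of_real (h x)) (%x. of_real (deriv h x)) s) has_integral
    I (%x. Complex (g x) (h x)) t - I (%x. Complex (g x) (h x)) 0) {0..t}"
   by (simp add: eI[OF t] eI[OF T0] algebra_simps)
  then show ?thesis by (rule has_integral_eq[rotated]) (use eJ t in auto)
 qed
 have key: "I \<phi> t - I \<phi> 0 = integral {0..t} (J \<phi> q)" if t: "t \<in> {0..<T}" for t
 proof -
  have T0: "0 \<in> {0..<T}" using t by auto
  obtain B where B: "B \<ge> 0" "\<forall>s\<in>{0..t}. L2_norm (p s) / (2 * m) + (LINT x|lborel. norm (F s x)) \<le> B"
   using path_bounds[OF H1_pathD(3)[OF v] F, of t m] t by auto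
  \<comment> \<open>This constant bounds the total error per unit of the approximation error 2
    \<delta>: two terms from the pairings at times t and 0 and one from the time integral, with B
    uniform on [0, t].\<close>
  define A where "A = L2_norm (v t) + L2_norm (v 0) + t * B"
  have A0: "A \<ge> 0" using B t by (auto simp: A_def)
  let ?E = "I \<phi> t - I \<phi> 0 - integral {0..t} (J \<phi> q)"
  have iJ: "J \<phi> q integrable_on {0..t}" if "H1 \<phi> q" for \<phi> q
   by (rule integrable_continuous_interval) (use t in \<open>auto intro: continuous_on_subset[OF cJ[OF that]]\<close>)
  have "norm ?E \<le> e" if e: "e > 0" for e
  proof -
   define \<delta> where "\<delta> = e / (2 * A + 1)"
   have \<delta>: "\<delta> > 0" "A * (2 * \<delta>) \<le> e" using e A0 by (auto simp: \<delta>_def field_simps)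
   obtain R g h where gh: "test_on (-R) R g" "test_on (-R) R h" "L2_norm (%x. Complex (g x) (h x) - \<phi> x) < \<delta>"
    "L2_norm (%x. Complex (deriv g x) (deriv h x) - q x) < \<delta>" using H1_dense[OF H \<delta>(1)] by blast
   define \<eta> where "\<eta> x = Complex (g x) (h x)" for x
   define \<eta>' where "\<eta>' x = Complex (deriv g x) (deriv h x)" for x
   have H\<eta>: "H1 \<eta> \<eta>'" unfolding \<eta>_def \<eta>'_def by (rule H1_test[OF gh(1,2)])
   note Hd = H1_diff[OF H H\<eta>]
   have small: "L2_norm (%x. \<phi> x - \<eta> x) < \<delta>" "L2_norm (%x. q x - \<eta>' x) < \<delta>"
    using gh(3,4) L2_norm_minus[of \<phi> \<eta>] L2_norm_minus[of q \<eta>'] by (simp_all add: \<eta>_def \<eta>'_def)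
   have Id: "I \<phi> s - I \<eta> s = I (%x. \<phi> x - \<eta> x) s" if s: "s \<in> {0..<T}" for s
    unfolding I_def right_diff_distrib
    by (rule Bochner_Integration.integral_diff[symmetric] integrable_L2_mult L2_pathD(1)[OF H1_pathD(2)[OF v] s] H1D(2)[OF H] H1D(2)[OF H\<eta>])+
   have Jd: "J \<phi> q s - J \<eta> \<eta>' s = J (%x. \<phi> x - \<eta> x) (%x. q x - \<eta>' x) s" if s: "s \<in> {0..<T}" for s
    unfolding J_def using schroedinger_form_diff[OF L2_pathD(1)[OF H1_pathD(3)[OF v] s] L1_pathD(1)[OF F s] H H\<eta>] by simp
   have Ib: "norm (I (%x. \<phi> x - \<eta> x) s) \<le> L2_norm (v s) * (2 * \<delta>)" if s: "s \<in> {0..<T}" for s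
   proof -
    have "norm (I (%x. \<phi> x - \<eta> x) s) \<le> L2_norm (v s) * L2_norm (%x. \<phi> x - \<eta> x)"
     unfolding I_def by (rule norm_integral_L2_mult_le[OF L2_pathD(1)[OF H1_pathD(2)[OF v] s] H1D(2)[OF Hd]])
    also have "... \<le> L2_norm (v s) * (2 * \<delta>)" using small \<delta> by (intro mult_left_mono) auto
    finally show ?thesis .
   qed
   have Jb: "norm (J (%x. \<phi> x - \<eta> x) (%x. q x - \<eta>' x) s) \<le> B * (2 * \<delta>)" if s: "s \<in> {0..t}" for s
   proof -
    have s': "s \<in> {0..<T}" using s t by auto
    have "norm (J (%x. \<phi> x - \<eta> x) (%x. q x - \<eta>' x) s) \<le>
      (L2_norm (p s) / (2 * m) + (LINT x|lborel. norm (F s x))) * (L2_norm (%x. \<phi> x - \<eta> x) + L2_norm (%x. q x - \<eta>' x))"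
     unfolding J_def by (rule schroedinger_form_bound[OF L2_pathD(1)[OF H1_pathD(3)[OF v] s'] L1_pathD(1)[OF F s'] Hd m])
    also have "... \<le> B * (2 * \<delta>)" using B s small by (intro mult_mono) auto
    finally show ?thesis .
   qed
   have E\<eta>: "I \<eta> t - I \<eta> 0 - integral {0..t} (J \<eta> \<eta>') = 0"
    using test[OF gh(1,2) t] unfolding \<eta>_def[symmetric] \<eta>'_def[symmetric] by (simp add: integral_unique)
   have "integral {0..t} (J \<phi> q) - integral {0..t} (J \<eta> \<eta>') = integral {0..t} (%s. J \<phi> q s - J \<eta> \<eta>' s)"
    by (rule Henstock_Kurzweil_Integration.integral_diff[symmetric, OF iJ[OF H] iJ[OF H\<eta>]])
   also have "... = integral {0..t} (J (%x. \<phi> x - \<eta> x) (%x. q x - \<eta>' x))"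
    by (rule Henstock_Kurzweil_Integration.integral_cong) (use Jd t in auto)
   finally have "?E = I (%x. \<phi> x - \<eta> x) t - I (%x. \<phi> x - \<eta> x) 0 - integral {0..t} (J (%x. \<phi> x - \<eta> x) (%x. q x - \<eta>' x))"
    using E\<eta> Id[OF t] Id[OF T0] by (simp add: algebra_simps)
   note E = this
   have n1: "norm ?E \<le> norm (I (%x. \<phi> x - \<eta> x) t) + norm (I (%x. \<phi> x - \<eta> x) 0) + norm (integral {0..t} (J (%x. \<phi> x - \<eta> x) (%x. q x - \<eta>' x)))"
    unfolding E by (rule order_trans[OF norm_triangle_ineq4 add_right_mono[OF norm_triangle_ineq4]])
   have n2: "norm (integral {0..t} (J (%x. \<phi> x - \<eta> x) (%x. q x - \<eta>' x))) \<le> B * (2 * \<delta>) * (t - 0)"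
    by (rule integral_bound) (use t Jb in \<open>auto intro: continuous_on_subset[OF cJ[OF Hd]]\<close>)
   have n3: "norm (I (%x. \<phi> x - \<eta> x) t) + norm (I (%x. \<phi> x - \<eta> x) 0) + B * (2 * \<delta>) * (t - 0) \<le> A * (2 * \<delta>)"
    using Ib[OF t] Ib[OF T0] by (simp add: A_def algebra_simps)
   show ?thesis using n1 n2 n3 \<delta>(2) by linarith
  qed
  then have "norm ?E \<le> 0" by (rule field_le_epsilon[of _ 0, simplified])
  then show ?thesis by simp
 qed
 define \<tau> where "\<tau> = (t + T) / 2"
 have \<tau>: "t < \<tau>" "\<tau> < T" using t by (auto simp: \<tau>_def)
 have "((%s. integral {0..s} (J \<phi> q)) has_vector_derivative J \<phi> q t) (at t within {0..\<tau>})"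
  by (rule integral_has_vector_derivative) (use t \<tau> in \<open>auto intro: continuous_on_subset[OF cJ[OF H]]\<close>)
 then have "((%s. I \<phi> 0 + integral {0..s} (J \<phi> q)) has_vector_derivative J \<phi> q t) (at t within {0..\<tau>})"
  using has_vector_derivative_add[OF has_vector_derivative_const] by fastforce
 then have 1: "(I \<phi> has_vector_derivative J \<phi> q t) (at t within {0..\<tau>})"
  by (rule has_vector_derivative_transform[rotated -1]) (use t \<tau> key[symmetric] in force)+
 have "at t within {0..\<tau>} = at t within {0..<T}" by (rule at_within_nhd[of _ "{..<\<tau>}"]) (use \<tau> in auto)
 then show "((%r. LINT x|lborel. v r x * \<phi> x) has_vector_derivative schroedinger_form m (p t) (F t) \<phi> q) (at t within {0..<T})"
  using 1 by (simp add: I_def[abs_def] J_def)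
qed

section \<open>Uniqueness\<close>

lemma norm_vector_derivative_bound:
 fixes f :: "real => complex"
 assumes "convex S" "!!s. s \<in> S ==> (f has_vector_derivative f' s) (at s within S)"
  "!!s. s \<in> S ==> norm (f' s) \<le> B" "x \<in> S" "y \<in> S" "0 \<le> B"
 shows "norm (f x - f y) \<le> B * \<bar>x - y\<bar>"
proof -
 have "norm (f x - f y) \<le> B * norm (x - y)"
 proof (rule differentiable_bound[OF assms(1)])
  show "(f has_derivative (%h. h *\<^sub>R f' s)) (at s within S)" if "s \<in> S" for s
   using assms(2)[OF that] by (simp add: has_vector_derivative_def)
  show "onorm (%h. h *\<^sub>R f' s) \<le> B" if "s \<in> S" for s
  proof (rule onorm_bound[OF assms(6)])
   show "norm (h *\<^sub>R f' s) \<le> B * norm h" for h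
    using mult_left_mono[OF assms(3)[OF that] abs_ge_zero, of h] by (simp add: mult.commute)
  qed
 qed (fact assms)+
 then show ?thesis by simp
qed

lemma has_vector_derivative_zeroI:
 fixes e :: "real => 'a::real_normed_vector"
 assumes "((%r. norm (e r - e t) / \<bar>r - t\<bar>) \<longlongrightarrow> 0) (at t within S)"
 shows "(e has_vector_derivative 0) (at t within S)"
proof -
 have "((%r. norm ((1 / norm (r - t)) *\<^sub>R (e r - (e t + (r - t) *\<^sub>R 0)))) \<longlongrightarrow> 0) (at t within S)"
  using assms by simp
 then have "((%r. (1 / norm (r - t)) *\<^sub>R (e r - (e t + (r - t) *\<^sub>R 0))) \<longlongrightarrow> 0) (at t within S)"
  by (rule tendsto_norm_zero_cancel)
 then show ?thesis unfolding has_vector_derivative_def has_derivative_within by (auto intro: bounded_linear_intros)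
qed

lemma eventually_within_lessThan:
 assumes "(t::real) < \<tau>" "\<tau> < T"
 shows "\<forall>\<^sub>F r in at t within {0..<T}. r \<in> {0..\<tau>} \<and> r \<noteq> t"
proof -
 have "\<forall>\<^sub>F r in at t within {0..<T}. r < \<tau>" by (rule order_tendstoD(2)[OF tendsto_ident_at assms(1)])
 moreover have "\<forall>\<^sub>F r in at t within {0..<T}. r \<in> {0..<T} \<and> r \<noteq> t" by (auto simp: eventually_at_filter)
 ultimately show ?thesis by eventually_elim auto
qed

lemma H1_path_diff_bound:
 assumes "H1_path T v p" "t \<in> {0..<T}"
 shows "((%r. L2_norm (%x. v r x - v t x) + L2_norm (%x. p r x - p t x)) \<longlongrightarrow> 0) (at t within {0..<T})"
 using tendsto_add[OF L2_pathD(2)[OF H1_pathD(2)[OF assms(1)] assms(2)] L2_pathD(2)[OF H1_pathD(3)[OF assms(1)] assms(2)]] by simp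

lemma L2_norm_cnj_square:
 assumes "square_integrable f"
 shows "(LINT x|lborel. f x * cnj (f x)) = of_real ((L2_norm f)\<^sup>2)"
 unfolding L2_norm_square complex_norm_square[symmetric] by (simp flip: of_real_power)

text \<open>Testing with \<open>v r - v t\<close> itself makes the increment \<open>o(\<bar>r - t\<bar>)\<close> in squared norm: this replaces
  any regularisation in time.\<close>

lemma weak_solution_increment:
 assumes v: "H1_path T v p" and F: "L1_path T F" and w: "weak_solution m T v p F" and m: "m > 0" and t: "t \<in> {0..<T}"
 shows "((%r. (L2_norm (%x. v r x - v t x))\<^sup>2 / \<bar>r - t\<bar>) \<longlongrightarrow> 0) (at t within {0..<T})"
proof -
 define \<tau> where "\<tau> = (t + T) / 2"
 have \<tau>: "t < \<tau>" "\<tau> < T" using t by (auto simp: \<tau>_def)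
 obtain B where B: "B \<ge> 0" "\<forall>s\<in>{0..\<tau>}. L2_norm (p s) / (2 * m) + (LINT x|lborel. norm (F s x)) \<le> B"
  using path_bounds[OF H1_pathD(3)[OF v] F \<tau>(2), of m] by auto
 define d where "d r = L2_norm (%x. v r x - v t x) + L2_norm (%x. p r x - p t x)" for r
 have d0: "(d \<longlongrightarrow> 0) (at t within {0..<T})" unfolding d_def by (rule H1_path_diff_bound[OF v t])
 show ?thesis
 proof (rule Lim_null_comparison)
  show "((%r. B * d r) \<longlongrightarrow> 0) (at t within {0..<T})" by (rule tendsto_mult_right_zero[OF d0])
  show "\<forall>\<^sub>F r in at t within {0..<T}. norm ((L2_norm (%x. v r x - v t x))\<^sup>2 / \<bar>r - t\<bar>) \<le> B * d r"
   using eventually_within_lessThan[OF \<tau>]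
  proof eventually_elim
   case (elim r)
   then have r: "r \<in> {0..<T}" "r \<in> {0..\<tau>}" "r \<noteq> t" using \<tau> by auto
   define D where "D x = v r x - v t x" for x
   define E where "E x = p r x - p t x" for x
   have HD: "H1 D E" unfolding D_def E_def by (rule H1_diff[OF H1_pathD(1)[OF v r(1)] H1_pathD(1)[OF v t]])
   have HC: "H1 (%x. cnj (D x)) (%x. cnj (E x))" by (rule H1_bounded_linear[OF bounded_linear_cnj HD])
   have nc: "L2_norm (%x. cnj (D x)) + L2_norm (%x. cnj (E x)) = d r"
   proof -
    have "L2_norm (%x. cnj (D x)) = L2_norm D" "L2_norm (%x. cnj (E x)) = L2_norm E" by (simp_all add: L2_norm_def)
    then show ?thesis by (simp add: d_def D_def[abs_def] E_def[abs_def])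
   qed
   \<comment> \<open>The increment at the fixed time r is frozen as test function. The total change
     of g between t and r is the squared norm of the increment, while the derivative of g is at most
     B d(r), where d(r) tends to 0.\<close>
   define g where "g s = (LINT x|lborel. v s x * cnj (D x))" for s
   have "norm (g r - g t) \<le> (B * d r) * \<bar>r - t\<bar>"
   proof (rule norm_vector_derivative_bound[where S="{0..\<tau>}"])
    fix s assume s: "s \<in> {0..\<tau>}"
    then have s': "s \<in> {0..<T}" using \<tau> by auto
    show "(g has_vector_derivative schroedinger_form m (p s) (F s) (%x. cnj (D x)) (%x. cnj (E x))) (at s within {0..\<tau>})"
     unfolding g_def by (rule has_vector_derivative_within_subset[of _ _ _ "{0..<T}"])
      (use w HC s' \<tau> in \<open>auto simp: weak_solution_def\<close>)
    have "norm (schroedinger_form m (p s) (F s) (%x. cnj (D x)) (%x. cnj (E x))) \<le>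
      (L2_norm (p s) / (2 * m) + (LINT x|lborel. norm (F s x))) * d r"
     using schroedinger_form_bound[OF L2_pathD(1)[OF H1_pathD(3)[OF v] s'] L1_pathD(1)[OF F s'] HC m] unfolding nc .
    also have "... \<le> B * d r" using B s by (intro mult_right_mono) (auto simp: d_def)
    finally show "norm (schroedinger_form m (p s) (F s) (%x. cnj (D x)) (%x. cnj (E x))) \<le> B * d r" .
   qed (use r t \<tau> B in \<open>auto simp: d_def\<close>)
   moreover have "g r - g t = of_real ((L2_norm D)\<^sup>2)"
   proof -
    have "g r - g t = (LINT x|lborel. D x * cnj (D x))" unfolding g_def D_def left_diff_distrib
     using integrable_L2_mult[OF L2_pathD(1)[OF H1_pathD(2)[OF v] r(1)] H1D(2)[OF HC]]
      integrable_L2_mult[OF L2_pathD(1)[OF H1_pathD(2)[OF v] t] H1D(2)[OF HC]] by (simp add: D_def)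
    then show ?thesis using L2_norm_cnj_square[OF H1D(2)[OF HD]] by simp
   qed
   ultimately have "(L2_norm D)\<^sup>2 \<le> (B * d r) * \<bar>r - t\<bar>" by (simp add: norm_power)
   then show ?case using r(3) by (simp add: D_def[abs_def] field_simps)
  qed
 qed
qed

text \<open>\<open>N\<close> bounds g and \<open>d\<close> bounds f - g uniformly. Factoring exp (c
  f) = exp (c g) exp (c (f - g)) reduces the differences to the elementary bounds for exp z - 1 and
  exp z - 1 - z.\<close>

lemma exp_H1_bounds:
 assumes f: "H1 f p" and g: "H1 g q"
 defines "d \<equiv> L2_norm (%x. f x - g x) + L2_norm (%x. p x - q x)" and "N \<equiv> L2_norm g + L2_norm q"
 shows "norm (f x - g x) \<le> d" "norm (exp (c * g x)) \<le> exp (norm c * N)" "norm (exp (c * f x)) \<le> exp (norm c * (N + d))"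
  "norm (exp (c * f x) - exp (c * g x)) \<le> (exp (norm c * N) * exp (norm c * d) * norm c) * norm (f x - g x)"
  "norm (exp (c * f x) - exp (c * g x)) \<le> (exp (norm c * N) * exp (norm c * d) * norm c) * d"
  "norm (exp (c * f x) - exp (c * g x) - c * exp (c * g x) * (f x - g x)) \<le>
   (exp (norm c * N) * exp (norm c * d) * (norm c)\<^sup>2) * (norm (f x - g x))\<^sup>2"
proof -
 show d: "norm (f x - g x) \<le> d" unfolding d_def by (rule H1_sup[OF H1_diff[OF f g]])
 have N: "norm (g x) \<le> N" unfolding N_def by (rule H1_sup[OF g])
 have "norm (exp (c * g x)) \<le> exp (norm (c * g x))" by (rule norm_exp)
 also have "... \<le> exp (norm c * N)" unfolding norm_mult using N by (simp add: mult_left_mono)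
 finally show e: "norm (exp (c * g x)) \<le> exp (norm c * N)" .
 have "norm (f x) \<le> N + d" using d N norm_triangle_sub[of "f x" "g x"] by linarith
 have "norm (exp (c * f x)) \<le> exp (norm (c * f x))" by (rule norm_exp)
 also have "... \<le> exp (norm c * (N + d))" unfolding norm_mult using \<open>norm (f x) \<le> N + d\<close> by (simp add: mult_left_mono)
 finally show "norm (exp (c * f x)) \<le> exp (norm c * (N + d))" .
 have split: "exp (c * f x) = exp (c * g x) * exp (c * (f x - g x))" by (simp add: exp_add[symmetric] algebra_simps)
 have ed: "exp (norm (c * (f x - g x))) \<le> exp (norm c * d)" unfolding norm_mult using d by (simp add: mult_left_mono)
 have "norm (exp (c * f x) - exp (c * g x)) = norm (exp (c * g x)) * norm (exp (c * (f x - g x)) - 1)"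
  unfolding split norm_mult[symmetric] by (simp add: right_diff_distrib)
 also have "... \<le> exp (norm c * N) * (exp (norm c * d) * norm (c * (f x - g x)))"
  by (intro mult_mono e order_trans[OF norm_exp_minus_1_le] mult_right_mono ed) auto
 finally show 1: "norm (exp (c * f x) - exp (c * g x)) \<le> (exp (norm c * N) * exp (norm c * d) * norm c) * norm (f x - g x)"
  by (simp add: norm_mult mult.assoc)
 also have "... \<le> (exp (norm c * N) * exp (norm c * d) * norm c) * d" by (intro mult_left_mono d) simp
 finally show "norm (exp (c * f x) - exp (c * g x)) \<le> (exp (norm c * N) * exp (norm c * d) * norm c) * d" .
 have "norm (exp (c * f x) - exp (c * g x) - c * exp (c * g x) * (f x - g x)) =
   norm (exp (c * g x)) * norm (exp (c * (f x - g x)) - 1 - c * (f x - g x))"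
  unfolding split norm_mult[symmetric] by (simp add: algebra_simps)
 also have "... \<le> exp (norm c * N) * (exp (norm c * d) * (norm (c * (f x - g x)))\<^sup>2)"
  by (intro mult_mono e order_trans[OF norm_exp_minus_1_minus_le] mult_right_mono ed) auto
 finally show "norm (exp (c * f x) - exp (c * g x) - c * exp (c * g x) * (f x - g x)) \<le>
   (exp (norm c * N) * exp (norm c * d) * (norm c)\<^sup>2) * (norm (f x - g x))\<^sup>2"
  by (simp add: norm_mult power_mult_distrib mult.assoc)
qed

lemma exp_measurable:
 assumes [measurable]: "f \<in> borel_measurable lborel"
 shows "(%x. exp (c * f x :: complex)) \<in> borel_measurable lborel" by measurable

lemma H1_path_exp:
 assumes v: "H1_path T v p"
 shows "H1_path T (%t x. exp (c * v t x) - 1) (%t x. c * exp (c * v t x) * p t x)"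
proof -
 have H: "H1 (%x. exp (c * v t x) - 1) (%x. c * exp (c * v t x) * p t x)" if "t \<in> {0..<T}" for t
  by (rule H1_exp[OF H1_pathD(1)[OF v that]])
 have "((%r. L2_norm (%x. (exp (c * v r x) - 1) - (exp (c * v t x) - 1))) \<longlongrightarrow> 0) (at t within {0..<T})"
  "((%r. L2_norm (%x. c * exp (c * v r x) * p r x - c * exp (c * v t x) * p t x)) \<longlongrightarrow> 0) (at t within {0..<T})"
  if t: "t \<in> {0..<T}" for t
 proof -
  define d where "d r = L2_norm (%x. v r x - v t x) + L2_norm (%x. p r x - p t x)" for r
  define N where "N = L2_norm (v t) + L2_norm (p t)"
  have d0: "(d \<longlongrightarrow> 0) (at t within {0..<T})" unfolding d_def by (rule H1_path_diff_bound[OF v t])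
  note Ht = H1_pathD(1)[OF v t]
  show "((%r. L2_norm (%x. (exp (c * v r x) - 1) - (exp (c * v t x) - 1))) \<longlongrightarrow> 0) (at t within {0..<T})"
  proof (rule tendsto_dominated_within)
   have "((%r. (exp (norm c * N) * exp (norm c * d r) * norm c) * d r) \<longlongrightarrow> (exp (norm c * N) * exp (norm c * 0) * norm c) * 0) (at t within {0..<T})"
    by (intro tendsto_intros d0)
   then show "((%r. (exp (norm c * N) * exp (norm c * d r) * norm c) * d r) \<longlongrightarrow> 0) (at t within {0..<T})" by simp
   fix r assume r: "r \<in> {0..<T}"
   note Hr = H1_pathD(1)[OF v r]
   let ?K = "exp (norm c * N) * exp (norm c * d r) * norm c"
   have K: "?K \<ge> 0" by simp
   have "L2_norm (%x. (exp (c * v r x) - 1) - (exp (c * v t x) - 1)) \<le> L2_norm (%x. of_real ?K * (v r x - v t x))"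
   proof (rule L2_norm_mono)
    show "(%x. (exp (c * v r x) - 1) - (exp (c * v t x) - 1)) \<in> borel_measurable lborel"
     by (rule H1D(5)[OF H1_diff[OF H[OF r] H[OF t]]])
    show "square_integrable (%x. complex_of_real ?K * (v r x - v t x))"
     by (rule L2_bounded_linear[OF bounded_linear_mult_right H1D(2)[OF H1_diff[OF Hr Ht]]])
    show "AE x in lborel. norm ((exp (c * v r x) - 1) - (exp (c * v t x) - 1)) \<le> norm (complex_of_real ?K * (v r x - v t x))"
    proof (rule AE_I2)
     fix x
     show "norm ((exp (c * v r x) - 1) - (exp (c * v t x) - 1)) \<le> norm (complex_of_real ?K * (v r x - v t x))"
      using exp_H1_bounds(4)[OF Hr Ht, of c x] K unfolding d_def N_def norm_mult norm_of_real by simp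
    qed
   qed
   also have "... = ?K * L2_norm (%x. v r x - v t x)" by (rule L2_norm_scale) (use K in \<open>simp_all only: norm_mult norm_of_real abs_of_nonneg\<close>)
   also have "... \<le> ?K * d r" by (intro mult_left_mono K) (simp add: d_def)
   finally show "norm (L2_norm (%x. (exp (c * v r x) - 1) - (exp (c * v t x) - 1)) - 0) \<le> ?K * d r" by simp
  qed
  show "((%r. L2_norm (%x. c * exp (c * v r x) * p r x - c * exp (c * v t x) * p t x)) \<longlongrightarrow> 0) (at t within {0..<T})"
  proof (rule tendsto_dominated_within)
   let ?G = "%r. (norm c * exp (norm c * (N + d r))) * d r + (norm c * ((exp (norm c * N) * exp (norm c * d r) * norm c) * d r)) * L2_norm (p t)"
   have "(?G \<longlongrightarrow> (norm c * exp (norm c * (N + 0))) * 0 + (norm c * ((exp (norm c * N) * exp (norm c * 0) * norm c) * 0)) * L2_norm (p t)) (at t within {0..<T})"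
    by (intro tendsto_intros d0)
   then show "(?G \<longlongrightarrow> 0) (at t within {0..<T})" by simp
   fix r assume r: "r \<in> {0..<T}"
   note Hr = H1_pathD(1)[OF v r]
   have m: "(%x. exp (c * v r x)) \<in> borel_measurable lborel" "(%x. exp (c * v t x)) \<in> borel_measurable lborel"
    by (rule exp_measurable[OF H1D(5)[OF Hr]] exp_measurable[OF H1D(5)[OF Ht]])+
   have sE: "square_integrable (%x. p r x - p t x)" by (rule H1D(3)[OF H1_diff[OF Hr Ht]])
   have b1: "norm (c * exp (c * v r x)) \<le> norm c * exp (norm c * (N + d r))" for x
    unfolding norm_mult[of c] d_def N_def by (intro mult_left_mono exp_H1_bounds(3)[OF Hr Ht]) simp
   have b2: "norm (c * (exp (c * v r x) - exp (c * v t x))) \<le> norm c * ((exp (norm c * N) * exp (norm c * d r) * norm c) * d r)" for x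
    unfolding norm_mult[of c] d_def N_def by (intro mult_left_mono exp_H1_bounds(5)[OF Hr Ht]) simp
   have m1: "(%x. c * exp (c * v r x)) \<in> borel_measurable lborel" using m by measurable
   have m2: "(%x. c * (exp (c * v r x) - exp (c * v t x))) \<in> borel_measurable lborel" using m by measurable
   \<comment> \<open>In the first term a bounded exponential multiplies a small derivative
     difference; in the second a uniformly small exponential difference multiplies the fixed p
     t.\<close>
   have "(%x. c * exp (c * v r x) * p r x - c * exp (c * v t x) * p t x) =
     (%x. (c * exp (c * v r x)) * (p r x - p t x) + (c * (exp (c * v r x) - exp (c * v t x))) * p t x)"
    by (auto simp: algebra_simps)
   then have "L2_norm (%x. c * exp (c * v r x) * p r x - c * exp (c * v t x) * p t x) \<le>
     L2_norm (%x. (c * exp (c * v r x)) * (p r x - p t x)) + L2_norm (%x. (c * (exp (c * v r x) - exp (c * v t x))) * p t x)"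
    using L2_norm_triangle[OF L2_bounded_mult[OF sE m1 b1] L2_bounded_mult[OF H1D(3)[OF Ht] m2 b2]] by simp
   also have "... \<le> (norm c * exp (norm c * (N + d r))) * L2_norm (%x. p r x - p t x) +
     (norm c * ((exp (norm c * N) * exp (norm c * d r) * norm c) * d r)) * L2_norm (p t)"
    by (intro add_mono L2_norm_bounded_mult[OF sE m1 b1] L2_norm_bounded_mult[OF H1D(3)[OF Ht] m2 b2])
   also have "... \<le> ?G r" by (intro add_mono mult_left_mono) (auto simp: d_def)
   finally show "norm (L2_norm (%x. c * exp (c * v r x) * p r x - c * exp (c * v t x) * p t x) - 0) \<le> ?G r" by simp
  qed
 qed
 then show ?thesis using H H1D(2,3) unfolding H1_path_def L2_path_def by blast
qed

text \<open>At a fixed time t the map v \<mapsto> exp (c v) is linearised. The linear part is the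
  weak equation tested with c exp (c v t) \<phi>; the remainder is quadratic in v r - v t, hence of
  smaller order than r - t. No differentiability of v in time is needed.\<close>

lemma weak_solution_exp:
 assumes v: "H1_path T v p" and F: "L1_path T F" and w: "weak_solution m T v p F" and m: "m > 0"
 shows "weak_solution m T (%t x. exp (c * v t x) - 1) (%t x. c * exp (c * v t x) * p t x)
  (%t x. c * exp (c * v t x) * (F t x + c * (p t x)\<^sup>2 / of_real (2 * m)))" unfolding weak_solution_def
proof (intro allI impI ballI)
 fix \<phi> q t assume H: "H1 \<phi> q" and t: "t \<in> {0..<T}"
 note Ht = H1_pathD(1)[OF v t]
 let ?E = "%x. exp (c * v t x)"
 \<comment> \<open>The derivative of exp (c v) at v t, with t frozen, times the original test
   function.\<close>
 define \<psi> where "\<psi> x = c * ?E x * \<phi> x" for x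
 define \<psi>' where "\<psi>' x = c * (c * ?E x * p t x) * \<phi> x + c * ?E x * q x" for x
 have H\<psi>: "H1 \<psi> \<psi>'"
 proof -
  have "H1 (%x. c * ((?E x - 1) * \<phi> x + \<phi> x)) (%x. c * (((c * ?E x * p t x) * \<phi> x + (?E x - 1) * q x) + q x))"
   by (rule H1_bounded_linear[OF bounded_linear_mult_right H1_add[OF H1_mult[OF H1_exp[OF Ht] H] H]])
  then show ?thesis by (simp add: \<psi>_def[abs_def] \<psi>'_def[abs_def] algebra_simps)
 qed
 have mE: "?E \<in> borel_measurable lborel" by (rule exp_measurable[OF H1D(5)[OF Ht]])
 have bE: "norm (?E x) \<le> exp (norm c * (L2_norm (v t) + L2_norm (p t)))" for x by (rule exp_H1_bounds(2)[OF Ht Ht])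
 have d1: "((%r. LINT x|lborel. v r x * \<psi> x) has_vector_derivative schroedinger_form m (p t) (F t) \<psi> \<psi>') (at t within {0..<T})"
  using w H\<psi> t by (simp add: weak_solution_def)
 \<comment> \<open>The spatial derivative falling on the exponential inside \<psi> produces c^2 exp
   (c v) p^2 \<phi> / (2 m), which is absorbed as the additional quadratic term of the new
   source.\<close>
 have form: "schroedinger_form m (p t) (F t) \<psi> \<psi>' =
  schroedinger_form m (%x. c * ?E x * p t x) (%x. c * ?E x * (F t x + c * (p t x)\<^sup>2 / of_real (2 * m))) \<phi> q"
 proof -
  note sp = H1D(3)[OF Ht]
  have m1: "(%x. c * ?E x) \<in> borel_measurable lborel" using mE by measurable
  have b1: "norm (c * ?E x) \<le> norm c * exp (norm c * (L2_norm (v t) + L2_norm (p t)))" for x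
   unfolding norm_mult[of c] by (intro mult_left_mono bE) simp
  have sEp: "square_integrable (%x. c * ?E x * p t x)" by (rule L2_bounded_mult[OF sp m1 b1])
  have s1: "square_integrable (%x. \<phi> x * (c * ?E x * p t x))" by (rule L2_bounded_mult[OF sEp H1D(5)[OF H] H1_sup[OF H]])
  have i1: "integrable lborel (%x. p t x * (\<phi> x * (c * ?E x * p t x)))" by (rule integrable_L2_mult[OF sp s1])
  have i2: "integrable lborel (%x. (c * ?E x * p t x) * q x)" by (rule integrable_L2_mult[OF sEp H1D(3)[OF H]])
  have i3: "integrable lborel (%x. F t x * \<psi> x)"
   by (rule integrable_bounded_mult[OF L1_pathD(1)[OF F t] H1D(5)[OF H\<psi>] H1_sup[OF H\<psi>]])
  have "(%x. p t x * \<psi>' x) = (%x. c * (p t x * (\<phi> x * (c * ?E x * p t x))) + (c * ?E x * p t x) * q x)"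
   by (auto simp: \<psi>'_def algebra_simps)
  then have 1: "(LINT x|lborel. p t x * \<psi>' x) = c * (LINT x|lborel. p t x * (\<phi> x * (c * ?E x * p t x))) + (LINT x|lborel. (c * ?E x * p t x) * q x)"
   using i1 i2 by simp
  have "(%x. (c * ?E x * (F t x + c * (p t x)\<^sup>2 / of_real (2 * m))) * \<phi> x) =
    (%x. F t x * \<psi> x + (c / of_real (2 * m)) * (p t x * (\<phi> x * (c * ?E x * p t x))))"
   by (auto simp: \<psi>_def power2_eq_square algebra_simps)
  then have 2: "(LINT x|lborel. (c * ?E x * (F t x + c * (p t x)\<^sup>2 / of_real (2 * m))) * \<phi> x) =
    (LINT x|lborel. F t x * \<psi> x) + (c / of_real (2 * m)) * (LINT x|lborel. p t x * (\<phi> x * (c * ?E x * p t x)))"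
   using i1 i3 by simp
  show ?thesis unfolding schroedinger_form_def 1 2 by (simp add: scaleR_conv_of_real algebra_simps)
 qed
 \<comment> \<open>This differs by a constant in r from the pairing of \<phi> with the error of the
   linearisation at time t.\<close>
 define e where "e r = (LINT x|lborel. (exp (c * v r x) - 1) * \<phi> x) - (LINT x|lborel. v r x * \<psi> x)" for r
 have d2: "(e has_vector_derivative 0) (at t within {0..<T})"
 proof (rule has_vector_derivative_zeroI, rule Lim_null_comparison)
  define d where "d r = L2_norm (%x. v r x - v t x) + L2_norm (%x. p r x - p t x)" for r
  define N where "N = L2_norm (v t) + L2_norm (p t)"
  have d0: "(d \<longlongrightarrow> 0) (at t within {0..<T})" unfolding d_def by (rule H1_path_diff_bound[OF v t])
  let ?K = "%r. (exp (norm c * N) * exp (norm c * d r) * (norm c)\<^sup>2) * (L2_norm \<phi> + L2_norm q)"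
  have "((%r. ?K r * ((L2_norm (%x. v r x - v t x))\<^sup>2 / \<bar>r - t\<bar>)) \<longlongrightarrow>
    ((exp (norm c * N) * exp (norm c * 0) * (norm c)\<^sup>2) * (L2_norm \<phi> + L2_norm q)) * 0) (at t within {0..<T})"
   by (intro tendsto_intros d0 weak_solution_increment[OF v F w m t])
  then show "((%r. ?K r * ((L2_norm (%x. v r x - v t x))\<^sup>2 / \<bar>r - t\<bar>)) \<longlongrightarrow> 0) (at t within {0..<T})" by simp
  have "norm (e r - e t) \<le> ?K r * (L2_norm (%x. v r x - v t x))\<^sup>2" if r: "r \<in> {0..<T}" for r
  proof -
   note Hr = H1_pathD(1)[OF v r]
   note sd = H1D(2)[OF H1_diff[OF Hr Ht]]
   have i: "integrable lborel (%x. (exp (c * v r x) - 1) * \<phi> x)" "integrable lborel (%x. (exp (c * v t x) - 1) * \<phi> x)"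
    "integrable lborel (%x. v r x * \<psi> x)" "integrable lborel (%x. v t x * \<psi> x)"
    by (rule integrable_L2_mult[OF H1D(2)[OF H1_exp[OF Hr]] H1D(2)[OF H]] integrable_L2_mult[OF H1D(2)[OF H1_exp[OF Ht]] H1D(2)[OF H]]
      integrable_L2_mult[OF H1D(2)[OF Hr] H1D(2)[OF H\<psi>]] integrable_L2_mult[OF H1D(2)[OF Ht] H1D(2)[OF H\<psi>]])+
   have E: "e r - e t = (LINT x|lborel. ((exp (c * v r x) - 1) * \<phi> x - (exp (c * v t x) - 1) * \<phi> x) - (v r x * \<psi> x - v t x * \<psi> x))"
    using i by (simp add: e_def)
   have A: "norm (e r - e t) \<le> (LINT x|lborel. ?K r * (norm (v r x - v t x))\<^sup>2)" unfolding E
   proof (rule Bochner_Integration.integral_norm_bound_integral)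
    show "integrable lborel (%x. ((exp (c * v r x) - 1) * \<phi> x - (exp (c * v t x) - 1) * \<phi> x) - (v r x * \<psi> x - v t x * \<psi> x))"
     using i by simp
    show "integrable lborel (%x. ?K r * (norm (v r x - v t x))\<^sup>2)" using L2D(2)[OF sd] by simp
    fix x
    have "((exp (c * v r x) - 1) * \<phi> x - (exp (c * v t x) - 1) * \<phi> x) - (v r x * \<psi> x - v t x * \<psi> x) =
      (exp (c * v r x) - exp (c * v t x) - c * exp (c * v t x) * (v r x - v t x)) * \<phi> x" by (simp add: \<psi>_def algebra_simps)
    also have "norm ... \<le> ((exp (norm c * N) * exp (norm c * d r) * (norm c)\<^sup>2) * (norm (v r x - v t x))\<^sup>2) * (L2_norm \<phi> + L2_norm q)"
     unfolding norm_mult[of _ "\<phi> x"] d_def N_def by (intro mult_mono exp_H1_bounds(6)[OF Hr Ht] H1_sup[OF H]) auto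
    finally show "norm (((exp (c * v r x) - 1) * \<phi> x - (exp (c * v t x) - 1) * \<phi> x) - (v r x * \<psi> x - v t x * \<psi> x)) \<le> ?K r * (norm (v r x - v t x))\<^sup>2"
     by (simp only: mult_ac)
   qed
   have B: "(LINT x|lborel. ?K r * (norm (v r x - v t x))\<^sup>2) = ?K r * (L2_norm (%x. v r x - v t x))\<^sup>2"
    unfolding L2_norm_square by (rule integral_mult_right_zero)
   show ?thesis by (rule order_trans[OF A eq_refl[OF B]])
  qed
  note eb = this
  have "\<forall>\<^sub>F r in at t within {0..<T}. r \<in> {0..<T} \<and> r \<noteq> t" by (auto simp: eventually_at_filter)
  then show "\<forall>\<^sub>F r in at t within {0..<T}. norm (norm (e r - e t) / \<bar>r - t\<bar>) \<le> ?K r * ((L2_norm (%x. v r x - v t x))\<^sup>2 / \<bar>r - t\<bar>)"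
  proof eventually_elim
   case (elim r)
   have "norm (e r - e t) / \<bar>r - t\<bar> \<le> ?K r * (L2_norm (%x. v r x - v t x))\<^sup>2 / \<bar>r - t\<bar>"
    by (rule divide_right_mono[OF eb]) (use elim in auto)
   then show ?case by simp
  qed
 qed
 have "((%r. (LINT x|lborel. v r x * \<psi> x) + e r) has_vector_derivative schroedinger_form m (p t) (F t) \<psi> \<psi>' + 0) (at t within {0..<T})"
  by (rule has_vector_derivative_add[OF d1 d2])
 then show "((%r. LINT x|lborel. (exp (c * v r x) - 1) * \<phi> x) has_vector_derivative
   schroedinger_form m (%x. c * ?E x * p t x) (%x. c * ?E x * (F t x + c * (p t x)\<^sup>2 / of_real (2 * m))) \<phi> q) (at t within {0..<T})"
  unfolding form e_def by simp
qed

section \<open>Uniqueness for the linear equation\<close>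

lemma L2_path_diff:
 assumes "L2_path T v" "L2_path T w"
 shows "L2_path T (%t x. v t x - w t x)" unfolding L2_path_def
proof (intro ballI conjI)
 fix t assume t: "t \<in> {0..<T}"
 note s = L2_pathD(1)[OF assms(1)] L2_pathD(1)[OF assms(2)]
 show "square_integrable (%x. v t x - w t x)" by (rule L2_diff[OF s(1)[OF t] s(2)[OF t]])
 show "((%r. L2_norm (%x. v r x - w r x - (v t x - w t x))) \<longlongrightarrow> 0) (at t within {0..<T})"
 proof (rule tendsto_dominated_within)
  show "((%r. L2_norm (%x. v r x - v t x) + L2_norm (%x. w t x - w r x)) \<longlongrightarrow> 0) (at t within {0..<T})"
   using tendsto_add[OF L2_pathD(2)[OF assms(1) t] L2_pathD(2)[OF assms(2) t]] by (simp add: L2_norm_minus[of "w t"])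
  fix r assume r: "r \<in> {0..<T}"
  have "(%x. v r x - w r x - (v t x - w t x)) = (%x. (v r x - v t x) + (w t x - w r x))" by auto
  then show "norm (L2_norm (%x. v r x - w r x - (v t x - w t x)) - 0) \<le> L2_norm (%x. v r x - v t x) + L2_norm (%x. w t x - w r x)"
   using L2_norm_triangle[OF L2_diff[OF s(1)[OF r] s(1)[OF t]] L2_diff[OF s(2)[OF t] s(2)[OF r]]] by simp
 qed
qed

lemma H1_path_diff: "H1_path T v p ==> H1_path T w q ==> H1_path T (%t x. v t x - w t x) (%t x. p t x - q t x)"
 by (simp add: H1_path_def L2_path_diff H1_diff)

lemma weak_solution_diff:
 assumes v: "H1_path T v p" "L1_path T F" "weak_solution m T v p F"
  and w: "H1_path T w q" "L1_path T G" "weak_solution m T w q G"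
  and FG: "!!t. t \<in> {0..<T} ==> AE x in lborel. F t x = G t x"
 shows "weak_solution m T (%t x. v t x - w t x) (%t x. p t x - q t x) (%t x. 0)" unfolding weak_solution_def
proof (intro allI impI ballI)
 fix \<phi> \<phi>' t assume H: "H1 \<phi> \<phi>'" and t: "t \<in> {0..<T}"
 have e: "(LINT x|lborel. v r x * \<phi> x) - (LINT x|lborel. w r x * \<phi> x) = (LINT x|lborel. (v r x - w r x) * \<phi> x)" if r: "r \<in> {0..<T}" for r
  using integrable_L2_mult[OF L2_pathD(1)[OF H1_pathD(2)[OF v(1)] r] H1D(2)[OF H]]
   integrable_L2_mult[OF L2_pathD(1)[OF H1_pathD(2)[OF w(1)] r] H1D(2)[OF H]] by (simp add: left_diff_distrib)
 have "(LINT x|lborel. F t x * \<phi> x) = (LINT x|lborel. G t x * \<phi> x)"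
 proof (rule integral_cong_AE)
  show "AE x in lborel. F t x * \<phi> x = G t x * \<phi> x" using FG[OF t] by eventually_elim simp
 qed (use borel_measurable_integrable[OF L1_pathD(1)[OF v(2) t]] borel_measurable_integrable[OF L1_pathD(1)[OF w(2) t]] H1D(5)[OF H] in measurable)
 then have f: "schroedinger_form m (p t) (F t) \<phi> \<phi>' - schroedinger_form m (q t) (G t) \<phi> \<phi>' =
   schroedinger_form m (%x. p t x - q t x) (%x. 0) \<phi> \<phi>'" unfolding schroedinger_form_def
  using integrable_L2_mult[OF L2_pathD(1)[OF H1_pathD(3)[OF v(1)] t] H1D(3)[OF H]]
   integrable_L2_mult[OF L2_pathD(1)[OF H1_pathD(3)[OF w(1)] t] H1D(3)[OF H]] by (simp add: left_diff_distrib algebra_simps)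
 have "((%r. (LINT x|lborel. v r x * \<phi> x) - (LINT x|lborel. w r x * \<phi> x)) has_vector_derivative
   schroedinger_form m (p t) (F t) \<phi> \<phi>' - schroedinger_form m (q t) (G t) \<phi> \<phi>') (at t within {0..<T})"
  using v(3) w(3) H t by (intro has_vector_derivative_diff) (auto simp: weak_solution_def)
 then show "((%r. LINT x|lborel. (v r x - w r x) * \<phi> x) has_vector_derivative schroedinger_form m (%x. p t x - q t x) (%x. 0) \<phi> \<phi>') (at t within {0..<T})"
  unfolding f by (rule has_vector_derivative_transform[rotated -1]) (use t e in auto)
qed

lemma L1_path_zero: "L1_path T (%t x. 0)" by (simp add: L1_path_def)

lemma L2_norm_add_square:
 fixes f g :: "real => complex"
 assumes "square_integrable f" "square_integrable g"
 shows "(L2_norm (%x. f x + g x))\<^sup>2 = (L2_norm f)\<^sup>2 + 2 * Re (LINT x|lborel. g x * cnj (f x)) + (L2_norm g)\<^sup>2"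
proof -
 have sc: "square_integrable (%x. cnj (f x))" by (rule L2_bounded_linear[OF bounded_linear_cnj assms(1)])
 have i: "integrable lborel (%x. g x * cnj (f x))" by (rule integrable_L2_mult[OF assms(2) sc])
 define R where "R x = Re (g x * cnj (f x))" for x
 have iR: "integrable lborel R" "(LINT x|lborel. R x) = Re (LINT x|lborel. g x * cnj (f x))"
  unfolding R_def by (rule integrable_Re[OF i] integral_Re[OF i])+
 have "(norm (f x + g x))\<^sup>2 = (norm (f x))\<^sup>2 + 2 * R x + (norm (g x))\<^sup>2" for x unfolding R_def
  unfolding cmod_power2 by (simp add: power2_eq_square algebra_simps)
 then have "(LINT x|lborel. (norm (f x + g x))\<^sup>2) = (LINT x|lborel. (norm (f x))\<^sup>2 + 2 * R x + (norm (g x))\<^sup>2)" by simp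
 also have "... = (L2_norm f)\<^sup>2 + 2 * (LINT x|lborel. R x) + (L2_norm g)\<^sup>2"
  using L2D(2)[OF assms(1)] L2D(2)[OF assms(2)] iR(1) by (simp add: L2_norm_square)
 finally show ?thesis by (simp add: L2_norm_square iR(2))
qed

text \<open>Conservation of mass. The expansion of the norm of v t + (v r - v t) leaves a linear
  term with vanishing derivative and the squared increment, which is negligible against r -
  t.\<close>

lemma weak_solution_zero:
 assumes v: "H1_path T v p" and w: "weak_solution m T v p (%t x. 0)" and m: "m > 0"
  and z: "AE x in lborel. v 0 x = 0" and t: "t \<in> {0..<T}"
 shows "AE x in lborel. v t x = 0"
proof -
 define E where "E t = (L2_norm (v t))\<^sup>2" for t
 have "(E has_vector_derivative 0) (at t within {0..<T})" if t: "t \<in> {0..<T}" for t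
 proof -
  note Ht = H1_pathD(1)[OF v t]
  have HC: "H1 (%x. cnj (v t x)) (%x. cnj (p t x))" by (rule H1_bounded_linear[OF bounded_linear_cnj Ht])
  have "((%r. LINT x|lborel. v r x * cnj (v t x)) has_vector_derivative schroedinger_form m (p t) (%x. 0) (%x. cnj (v t x)) (%x. cnj (p t x))) (at t within {0..<T})"
   using w HC t by (simp add: weak_solution_def)
  then have "((%r. Re (LINT x|lborel. v r x * cnj (v t x))) has_vector_derivative
    Re (schroedinger_form m (p t) (%x. 0) (%x. cnj (v t x)) (%x. cnj (p t x)))) (at t within {0..<T})"
   by (rule bounded_linear.has_vector_derivative[OF bounded_linear_Re])
  \<comment> \<open>Tested with its own conjugate the form equals - \<i> times a real multiple of
    the squared norm of p t, hence is imaginary.\<close>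
  moreover have "Re (schroedinger_form m (p t) (%x. 0) (%x. cnj (v t x)) (%x. cnj (p t x))) = 0"
   by (simp add: schroedinger_form_def L2_norm_cnj_square[OF H1D(3)[OF Ht]])
  ultimately have d1: "((%r. Re (LINT x|lborel. v r x * cnj (v t x))) has_vector_derivative 0) (at t within {0..<T})" by simp
  have d2: "((%r. (L2_norm (%x. v r x - v t x))\<^sup>2) has_vector_derivative 0) (at t within {0..<T})"
   by (rule has_vector_derivative_zeroI) (use weak_solution_increment[OF v L1_path_zero w m t] in \<open>simp add: L2_norm_def\<close>)
  have "((%r. 2 * Re (LINT x|lborel. v r x * cnj (v t x)) + (L2_norm (%x. v r x - v t x))\<^sup>2 - E t) has_vector_derivative 2 * 0 + 0 - 0) (at t within {0..<T})"
   by (intro has_vector_derivative_add has_vector_derivative_diff has_vector_derivative_mult_right d1 d2 has_vector_derivative_const)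
  then have "((%r. 2 * Re (LINT x|lborel. v r x * cnj (v t x)) + (L2_norm (%x. v r x - v t x))\<^sup>2 - E t) has_vector_derivative 0) (at t within {0..<T})" by simp
  then show ?thesis
  proof (rule has_vector_derivative_transform[rotated -1])
   show "E r = 2 * Re (LINT x|lborel. v r x * cnj (v t x)) + (L2_norm (%x. v r x - v t x))\<^sup>2 - E t" if r: "r \<in> {0..<T}" for r
   proof -
    note Hr = H1_pathD(1)[OF v r]
    have "E r = (L2_norm (%x. v t x + (v r x - v t x)))\<^sup>2" by (simp add: E_def)
    also have "... = E t + 2 * Re (LINT x|lborel. (v r x - v t x) * cnj (v t x)) + (L2_norm (%x. v r x - v t x))\<^sup>2"
     unfolding E_def by (rule L2_norm_add_square[OF H1D(2)[OF Ht] H1D(2)[OF H1_diff[OF Hr Ht]]])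
    also have "(LINT x|lborel. (v r x - v t x) * cnj (v t x)) = (LINT x|lborel. v r x * cnj (v t x)) - (LINT x|lborel. v t x * cnj (v t x))"
     using integrable_L2_mult[OF H1D(2)[OF Hr] H1D(2)[OF HC]] integrable_L2_mult[OF H1D(2)[OF Ht] H1D(2)[OF HC]] by (simp add: left_diff_distrib)
    also have "(LINT x|lborel. v t x * cnj (v t x)) = of_real (E t)" unfolding E_def by (rule L2_norm_cnj_square[OF H1D(2)[OF Ht]])
    finally show ?thesis by (simp add: algebra_simps)
   qed
  qed (rule t)
 qed
 then have "E t = E 0" using t by (intro has_derivative_zero_unique[of "{0..<T}" E t 0]) (auto simp: has_vector_derivative_def)
 moreover have "E 0 = 0"
 proof -
  have "(LINT x|lborel. (norm (v 0 x))\<^sup>2) = 0" by (rule integral_eq_zero_AE) (use z in eventually_elim, simp)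
  then show ?thesis by (simp add: E_def L2_norm_square)
 qed
 ultimately have "(LINT x|lborel. (norm (v t x))\<^sup>2) = 0" by (simp add: E_def L2_norm_square)
 then have "AE x in lborel. (norm (v t x))\<^sup>2 = 0"
  using integral_nonneg_eq_0_iff_AE[OF L2D(2)[OF H1D(2)[OF H1_pathD(1)[OF v t]]]] by simp
 then show ?thesis by eventually_elim simp
qed

text \<open>A common property of the four nonlinearities. By Cauchy-Schwarz it is what turns
  L^2-continuous factors into an L^1-continuous source.\<close>

definition quadratic_Lipschitz :: "(complex => complex => complex) => bool" where
 "quadratic_Lipschitz Q \<longleftrightarrow> continuous_on UNIV (%z. Q (fst z) (snd z)) \<and> Q 0 0 = 0 \<and>
   (\<exists>C\<ge>0. \<forall>z w z' w'. norm (Q z w - Q z' w') \<le>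
    C * ((norm (z - z') + norm (w - w')) * (norm z + norm w + norm z' + norm w')))"

lemma quadratic_Lipschitz_measurable:
 assumes "quadratic_Lipschitz Q" "f \<in> borel_measurable lborel" "g \<in> borel_measurable lborel"
 shows "(%x. Q (f x) (g x)) \<in> borel_measurable lborel"
proof -
 have "(%z. Q (fst z) (snd z)) \<in> borel_measurable borel"
  using assms(1) by (intro borel_measurable_continuous_onI) (simp add: quadratic_Lipschitz_def)
 from measurable_compose[OF borel_measurable_Pair[OF assms(2,3)] this] show ?thesis by simp
qed

lemma L1_path_quadratic:
 assumes Q: "quadratic_Lipschitz Q" and v: "L2_path T v" and w: "L2_path T w"
 shows "L1_path T (%t x. Q (v t x) (w t x))"
proof -
 obtain C where C: "C \<ge> 0" "!!z w z' w'. norm (Q z w - Q z' w') \<le>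
    C * ((norm (z - z') + norm (w - w')) * (norm z + norm w + norm z' + norm w'))" using Q unfolding quadratic_Lipschitz_def by blast
 have Q0: "Q 0 0 = 0" using Q by (simp add: quadratic_Lipschitz_def)
 have sn: "square_integrable (%x. norm (f x))" if "square_integrable f" for f :: "real => complex"
  by (rule L2_dominated[OF _ that, of _ 1]) (use L2D(1)[OF that] in auto)
 have nn: "L2_norm (%x. norm (f x)) = L2_norm f" for f :: "real => complex" by (simp add: L2_norm_def)
 have meas: "(%x. Q (v t x) (w t x)) \<in> borel_measurable lborel" if t: "t \<in> {0..<T}" for t
  by (rule quadratic_Lipschitz_measurable[OF Q L2D(1)[OF L2_pathD(1)[OF v t]] L2D(1)[OF L2_pathD(1)[OF w t]]])
 have bnd: "integrable lborel (%x. C * (norm (f x) * norm (g x)))" "(LINT x|lborel. C * (norm (f x) * norm (g x))) \<le> C * (L2_norm f * L2_norm g)"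
  if "square_integrable f" "square_integrable g" for f g :: "real => real"
  using L2_Cauchy_Schwarz[OF that] C(1) by (auto intro: mult_left_mono)
 have int: "integrable lborel (%x. Q (v t x) (w t x))" if t: "t \<in> {0..<T}" for t
 proof (rule Bochner_Integration.integrable_bound)
  have s: "square_integrable (%x. norm (v t x) + norm (w t x))"
   by (intro L2_add sn L2_pathD(1)[OF v t] L2_pathD(1)[OF w t])
  show "integrable lborel (%x. C * (norm (norm (v t x) + norm (w t x)) * norm (norm (v t x) + norm (w t x))))" by (rule bnd(1)[OF s s])
  show "(%x. Q (v t x) (w t x)) \<in> borel_measurable lborel" by (rule meas[OF t])
  have "norm (Q (v t x) (w t x)) \<le> norm (C * (norm (norm (v t x) + norm (w t x)) * norm (norm (v t x) + norm (w t x))))" for x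
   using C(2)[of "v t x" "w t x" 0 0] C(1) Q0 by simp
  then show "AE x in lborel. norm (Q (v t x) (w t x)) \<le> norm (C * (norm (norm (v t x) + norm (w t x)) * norm (norm (v t x) + norm (w t x))))" by simp
 qed
 have "((%r. LINT x|lborel. norm (Q (v r x) (w r x) - Q (v t x) (w t x))) \<longlongrightarrow> 0) (at t within {0..<T})" if t: "t \<in> {0..<T}" for t
 proof (rule tendsto_dominated_within)
  define d where "d r = L2_norm (%x. v r x - v t x) + L2_norm (%x. w r x - w t x)" for r
  have d0: "(d \<longlongrightarrow> 0 + 0) (at t within {0..<T})"
   unfolding d_def by (intro tendsto_add L2_pathD(2)[OF v t] L2_pathD(2)[OF w t])
  define N where "N = L2_norm (v t) + L2_norm (w t)"
  have "((%r. C * (d r * (d r + 2 * N))) \<longlongrightarrow> C * ((0 + 0) * ((0 + 0) + 2 * N))) (at t within {0..<T})"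
   by (intro tendsto_intros d0)
  then show "((%r. C * (d r * (d r + 2 * N))) \<longlongrightarrow> 0) (at t within {0..<T})" by simp
  fix r assume r: "r \<in> {0..<T}"
  note sv = L2_pathD(1)[OF v r] L2_pathD(1)[OF v t] and sw = L2_pathD(1)[OF w r] L2_pathD(1)[OF w t]
  let ?f = "%x. norm (v r x - v t x) + norm (w r x - w t x)"
  let ?g = "%x. (norm (v r x) + norm (w r x)) + (norm (v t x) + norm (w t x))"
  have sf: "square_integrable ?f" by (intro L2_add sn L2_diff sv sw)
  have sg: "square_integrable ?g" by (intro L2_add sn sv sw)
  have "(LINT x|lborel. norm (Q (v r x) (w r x) - Q (v t x) (w t x))) \<le> (LINT x|lborel. C * (norm (?f x) * norm (?g x)))"
  proof (rule integral_mono)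
   show "integrable lborel (%x. norm (Q (v r x) (w r x) - Q (v t x) (w t x)))" using int[OF r] int[OF t] by simp
   show "integrable lborel (%x. C * (norm (?f x) * norm (?g x)))" by (rule bnd(1)[OF sf sg])
   show "norm (Q (v r x) (w r x) - Q (v t x) (w t x)) \<le> C * (norm (?f x) * norm (?g x))" for x
    using C(2)[of "v r x" "w r x" "v t x" "w t x"] by (simp add: add.assoc)
  qed
  also have "... \<le> C * (L2_norm ?f * L2_norm ?g)" by (rule bnd(2)[OF sf sg])
  also have "... \<le> C * (d r * (d r + 2 * N))"
  proof (intro mult_left_mono mult_mono C(1))
   show f: "L2_norm ?f \<le> d r"
    using L2_norm_triangle[OF sn[OF L2_diff[OF sv]] sn[OF L2_diff[OF sw]]] by (simp add: nn d_def)
   have "L2_norm ?g \<le> L2_norm (%x. norm (v r x) + norm (w r x)) + L2_norm (%x. norm (v t x) + norm (w t x))"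
    by (intro L2_norm_triangle L2_add sn sv sw)
   also have "... \<le> (L2_norm (v r) + L2_norm (w r)) + (L2_norm (v t) + L2_norm (w t))"
    using L2_norm_triangle[OF sn[OF sv(1)] sn[OF sw(1)]] L2_norm_triangle[OF sn[OF sv(2)] sn[OF sw(2)]] by (simp add: nn)
   also have "... \<le> d r + 2 * N" using L2_norm_le_add[OF sv] L2_norm_le_add[OF sw] by (simp add: d_def N_def)
   finally show "L2_norm ?g \<le> d r + 2 * N" .
  qed (auto simp: d_def)
  finally show "norm ((LINT x|lborel. norm (Q (v r x) (w r x) - Q (v t x) (w t x))) - 0) \<le> C * (d r * (d r + 2 * N))" by simp
 qed
 then show ?thesis using int by (simp add: L1_path_def)
qed

lemma L1_path_add:
 assumes "L1_path T F" "L1_path T G"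
 shows "L1_path T (%t x. F t x + G t x)" unfolding L1_path_def
proof (intro ballI conjI)
 fix t assume t: "t \<in> {0..<T}"
 note i = L1_pathD(1)[OF assms(1)] L1_pathD(1)[OF assms(2)]
 show "integrable lborel (%x. F t x + G t x)" using i(1)[OF t] i(2)[OF t] by simp
 show "((%r. LINT x|lborel. norm (F r x + G r x - (F t x + G t x))) \<longlongrightarrow> 0) (at t within {0..<T})"
 proof (rule tendsto_dominated_within)
  show "((%r. (LINT x|lborel. norm (F r x - F t x)) + (LINT x|lborel. norm (G r x - G t x))) \<longlongrightarrow> 0) (at t within {0..<T})"
   using tendsto_add[OF L1_pathD(2)[OF assms(1) t] L1_pathD(2)[OF assms(2) t]] by simp
  fix r assume r: "r \<in> {0..<T}"
  have "(LINT x|lborel. norm (F r x + G r x - (F t x + G t x))) \<le> (LINT x|lborel. norm (F r x - F t x) + norm (G r x - G t x))"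
  proof (rule integral_mono)
   show "norm (F r x + G r x - (F t x + G t x)) \<le> norm (F r x - F t x) + norm (G r x - G t x)" for x
    by (rule norm_diff_triangle_ineq)
  qed (use i(1)[OF r] i(1)[OF t] i(2)[OF r] i(2)[OF t] in auto)
  then show "norm ((LINT x|lborel. norm (F r x + G r x - (F t x + G t x))) - 0) \<le> (LINT x|lborel. norm (F r x - F t x)) + (LINT x|lborel. norm (G r x - G t x))"
   using i(1)[OF r] i(1)[OF t] i(2)[OF r] i(2)[OF t] by simp
 qed
qed

lemma L1_path_mult_exp:
 assumes F: "L1_path T F" and v: "H1_path T v p"
 shows "L1_path T (%t x. F t x * exp (c * v t x))" unfolding L1_path_def
proof (intro ballI conjI)
 fix t assume t: "t \<in> {0..<T}"
 have int: "integrable lborel (%x. F t x * exp (c * v s x))" if "t \<in> {0..<T}" "s \<in> {0..<T}" for s t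
  by (rule integrable_bounded_mult[OF L1_pathD(1)[OF F that(1)] exp_measurable[OF H1D(5)[OF H1_pathD(1)[OF v that(2)]]]
     exp_H1_bounds(2)[OF H1_pathD(1)[OF v that(2)] H1_pathD(1)[OF v that(2)]]])
 show "integrable lborel (%x. F t x * exp (c * v t x))" by (rule int[OF t t])
 define d where "d r = L2_norm (%x. v r x - v t x) + L2_norm (%x. p r x - p t x)" for r
 define N where "N = L2_norm (v t) + L2_norm (p t)"
 have d0: "(d \<longlongrightarrow> 0) (at t within {0..<T})" unfolding d_def by (rule H1_path_diff_bound[OF v t])
 note Ht = H1_pathD(1)[OF v t]
 show "((%r. LINT x|lborel. norm (F r x * exp (c * v r x) - F t x * exp (c * v t x))) \<longlongrightarrow> 0) (at t within {0..<T})"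
 proof (rule tendsto_dominated_within)
  let ?G = "%r. (LINT x|lborel. norm (F r x - F t x)) * exp (norm c * (N + d r)) + (LINT x|lborel. norm (F t x)) * ((exp (norm c * N) * exp (norm c * d r) * norm c) * d r)"
  have "(?G \<longlongrightarrow> 0 * exp (norm c * (N + 0)) + (LINT x|lborel. norm (F t x)) * ((exp (norm c * N) * exp (norm c * 0) * norm c) * 0)) (at t within {0..<T})"
   by (intro tendsto_intros d0 L1_pathD(2)[OF F t])
  then show "(?G \<longlongrightarrow> 0) (at t within {0..<T})" by simp
  fix r assume r: "r \<in> {0..<T}"
  note Hr = H1_pathD(1)[OF v r]
  have iF: "integrable lborel (%x. norm (F r x - F t x) * exp (norm c * (N + d r)))"
   "integrable lborel (%x. norm (F t x) * ((exp (norm c * N) * exp (norm c * d r) * norm c) * d r))"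
   using L1_pathD(1)[OF F r] L1_pathD(1)[OF F t] by auto
  have "(LINT x|lborel. norm (F r x * exp (c * v r x) - F t x * exp (c * v t x))) \<le>
   (LINT x|lborel. norm (F r x - F t x) * exp (norm c * (N + d r)) + norm (F t x) * ((exp (norm c * N) * exp (norm c * d r) * norm c) * d r))"
  proof (rule integral_mono)
   show "integrable lborel (%x. norm (F r x * exp (c * v r x) - F t x * exp (c * v t x)))" using int[OF r r] int[OF t t] by simp
   fix x
   have "F r x * exp (c * v r x) - F t x * exp (c * v t x) = (F r x - F t x) * exp (c * v r x) + F t x * (exp (c * v r x) - exp (c * v t x))"
    by (simp add: algebra_simps)
   also have "norm ... \<le> norm (F r x - F t x) * norm (exp (c * v r x)) + norm (F t x) * norm (exp (c * v r x) - exp (c * v t x))"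
    unfolding norm_mult[symmetric] by (rule norm_triangle_ineq)
   also have "... \<le> norm (F r x - F t x) * exp (norm c * (N + d r)) + norm (F t x) * ((exp (norm c * N) * exp (norm c * d r) * norm c) * d r)"
    unfolding d_def N_def by (intro add_mono mult_left_mono exp_H1_bounds(3)[OF Hr Ht] exp_H1_bounds(5)[OF Hr Ht]) auto
   finally show "norm (F r x * exp (c * v r x) - F t x * exp (c * v t x)) \<le>
    norm (F r x - F t x) * exp (norm c * (N + d r)) + norm (F t x) * ((exp (norm c * N) * exp (norm c * d r) * norm c) * d r)" .
  qed (use iF in simp)
  also have "... = ?G r" using iF by simp
  finally show "norm ((LINT x|lborel. norm (F r x * exp (c * v r x) - F t x * exp (c * v t x))) - 0) \<le> ?G r" by simp
 qed
qed

section \<open>Components of Sobolev paths and the weak form of the system\<close>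

lemma finite_sobolev_orders: "finite {k::nat. real k \<le> s}"
proof (rule finite_subset)
 show "{k::nat. real k \<le> s} \<subseteq> {..nat \<lfloor>s\<rfloor>}" by (auto simp: le_nat_floor)
qed simp

lemma L2_norm_weak_deriv_le:
 assumes "real k \<le> s"
 shows "L2_norm (weak_deriv k f) \<le> sobolev_norm s f" unfolding sobolev_norm_def
 by (rule member_le_sum[of k _ "%k. L2_norm (weak_deriv k f)"]) (use assms finite_sobolev_orders in auto)

lemma L2_norm_component_le:
 fixes f :: "real => complex ^ 'n"
 assumes "square_integrable f"
 shows "L2_norm (%x. f x $ j) \<le> L2_norm f"
 by (rule L2_norm_mono[OF L2D(1)[OF L2_bounded_linear[OF bounded_linear_vec_nth assms]] assms])
  (auto intro!: AE_I2 Finite_Cartesian_Product.norm_nth_le)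

text \<open>Each component is replaced by its continuous representative, whereas the derivative is
  kept as \<open>weak_deriv 1\<close> of the component itself, the very function in the nonlinearity
  of \<open>is_solution\<close>. Differences are controlled by the terms of order 0 and 1 in the
  Sobolev norm.\<close>

lemma sobolev_component_path:
 fixes u :: "real => real => complex ^ 'n"
 assumes u: "continuous_into_sobolev s T u" and s: "1 \<le> s"
 shows "\<exists>w. H1_path T w (%t. weak_deriv 1 (%x. u t x $ j)) \<and>
  (\<forall>t\<in>{0..<T}. (AE x in lborel. u t x $ j = w t x) \<and> (%x. u t x $ j) \<in> borel_measurable lborel)"
proof -
 have us: "u t \<in> sobolev_space s" if "t \<in> {0..<T}" for t using u that by (auto simp: continuous_into_sobolev_def)
 have cs: "(%x. u t x $ j) \<in> sobolev_space s" if "t \<in> {0..<T}" for t unfolding sobolev_space_def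
 proof (intro CollectI allI impI)
  fix k :: nat assume k: "real k \<le> s"
  note w = sobolev_space_weak_deriv[OF us[OF that] k]
  show "\<exists>g. has_weak_deriv k (%x. u t x $ j) g \<and> square_integrable g"
   using has_weak_deriv_bounded_linear[OF bounded_linear_vec_nth w(1)] L2_bounded_linear[OF bounded_linear_vec_nth w(2)] by blast
 qed
 define p where "p t = weak_deriv 1 (%x. u t x $ j)" for t
 have "\<forall>t\<in>{0..<T}. \<exists>g. H1 g (p t) \<and> (AE x in lborel. u t x $ j = g x)"
  unfolding p_def using H1_of_sobolev[OF cs s] by blast
 then obtain w where w: "!!t. t \<in> {0..<T} ==> H1 (w t) (p t)" "!!t. t \<in> {0..<T} ==> AE x in lborel. u t x $ j = w t x"
  by metis
 have d: "((%r. sobolev_norm s (%x. u r x - u t x)) \<longlongrightarrow> 0) (at t within {0..<T})" if "t \<in> {0..<T}" for t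
  using u that by (auto simp: continuous_into_sobolev_def)
 have k0: "real 0 \<le> s" and k1: "real 1 \<le> s" using s by auto
 have bound: "L2_norm (%x. w r x - w t x) \<le> sobolev_norm s (%x. u r x - u t x)"
  "L2_norm (%x. p r x - p t x) \<le> sobolev_norm s (%x. u r x - u t x)" if r: "r \<in> {0..<T}" and t: "t \<in> {0..<T}" for r t
 proof -
  note wr0 = sobolev_space_weak_deriv[OF us[OF r] k0] and wt0 = sobolev_space_weak_deriv[OF us[OF t] k0]
  note wr1 = sobolev_space_weak_deriv[OF us[OF r] k1] and wt1 = sobolev_space_weak_deriv[OF us[OF t] k1]
  have gen: "square_integrable (weak_deriv k (%x. u r x - u t x))"
   "AE x in lborel. weak_deriv k (%x. u r x - u t x) x = weak_deriv k (u r) x - weak_deriv k (u t) x" if k: "real k \<le> s" for k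
  proof -
   note a = sobolev_space_weak_deriv[OF us[OF r] k] and b = sobolev_space_weak_deriv[OF us[OF t] k]
   note h = has_weak_deriv_diff[OF a(1) b(1)]
   show ae: "AE x in lborel. weak_deriv k (%x. u r x - u t x) x = weak_deriv k (u r) x - weak_deriv k (u t) x"
    by (rule weak_deriv_AE(2)[OF h])
   show "square_integrable (weak_deriv k (%x. u r x - u t x))"
   proof (rule L2_dominated[OF _ L2_diff[OF a(2) b(2)], of _ 1])
    show "weak_deriv k (%x. u r x - u t x) \<in> borel_measurable lborel"
     by (rule locally_integrable_measurable[OF has_weak_derivD(2)[OF weak_deriv_AE(1)[OF h]]])
    show "AE x in lborel. norm (weak_deriv k (%x. u r x - u t x) x) \<le> 1 * norm (weak_deriv k (u r) x - weak_deriv k (u t) x)"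
     using ae by eventually_elim simp
   qed
  qed
  have comp: "AE x in lborel. weak_deriv k (%x. u q x $ j) x = weak_deriv k (u q) x $ j" if k: "real k \<le> s" and q: "q \<in> {0..<T}" for k q
   by (rule weak_deriv_AE(2)[OF has_weak_deriv_bounded_linear[OF bounded_linear_vec_nth sobolev_space_weak_deriv(1)[OF us[OF q] k]]])
  have fin: "L2_norm f \<le> sobolev_norm s (%x. u r x - u t x)"
   if f: "f \<in> borel_measurable lborel" and ae: "AE x in lborel. f x = weak_deriv k (u r) x $ j - weak_deriv k (u t) x $ j" and k: "real k \<le> s" for f k
  proof -
   have "L2_norm f = L2_norm (%x. weak_deriv k (%x. u r x - u t x) x $ j)"
   proof (rule L2_norm_cong_AE[OF _ f])
    show "AE x in lborel. norm (f x) = norm (weak_deriv k (%x. u r x - u t x) x $ j)"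
     using ae gen(2)[OF k] by eventually_elim simp
    show "(%x. weak_deriv k (%x. u r x - u t x) x $ j) \<in> borel_measurable lborel"
     by (rule L2D(1)[OF L2_bounded_linear[OF bounded_linear_vec_nth gen(1)[OF k]]])
   qed
   also have "... \<le> L2_norm (weak_deriv k (%x. u r x - u t x))" by (rule L2_norm_component_le[OF gen(1)[OF k]])
   also have "... \<le> sobolev_norm s (%x. u r x - u t x)" by (rule L2_norm_weak_deriv_le[OF k])
   finally show ?thesis .
  qed
  have u0: "AE x in lborel. weak_deriv 0 (u q) x = u q x" if "q \<in> {0..<T}" for q
   by (rule weak_deriv_0_AE[OF has_weak_derivD(1)[OF sobolev_space_weak_deriv(1)[OF us[OF that] k0]]])
  show "L2_norm (%x. w r x - w t x) \<le> sobolev_norm s (%x. u r x - u t x)"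
  proof (rule fin[OF _ _ k0])
   show "(%x. w r x - w t x) \<in> borel_measurable lborel" by (rule H1D(5)[OF H1_diff[OF w(1)[OF r] w(1)[OF t]]])
   show "AE x in lborel. w r x - w t x = weak_deriv 0 (u r) x $ j - weak_deriv 0 (u t) x $ j"
    using u0[OF r] u0[OF t] w(2)[OF r] w(2)[OF t] by eventually_elim simp
  qed
  show "L2_norm (%x. p r x - p t x) \<le> sobolev_norm s (%x. u r x - u t x)"
  proof (rule fin[OF _ _ k1])
   show "(%x. p r x - p t x) \<in> borel_measurable lborel" by (rule H1D(6)[OF H1_diff[OF w(1)[OF r] w(1)[OF t]]])
   show "AE x in lborel. p r x - p t x = weak_deriv 1 (u r) x $ j - weak_deriv 1 (u t) x $ j"
    using comp[OF k1 r] comp[OF k1 t] unfolding p_def by eventually_elim simp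
  qed
 qed
 have "H1_path T w p" unfolding H1_path_def L2_path_def
 proof (intro conjI ballI)
  fix t assume t: "t \<in> {0..<T}"
  show "H1 (w t) (p t)" "square_integrable (w t)" "square_integrable (p t)" using w(1)[OF t] H1D by blast+
  show "((%r. L2_norm (%x. w r x - w t x)) \<longlongrightarrow> 0) (at t within {0..<T})"
   by (rule tendsto_dominated_within[OF d[OF t]]) (use bound(1) t in simp)
  show "((%r. L2_norm (%x. p r x - p t x)) \<longlongrightarrow> 0) (at t within {0..<T})"
   by (rule tendsto_dominated_within[OF d[OF t]]) (use bound(2) t in simp)
 qed
 moreover have "(%x. u t x $ j) \<in> borel_measurable lborel" if "t \<in> {0..<T}" for t
  by (rule locally_integrable_measurable[OF sobolev_space_square_integrable(2)[OF cs[OF that]]]) (use s in simp)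
 ultimately show ?thesis using w(2) unfolding p_def[abs_def] by blast
qed

lemma quadratic_Lipschitz_square: "quadratic_Lipschitz (%z w. z\<^sup>2)" unfolding quadratic_Lipschitz_def
proof (intro conjI exI[of _ 1] allI)
 show "continuous_on UNIV (%z::complex \<times> complex. (fst z)\<^sup>2)" by (intro continuous_intros)
 fix z w z' w' :: complex
 have "norm (z\<^sup>2 - z'\<^sup>2) = norm (z - z') * norm (z + z')" by (simp add: norm_mult[symmetric] power2_eq_square algebra_simps)
 also have "... \<le> (norm (z - z') + norm (w - w')) * (norm z + norm w + norm z' + norm w')"
  using norm_triangle_ineq[of z z'] norm_ge_zero[of w] norm_ge_zero[of w'] norm_ge_zero[of "w - w'"]
   norm_ge_zero[of "z - z'"] norm_ge_zero[of "z + z'"] by (intro mult_mono) linarith+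
 finally show "norm (z\<^sup>2 - z'\<^sup>2) \<le> 1 * ((norm (z - z') + norm (w - w')) * (norm z + norm w + norm z' + norm w'))" by simp
qed auto

lemma quadratic_Lipschitz_divide:
 assumes "quadratic_Lipschitz Q"
 shows "quadratic_Lipschitz (%z w. Q z w / a)"
proof -
 obtain C where C: "C \<ge> 0" "!!z w z' w'. norm (Q z w - Q z' w') \<le>
    C * ((norm (z - z') + norm (w - w')) * (norm z + norm w + norm z' + norm w'))"
  using assms unfolding quadratic_Lipschitz_def by blast
 have "norm (Q z w / a - Q z' w' / a) \<le> (C / norm a) * ((norm (z - z') + norm (w - w')) * (norm z + norm w + norm z' + norm w'))" for z w z' w'
  using divide_right_mono[OF C(2)[of z w z' w'], of "norm a"] by (simp add: diff_divide_distrib[symmetric] norm_divide)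
 moreover have "continuous_on UNIV (%z. Q (fst z) (snd z) / a)"
  using assms unfolding quadratic_Lipschitz_def divide_inverse by (intro continuous_intros) auto
 ultimately show ?thesis using assms C(1) unfolding quadratic_Lipschitz_def by (intro conjI exI[of _ "C / norm a"]) auto
qed

lemma solution_weak_formulation:
 assumes sol: "is_solution m1 m2 m3 Q s \<phi> T u" and m: "m1 > 0" "m2 > 0" "m3 > 0" and s: "1 \<le> s" and Q: "quadratic_Lipschitz Q"
 obtains w1 w2 w3 p1 p2 p3 where "H1_path T w1 p1" "H1_path T w2 p2" "H1_path T w3 p3"
  "\<forall>t\<in>{0..<T}. AE x in lborel. u t x $ 1 = w1 t x \<and> u t x $ 2 = w2 t x \<and> u t x $ 3 = w3 t x"
  "weak_solution m1 T w1 p1 (%t x. 0)" "weak_solution m2 T w2 p2 (%t x. (w1 t x)\<^sup>2)"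
  "weak_solution m3 T w3 p3 (%t x. (p3 t x)\<^sup>2 + (Q (w1 t x) (w2 t x) / of_real (2 * m3)) * exp (of_real (2 * m3) * w3 t x))"
proof -
 have c: "continuous_into_sobolev s T u" using sol by (simp add: is_solution_def)
 define p where "p j t = weak_deriv 1 (%x. u t x $ j)" for j :: 3 and t
 have "\<forall>j. \<exists>w. H1_path T w (p j) \<and> (\<forall>t\<in>{0..<T}. (AE x in lborel. u t x $ j = w t x) \<and> (%x. u t x $ j) \<in> borel_measurable lborel)"
  using sobolev_component_path[OF c s] unfolding p_def[abs_def] by blast
 then obtain w where w: "!!j. H1_path T (w j) (p j)" "!!j t. t \<in> {0..<T} ==> AE x in lborel. u t x $ j = w j t x"
  "!!j t. t \<in> {0..<T} ==> (%x. u t x $ j) \<in> borel_measurable lborel" by metis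
 have mp: "p j t \<in> borel_measurable lborel" if "t \<in> {0..<T}" for j t by (rule H1D(6)[OF H1_pathD(1)[OF w(1) that]])
 have ws1: "weak_solution m1 T (w 1) (p 1) (%t x. 0)"
 proof (rule distributional_imp_weak_solution[of m1 T "%t x. u t x $ 1" "%t x. 0"])
  show "schrodinger_distributional m1 T (%t x. u t x $ 1) (%t x. 0)" using sol by (simp add: is_solution_def)
 qed (rule m w L1_path_zero AE_I2 refl borel_measurable_const | assumption)+
 have ws2: "weak_solution m2 T (w 2) (p 2) (%t x. (w 1 t x)\<^sup>2)"
 proof (rule distributional_imp_weak_solution[of m2 T "%t x. u t x $ 2" "%t x. (u t x $ 1)\<^sup>2"])
  show "schrodinger_distributional m2 T (%t x. u t x $ 2) (%t x. (u t x $ 1)\<^sup>2)" using sol by (simp add: is_solution_def)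
  show "L1_path T (%t x. (w 1 t x)\<^sup>2)"
   by (rule L1_path_quadratic[OF quadratic_Lipschitz_square H1_pathD(2)[OF w(1)] H1_pathD(2)[OF w(1)]])
  fix t assume t: "t \<in> {0..<T}"
  show "AE x in lborel. (u t x $ 1)\<^sup>2 = (w 1 t x)\<^sup>2" using w(2)[OF t, of 1] by eventually_elim simp
  show "(%x. (u t x $ 1)\<^sup>2) \<in> borel_measurable lborel" using w(3)[OF t, of 1] by (rule borel_measurable_power)
 qed (use m w in auto)
 let ?F = "%t x. (p 3 t x)\<^sup>2 + (Q (w 1 t x) (w 2 t x) / of_real (2 * m3)) * exp (of_real (2 * m3) * w 3 t x)"
 let ?G = "%t x. (weak_deriv 1 (%y. u t y $ 3) x)\<^sup>2
     + Q (u t x $ 1) (u t x $ 2) * (exp (of_real (2 * m3) * u t x $ 3) / of_real (2 * m3))"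
 have ws3: "weak_solution m3 T (w 3) (p 3) ?F"
 proof (rule distributional_imp_weak_solution[of m3 T "%t x. u t x $ 3" ?G])
  show "schrodinger_distributional m3 T (%t x. u t x $ 3) ?G" using sol by (simp add: is_solution_def)
  show "L1_path T ?F" by (intro L1_path_add L1_path_mult_exp[OF L1_path_quadratic[OF quadratic_Lipschitz_divide[OF Q]] w(1)]
     L1_path_quadratic[OF quadratic_Lipschitz_square _ H1_pathD(3)[OF w(1)[of 3]]] H1_pathD(2)[OF w(1)] H1_pathD(3)[OF w(1)])
  fix t assume t: "t \<in> {0..<T}"
  show "AE x in lborel. ?G t x = ?F t x" using w(2)[OF t, of 1] w(2)[OF t, of 2] w(2)[OF t, of 3] by eventually_elim (simp add: p_def)
  have "(%x. Q (u t x $ 1) (u t x $ 2)) \<in> borel_measurable lborel"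
   by (rule quadratic_Lipschitz_measurable[OF Q w(3)[OF t] w(3)[OF t]])
  moreover have "(%x. exp (of_real (2 * m3) * u t x $ 3)) \<in> borel_measurable lborel" by (rule exp_measurable[OF w(3)[OF t]])
  moreover have "(%x. weak_deriv 1 (%y. u t y $ 3) x) \<in> borel_measurable lborel"
   using mp[OF t, of 3] by (simp add: p_def)
  ultimately show "?G t \<in> borel_measurable lborel"
   by (intro borel_measurable_add borel_measurable_times borel_measurable_power borel_measurable_divide borel_measurable_const)
 qed (use m w in auto)
 have "\<forall>t\<in>{0..<T}. AE x in lborel. u t x $ 1 = w 1 t x \<and> u t x $ 2 = w 2 t x \<and> u t x $ 3 = w 3 t x"
 proof
  fix t assume t: "t \<in> {0..<T}"
  show "AE x in lborel. u t x $ 1 = w 1 t x \<and> u t x $ 2 = w 2 t x \<and> u t x $ 3 = w 3 t x"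
   using w(2)[OF t, of 1] w(2)[OF t, of 2] w(2)[OF t, of 3] by eventually_elim simp
 qed
 then show ?thesis by (rule that[OF w(1) w(1) w(1) _ ws1 ws2 ws3])
qed

section \<open>Uniqueness for the nonlinear system\<close>

lemma continuous_AE_eq:
 fixes f g :: "real => complex"
 assumes "continuous_on UNIV f" "continuous_on UNIV g" "AE x in lborel. f x = g x"
 shows "f x = g x"
proof -
 have c: "continuous_on UNIV (%x. f x - g x)" by (intro continuous_intros assms)
 have "AE y in lborel. y \<in> {x-1..x+1} \<longrightarrow> f y - g y = 0" using assms(3) by eventually_elim simp
 from continuous_AE_const[OF c this, of x] show ?thesis by simp
qed

lemma L2_const_zero:
 assumes "square_integrable (%x::real. k :: complex)"
 shows "k = 0"
proof (rule ccontr)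
 assume "k \<noteq> 0"
 have "integrable lborel (%x::real. (norm k)\<^sup>2)" using L2D(2)[OF assms] .
 then have "(\<integral>\<^sup>+ x. ennreal ((norm k)\<^sup>2) \<partial>(lborel :: real measure)) < \<infinity>"
  unfolding integrable_iff_bounded by simp
 then show False using \<open>k \<noteq> 0\<close> by (simp add: ennreal_mult_top)
qed

text \<open>Undoing the exponential substitution: c (f - g) is continuous with values in 2 \<pi>
  \<i> times the integers, hence constant by connectedness, and a square integrable constant on the
  line is zero.\<close>

lemma exp_eq_imp_eq:
 assumes f: "H1 f p" and g: "H1 g q" and c: "c \<noteq> 0" and e: "AE x in lborel. exp (c * f x) = exp (c * g x)"
 shows "f x = g x"
proof -
 define d where "d x = c * (f x - g x)" for x
 have cd: "continuous_on UNIV d" unfolding d_def by (intro continuous_intros H1D(4)[OF f] H1D(4)[OF g])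
 have e1: "exp (d x) = 1" for x
 proof -
  have "exp (c * f x) = exp (c * g x)" by (rule continuous_AE_eq[OF _ _ e]) (intro continuous_intros H1D(4)[OF f] H1D(4)[OF g])+
  then show ?thesis by (simp add: d_def right_diff_distrib exp_diff)
 qed
 have "d constant_on UNIV"
 proof (rule continuous_discrete_range_constant[OF connected_UNIV cd])
  fix x
  have "1 \<le> norm (d y - d x)" if "d y \<noteq> d x" for y
  proof -
   obtain k l :: int where kl: "Re (d x) = 0" "Im (d x) = of_int (2 * k) * pi" "Re (d y) = 0" "Im (d y) = of_int (2 * l) * pi"
    using e1[of x] e1[of y] unfolding exp_eq_1 by blast
   then have "k \<noteq> l" using that by (auto simp: complex_eq_iff)
   then have "\<bar>l - k\<bar> \<ge> 1" by linarith
   then have "real_of_int \<bar>l - k\<bar> \<ge> 1" by linarith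
   have "1 \<le> 2 * pi * 1" using pi_gt3 by simp
   also have "... \<le> 2 * pi * real_of_int \<bar>l - k\<bar>" using \<open>real_of_int \<bar>l - k\<bar> \<ge> 1\<close> by (intro mult_left_mono) auto
   also have "... = \<bar>Im (d y - d x)\<bar>"
   proof -
    have "Im (d y - d x) = 2 * pi * real_of_int (l - k)" using kl by (simp add: algebra_simps)
    then show ?thesis by (simp only: abs_mult of_int_abs) simp
   qed
   also have "... \<le> norm (d y - d x)" by (rule abs_Im_le_cmod)
   finally show ?thesis .
  qed
  then show "\<exists>e>0. \<forall>y. y \<in> UNIV \<and> d y \<noteq> d x \<longrightarrow> e \<le> norm (d y - d x)" by (intro exI[of _ 1]) auto
 qed
 then obtain k where k: "!!x. d x = k" by (auto simp: constant_on_def)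
 have fg: "f x - g x = k / c" for x using k[of x] c by (simp add: d_def field_simps)
 then have "square_integrable (%x::real. k / c)" using H1D(2)[OF H1_diff[OF f g]] by simp
 then have "k / c = 0" by (rule L2_const_zero)
 then show ?thesis using fg[of x] by (metis eq_iff_diff_eq_0)
qed

text \<open>The substitution \<open>exp (- 2 m\<^sub>3 u\<^sub>3)\<close> turns the third equation into a linear one.\<close>

theorem solution_unique:
 assumes u: "is_solution m1 m2 m3 Q s \<phi> T u" and v: "is_solution m1 m2 m3 Q s \<phi> T v"
  and m: "m1 > 0" "m2 > 0" "m3 > 0" and s: "1 \<le> s" and Q: "quadratic_Lipschitz Q" and t: "t \<in> {0..<T}"
 shows "AE x in lborel. v t x = u t x"
proof -
 obtain w1 w2 w3 p1 p2 p3 where w: "H1_path T w1 p1" "H1_path T w2 p2" "H1_path T w3 p3"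
  "\<forall>t\<in>{0..<T}. AE x in lborel. u t x $ 1 = w1 t x \<and> u t x $ 2 = w2 t x \<and> u t x $ 3 = w3 t x"
  "weak_solution m1 T w1 p1 (%t x. 0)" "weak_solution m2 T w2 p2 (%t x. (w1 t x)\<^sup>2)"
  "weak_solution m3 T w3 p3 (%t x. (p3 t x)\<^sup>2 + (Q (w1 t x) (w2 t x) / of_real (2 * m3)) * exp (of_real (2 * m3) * w3 t x))"
  by (rule solution_weak_formulation[OF u m s Q])
 obtain y1 y2 y3 q1 q2 q3 where y: "H1_path T y1 q1" "H1_path T y2 q2" "H1_path T y3 q3"
  "\<forall>t\<in>{0..<T}. AE x in lborel. v t x $ 1 = y1 t x \<and> v t x $ 2 = y2 t x \<and> v t x $ 3 = y3 t x"
  "weak_solution m1 T y1 q1 (%t x. 0)" "weak_solution m2 T y2 q2 (%t x. (y1 t x)\<^sup>2)"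
  "weak_solution m3 T y3 q3 (%t x. (q3 t x)\<^sup>2 + (Q (y1 t x) (y2 t x) / of_real (2 * m3)) * exp (of_real (2 * m3) * y3 t x))"
  by (rule solution_weak_formulation[OF v m s Q])
 have T0: "0 \<in> {0..<T}" using t by auto
 have init: "AE x in lborel. w1 0 x = y1 0 x \<and> w2 0 x = y2 0 x \<and> w3 0 x = y3 0 x"
 proof -
  have "AE x in lborel. u 0 x = \<phi> x" "AE x in lborel. v 0 x = \<phi> x" using u v by (auto simp: is_solution_def)
  then show ?thesis using w(4)[rule_format, OF T0] y(4)[rule_format, OF T0] by eventually_elim auto
 qed
 have e1: "AE x in lborel. w1 t x = y1 t x" if t: "t \<in> {0..<T}" for t
 proof -
  have "AE x in lborel. w1 t x - y1 t x = 0"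
   by (rule weak_solution_zero[OF H1_path_diff[OF w(1) y(1)] weak_solution_diff[OF w(1) L1_path_zero w(5) y(1) L1_path_zero y(5)] m(1) _ t])
    (use init in auto)
  then show ?thesis by simp
 qed
 have L1sq: "L1_path T (%t x. (a t x)\<^sup>2)" if "L2_path T a" for a
  by (rule L1_path_quadratic[OF quadratic_Lipschitz_square that that])
 have e2: "AE x in lborel. w2 t x = y2 t x" if t: "t \<in> {0..<T}" for t
 proof -
  have "AE x in lborel. (w1 s x)\<^sup>2 = (y1 s x)\<^sup>2" if "s \<in> {0..<T}" for s using e1[OF that] by eventually_elim simp
  then have "AE x in lborel. w2 t x - y2 t x = 0"
   by (intro weak_solution_zero[OF H1_path_diff[OF w(2) y(2)] weak_solution_diff[OF w(2) L1sq[OF H1_pathD(2)[OF w(1)]] w(6) y(2) L1sq[OF H1_pathD(2)[OF y(1)]] y(6)] m(2) _ t])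
    (use init in auto)
  then show ?thesis by simp
 qed
 \<comment> \<open>With this c the additional term c p^2 / (2 m3) of the exponentiated equation
   cancels the squared derivative in the third equation.\<close>
 define c :: complex where "c = - of_real (2 * m3)"
 have c0: "c \<noteq> 0" using m by (simp add: c_def)
 have lin: "weak_solution m3 T (%t x. exp (c * a3 t x) - 1) (%t x. c * exp (c * a3 t x) * b3 t x) (%t x. - Q (a1 t x) (a2 t x))"
  if a: "H1_path T a1 b1" "H1_path T a2 b2" "H1_path T a3 b3"
   "weak_solution m3 T a3 b3 (%t x. (b3 t x)\<^sup>2 + (Q (a1 t x) (a2 t x) / of_real (2 * m3)) * exp (of_real (2 * m3) * a3 t x))" for a1 a2 a3 b1 b2 b3
 proof -
  have "L1_path T (%t x. (b3 t x)\<^sup>2 + (Q (a1 t x) (a2 t x) / of_real (2 * m3)) * exp (of_real (2 * m3) * a3 t x))"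
   by (intro L1_path_add L1sq H1_pathD(3)[OF a(3)] L1_path_mult_exp[OF L1_path_quadratic[OF quadratic_Lipschitz_divide[OF Q]] a(3)]
     H1_pathD(2)[OF a(1)] H1_pathD(2)[OF a(2)])
  from weak_solution_exp[OF a(3) this a(4) m(3), of c]
  have "weak_solution m3 T (%t x. exp (c * a3 t x) - 1) (%t x. c * exp (c * a3 t x) * b3 t x)
    (%t x. c * exp (c * a3 t x) * ((b3 t x)\<^sup>2 + (Q (a1 t x) (a2 t x) / of_real (2 * m3)) * exp (of_real (2 * m3) * a3 t x) + c * (b3 t x)\<^sup>2 / of_real (2 * m3)))" .
  \<comment> \<open>The squares cancel, and exp (c a3) compensates exp (2 m3 a3); what remains is a
    source without the third unknown.\<close>
  moreover have "c * exp (c * a3 t x) * ((b3 t x)\<^sup>2 + (Q (a1 t x) (a2 t x) / of_real (2 * m3)) * exp (of_real (2 * m3) * a3 t x) + c * (b3 t x)\<^sup>2 / of_real (2 * m3))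
    = - Q (a1 t x) (a2 t x)" for t x
  proof -
   have k0: "complex_of_real (2 * m3) \<noteq> 0" using m by simp
   have "c * (b3 t x)\<^sup>2 / of_real (2 * m3) = - (b3 t x)\<^sup>2" using k0 by (simp add: c_def)
   moreover have "exp (c * a3 t x) * exp (of_real (2 * m3) * a3 t x) = 1" by (simp add: c_def exp_add[symmetric])
   ultimately show ?thesis using k0 by (simp add: c_def field_simps)
  qed
  ultimately show ?thesis by simp
 qed
 have L1Q: "L1_path T (%t x. - Q (a1 t x) (a2 t x))" if "L2_path T a1" "L2_path T a2" for a1 a2
  using L1_path_quadratic[OF quadratic_Lipschitz_divide[OF Q, of "-1"] that] by simp
 have "AE x in lborel. - Q (w1 s x) (w2 s x) = - Q (y1 s x) (y2 s x)" if "s \<in> {0..<T}" for s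
  using e1[OF that] e2[OF that] by eventually_elim simp
 then have "AE x in lborel. (exp (c * w3 t x) - 1) - (exp (c * y3 t x) - 1) = 0"
  by (intro weak_solution_zero[OF H1_path_diff[OF H1_path_exp[OF w(3)] H1_path_exp[OF y(3)]]
    weak_solution_diff[OF H1_path_exp[OF w(3)] L1Q[OF H1_pathD(2)[OF w(1)] H1_pathD(2)[OF w(2)]] lin[OF w(1,2,3,7)]
     H1_path_exp[OF y(3)] L1Q[OF H1_pathD(2)[OF y(1)] H1_pathD(2)[OF y(2)]] lin[OF y(1,2,3,7)]] m(3) _ t]) (use init in auto)
 then have "AE x in lborel. exp (c * w3 t x) = exp (c * y3 t x)" by simp
 from exp_eq_imp_eq[OF H1_pathD(1)[OF w(3) t] H1_pathD(1)[OF y(3) t] c0 this]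
 have e3: "w3 t x = y3 t x" for x .
 show ?thesis using w(4)[rule_format, OF t] y(4)[rule_format, OF t] e1[OF t] e2[OF t]
  by eventually_elim (auto simp: vec_eq_iff forall_3 e3)
qed

section \<open>Classical solutions\<close>

text \<open>The weight is square integrable and at most 1. The constant may depend on the final
  time, because solutions may blow up as T is approached.\<close>

definition decaying :: "real => (real => real => 'a::euclidean_space) => bool" where
 "decaying T f \<longleftrightarrow> continuous_on ({0..<T} \<times> UNIV) (%z. f (fst z) (snd z)) \<and>
   (\<forall>\<tau><T. \<exists>C. \<forall>t\<in>{0..\<tau>}. \<forall>x. norm (f t x) \<le> C * (1 / (1 + x\<^sup>2)))"

text \<open>Only spatial derivatives are counted. Joint continuity and decay of these suffice for
  continuity in time with values in Sobolev spaces; time derivatives enter separately, when the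
  equation is verified.\<close>

primrec regular :: "real => nat => (real => real => 'a::euclidean_space) => bool" where
 "regular T 0 f \<longleftrightarrow> decaying T f"
| "regular T (Suc n) f \<longleftrightarrow> decaying T f \<and>
   (\<exists>f'. (\<forall>t\<in>{0..<T}. \<forall>x. (f t has_vector_derivative f' t x) (at x)) \<and> regular T n f')"

lemma regular_decaying: "regular T n f ==> decaying T f" by (cases n) auto

lemma regular_SucI:
 "decaying T f ==> (!!t x. t \<in> {0..<T} ==> (f t has_vector_derivative f' t x) (at x)) ==> regular T n f' ==> regular T (Suc n) f"
 by (simp only: regular.simps) blast

lemma regular_Suc_imp: "regular T (Suc n) f ==> regular T n f"
proof (induction n arbitrary: f)
 case (Suc n)
 then obtain f' where "\<forall>t\<in>{0..<T}. \<forall>x. (f t has_vector_derivative f' t x) (at x)" "regular T (Suc n) f'" "decaying T f"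
  by auto
 with Suc.IH show ?case by auto
qed simp

lemma decayingD:
 assumes "decaying T f" "\<tau> < T"
 shows "\<exists>C\<ge>0. \<forall>t\<in>{0..\<tau>}. \<forall>x. norm (f t x) \<le> C * (1 / (1 + x\<^sup>2))"
proof -
 obtain C where C: "\<forall>t\<in>{0..\<tau>}. \<forall>x. norm (f t x) \<le> C * (1 / (1 + x\<^sup>2))" using assms by (auto simp: decaying_def)
 have "norm (f t x) \<le> \<bar>C\<bar> * (1 / (1 + x\<^sup>2))" if "t \<in> {0..\<tau>}" for t x
 proof -
  have "norm (f t x) \<le> C * (1 / (1 + x\<^sup>2))" using C that by blast
  also have "... \<le> \<bar>C\<bar> * (1 / (1 + x\<^sup>2))" by (intro mult_right_mono) auto
  finally show ?thesis .
 qed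
 then show ?thesis by (intro exI[of _ "\<bar>C\<bar>"]) simp
qed

lemma decayingI:
 assumes "continuous_on ({0..<T} \<times> UNIV) (%z. f (fst z) (snd z))"
  "!!\<tau>. \<tau> < T ==> \<exists>C. \<forall>t\<in>{0..\<tau>}. \<forall>x. norm (f t x) \<le> C * (1 / (1 + x\<^sup>2))"
 shows "decaying T f" using assms by (auto simp: decaying_def)

lemma decaying_continuous: "decaying T f ==> continuous_on ({0..<T} \<times> UNIV) (%z. f (fst z) (snd z))"
 by (simp add: decaying_def)

lemma continuous_on_slices:
 assumes "continuous_on (A \<times> B) f"
 shows "a \<in> A ==> continuous_on B (%x. f (a, x))" "b \<in> B ==> continuous_on A (%x. f (x, b))"
proof -
 show "continuous_on B (%x. f (a, x))" if "a \<in> A"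
  by (rule continuous_on_compose2[OF assms continuous_on_Pair[OF continuous_on_const continuous_on_id]]) (use that in auto)
 show "continuous_on A (%x. f (x, b))" if "b \<in> B"
  by (rule continuous_on_compose2[OF assms continuous_on_Pair[OF continuous_on_id continuous_on_const]]) (use that in auto)
qed

lemma decaying_continuous_x:
 assumes "decaying T f" "t \<in> {0..<T}"
 shows "continuous_on UNIV (f t)" using continuous_on_slices(1)[OF decaying_continuous[OF assms(1)] assms(2)] by simp

lemma decaying_add:
 assumes "decaying T f" "decaying T g"
 shows "decaying T (%t x. f t x + g t x)"
proof (rule decayingI)
 show "continuous_on ({0..<T} \<times> UNIV) (%z. f (fst z) (snd z) + g (fst z) (snd z))"
  by (intro continuous_intros decaying_continuous assms)
 fix \<tau> assume \<tau>: "\<tau> < T"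
 obtain C where C: "!!t x. t \<in> {0..\<tau>} ==> norm (f t x) \<le> C * (1 / (1 + x\<^sup>2))" using decayingD[OF assms(1) \<tau>] by metis
 obtain D where D: "!!t x. t \<in> {0..\<tau>} ==> norm (g t x) \<le> D * (1 / (1 + x\<^sup>2))" using decayingD[OF assms(2) \<tau>] by metis
 have "norm (f t x + g t x) \<le> (C + D) * (1 / (1 + x\<^sup>2))" if "t \<in> {0..\<tau>}" for t x
  using norm_triangle_ineq[of "f t x" "g t x"] C[OF that, of x] D[OF that, of x] unfolding distrib_right by linarith
 then show "\<exists>C. \<forall>t\<in>{0..\<tau>}. \<forall>x. norm (f t x + g t x) \<le> C * (1 / (1 + x\<^sup>2))" by blast
qed

lemma decaying_bounded_mult:
 fixes f g :: "real => real => complex"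
 assumes f: "decaying T f" and g: "continuous_on ({0..<T} \<times> UNIV) (%z. g (fst z) (snd z))"
  and b: "!!\<tau>. \<tau> < T ==> \<exists>C. \<forall>t\<in>{0..\<tau>}. \<forall>x. norm (g t x) \<le> C"
 shows "decaying T (%t x. f t x * g t x)"
proof (rule decayingI)
 show "continuous_on ({0..<T} \<times> UNIV) (%z. f (fst z) (snd z) * g (fst z) (snd z))"
  by (intro continuous_intros decaying_continuous f g)
 fix \<tau> assume \<tau>: "\<tau> < T"
 obtain C where C: "C \<ge> 0" "!!t x. t \<in> {0..\<tau>} ==> norm (f t x) \<le> C * (1 / (1 + x\<^sup>2))" using decayingD[OF f \<tau>] by metis
 obtain D where D: "\<forall>t\<in>{0..\<tau>}. \<forall>x. norm (g t x) \<le> D" using b[OF \<tau>] by blast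
 have "norm (f t x * g t x) \<le> (C * D) * (1 / (1 + x\<^sup>2))" if "t \<in> {0..\<tau>}" for t x
 proof -
  have "norm (f t x) * norm (g t x) \<le> (C * (1 / (1 + x\<^sup>2))) * D" using C(1) C(2)[OF that] D that by (intro mult_mono) auto
  then show ?thesis by (simp add: norm_mult mult_ac)
 qed
 then show "\<exists>C. \<forall>t\<in>{0..\<tau>}. \<forall>x. norm (f t x * g t x) \<le> C * (1 / (1 + x\<^sup>2))" by blast
qed

lemma decaying_bounded:
 assumes "decaying T f" "\<tau> < T"
 shows "\<exists>C. \<forall>t\<in>{0..\<tau>}. \<forall>x. norm (f t x) \<le> C"
proof -
 obtain C where C: "C \<ge> 0" "!!t x. t \<in> {0..\<tau>} ==> norm (f t x) \<le> C * (1 / (1 + x\<^sup>2))" using decayingD[OF assms] by metis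
 have "C * (1 / (1 + x\<^sup>2)) \<le> C * 1" for x :: real using C(1) by (intro mult_left_mono) (auto simp: divide_le_eq add_pos_nonneg)
 then show ?thesis using C(2) by (metis mult_1_right order_trans)
qed

lemma decaying_mult:
 fixes f g :: "real => real => complex"
 shows "decaying T f ==> decaying T g ==> decaying T (%t x. f t x * g t x)"
 by (rule decaying_bounded_mult) (auto intro: decaying_continuous decaying_bounded)

lemma decaying_bounded_linear:
 assumes L: "bounded_linear L" and f: "decaying T f"
 shows "decaying T (%t x. L (f t x))"
proof (rule decayingI)
 show "continuous_on ({0..<T} \<times> UNIV) (%z. L (f (fst z) (snd z)))"
  by (rule bounded_linear.continuous_on[OF L decaying_continuous[OF f]])
 fix \<tau> assume \<tau>: "\<tau> < T"
 obtain C where C: "C \<ge> 0" "!!t x. t \<in> {0..\<tau>} ==> norm (f t x) \<le> C * (1 / (1 + x\<^sup>2))" using decayingD[OF f \<tau>] by metis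
 obtain K where K: "K \<ge> 0" "!!x. norm (L x) \<le> norm x * K" using bounded_linear.nonneg_bounded[OF L] by blast
 have "norm (L (f t x)) \<le> (C * K) * (1 / (1 + x\<^sup>2))" if "t \<in> {0..\<tau>}" for t x
  using K(2)[of "f t x"] mult_right_mono[OF C(2)[OF that, of x] K(1)] by (simp add: mult_ac)
 then show "\<exists>C. \<forall>t\<in>{0..\<tau>}. \<forall>x. norm (L (f t x)) \<le> C * (1 / (1 + x\<^sup>2))" by blast
qed

lemma regular_bounded_linear:
 assumes L: "bounded_linear L"
 shows "regular T n f ==> regular T n (%t x. L (f t x))"
proof (induction n arbitrary: f)
 case 0 then show ?case by (simp add: decaying_bounded_linear[OF L])
next
 case (Suc n)
 then obtain f' where f': "\<forall>t\<in>{0..<T}. \<forall>x. (f t has_vector_derivative f' t x) (at x)" "regular T n f'" "decaying T f" by auto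
 show ?case by (rule regular_SucI[where f'="%t x. L (f' t x)"])
   (use f' Suc.IH bounded_linear.has_vector_derivative[OF L] decaying_bounded_linear[OF L] in auto)
qed

lemma regular_add: "regular T n f ==> regular T n g ==> regular T n (%t x. f t x + g t x)"
proof (induction n arbitrary: f g)
 case 0 then show ?case by (simp add: decaying_add)
next
 case (Suc n)
 then obtain f' g' where f': "\<forall>t\<in>{0..<T}. \<forall>x. (f t has_vector_derivative f' t x) (at x)" "regular T n f'" "decaying T f"
  and g': "\<forall>t\<in>{0..<T}. \<forall>x. (g t has_vector_derivative g' t x) (at x)" "regular T n g'" "decaying T g" by auto
 show ?case by (rule regular_SucI[where f'="%t x. f' t x + g' t x"])
   (use f' g' Suc.IH in \<open>auto intro: decaying_add has_vector_derivative_add\<close>)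
qed

lemma regular_mult:
 fixes f g :: "real => real => complex"
 shows "regular T n f ==> regular T n g ==> regular T n (%t x. f t x * g t x)"
proof (induction n arbitrary: f g)
 case 0 then show ?case by (simp add: decaying_mult)
next
 case (Suc n)
 obtain f' g' where f': "\<forall>t\<in>{0..<T}. \<forall>x. (f t has_vector_derivative f' t x) (at x)" "regular T n f'" "decaying T f"
  and g': "\<forall>t\<in>{0..<T}. \<forall>x. (g t has_vector_derivative g' t x) (at x)" "regular T n g'" "decaying T g" using Suc.prems by auto
 show ?case
 proof (rule regular_SucI[where f'="%t x. f t x * g' t x + f' t x * g t x"])
  show "regular T n (%t x. f t x * g' t x + f' t x * g t x)"
   by (intro regular_add Suc.IH f' g' regular_Suc_imp[OF Suc.prems(1)] regular_Suc_imp[OF Suc.prems(2)])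
 qed (use f' g' in \<open>auto intro: decaying_mult has_vector_derivative_mult\<close>)
qed

definition away_from_zero :: "real => (real => real => complex) => bool" where
 "away_from_zero T w \<longleftrightarrow> (\<forall>\<tau><T. \<exists>c>0. \<forall>t\<in>{0..\<tau>}. \<forall>x. c \<le> norm (w t x))"

lemma away_from_zero_nonzero: "away_from_zero T w ==> t \<in> {0..<T} ==> w t x \<noteq> 0"
 unfolding away_from_zero_def by (metis atLeastAtMost_iff atLeastLessThan_iff norm_zero not_le order_refl)

lemma decaying_divide:
 assumes f: "decaying T f" and g: "decaying T g" and a: "away_from_zero T (%t x. 1 + g t x)"
 shows "decaying T (%t x. f t x / (1 + g t x))" unfolding divide_inverse
proof (rule decaying_bounded_mult[OF f])
 show "continuous_on ({0..<T} \<times> UNIV) (%z. inverse (1 + g (fst z) (snd z)))"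
  by (intro continuous_intros decaying_continuous g) (use away_from_zero_nonzero[OF a] in auto)
 fix \<tau> assume "\<tau> < T"
 then obtain c where c: "c > 0" "\<forall>t\<in>{0..\<tau>}. \<forall>x. c \<le> norm (1 + g t x)" using a unfolding away_from_zero_def by blast
 then have "\<forall>t\<in>{0..\<tau>}. \<forall>x. norm (inverse (1 + g t x)) \<le> inverse c"
  by (auto simp: norm_inverse intro!: le_imp_inverse_le)
 then show "\<exists>C. \<forall>t\<in>{0..\<tau>}. \<forall>x. norm (inverse (1 + g t x)) \<le> C" by blast
qed

lemma regular_divide:
 assumes a: "away_from_zero T (%t x. 1 + g t x)"
 shows "regular T n f ==> regular T n g ==> regular T n (%t x. f t x / (1 + g t x))"
proof (induction n arbitrary: f)
 case 0 then show ?case by (simp add: decaying_divide[OF _ _ a])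
next
 case (Suc n)
 obtain f' g' where f': "\<forall>t\<in>{0..<T}. \<forall>x. (f t has_vector_derivative f' t x) (at x)" "regular T n f'" "decaying T f"
  and g': "\<forall>t\<in>{0..<T}. \<forall>x. (g t has_vector_derivative g' t x) (at x)" "regular T n g'" "decaying T g" using Suc.prems by auto
 note gn = regular_Suc_imp[OF Suc.prems(2)] and fn = regular_Suc_imp[OF Suc.prems(1)]
 \<comment> \<open>The quotient rule is arranged so that every factor is again a quotient with
   denominator 1 + g, to which the induction hypothesis applies; no squared denominator
   arises.\<close>
 show ?case
 proof (rule regular_SucI[where f'="%t x. f' t x / (1 + g t x) + (- (f t x / (1 + g t x))) * (g' t x / (1 + g t x))"])
  show "regular T n (%t x. f' t x / (1 + g t x) + (- (f t x / (1 + g t x))) * (g' t x / (1 + g t x)))"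
   by (intro regular_add regular_mult regular_bounded_linear[OF bounded_linear_minus[OF bounded_linear_ident]] Suc.IH f' g' gn fn)
  show "decaying T (%t x. f t x / (1 + g t x))" by (rule decaying_divide[OF f'(3) g'(3) a])
  fix t x assume t: "t \<in> {0..<T}"
  have nz: "1 + g t x \<noteq> 0" by (rule away_from_zero_nonzero[OF a t])
  have "((%x. 1 + g t x) has_vector_derivative 0 + g' t x) (at x)"
   using g' t by (intro has_vector_derivative_add has_vector_derivative_const) auto
  from field_vector_diff_chain_at[OF this DERIV_inverse[OF nz]]
  have "((%x. inverse (1 + g t x)) has_vector_derivative g' t x * - (inverse (1 + g t x) ^ Suc (Suc 0))) (at x)"
   by (simp add: o_def numeral_2_eq_2)
  note d = has_vector_derivative_mult[OF f'(1)[rule_format, OF t] this]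
  have "f t x * (g' t x * - (inverse (1 + g t x) ^ Suc (Suc 0))) + f' t x * inverse (1 + g t x) =
   f' t x / (1 + g t x) + (- (f t x / (1 + g t x))) * (g' t x / (1 + g t x))" by (simp add: divide_inverse algebra_simps)
  with d show "((%x. f t x / (1 + g t x)) has_vector_derivative f' t x / (1 + g t x) + (- (f t x / (1 + g t x))) * (g' t x / (1 + g t x))) (at x)"
   by (simp only: divide_inverse)
 qed
qed

text \<open>Mean value estimate on the disc of radius \<rho>, where the derivative 1 / (1 + w) is at
  most 1 / (1 - \<rho>). It transfers the decay of z to the logarithm.\<close>

lemma norm_Ln_one_plus_le:
 assumes "norm z \<le> \<rho>" "\<rho> < 1"
 shows "norm (Ln (1 + z)) \<le> (1 / (1 - \<rho>)) * norm z"
proof -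
 have \<rho>: "0 \<le> \<rho>" using assms norm_ge_zero order_trans by blast
 have "norm (Ln (1 + z) - Ln (1 + 0)) \<le> (1 / (1 - \<rho>)) * norm (z - 0)"
 proof (rule field_differentiable_bound[where S="cball 0 \<rho>" and f="%z. Ln (1 + z)" and f'="%z. inverse (1 + z)"])
  fix w :: complex assume w: "w \<in> cball 0 \<rho>"
  then have wn: "norm w \<le> \<rho>" by simp
  have "Re (1 + w) > 0" using abs_Re_le_cmod[of w] wn assms(2) by simp
  then have "1 + w \<notin> \<real>\<^sub>\<le>\<^sub>0" using complex_nonpos_Reals_iff by auto
  then show "((%z. Ln (1 + z)) has_field_derivative inverse (1 + w)) (at w within cball 0 \<rho>)"
   by (auto intro!: derivative_eq_intros)
  have "1 - \<rho> \<le> norm (1 + w)" using norm_triangle_ineq4[of "1 + w" w] wn by simp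
  then show "norm (inverse (1 + w)) \<le> 1 / (1 - \<rho>)" using assms(2) by (simp add: norm_inverse divide_inverse le_imp_inverse_le)
 qed (use assms \<rho> in auto)
 then show ?thesis by simp
qed

text \<open>Keeps 1 + g in a disc around 1 that avoids the cut of the principal logarithm, uniformly
  in x on each closed time interval before T.\<close>

definition contracted :: "real => (real => real => complex) => bool" where
 "contracted T g \<longleftrightarrow> (\<forall>\<tau><T. \<exists>\<rho><1. \<forall>t\<in>{0..\<tau>}. \<forall>x. norm (g t x) \<le> \<rho>)"

lemma contracted_away_from_zero: "contracted T g ==> away_from_zero T (%t x. 1 + g t x)" unfolding away_from_zero_def
proof (intro allI impI)
 fix \<tau> assume "contracted T g" "\<tau> < T"
 then obtain \<rho> where \<rho>: "\<rho> < 1" "\<forall>t\<in>{0..\<tau>}. \<forall>x. norm (g t x) \<le> \<rho>" unfolding contracted_def by blast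
 have "1 - \<rho> \<le> norm (1 + g t x)" if "t \<in> {0..\<tau>}" for t x
 proof -
  have "norm (g t x) \<le> \<rho>" using \<rho> that by blast
  then show ?thesis using norm_triangle_ineq4[of "1 + g t x" "g t x"] by simp
 qed
 then show "\<exists>c>0. \<forall>t\<in>{0..\<tau>}. \<forall>x. c \<le> norm (1 + g t x)" using \<rho>(1) by (intro exI[of _ "1 - \<rho>"]) auto
qed

lemma contracted_less_1: "contracted T g ==> t \<in> {0..<T} ==> norm (g t x) < 1"
 unfolding contracted_def by (metis atLeastAtMost_iff atLeastLessThan_iff le_less_trans order_refl)

lemma one_plus_notin_nonpos: "norm (z::complex) < 1 ==> 1 + z \<notin> \<real>\<^sub>\<le>\<^sub>0"
 using abs_Re_le_cmod[of z] by (auto simp: complex_nonpos_Reals_iff)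

text \<open>Only the function itself needs a logarithm estimate. Its derivative g' / (1 + g) is a
  quotient already known to be regular, so no induction is required.\<close>

lemma regular_Ln:
 assumes c: "contracted T g" and g: "regular T n g"
 shows "regular T n (%t x. Ln (1 + g t x))"
proof -
 have d: "decaying T (%t x. Ln (1 + g t x))"
 proof (rule decayingI)
  note dg = regular_decaying[OF g]
  show "continuous_on ({0..<T} \<times> UNIV) (%z. Ln (1 + g (fst z) (snd z)))"
   by (intro continuous_on_Ln continuous_intros decaying_continuous[OF dg])
    (use one_plus_notin_nonpos[OF contracted_less_1[OF c]] in auto)
  fix \<tau> assume \<tau>: "\<tau> < T"
  obtain C where C: "C \<ge> 0" "!!t x. t \<in> {0..\<tau>} ==> norm (g t x) \<le> C * (1 / (1 + x\<^sup>2))" using decayingD[OF dg \<tau>] by metis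
  obtain \<rho> where \<rho>: "\<rho> < 1" "\<forall>t\<in>{0..\<tau>}. \<forall>x. norm (g t x) \<le> \<rho>" using c \<tau> unfolding contracted_def by blast
  have "norm (Ln (1 + g t x)) \<le> ((1 / (1 - \<rho>)) * C) * (1 / (1 + x\<^sup>2))" if t: "t \<in> {0..\<tau>}" for t x
  proof -
   have "norm (Ln (1 + g t x)) \<le> (1 / (1 - \<rho>)) * norm (g t x)" using \<rho> t by (intro norm_Ln_one_plus_le) auto
   also have "... \<le> (1 / (1 - \<rho>)) * (C * (1 / (1 + x\<^sup>2)))" using \<rho>(1) by (intro mult_left_mono C(2)[OF t]) auto
   finally show ?thesis by (simp only: mult.assoc)
  qed
  then show "\<exists>C. \<forall>t\<in>{0..\<tau>}. \<forall>x. norm (Ln (1 + g t x)) \<le> C * (1 / (1 + x\<^sup>2))" by blast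
 qed
 show ?thesis
 proof (cases n)
  case (Suc k)
  then obtain g' where g': "\<forall>t\<in>{0..<T}. \<forall>x. (g t has_vector_derivative g' t x) (at x)" "regular T k g'" using g by auto
  have gk: "regular T k g" using g Suc regular_Suc_imp by blast
  show ?thesis unfolding Suc
  proof (rule regular_SucI[OF d])
   show "regular T k (%t x. g' t x / (1 + g t x))" by (rule regular_divide[OF contracted_away_from_zero[OF c] g'(2) gk])
   fix t x assume t: "t \<in> {0..<T}"
   have "((%x. 1 + g t x) has_vector_derivative 0 + g' t x) (at x)"
    using g' t by (intro has_vector_derivative_add has_vector_derivative_const) auto
   from field_vector_diff_chain_at[OF this has_field_derivative_Ln[OF one_plus_notin_nonpos[OF contracted_less_1[OF c t]]]]
   show "((%x. Ln (1 + g t x)) has_vector_derivative g' t x / (1 + g t x)) (at x)" by (simp add: o_def divide_inverse)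
  qed
 qed (use d in simp)
qed

lemma regular_chain:
 "regular T n f ==> \<exists>D. D 0 = f \<and> (\<forall>k<n. \<forall>t\<in>{0..<T}. \<forall>x. (D k t has_vector_derivative D (Suc k) t x) (at x)) \<and> (\<forall>k\<le>n. decaying T (D k))"
proof (induction n arbitrary: f)
 case 0
 then show ?case by (intro exI[of _ "%_. f"]) simp
next
 case (Suc n)
 then obtain f' where f': "\<forall>t\<in>{0..<T}. \<forall>x. (f t has_vector_derivative f' t x) (at x)" "regular T n f'" "decaying T f" by auto
 obtain D where D: "D 0 = f'" "\<forall>k<n. \<forall>t\<in>{0..<T}. \<forall>x. (D k t has_vector_derivative D (Suc k) t x) (at x)" "\<forall>k\<le>n. decaying T (D k)"
  using Suc.IH[OF f'(2)] by blast
 define E where "E k = (case k of 0 => f | Suc j => D j)" for k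
 have "\<forall>t\<in>{0..<T}. \<forall>x. (E k t has_vector_derivative E (Suc k) t x) (at x)" if "k < Suc n" for k
  using that f' D by (cases k) (auto simp: E_def)
 moreover have "decaying T (E k)" if "k \<le> Suc n" for k using that f' D by (cases k) (auto simp: E_def)
 ultimately show ?case by (intro exI[of _ E]) (auto simp: E_def)
qed

section \<open>From decaying families to Sobolev paths\<close>

lemma L2_weight: "square_integrable (%x::real. 1 / (1 + x\<^sup>2))" unfolding square_integrable_def
proof
 have nz: "1 + x\<^sup>2 \<noteq> 0" for x :: real using zero_le_power2[of x] by linarith
 show m: "(%x::real. 1 / (1 + x\<^sup>2)) \<in> borel_measurable lborel" by measurable
 have "set_integrable lborel (einterval (-\<infinity>) \<infinity>) (%x::real. inverse (1 + x\<^sup>2))"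
 proof (rule interval_integral_FTC_nonneg(1)[where F=arctan and A="-(pi/2)" and B="pi/2"])
  show "((arctan \<circ> real_of_ereal) \<longlongrightarrow> -(pi/2)) (at_right (-\<infinity>))"
   by (simp add: ereal_tendsto_simps tendsto_arctan_at_bot)
  show "((arctan \<circ> real_of_ereal) \<longlongrightarrow> pi/2) (at_left \<infinity>)"
   by (simp add: ereal_tendsto_simps tendsto_arctan_at_top)
  show "isCont (%x::real. inverse (1 + x\<^sup>2)) x" for x by (intro continuous_intros nz)
 qed (auto intro!: DERIV_arctan add_nonneg_nonneg)
 then have "integrable lborel (%x::real. inverse (1 + x\<^sup>2))" by (simp add: set_integrable_def einterval_def)
 then show "integrable lborel (%x::real. (norm (1 / (1 + x\<^sup>2)))\<^sup>2)"
 proof (rule Bochner_Integration.integrable_bound)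
  have "norm ((norm (1 / (1 + x\<^sup>2)))\<^sup>2) \<le> norm (inverse (1 + x\<^sup>2))" for x :: real
  proof -
   have y: "0 \<le> 1 / (1 + x\<^sup>2)" "1 / (1 + x\<^sup>2) \<le> 1" by (auto simp: add_nonneg_nonneg divide_le_eq add_pos_nonneg)
   then have "(1 / (1 + x\<^sup>2)) * (1 / (1 + x\<^sup>2)) \<le> 1 * (1 / (1 + x\<^sup>2))" by (intro mult_right_mono)
   then show ?thesis using y by (simp add: power2_eq_square inverse_eq_divide)
  qed
  then show "AE x in lborel. norm ((norm (1 / (1 + x\<^sup>2)))\<^sup>2) \<le> norm (inverse (1 + x\<^sup>2 :: real))" by simp
 qed (use m in measurable)
qed

lemma decaying_square_integrable:
 assumes f: "decaying T f" and t: "t \<in> {0..<T}"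
 shows "square_integrable (f t)"
proof -
 obtain C where C: "C \<ge> 0" "!!s x. s \<in> {0..t} ==> norm (f s x) \<le> C * (1 / (1 + x\<^sup>2))"
  using decayingD[OF f, of t] t by (metis atLeastLessThan_iff)
 show ?thesis
  by (rule L2_dominated[OF continuous_on_UNIV_measurable[OF decaying_continuous_x[OF f t]] L2_weight, of C])
   (use C(2)[of t] t in auto)
qed

text \<open>Dominated convergence along sequences of times, with the decay bound on an interval that
  ends halfway between t and T as majorant.\<close>

lemma decaying_L2_continuous:
 assumes f: "decaying T f" and t: "t \<in> {0..<T}"
 shows "((%r. L2_norm (%x. f r x - f t x)) \<longlongrightarrow> 0) (at t within {0..<T})"
proof -
 define \<tau> where "\<tau> = (t + T) / 2"
 have \<tau>: "t < \<tau>" "\<tau> < T" using t by (auto simp: \<tau>_def)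
 obtain C where C: "C \<ge> 0" "!!s x. s \<in> {0..\<tau>} ==> norm (f s x) \<le> C * (1 / (1 + x\<^sup>2))"
  using decayingD[OF f \<tau>(2)] by metis
 have at: "at t within {0..<T} = at t within {0..\<tau>}" by (rule at_within_nhd[of _ "{..<\<tau>}"]) (use \<tau> in auto)
 show ?thesis unfolding at tendsto_at_iff_sequentially
 proof (intro allI impI)
  fix X :: "nat => real" assume X: "\<forall>i. X i \<in> {0..\<tau>} - {t}" "X \<longlonglongrightarrow> t"
  have XT: "X i \<in> {0..<T}" for i using X(1)[rule_format, of i] \<tau> by auto
  have "(%n. L2_norm (%x. f (X n) x - f t x)) \<longlonglongrightarrow> 0"
  proof (rule L2_dominated_convergence[where w="%x. (2 * C) * (1 / (1 + x\<^sup>2))"])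
   show "square_integrable (%x. (2 * C) * (1 / (1 + x\<^sup>2)))"
    by (rule L2_bounded_linear[OF bounded_linear_mult_right L2_weight])
   show "(%x. f (X n) x - f t x) \<in> borel_measurable lborel" for n
    by (intro borel_measurable_diff continuous_on_UNIV_measurable decaying_continuous_x[OF f] XT t)
   have "norm (f (X n) x - f t x) \<le> (2 * C) * (1 / (1 + x\<^sup>2))" for n x
   proof -
    have "norm (f (X n) x - f t x) \<le> norm (f (X n) x) + norm (f t x)" by (rule norm_triangle_ineq4)
    also have "... \<le> C * (1 / (1 + x\<^sup>2)) + C * (1 / (1 + x\<^sup>2))" using X(1) t \<tau> by (intro add_mono C(2)) auto
    finally show ?thesis by simp
   qed
   then show "AE x in lborel. norm (f (X n) x - f t x) \<le> (2 * C) * (1 / (1 + x\<^sup>2))" for n by simp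
   show "AE x in lborel. (%n. f (X n) x - f t x) \<longlonglongrightarrow> 0"
   proof (rule AE_I2)
    fix x
    have c: "continuous_on {0..<T} (%s. f s x)" using continuous_on_slices(2)[OF decaying_continuous[OF f], of x] by simp
    have "(%n. f (X n) x) \<longlonglongrightarrow> f t x" by (rule continuous_on_tendsto_compose[OF c X(2) t]) (use XT in auto)
    then show "(%n. f (X n) x - f t x) \<longlonglongrightarrow> 0" by (rule LIM_zero)
   qed
  qed
  then show "((%r. L2_norm (%x. f r x - f t x)) \<circ> X) \<longlonglongrightarrow> 0" by (simp add: o_def)
 qed
qed

lemma regular_weak_derivs:
 assumes f: "!!n. regular T n f"
 shows "\<exists>g. decaying T g \<and> (\<forall>t\<in>{0..<T}. has_weak_deriv k (f t) (g t))"
proof -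
 obtain D where D: "D 0 = f" "\<forall>j<k. \<forall>t\<in>{0..<T}. \<forall>x. (D j t has_vector_derivative D (Suc j) t x) (at x)"
  "\<forall>j\<le>k. decaying T (D j)" using regular_chain[OF f[of k]] by blast
 have "has_weak_deriv j (f t) (D j t)" if "j \<le> k" "t \<in> {0..<T}" for j t using that(1)
 proof (induction j)
  case 0
  have "continuous_on UNIV (f t)" by (rule decaying_continuous_x[OF regular_decaying[OF f] that(2)])
  then show ?case unfolding D(1) by (intro has_weak_deriv_0 continuous_imp_locally_integrable)
 next
  case (Suc j)
  show ?case
  proof (rule has_weak_deriv_Suc[OF Suc.IH])
   show "(D j t has_vector_derivative D (Suc j) t x) (at x)" for x using D(2) Suc.prems that(2) by auto
   show "continuous_on UNIV (D (Suc j) t)" using D(3) Suc.prems that(2) decaying_continuous_x by blast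
  qed (use Suc.prems in simp)
 qed
 then show ?thesis using D(3) by blast
qed

text \<open>Regularity of all orders serves every \<open>s\<close> simultaneously. Each of the
  finitely many derivatives in the norm is continuous in L^2, and the chosen weak derivatives agree
  with the classical ones almost everywhere.\<close>

lemma regular_continuous_into_sobolev:
 assumes f: "!!n. regular T n f"
 shows "continuous_into_sobolev s T f" unfolding continuous_into_sobolev_def
proof (intro ballI conjI)
 fix t assume t: "t \<in> {0..<T}"
 have "\<exists>g. decaying T g \<and> (\<forall>t\<in>{0..<T}. has_weak_deriv k (f t) (g t))" for k by (rule regular_weak_derivs[OF f])
 then obtain g where g: "!!k. decaying T (g k)" "!!k t. t \<in> {0..<T} ==> has_weak_deriv k (f t) (g k t)" by metis
 show "f t \<in> sobolev_space s" unfolding sobolev_space_def using g t decaying_square_integrable by blast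
 show "((%r. sobolev_norm s (%x. f r x - f t x)) \<longlongrightarrow> 0) (at t within {0..<T})"
 proof (rule tendsto_dominated_within)
  have "((%r. \<Sum>k | real k \<le> s. L2_norm (%x. g k r x - g k t x)) \<longlongrightarrow> (\<Sum>k | real k \<le> s. 0)) (at t within {0..<T})"
   by (intro tendsto_sum decaying_L2_continuous[OF g(1) t])
  then show "((%r. \<Sum>k | real k \<le> s. L2_norm (%x. g k r x - g k t x)) \<longlongrightarrow> 0) (at t within {0..<T})" by simp
  fix r assume r: "r \<in> {0..<T}"
  have "L2_norm (weak_deriv k (%x. f r x - f t x)) = L2_norm (%x. g k r x - g k t x)" for k
  proof (rule L2_norm_cong_AE)
   note h = has_weak_deriv_diff[OF g(2)[OF r] g(2)[OF t], of k]
   show "AE x in lborel. norm (weak_deriv k (%x. f r x - f t x) x) = norm (g k r x - g k t x)"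
    using weak_deriv_AE(2)[OF h] by eventually_elim simp
   show "weak_deriv k (%x. f r x - f t x) \<in> borel_measurable lborel"
    by (rule locally_integrable_measurable[OF has_weak_derivD(2)[OF weak_deriv_AE(1)[OF h]]])
   show "(%x. g k r x - g k t x) \<in> borel_measurable lborel"
    by (rule locally_integrable_measurable[OF has_weak_derivD(2)[OF h]])
  qed
  then have "sobolev_norm s (%x. f r x - f t x) = (\<Sum>k | real k \<le> s. L2_norm (%x. g k r x - g k t x))"
   by (simp add: sobolev_norm_def)
  moreover have "0 \<le> sobolev_norm s (%x. f r x - f t x)" by (simp add: sobolev_norm_def sum_nonneg)
  ultimately show "norm (sobolev_norm s (%x. f r x - f t x) - 0) \<le> (\<Sum>k | real k \<le> s. L2_norm (%x. g k r x - g k t x))"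
   by simp
 qed
qed

text \<open>Multiples of isometries commute with weak differentiation and scale each term by c.
  Applied to the embedding of a scaled profile into a coordinate axis, this makes the Sobolev norm
  of the datum exactly computable.\<close>

lemma sobolev_norm_isometry:
 fixes f :: "real => 'a::euclidean_space" and L :: "'a => 'b::euclidean_space"
 assumes L: "bounded_linear L" "!!y. norm (L y) = c * norm y" and f: "f \<in> sobolev_space s"
 shows "sobolev_norm s (%x. L (f x)) = c * sobolev_norm s f" "(%x. L (f x)) \<in> sobolev_space s"
proof -
 have c: "c \<ge> 0"
 proof -
  obtain b :: 'a where "b \<in> Basis" using nonempty_Basis by blast
  then have "norm (L b) = c" using L(2)[of b] by simp
  then show ?thesis by (metis norm_ge_zero)
 qed
 have "L2_norm (weak_deriv k (%x. L (f x))) = c * L2_norm (weak_deriv k f)" if k: "real k \<le> s" for k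
 proof -
  note w = sobolev_space_weak_deriv[OF f k]
  note h = has_weak_deriv_bounded_linear[OF L(1) w(1)]
  have "L2_norm (weak_deriv k (%x. L (f x))) = L2_norm (%x. L (weak_deriv k f x))"
  proof (rule L2_norm_cong_AE)
   show "AE x in lborel. norm (weak_deriv k (%x. L (f x)) x) = norm (L (weak_deriv k f x))"
    using weak_deriv_AE(2)[OF h] by eventually_elim simp
   show "weak_deriv k (%x. L (f x)) \<in> borel_measurable lborel"
    by (rule locally_integrable_measurable[OF has_weak_derivD(2)[OF weak_deriv_AE(1)[OF h]]])
   show "(%x. L (weak_deriv k f x)) \<in> borel_measurable lborel"
    by (rule locally_integrable_measurable[OF has_weak_derivD(2)[OF h]])
  qed
  also have "... = c * L2_norm (weak_deriv k f)" by (rule L2_norm_scale[OF L(2) c])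
  finally show ?thesis .
 qed
 then show "sobolev_norm s (%x. L (f x)) = c * sobolev_norm s f" by (simp add: sobolev_norm_def sum_distrib_left)
 show "(%x. L (f x)) \<in> sobolev_space s" unfolding sobolev_space_def
  using has_weak_deriv_bounded_linear[OF L(1) sobolev_space_weak_deriv(1)[OF f]]
   L2_bounded_linear[OF L(1) sobolev_space_weak_deriv(2)[OF f]] by blast
qed

text \<open>Makes pointwise blow-up visible in the norm. The factor 2 counts the function and its
  first derivative, each bounded by the full norm.\<close>

lemma sobolev_norm_sup:
 fixes f :: "real => complex ^ 'n"
 assumes f: "f \<in> sobolev_space s" "1 \<le> s" and c: "continuous_on UNIV (%x. f x $ j)"
 shows "norm (f x $ j) \<le> 2 * sobolev_norm s f"
proof -
 have k0: "real 0 \<le> s" and k1: "real 1 \<le> s" using f by auto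
 note w0 = sobolev_space_weak_deriv[OF f(1) k0] and w1 = sobolev_space_weak_deriv[OF f(1) k1]
 have cs: "(%x. f x $ j) \<in> sobolev_space s" unfolding sobolev_space_def
  using has_weak_deriv_bounded_linear[OF bounded_linear_vec_nth sobolev_space_weak_deriv(1)[OF f(1)]]
   L2_bounded_linear[OF bounded_linear_vec_nth sobolev_space_weak_deriv(2)[OF f(1)]] by blast
 obtain g where g: "H1 g (weak_deriv 1 (%x. f x $ j))" "AE x in lborel. f x $ j = g x" using H1_of_sobolev[OF cs f(2)] by blast
 have "f x $ j = g x" by (rule continuous_AE_eq[OF c H1D(4)[OF g(1)] g(2)])
 then have "norm (f x $ j) \<le> L2_norm g + L2_norm (weak_deriv 1 (%x. f x $ j))" using H1_sup[OF g(1)] by simp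
 also have "L2_norm g \<le> sobolev_norm s f"
 proof -
  have "L2_norm g = L2_norm (%x. weak_deriv 0 f x $ j)"
  proof (rule L2_norm_cong_AE[OF _ H1D(5)[OF g(1)]])
   show "AE x in lborel. norm (g x) = norm (weak_deriv 0 f x $ j)"
    using g(2) weak_deriv_0_AE[OF has_weak_derivD(1)[OF w0(1)]] by eventually_elim simp
  qed (rule L2D(1)[OF L2_bounded_linear[OF bounded_linear_vec_nth w0(2)]])
  also have "... \<le> L2_norm (weak_deriv 0 f)" by (rule L2_norm_component_le[OF w0(2)])
  also have "... \<le> sobolev_norm s f" by (rule L2_norm_weak_deriv_le[OF k0])
  finally show ?thesis .
 qed
 also have "L2_norm (weak_deriv 1 (%x. f x $ j)) \<le> sobolev_norm s f"
 proof -
  have "L2_norm (weak_deriv 1 (%x. f x $ j)) = L2_norm (%x. weak_deriv 1 f x $ j)"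
  proof (rule L2_norm_cong_AE[OF _ H1D(6)[OF g(1)]])
   show "AE x in lborel. norm (weak_deriv 1 (%x. f x $ j) x) = norm (weak_deriv 1 f x $ j)"
    using weak_deriv_AE(2)[OF has_weak_deriv_bounded_linear[OF bounded_linear_vec_nth[of j] w1(1)]] by eventually_elim simp
  qed (rule L2D(1)[OF L2_bounded_linear[OF bounded_linear_vec_nth w1(2)]])
  also have "... \<le> L2_norm (weak_deriv 1 f)" by (rule L2_norm_component_le[OF w1(2)])
  also have "... \<le> sobolev_norm s f" by (rule L2_norm_weak_deriv_le[OF k1])
  finally show ?thesis .
 qed
 finally show ?thesis by simp
qed

section \<open>Classical solutions are distributional solutions\<close>

lemma continuous_on_UNIV_by_support:
 fixes f :: "real => 'a::real_normed_vector"
 assumes "continuous_on {0<..<T} f" "!!t. t \<notin> {\<alpha>..\<beta>} ==> f t = 0" "0 < \<alpha>" "\<beta> < T"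
 shows "continuous_on UNIV f"
proof -
 have "continuous_on (- {\<alpha>..\<beta>}) f" by (rule continuous_on_eq[OF continuous_on_const[of _ 0]]) (use assms in auto)
 then have "continuous_on ({0<..<T} \<union> - {\<alpha>..\<beta>}) f" by (intro continuous_on_open_Un assms(1)) auto
 moreover have "{0<..<T} \<union> - {\<alpha>..\<beta>} = UNIV" using assms by auto
 ultimately show ?thesis by simp
qed

lemma compact_support_box:
 fixes C :: "(real \<times> real) set"
 assumes "compact C" "C \<subseteq> {0<..<T} \<times> UNIV" "C \<noteq> {}"
 obtains \<alpha> \<beta> R where "0 < \<alpha>" "\<beta> < T" "\<alpha> \<le> \<beta>" "R > 0" "C \<subseteq> {\<alpha>..\<beta>} \<times> {-R..R}"
proof -
 have cf: "compact (fst ` C)" by (intro compact_continuous_image continuous_intros assms)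
 have ne: "fst ` C \<noteq> {}" using assms by simp
 obtain \<alpha> where \<alpha>: "\<alpha> \<in> fst ` C" "\<forall>t\<in>fst ` C. \<alpha> \<le> t" using compact_attains_inf[OF cf ne] by blast
 obtain \<beta> where \<beta>: "\<beta> \<in> fst ` C" "\<forall>t\<in>fst ` C. t \<le> \<beta>" using compact_attains_sup[OF cf ne] by blast
 have "bounded (snd ` C)" by (intro compact_imp_bounded compact_continuous_image continuous_intros assms)
 then obtain R where R: "R > 0" "\<forall>x\<in>snd ` C. norm x \<le> R" using bounded_pos[of "snd ` C"] by blast
 have "C \<subseteq> {\<alpha>..\<beta>} \<times> {-R..R}"
 proof
  fix c assume c: "c \<in> C"
  then have "\<alpha> \<le> fst c" "fst c \<le> \<beta>" "norm (snd c) \<le> R" using \<alpha> \<beta> R by auto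
  then show "c \<in> {\<alpha>..\<beta>} \<times> {-R..R}" by (cases c) (auto simp: abs_le_iff)
 qed
 moreover have "0 < \<alpha>" "\<beta> < T" "\<alpha> \<le> \<beta>" using \<alpha> \<beta> assms(2) by auto
 ultimately show ?thesis using that R by blast
qed

text \<open>Both integrations by parts respect the order of the iterated integrals. In time, the
  spatial integral of v \<psi> has compact support, so its derivative integrates to zero; in space,
  v \<psi>_x - v_x \<psi> plays the same role. \<open>F\<close> is fixed only almost everywhere in
  x, since it may contain a chosen weak derivative.\<close>

lemma classical_imp_distributional:
 fixes v vt vx vxx F :: "real => real => complex"
 assumes D: "!!t x. t \<in> {0<..<T} ==> ((%r. v r x) has_vector_derivative vt t x) (at t)"
  "!!t x. t \<in> {0<..<T} ==> (v t has_vector_derivative vx t x) (at x)"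
  "!!t x. t \<in> {0<..<T} ==> (vx t has_vector_derivative vxx t x) (at x)"
  and C: "continuous_on ({0<..<T} \<times> UNIV) (%z. v (fst z) (snd z))"
  "continuous_on ({0<..<T} \<times> UNIV) (%z. vt (fst z) (snd z))"
  "continuous_on ({0<..<T} \<times> UNIV) (%z. vxx (fst z) (snd z))"
  and F: "!!t. t \<in> {0<..<T} ==> AE x in lborel. F t x = \<i> * vt t x + of_real (1 / (2 * m)) * vxx t x"
  "!!t. t \<in> {0<..<T} ==> F t \<in> borel_measurable lborel"
 shows "schrodinger_distributional m T v F" unfolding schrodinger_distributional_def
proof (intro allI impI)
 fix \<psi> :: "real \<times> real => real" assume tf: "test_function ({0<..<T} \<times> UNIV) \<psi>"
 obtain \<psi>t \<psi>x where p1: "!!t x. ((%r. \<psi> (r, x)) has_real_derivative \<psi>t (t, x)) (at t)"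
  "!!t x. ((%y. \<psi> (t, y)) has_real_derivative \<psi>x (t, x)) (at x)"
  "higher_differentiable 1 \<psi>t" "higher_differentiable 1 \<psi>x"
  using hd_partials[of 1 \<psi>] tf unfolding test_function_def by auto
 obtain \<psi>y \<psi>xx where p2: "!!t x. ((%r. \<psi>x (r, x)) has_real_derivative \<psi>y (t, x)) (at t)"
  "!!t x. ((%y. \<psi>x (t, y)) has_real_derivative \<psi>xx (t, x)) (at x)"
  "higher_differentiable 0 \<psi>y" "higher_differentiable 0 \<psi>xx" using hd_partials[of 0 \<psi>x] p1(4) by (auto simp: One_nat_def)
 have cpsi: "continuous_on UNIV \<psi>" "continuous_on UNIV \<psi>t" "continuous_on UNIV \<psi>x" "continuous_on UNIV \<psi>xx"
  using tf hd_continuous p1(3,4) p2(4) unfolding test_function_def by blast+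
 have dt: "deriv (%r. \<psi> (r, x)) t = \<psi>t (t, x)" for t x by (rule DERIV_imp_deriv[OF p1(1)])
 have dxx: "(deriv ^^ 2) (%y. \<psi> (t, y)) x = \<psi>xx (t, x)" for t x
 proof -
  have "deriv (%y. \<psi> (t, y)) = (%y. \<psi>x (t, y))" by (intro ext DERIV_imp_deriv p1(2))
  then show ?thesis by (simp add: numeral_2_eq_2 DERIV_imp_deriv[OF p2(2)])
 qed
 obtain S where S: "compact S" "S \<subseteq> {0<..<T} \<times> UNIV" "!!z. z \<notin> S ==> \<psi> z = 0"
  using tf unfolding test_function_def by blast
 show "(LINT t|lborel. (LINT x|lborel. v t x * (- \<i> * of_real (deriv (%r. \<psi> (r, x)) t)
       + of_real (1 / (2 * m) * (deriv ^^ 2) (%y. \<psi> (t, y)) x))))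
    = (LINT t|lborel. (LINT x|lborel. F t x * of_real (\<psi> (t, x))))"
 proof (cases "S = {}")
  case True
  then have "\<psi> z = 0" for z using S by blast
  then have "\<psi> = (%z. 0)" by auto
  then show ?thesis by (simp add: numeral_2_eq_2)
 next
  case False
  obtain \<alpha> \<beta> R where box: "0 < \<alpha>" "\<beta> < T" "\<alpha> \<le> \<beta>" "R > 0" "S \<subseteq> {\<alpha>..\<beta>} \<times> {-R..R}"
   by (rule compact_support_box[OF S(1,2) False])
  have z0: "\<psi> (t, x) = 0" if "t \<notin> {\<alpha>..\<beta>} \<or> x \<notin> {-R..R}" for t x
   by (rule S(3)) (use box(5) that in auto)
  have zt: "\<psi>t (t, x) = 0" if "t \<notin> {\<alpha>..\<beta>} \<or> x \<notin> {-R..R}" for t x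
  proof (cases "x \<in> {-R..R}")
   case True
   then show ?thesis using zero_outside_Icc_imp_deriv_zero[of \<alpha> \<beta> "%r. \<psi> (r, x)" t] z0 that p1(1)
    by (auto simp: has_real_derivative_iff_has_vector_derivative)
  next
   case False
   then have "(%r. \<psi> (r, x)) = (%r. 0)" using z0 by auto
   then show ?thesis using p1(1)[of x t] DERIV_unique DERIV_const by metis
  qed
  have zx: "\<psi>x (t, x) = 0" if "t \<notin> {\<alpha>..\<beta>} \<or> x \<notin> {-R..R}" for t x
  proof (cases "t \<in> {\<alpha>..\<beta>}")
   case True
   then show ?thesis using zero_outside_Icc_imp_deriv_zero[of "-R" R "%y. \<psi> (t, y)" x] z0 that p1(2)
    by (auto simp: has_real_derivative_iff_has_vector_derivative)
  next
   case False
   then have "(%y. \<psi> (t, y)) = (%y. 0)" using z0 by auto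
   then show ?thesis using p1(2)[of t x] DERIV_unique DERIV_const by metis
  qed
  have zxx: "\<psi>xx (t, x) = 0" if "t \<notin> {\<alpha>..\<beta>} \<or> x \<notin> {-R..R}" for t x
  proof (cases "t \<in> {\<alpha>..\<beta>}")
   case True
   then show ?thesis using zero_outside_Icc_imp_deriv_zero[of "-R" R "%y. \<psi>x (t, y)" x] zx that p2(2)
    by (auto simp: has_real_derivative_iff_has_vector_derivative)
  next
   case False
   then have "(%y. \<psi>x (t, y)) = (%y. 0)" using zx by auto
   then show ?thesis using p2(2)[of t x] DERIV_unique DERIV_const by metis
  qed
  have inT: "t \<in> {0<..<T}" if "t \<in> {\<alpha>..\<beta>}" for t using that box by auto
  have cx: "continuous_on UNIV (%x. f (t, x))" if "continuous_on UNIV f" for f :: "real \<times> real => real" and t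
   using continuous_on_slices(1)[of UNIV UNIV f t] that by simp
  have cvx: "continuous_on UNIV (w t)" if "continuous_on ({0<..<T} \<times> UNIV) (%z. w (fst z) (snd z))" "t \<in> {0<..<T}" for w :: "real => real => complex" and t
   using continuous_on_slices(1)[OF that] by simp
  define A where "A t x = \<i> * vt t x + of_real (1 / (2 * m)) * vxx t x" for t x
  \<comment> \<open>\<open>k\<close> is the time derivative of \<open>h\<close> by the Leibniz rule,
    and \<open>r\<close> is the tested right-hand side; the left-hand side turns out to be r - \<i>
    k.\<close>
  define h where "h t = integral {-R..R} (%x. v t x * of_real (\<psi> (t, x)))" for t
  define k where "k t = integral {-R..R} (%x. vt t x * of_real (\<psi> (t, x)) + v t x * of_real (\<psi>t (t, x)))" for t
  define r where "r t = integral {-R..R} (%x. A t x * of_real (\<psi> (t, x)))" for t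
  have cU: "continuous_on ({0<..<T} \<times> cbox (-R) R) (%z. w (fst z) (snd z) * of_real (f z))"
   if "continuous_on ({0<..<T} \<times> UNIV) (%z. w (fst z) (snd z))" "continuous_on UNIV f" for w :: "real => real => complex" and f :: "real \<times> real => real"
   by (intro continuous_intros continuous_on_subset[OF that(1)] continuous_on_subset[OF that(2)]) auto
  have cA: "continuous_on ({0<..<T} \<times> UNIV) (%z. A (fst z) (snd z))" unfolding A_def by (intro continuous_intros C)
  have ck: "continuous_on {0<..<T} k"
  proof -
   have "continuous_on {0<..<T} (%t. integral (cbox (-R) R) (%x. vt t x * of_real (\<psi> (t, x)) + v t x * of_real (\<psi>t (t, x))))"
    using continuous_on_add[OF cU[OF C(2) cpsi(1)] cU[OF C(1) cpsi(2)]]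
    by (intro integral_continuous_on_param) (simp add: case_prod_beta)
   then show ?thesis by (simp add: k_def[abs_def])
  qed
  have cr: "continuous_on {0<..<T} r"
  proof -
   have "continuous_on {0<..<T} (%t. integral (cbox (-R) R) (%x. A t x * of_real (\<psi> (t, x))))"
    using cU[OF cA cpsi(1)] by (intro integral_continuous_on_param) (simp add: case_prod_beta)
   then show ?thesis by (simp add: r_def[abs_def])
  qed
  have hz: "h t = 0" "k t = 0" "r t = 0" if "t \<notin> {\<alpha>..\<beta>}" for t using that z0 zt by (simp_all add: h_def k_def r_def)
  have hk: "(h has_vector_derivative k t) (at t)" for t
  proof (cases "t \<in> {\<alpha>..\<beta>}")
   case True
   then have t: "t \<in> {0<..<T}" by (rule inT)
   have "((%t. integral (cbox (-R) R) (%x. v t x * of_real (\<psi> (t, x)))) has_vector_derivative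
     integral (cbox (-R) R) (%x. vt t x * of_real (\<psi> (t, x)) + v t x * of_real (\<psi>t (t, x)))) (at t within {0<..<T})"
   proof (rule leibniz_rule_vector_derivative)
    fix s x assume s: "s \<in> {0<..<T}"
    have "((%r. complex_of_real (\<psi> (r, x))) has_vector_derivative of_real (\<psi>t (s, x))) (at s)"
     using p1(1) by (intro has_vector_derivative_of_real) (simp add: has_real_derivative_iff_has_vector_derivative)
    from has_vector_derivative_at_within[OF has_vector_derivative_mult[OF D(1)[OF s, of x] this], of "{0<..<T}"]
    show "((%t. v t x * of_real (\<psi> (t, x))) has_vector_derivative vt s x * of_real (\<psi> (s, x)) + v s x * of_real (\<psi>t (s, x))) (at s within {0<..<T})"
     by (simp add: add.commute)
   next
    fix s assume s: "s \<in> {0<..<T}"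
    show "(%x. v s x * of_real (\<psi> (s, x))) integrable_on cbox (-R) R"
     by (intro integrable_continuous continuous_intros continuous_on_subset[OF cvx[OF C(1) s]] continuous_on_subset[OF cx[OF cpsi(1)]]) auto
   next
    show "continuous_on ({0<..<T} \<times> cbox (-R) R) (%(t, x). vt t x * of_real (\<psi> (t, x)) + v t x * of_real (\<psi>t (t, x)))"
     using continuous_on_add[OF cU[OF C(2) cpsi(1)] cU[OF C(1) cpsi(2)]] by (simp add: case_prod_beta)
   qed (use t in auto)
   then show ?thesis using t by (simp add: h_def[abs_def] k_def at_within_open[of t "{0<..<T}"])
  next
   case False
   have "((%t. 0) has_vector_derivative k t) (at t)" using hz(2)[OF False] by simp
   then show ?thesis by (rule has_vector_derivative_transform_within_open[of _ _ _ "- {\<alpha>..\<beta>}"]) (use False hz in auto)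
  qed
  have ckU: "continuous_on UNIV k" and crU: "continuous_on UNIV r"
   by (rule continuous_on_UNIV_by_support[OF ck hz(2) box(1,2)], assumption)
    (rule continuous_on_UNIV_by_support[OF cr hz(3) box(1,2)], assumption)
  have k0: "(LINT t|lborel. k t) = 0" by (rule integral_deriv_support[OF hk ckU hz(1)])
  have ik: "integrable lborel k" by (rule continuous_support_integral(1)[OF ckU hz(2)])
  have ir: "integrable lborel r" by (rule continuous_support_integral(1)[OF crU hz(3)])
  have rhs: "(LINT x|lborel. F t x * of_real (\<psi> (t, x))) = r t" for t
  proof (cases "t \<in> {\<alpha>..\<beta>}")
   case True
   then have t: "t \<in> {0<..<T}" by (rule inT)
   have cAp: "continuous_on UNIV (%x. A t x * of_real (\<psi> (t, x)))" by (intro continuous_intros cvx[OF cA t] cx[OF cpsi(1)])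
   have "(LINT x|lborel. F t x * of_real (\<psi> (t, x))) = (LINT x|lborel. A t x * of_real (\<psi> (t, x)))"
   proof (rule integral_cong_AE)
    have mp: "(%x. complex_of_real (\<psi> (t, x))) \<in> borel_measurable lborel"
     by (intro continuous_on_UNIV_measurable continuous_intros cx[OF cpsi(1)])
    show "(%x. F t x * of_real (\<psi> (t, x))) \<in> borel_measurable lborel"
     by (rule borel_measurable_times[OF F(2)[OF t] mp])
    show "(%x. A t x * of_real (\<psi> (t, x))) \<in> borel_measurable lborel" by (rule continuous_on_UNIV_measurable[OF cAp])
    show "AE x in lborel. F t x * of_real (\<psi> (t, x)) = A t x * of_real (\<psi> (t, x))"
     using F(1)[OF t] by eventually_elim (simp add: A_def)
   qed
   also have "... = r t" unfolding r_def by (rule continuous_support_integral(2)[OF cAp]) (use z0 in auto)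
   finally show ?thesis .
  qed (use z0 hz in simp)
  have lhs: "(LINT x|lborel. v t x * (- \<i> * of_real (\<psi>t (t, x)) + of_real (1 / (2 * m) * \<psi>xx (t, x)))) = r t - \<i> * k t" for t
  proof (cases "t \<in> {\<alpha>..\<beta>}")
   case True
   then have t: "t \<in> {0<..<T}" by (rule inT)
   have cv: "continuous_on UNIV (v t)" "continuous_on UNIV (vt t)" "continuous_on UNIV (vxx t)" by (rule cvx[OF _ t], fact C)+
   have cp: "continuous_on UNIV (%x. complex_of_real (\<psi> (t, x)))" "continuous_on UNIV (%x. complex_of_real (\<psi>t (t, x)))"
    "continuous_on UNIV (%x. complex_of_real (\<psi>xx (t, x)))" by (intro continuous_intros cx cpsi)+
   have i1: "integrable lborel (%x. v t x * of_real (\<psi>t (t, x)))"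
    by (rule continuous_support_integral(1)[of _ "-R" R]) (intro continuous_intros cv cp, use zt in auto)
   have i2: "integrable lborel (%x. v t x * of_real (\<psi>xx (t, x)))"
    by (rule continuous_support_integral(1)[of _ "-R" R]) (intro continuous_intros cv cp, use zxx in auto)
   have i3: "integrable lborel (%x. vxx t x * of_real (\<psi> (t, x)))"
    by (rule continuous_support_integral(1)[of _ "-R" R]) (intro continuous_intros cv cp, use z0 in auto)
   have i4: "integrable lborel (%x. vt t x * of_real (\<psi> (t, x)))"
    by (rule continuous_support_integral(1)[of _ "-R" R]) (intro continuous_intros cv cp, use z0 in auto)
   have "(LINT x|lborel. v t x * of_real (\<psi>xx (t, x)) - vxx t x * of_real (\<psi> (t, x))) = 0"
   proof (rule integral_deriv_support[where h="%x. v t x * of_real (\<psi>x (t, x)) - vx t x * of_real (\<psi> (t, x))" and a="-R" and b=R])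
    fix x
    have d1: "((%y. complex_of_real (\<psi> (t, y))) has_vector_derivative of_real (\<psi>x (t, x))) (at x)"
     using p1(2) by (intro has_vector_derivative_of_real) (simp add: has_real_derivative_iff_has_vector_derivative)
    have d2: "((%y. complex_of_real (\<psi>x (t, y))) has_vector_derivative of_real (\<psi>xx (t, x))) (at x)"
     using p2(2) by (intro has_vector_derivative_of_real) (simp add: has_real_derivative_iff_has_vector_derivative)
    from has_vector_derivative_diff[OF has_vector_derivative_mult[OF D(2)[OF t, of x] d2] has_vector_derivative_mult[OF D(3)[OF t, of x] d1]]
    show "((%x. v t x * of_real (\<psi>x (t, x)) - vx t x * of_real (\<psi> (t, x))) has_vector_derivative
      v t x * of_real (\<psi>xx (t, x)) - vxx t x * of_real (\<psi> (t, x))) (at x)" by (simp add: algebra_simps)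
   next
    show "continuous_on UNIV (%x. v t x * of_real (\<psi>xx (t, x)) - vxx t x * of_real (\<psi> (t, x)))"
     by (intro continuous_intros cv cp)
   qed (use z0 zx in simp)
   then have parts: "(LINT x|lborel. v t x * of_real (\<psi>xx (t, x))) = (LINT x|lborel. vxx t x * of_real (\<psi> (t, x)))"
    using i2 i3 by simp
   have kt: "k t = (LINT x|lborel. vt t x * of_real (\<psi> (t, x))) + (LINT x|lborel. v t x * of_real (\<psi>t (t, x)))"
   proof -
    have "k t = (LINT x|lborel. vt t x * of_real (\<psi> (t, x)) + v t x * of_real (\<psi>t (t, x)))"
     unfolding k_def by (rule continuous_support_integral(2)[symmetric]) (intro continuous_intros cv cp, use z0 zt in auto)
    then show ?thesis using i1 i4 by simp
   qed
   have rt: "r t = \<i> * (LINT x|lborel. vt t x * of_real (\<psi> (t, x))) + of_real (1 / (2 * m)) * (LINT x|lborel. vxx t x * of_real (\<psi> (t, x)))"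
   proof -
    have "r t = (LINT x|lborel. A t x * of_real (\<psi> (t, x)))"
     unfolding r_def by (rule continuous_support_integral(2)[symmetric]) (intro continuous_intros cvx[OF cA t] cp, use z0 in auto)
    also have "(%x. A t x * of_real (\<psi> (t, x))) = (%x. \<i> * (vt t x * of_real (\<psi> (t, x))) + of_real (1 / (2 * m)) * (vxx t x * of_real (\<psi> (t, x))))"
     by (auto simp: A_def algebra_simps)
    finally show ?thesis using i3 i4 by simp
   qed
   have "(%x. v t x * (- \<i> * of_real (\<psi>t (t, x)) + of_real (1 / (2 * m) * \<psi>xx (t, x)))) =
     (%x. - \<i> * (v t x * of_real (\<psi>t (t, x))) + of_real (1 / (2 * m)) * (v t x * of_real (\<psi>xx (t, x))))"
    by (auto simp: algebra_simps)
   then have "(LINT x|lborel. v t x * (- \<i> * of_real (\<psi>t (t, x)) + of_real (1 / (2 * m) * \<psi>xx (t, x)))) =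
     - \<i> * (LINT x|lborel. v t x * of_real (\<psi>t (t, x))) + of_real (1 / (2 * m)) * (LINT x|lborel. v t x * of_real (\<psi>xx (t, x)))"
    using i1 i2 by simp
   then show ?thesis unfolding parts kt rt by (simp add: algebra_simps)
  qed (use zt zxx hz in simp)
  have "(LINT t|lborel. r t - \<i> * k t) = (LINT t|lborel. r t)" using ik ir k0 by simp
  then show ?thesis unfolding dt dxx lhs rhs .
 qed
qed

section \<open>Superpositions of Gaussians\<close>

text \<open>The power of x makes the family closed under spatial differentiation. The parameter runs
  over the fixed interval [0, 1], so that a Duhamel integral over [0, t] becomes an instance with t
  only in the coefficients.\<close>

definition gauss_int :: "(real => real => complex) => (real => real => complex) => nat => real => real => complex" where
 "gauss_int \<beta> \<omega> j t x = integral {0..1} (%\<theta>. \<beta> t \<theta> * of_real (x ^ j) * exp (- (\<omega> t \<theta> * of_real (x\<^sup>2))))"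

definition continuous2 :: "(real => real => complex) => bool" where
 "continuous2 f \<longleftrightarrow> continuous_on UNIV (%z. f (fst z) (snd z))"

lemma continuous2_compose:
 assumes "continuous2 f" "continuous_on A g" "continuous_on A h"
 shows "continuous_on A (%w. f (g w) (h w))"
 using continuous_on_compose2[OF assms(1)[unfolded continuous2_def] continuous_on_Pair[OF assms(2,3)]] by simp

lemma gauss_int_continuous:
 assumes "continuous2 \<beta>" "continuous2 \<omega>"
 shows "continuous_on A (%z. gauss_int \<beta> \<omega> j (fst z) (snd z))"
proof -
 have "continuous_on (A \<times> cbox 0 1) (%(z, \<theta>). \<beta> (fst z) \<theta> * of_real (snd z ^ j) * exp (- (\<omega> (fst z) \<theta> * of_real ((snd z)\<^sup>2))))"
  unfolding case_prod_beta by (intro continuous_intros continuous2_compose[OF assms(1)] continuous2_compose[OF assms(2)])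
 from integral_continuous_on_param[OF this] show ?thesis by (simp add: gauss_int_def)
qed

lemma gauss_int_integrable:
 assumes "continuous2 \<beta>" "continuous2 \<omega>"
 shows "(%\<theta>. \<beta> t \<theta> * of_real (x ^ j) * exp (- (\<omega> t \<theta> * of_real (x\<^sup>2)))) integrable_on {0..1}"
 by (intro integrable_continuous_interval continuous_intros continuous2_compose[OF assms(1)] continuous2_compose[OF assms(2)])

text \<open>Differentiation under the integral. For j = 0 the truncated exponent j - 1 is harmless,
  as its coefficient is zero.\<close>

lemma gauss_int_deriv:
 assumes c: "continuous2 \<beta>" "continuous2 \<omega>"
 shows "(gauss_int \<beta> \<omega> j t has_vector_derivative
  gauss_int (%t \<theta>. of_nat j * \<beta> t \<theta>) \<omega> (j - 1) t x + gauss_int (%t \<theta>. - 2 * \<omega> t \<theta> * \<beta> t \<theta>) \<omega> (Suc j) t x) (at x)"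
proof -
 let ?f = "%x \<theta>. \<beta> t \<theta> * of_real (x ^ j) * exp (- (\<omega> t \<theta> * of_real (x\<^sup>2)))"
 let ?f' = "%x \<theta>. of_nat j * \<beta> t \<theta> * of_real (x ^ (j - 1)) * exp (- (\<omega> t \<theta> * of_real (x\<^sup>2))) +
   - 2 * \<omega> t \<theta> * \<beta> t \<theta> * of_real (x ^ Suc j) * exp (- (\<omega> t \<theta> * of_real (x\<^sup>2)))"
 have "((%x. integral (cbox 0 1) (?f x)) has_vector_derivative integral (cbox 0 1) (?f' x)) (at x within UNIV)"
 proof (rule leibniz_rule_vector_derivative)
  fix y \<theta> :: real
  have "((%z. \<beta> t \<theta> * z ^ j * exp (- (\<omega> t \<theta> * z\<^sup>2))) has_field_derivative
    of_nat j * \<beta> t \<theta> * of_real y ^ (j - 1) * exp (- (\<omega> t \<theta> * (of_real y)\<^sup>2)) +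
    - 2 * \<omega> t \<theta> * \<beta> t \<theta> * of_real y ^ Suc j * exp (- (\<omega> t \<theta> * (of_real y)\<^sup>2))) (at (of_real y))"
   by (auto intro!: derivative_eq_intros simp: algebra_simps)
  from has_vector_derivative_real_field[OF this]
  show "((%x. ?f x \<theta>) has_vector_derivative ?f' y \<theta>) (at y within UNIV)" by simp
 next
  show "?f y integrable_on cbox 0 1" for y using gauss_int_integrable[OF c] by simp
 next
  show "continuous_on (UNIV \<times> cbox 0 1) (%(y, \<theta>). ?f' y \<theta>)"
   unfolding case_prod_beta by (intro continuous_intros continuous2_compose[OF c(1)] continuous2_compose[OF c(2)])
 qed auto
 moreover have "integral (cbox 0 1) (?f' x) =
   gauss_int (%t \<theta>. of_nat j * \<beta> t \<theta>) \<omega> (j - 1) t x + gauss_int (%t \<theta>. - 2 * \<omega> t \<theta> * \<beta> t \<theta>) \<omega> (Suc j) t x"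
  unfolding gauss_int_def cbox_interval
  by (intro Henstock_Kurzweil_Integration.integral_add integrable_continuous_interval continuous_intros
    continuous2_compose[OF c(1)] continuous2_compose[OF c(2)])
 ultimately show ?thesis by (simp add: gauss_int_def[abs_def])
qed

text \<open>With m = j + 1, the left side times 1 + x^2 is at most (1 + x^2)^m exp (- c x^2), and (1
  + y / m)^m is at most exp y for y = c x^2.\<close>

lemma power_times_gauss_bound:
 assumes "c > 0"
 shows "\<exists>K\<ge>0. \<forall>x::real. \<bar>x\<bar> ^ j * exp (- (c * x\<^sup>2)) \<le> K * (1 / (1 + x\<^sup>2))"
proof -
 define m where "m = Suc j"
 \<comment> \<open>Chosen such that a (1 + x^2) is at most 1 + c x^2 / m.\<close>
 define a where "a = min 1 (c / real m)"
 have a: "a > 0" "a \<le> 1" "a \<le> c / real m" using assms by (auto simp: a_def m_def)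
 have "\<bar>x\<bar> ^ j * exp (- (c * x\<^sup>2)) \<le> (1 / a ^ m) * (1 / (1 + x\<^sup>2))" for x
 proof -
  have y: "1 + x\<^sup>2 > 0" by (simp add: add_pos_nonneg)
  have "\<bar>x\<bar> \<le> 1 + x\<^sup>2"
  proof -
   have "2 * \<bar>x\<bar> \<le> \<bar>x\<bar>\<^sup>2 + 1" using sum_squares_bound[of "\<bar>x\<bar>" 1] by simp
   then have "2 * \<bar>x\<bar> \<le> x\<^sup>2 + 1" by simp
   then show ?thesis using abs_ge_zero[of x] by linarith
  qed
  then have 1: "\<bar>x\<bar> ^ j * (1 + x\<^sup>2) \<le> (1 + x\<^sup>2) ^ m"
   unfolding m_def power_Suc2 using y by (intro mult_right_mono power_mono) auto
  have "a * (1 + x\<^sup>2) \<le> 1 + c * x\<^sup>2 / real m"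
  proof -
   have "a * x\<^sup>2 \<le> (c / real m) * x\<^sup>2" by (rule mult_right_mono[OF a(3)]) simp
   then show ?thesis using a(2) by (simp add: distrib_left)
  qed
  then have "(a * (1 + x\<^sup>2)) ^ m \<le> (1 + c * x\<^sup>2 / real m) ^ m" using a y by (intro power_mono) auto
  also have "... \<le> exp (c * x\<^sup>2)"
  proof (rule exp_ge_one_plus_x_over_n_power_n)
   have "0 \<le> c * x\<^sup>2" using assms by simp
   then show "- real m \<le> c * x\<^sup>2" by linarith
  qed (simp add: m_def)
  finally have "a ^ m * (1 + x\<^sup>2) ^ m \<le> exp (c * x\<^sup>2)" by (simp add: power_mult_distrib)
  then have "a ^ m * (\<bar>x\<bar> ^ j * (1 + x\<^sup>2)) \<le> exp (c * x\<^sup>2)"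
   using mult_left_mono[OF 1, of "a ^ m"] zero_le_power[of a m] a(1) by linarith
  then have "\<bar>x\<bar> ^ j * (a ^ m * (1 + x\<^sup>2)) \<le> exp (c * x\<^sup>2)" by (simp only: mult_ac)
  then have "\<bar>x\<bar> ^ j \<le> exp (c * x\<^sup>2) / (a ^ m * (1 + x\<^sup>2))" using a y by (subst pos_le_divide_eq) auto
  then have "\<bar>x\<bar> ^ j * exp (- (c * x\<^sup>2)) \<le> exp (c * x\<^sup>2) / (a ^ m * (1 + x\<^sup>2)) * exp (- (c * x\<^sup>2))"
   by (rule mult_right_mono) simp
  then show ?thesis by (simp add: exp_minus)
 qed
 then show ?thesis using a by (intro exI[of _ "1 / a ^ m"]) auto
qed

text \<open>On the compact set of times and parameters the coefficient is bounded and the real part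
  of the rate has a positive minimum, so all Gaussians are dominated by a single one.\<close>

lemma gauss_int_decaying:
 assumes c: "continuous2 \<beta>" "continuous2 \<omega>" and pos: "!!t \<theta>. Re (\<omega> t \<theta>) > 0"
 shows "decaying T (gauss_int \<beta> \<omega> j)"
proof (rule decayingI)
 show "continuous_on ({0..<T} \<times> UNIV) (%z. gauss_int \<beta> \<omega> j (fst z) (snd z))" by (rule gauss_int_continuous[OF c])
 fix \<tau> assume "\<tau> < T"
 let ?S = "{0..\<tau>} \<times> {0..1::real}"
 have S: "compact ?S" by (intro compact_Times compact_Icc)
 show "\<exists>C. \<forall>t\<in>{0..\<tau>}. \<forall>x. norm (gauss_int \<beta> \<omega> j t x) \<le> C * (1 / (1 + x\<^sup>2))"
 proof (cases "0 \<le> \<tau>")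
  case True
  then have ne: "?S \<noteq> {}" by auto
  have "bounded ((%z. \<beta> (fst z) (snd z)) ` ?S)"
   by (intro compact_imp_bounded compact_continuous_image S continuous2_compose[OF c(1)] continuous_intros)
  then obtain M where M: "\<forall>z\<in>?S. norm (\<beta> (fst z) (snd z)) \<le> M" by (auto simp: bounded_iff)
  have "continuous_on ?S (%z. Re (\<omega> (fst z) (snd z)))" by (intro continuous_intros continuous2_compose[OF c(2)])
  from continuous_attains_inf[OF S ne this] obtain z0 where "\<forall>z\<in>?S. Re (\<omega> (fst z0) (snd z0)) \<le> Re (\<omega> (fst z) (snd z))" by blast
  define k where "k = Re (\<omega> (fst z0) (snd z0))"
  have k: "k > 0" "!!t \<theta>. t \<in> {0..\<tau>} ==> \<theta> \<in> {0..1} ==> k \<le> Re (\<omega> t \<theta>)"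
   using pos \<open>\<forall>z\<in>?S. Re (\<omega> (fst z0) (snd z0)) \<le> Re (\<omega> (fst z) (snd z))\<close> by (auto simp: k_def)
  obtain K where K: "K \<ge> 0" "\<forall>x. \<bar>x\<bar> ^ j * exp (- (k * x\<^sup>2)) \<le> K * (1 / (1 + x\<^sup>2))"
   using power_times_gauss_bound[OF k(1), of j] by blast
  have M0: "0 \<le> M" using M True by (metis SigmaI atLeastAtMost_iff norm_ge_zero order_refl order_trans zero_le_one)
  have "norm (gauss_int \<beta> \<omega> j t x) \<le> (M * K) * (1 / (1 + x\<^sup>2))" if t: "t \<in> {0..\<tau>}" for t x
  proof -
   have "norm (integral {0..1} (%\<theta>. \<beta> t \<theta> * of_real (x ^ j) * exp (- (\<omega> t \<theta> * of_real (x\<^sup>2))))) \<le> ((M * K) * (1 / (1 + x\<^sup>2))) * (1 - 0)"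
   proof (rule integral_bound)
    show "continuous_on {0..1} (%\<theta>. \<beta> t \<theta> * of_real (x ^ j) * exp (- (\<omega> t \<theta> * of_real (x\<^sup>2))))"
     by (intro continuous_intros continuous2_compose[OF c(1)] continuous2_compose[OF c(2)])
    fix \<theta> :: real assume th: "\<theta> \<in> {0..1}"
    have "norm (\<beta> t \<theta> * of_real (x ^ j) * exp (- (\<omega> t \<theta> * of_real (x\<^sup>2)))) = norm (\<beta> t \<theta>) * (\<bar>x\<bar> ^ j * exp (- (Re (\<omega> t \<theta>) * x\<^sup>2)))"
     by (simp add: norm_mult norm_power power_abs mult.assoc)
    also have "... \<le> M * (\<bar>x\<bar> ^ j * exp (- (k * x\<^sup>2)))"
     using M t th k(2)[OF t th] M0 by (intro mult_mono mult_left_mono) (auto intro: mult_right_mono)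
    also have "... \<le> M * (K * (1 / (1 + x\<^sup>2)))" using K M0 by (intro mult_left_mono) auto
    finally show "norm (\<beta> t \<theta> * of_real (x ^ j) * exp (- (\<omega> t \<theta> * of_real (x\<^sup>2)))) \<le> (M * K) * (1 / (1 + x\<^sup>2))" by (simp only: mult.assoc)
   qed simp
   then show ?thesis by (simp add: gauss_int_def)
  qed
  then show ?thesis by blast
 qed auto
qed

lemma gauss_int_regular:
 assumes w: "continuous2 \<omega>" "!!t \<theta>. Re (\<omega> t \<theta>) > 0"
 shows "continuous2 \<beta> ==> regular T n (gauss_int \<beta> \<omega> j)"
proof (induction n arbitrary: \<beta> j)
 case 0 then show ?case by (simp add: gauss_int_decaying[OF _ w])
next
 case (Suc n)
 have c1: "continuous2 (%t \<theta>. of_nat k * \<beta> t \<theta>)" "continuous2 (%t \<theta>. - 2 * \<omega> t \<theta> * \<beta> t \<theta>)" for k :: nat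
  unfolding continuous2_def by (intro continuous_intros continuous2_compose[OF Suc.prems] continuous2_compose[OF w(1)])+
 show ?case by (rule regular_SucI[OF gauss_int_decaying[OF Suc.prems w] gauss_int_deriv[OF Suc.prems w(1)]])
   (intro regular_add Suc.IH c1)
qed

definition gauss :: "(real => complex) => (real => complex) => real => real => complex" where
 "gauss \<beta> \<omega> t x = \<beta> t * exp (- (\<omega> t * of_real (x\<^sup>2)))"

lemma gauss_eq_gauss_int: "gauss \<beta> \<omega> = gauss_int (%t \<theta>. \<beta> t) (%t \<theta>. \<omega> t) 0"
 by (auto simp: gauss_def gauss_int_def fun_eq_iff)

lemma continuous2_fst: "continuous_on UNIV \<beta> ==> continuous2 (%t \<theta>. \<beta> t)"
 unfolding continuous2_def by (rule continuous_on_compose2[of UNIV \<beta>]) (auto intro: continuous_intros)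

lemma gauss_regular:
 assumes "continuous_on UNIV \<beta>" "continuous_on UNIV \<omega>" "!!t. Re (\<omega> t) > 0"
 shows "regular T n (gauss \<beta> \<omega>)" unfolding gauss_eq_gauss_int by (rule gauss_int_regular) (use assms continuous2_fst in auto)

text \<open>The operator maps a Gaussian with moving amplitude and rate to a quadratic polynomial in
  x times the same Gaussian. The condition on \<open>F\<close> records this polynomial, so that
  applications reduce to field identities.\<close>

lemma gauss_distributional:
 assumes b: "!!t. (\<beta> has_vector_derivative \<beta>' t) (at t)" "continuous_on UNIV \<beta>'"
  and w: "!!t. (\<omega> has_vector_derivative \<omega>' t) (at t)" "continuous_on UNIV \<omega>'"
  and F: "!!t x. F t x = (\<i> * (\<beta>' t - \<omega>' t * of_real (x\<^sup>2) * \<beta> t) +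
   of_real (1 / (2 * m)) * ((4 * (\<omega> t)\<^sup>2 * of_real (x\<^sup>2) - 2 * \<omega> t) * \<beta> t)) * exp (- (\<omega> t * of_real (x\<^sup>2)))"
 shows "schrodinger_distributional m T (gauss \<beta> \<omega>) F"
proof -
 have cb: "continuous_on UNIV \<beta>" "continuous_on UNIV \<omega>"
  by (intro continuous_at_imp_continuous_on ballI has_vector_derivative_continuous[OF b(1)] has_vector_derivative_continuous[OF w(1)])+
 have c: "continuous_on A (%z. f (fst z))" if "continuous_on UNIV f" for f :: "real => complex" and A :: "(real \<times> real) set"
  by (rule continuous_on_compose2[OF that]) (auto intro: continuous_intros)
 let ?E = "%t x. exp (- (\<omega> t * of_real (x\<^sup>2)))"
 let ?vt = "%t x. (\<beta>' t - \<omega>' t * of_real (x\<^sup>2) * \<beta> t) * ?E t x"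
 let ?vx = "%t x. - 2 * \<omega> t * of_real x * \<beta> t * ?E t x"
 let ?vxx = "%t x. (4 * (\<omega> t)\<^sup>2 * of_real (x\<^sup>2) - 2 * \<omega> t) * \<beta> t * ?E t x"
 show ?thesis
 proof (rule classical_imp_distributional[where vt="?vt" and vx="?vx" and vxx="?vxx"])
  fix t x
  have "((%t. - (\<omega> t * of_real (x\<^sup>2))) has_vector_derivative - (\<omega>' t * of_real (x\<^sup>2))) (at t)"
   by (intro has_vector_derivative_minus has_vector_derivative_mult_left w(1))
  from has_vector_derivative_mult[OF b(1)[of t] field_vector_diff_chain_at[OF this DERIV_exp]]
  show "((%t. gauss \<beta> \<omega> t x) has_vector_derivative ?vt t x) (at t)" by (simp add: gauss_def o_def algebra_simps)
  have "((%z. \<beta> t * exp (- (\<omega> t * z\<^sup>2))) has_field_derivative - 2 * \<omega> t * of_real x * \<beta> t * exp (- (\<omega> t * (of_real x)\<^sup>2))) (at (of_real x))"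
   by (auto intro!: derivative_eq_intros)
  from has_vector_derivative_real_field[OF this]
  show "(gauss \<beta> \<omega> t has_vector_derivative ?vx t x) (at x)" by (simp add: gauss_def[abs_def])
  have "((%z. - 2 * \<omega> t * z * \<beta> t * exp (- (\<omega> t * z\<^sup>2))) has_field_derivative
    (4 * (\<omega> t)\<^sup>2 * (of_real x)\<^sup>2 - 2 * \<omega> t) * \<beta> t * exp (- (\<omega> t * (of_real x)\<^sup>2))) (at (of_real x))"
   by (auto intro!: derivative_eq_intros simp: power2_eq_square algebra_simps)
  from has_vector_derivative_real_field[OF this]
  show "(?vx t has_vector_derivative ?vxx t x) (at x)" by simp
 next
  show "continuous_on ({0<..<T} \<times> UNIV) (%z. gauss \<beta> \<omega> (fst z) (snd z))"
   unfolding gauss_def by (intro continuous_intros c cb)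
  show "continuous_on ({0<..<T} \<times> UNIV) (%z. ?vt (fst z) (snd z))" by (intro continuous_intros c cb b(2) w(2))
  show "continuous_on ({0<..<T} \<times> UNIV) (%z. ?vxx (fst z) (snd z))" by (intro continuous_intros c cb)
 next
  fix t
  show "AE x in lborel. F t x = \<i> * ?vt t x + of_real (1 / (2 * m)) * ?vxx t x" unfolding F by (intro AE_I2) (simp only: algebra_simps)
  have "F t = (%x. (\<i> * (\<beta>' t - \<omega>' t * of_real (x\<^sup>2) * \<beta> t) +
   of_real (1 / (2 * m)) * ((4 * (\<omega> t)\<^sup>2 * of_real (x\<^sup>2) - 2 * \<omega> t) * \<beta> t)) * exp (- (\<omega> t * of_real (x\<^sup>2))))"
   using F by auto
  moreover have "continuous_on UNIV ..." by (intro continuous_intros)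
  ultimately show "F t \<in> borel_measurable lborel" using continuous_on_UNIV_measurable by metis
 qed
qed

section \<open>The Duhamel term\<close>

text \<open>The number (1 + \<tau>^2) / (p - \<i> \<tau>) in Cartesian form; it equals 1 + \<i>
  \<tau> for p = 1. The parameter p accommodates sources that contain a conjugate (p = 3) or a
  modulus (p = 2), whose rates are not multiples of 1 / (1 + \<i> \<tau>).\<close>

definition zeta :: "real => real => complex" where
 "zeta p \<tau> = of_real (p * (1 + \<tau>\<^sup>2) / (p\<^sup>2 + \<tau>\<^sup>2)) + \<i> * of_real (\<tau> * (1 + \<tau>\<^sup>2) / (p\<^sup>2 + \<tau>\<^sup>2))"

text \<open>The complex width at time t of a Gaussian released at time \<tau>: free evolution adds
  \<i> times the elapsed time.\<close>

definition width :: "real => real => real => complex" where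
 "width p t \<tau> = zeta p \<tau> + \<i> * of_real (t - \<tau>)"

context
 fixes p :: real
 assumes p: "p \<ge> 1"
begin

lemma denominator_pos: "p\<^sup>2 + \<tau>\<^sup>2 > 0" using p by (intro add_pos_nonneg) auto

lemma inverse_zeta: "1 / zeta p \<tau> = (of_real p - \<i> * of_real \<tau>) / of_real (1 + \<tau>\<^sup>2)"
proof -
 have "zeta p \<tau> = of_real (1 + \<tau>\<^sup>2) * (of_real p + \<i> * of_real \<tau>) / of_real (p\<^sup>2 + \<tau>\<^sup>2)"
  by (simp add: zeta_def algebra_simps add_divide_distrib)
 also have "complex_of_real (p\<^sup>2 + \<tau>\<^sup>2) = (of_real p + \<i> * of_real \<tau>) * (of_real p - \<i> * of_real \<tau>)"
  by (simp add: algebra_simps power2_eq_square)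
 also have "of_real (1 + \<tau>\<^sup>2) * (of_real p + \<i> * of_real \<tau>) / ((of_real p + \<i> * of_real \<tau>) * (of_real p - \<i> * of_real \<tau>)) = of_real (1 + \<tau>\<^sup>2) / (of_real p - \<i> * of_real \<tau>)"
 proof -
  have "of_real p + \<i> * of_real \<tau> \<noteq> 0" using p by (auto simp: complex_eq_iff)
  then show ?thesis by simp
 qed
 finally have "zeta p \<tau> = of_real (1 + \<tau>\<^sup>2) / (of_real p - \<i> * of_real \<tau>)" .
 then show ?thesis by (simp only: divide_divide_eq_right mult_1_left)
qed

lemma Re_zeta: "Re (zeta p \<tau>) = p * (1 + \<tau>\<^sup>2) / (p\<^sup>2 + \<tau>\<^sup>2)" and Im_zeta: "Im (zeta p \<tau>) = \<tau> * (1 + \<tau>\<^sup>2) / (p\<^sup>2 + \<tau>\<^sup>2)"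
 by (simp_all add: zeta_def)

lemma Re_width: "Re (width p t \<tau>) = Re (zeta p \<tau>)" by (simp add: width_def)

lemma Re_zeta_ge: "Re (zeta p \<tau>) \<ge> 1 / p"
proof -
 have "p\<^sup>2 + \<tau>\<^sup>2 \<le> p\<^sup>2 * (1 + \<tau>\<^sup>2)"
  using p mult_right_mono[of 1 "p\<^sup>2" "\<tau>\<^sup>2"] by (simp add: algebra_simps one_le_power)
 then show ?thesis using denominator_pos[of \<tau>] p unfolding Re_zeta
  by (simp add: divide_le_eq le_divide_eq field_simps power2_eq_square)
qed

lemma Re_width_pos: "Re (width p t \<tau>) > 0" using Re_zeta_ge[of \<tau>] p unfolding Re_width by (smt (verit) divide_pos_pos)

lemma Re_zeta_pos: "Re (zeta p \<tau>) > 0" using Re_width_pos[of 0 \<tau>] by (simp add: Re_width)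

lemma width_nonzero: "width p t \<tau> \<noteq> 0" "zeta p \<tau> \<noteq> 0" "width p t \<tau> \<notin> \<real>\<^sub>\<le>\<^sub>0" "zeta p \<tau> \<notin> \<real>\<^sub>\<le>\<^sub>0"
 using Re_width_pos[of t \<tau>] Re_zeta_pos[of \<tau>] by (auto simp: complex_nonpos_Reals_iff)

lemma norm_zeta_le:
 assumes "\<tau> \<ge> 0"
 shows "norm (zeta p \<tau>) \<le> 1 + \<tau>"
proof -
 have t: "1 + \<tau>\<^sup>2 > 0" by (simp add: add_pos_nonneg)
 have "\<tau>\<^sup>2 + 1 \<le> \<tau>\<^sup>2 + p\<^sup>2" using p by simp
 then have "sqrt (1 + \<tau>\<^sup>2) \<le> norm (of_real p - \<i> * complex_of_real \<tau>)" by (simp add: cmod_def add.commute)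
 then have "norm (1 / zeta p \<tau>) \<ge> sqrt (1 + \<tau>\<^sup>2) / (1 + \<tau>\<^sup>2)"
  unfolding inverse_zeta norm_divide norm_of_real using t by (simp add: divide_right_mono)
 moreover have "sqrt (1 + \<tau>\<^sup>2) / (1 + \<tau>\<^sup>2) = 1 / sqrt (1 + \<tau>\<^sup>2)"
  using t by (simp add: real_div_sqrt field_simps)
 ultimately have "1 / sqrt (1 + \<tau>\<^sup>2) \<le> 1 / norm (zeta p \<tau>)" by (simp add: norm_divide)
 then have "norm (zeta p \<tau>) \<le> sqrt (1 + \<tau>\<^sup>2)" using width_nonzero(2)[of \<tau>] t by (simp add: field_simps)
 also have "... \<le> 1 + \<tau>" by (rule real_le_lsqrt) (use assms in \<open>auto simp: power2_sum\<close>)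
 finally show ?thesis .
qed

text \<open>A bound linear in t and uniform in \<tau>. For t at least 2 p the imaginary part t -
  \<tau> (p^2 - 1) / (p^2 + \<tau>^2) is at least t - p, hence at least t / 2; for smaller t the
  real part is at least 1 / p.\<close>

lemma norm_width_ge:
 assumes "t \<ge> 0" "\<tau> \<ge> 0"
 shows "norm (width p t \<tau>) \<ge> (1 + t) / (4 * p * (1 + 2 * p))"
proof (cases "t \<ge> 2 * p")
 case True
 have "\<tau> * (p\<^sup>2 - 1) / (p\<^sup>2 + \<tau>\<^sup>2) \<le> p"
 proof -
  have "\<tau> * (p\<^sup>2 - 1) \<le> \<tau> * p\<^sup>2" using assms by (intro mult_left_mono) auto
  also have "\<tau> * p\<^sup>2 \<le> p * (p\<^sup>2 + \<tau>\<^sup>2)"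
  proof -
   have "p * (2 * p * \<tau>) \<le> p * (p\<^sup>2 + \<tau>\<^sup>2)" using sum_squares_bound[of p \<tau>] p by (intro mult_left_mono) auto
   moreover have "\<tau> * p\<^sup>2 \<le> p * (2 * p * \<tau>)" using assms p by (simp add: power2_eq_square)
   ultimately show ?thesis by linarith
  qed
  finally show ?thesis using denominator_pos[of \<tau>] by (simp add: divide_le_eq)
 qed
 moreover have "Im (width p t \<tau>) = t - \<tau> * (p\<^sup>2 - 1) / (p\<^sup>2 + \<tau>\<^sup>2)"
 proof -
  have "\<tau> * (p\<^sup>2 - 1) + \<tau> * (1 + \<tau>\<^sup>2) = \<tau> * (p\<^sup>2 + \<tau>\<^sup>2)" by algebra
  then have "\<tau> * (p\<^sup>2 - 1) / (p\<^sup>2 + \<tau>\<^sup>2) + \<tau> * (1 + \<tau>\<^sup>2) / (p\<^sup>2 + \<tau>\<^sup>2) = \<tau>"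
   using denominator_pos[of \<tau>] unfolding add_divide_distrib[symmetric] by simp
  then show ?thesis by (simp add: width_def Im_zeta)
 qed
 ultimately have "Im (width p t \<tau>) \<ge> t - p" by linarith
 then have "norm (width p t \<tau>) \<ge> t / 2" using True abs_Im_le_cmod[of "width p t \<tau>"] by linarith
 moreover have "(1 + t) / (4 * p * (1 + 2 * p)) \<le> (1 + t) / (4 * 1)"
 proof (rule divide_left_mono)
  have "1 * 1 \<le> p * (1 + 2 * p)" using p by (intro mult_mono) auto
  then show "4 * 1 \<le> 4 * p * (1 + 2 * p)" by simp
 qed (use assms p in auto)
 moreover have "(1 + t) / (4 * 1) \<le> t / 2" using True p by simp
 ultimately show ?thesis by linarith
next
 case False
 have "1 / p \<le> norm (width p t \<tau>)"
  using Re_zeta_ge[of \<tau>] abs_Re_le_cmod[of "width p t \<tau>"] unfolding Re_width by linarith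
 moreover have "(1 + t) / (4 * p * (1 + 2 * p)) \<le> 1 / p"
 proof -
  have "t < 2 * p" using False by simp
  then have "1 + t \<le> 4 * (1 + 2 * p)" using p unfolding distrib_left by linarith
  then have "(1 + t) / (4 * (1 + 2 * p)) \<le> 1" using p by (simp add: divide_le_eq)
  from divide_right_mono[OF this, of p] show ?thesis using p by (simp add: mult_ac)
 qed
 ultimately show ?thesis by linarith
qed

lemma continuous_zeta: "continuous_on A f ==> continuous_on A (%w. zeta p (f w))"
 unfolding zeta_def by (intro continuous_intros) (use denominator_pos in \<open>auto simp: less_imp_neq[symmetric]\<close>)

lemma continuous_width: "continuous_on A f ==> continuous_on A g ==> continuous_on A (%w. width p (f w) (g w))"
 unfolding width_def by (intro continuous_intros continuous_zeta)

lemma continuous_csqrt_compose: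
 assumes "continuous_on A f" "!!w. w \<in> A ==> f w \<notin> \<real>\<^sub>\<le>\<^sub>0"
 shows "continuous_on A (%w. csqrt (f w))" by (rule continuous_on_compose2[OF continuous_on_csqrt assms(1)]) (use assms(2) in auto)

end

lemma Re_of_real_divide_pos: "c > 0 ==> Re w > 0 ==> Re (of_real c / w) > 0"
 by (auto simp: Re_divide intro!: divide_pos_pos mult_pos_pos add_pos_nonneg)

section \<open>Differentiation of the Duhamel integral\<close>

lemma integral_rescale:
 fixes f :: "real => complex"
 assumes "continuous_on UNIV f" "t \<ge> 0"
 shows "integral {0..1} (%\<theta>. of_real t * f (t * \<theta>)) = integral {0..t} f"
proof -
 have "((%\<theta>. t *\<^sub>R f (t * \<theta>)) has_integral (integral {t * 0..t * 1} f)) {0..1}"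
 proof (rule has_integral_substitution[where c=0 and d=t])
  show "continuous_on {0..t} f" using assms(1) by (rule continuous_on_subset) simp
  show "((%\<theta>. t * \<theta>) has_field_derivative t) (at x within {0..1})" for x by (auto intro!: derivative_eq_intros)
 qed (use assms(2) in \<open>auto intro: mult_left_le\<close>)
 from integral_unique[OF this] show ?thesis by (simp only: scaleR_conv_of_real mult_zero_right mult_1_right)
qed

text \<open>The integral is treated as a function of two variables, the upper limit and the time in
  the integrand. It has partial derivatives and one of them is continuous; the total derivative is
  restricted to the diagonal.\<close>

lemma leibniz_diagonal:
 fixes f f' :: "real => real => complex"
 assumes f: "continuous2 f" and f': "continuous2 f'"
  and d: "!!t \<tau>. ((%t. f t \<tau>) has_vector_derivative f' t \<tau>) (at t)"
  and t: "t > 0"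
 shows "((%t. integral {0..t} (f t)) has_vector_derivative f t t + integral {0..t} (f' t)) (at t)"
proof -
 have c: "continuous_on A (f r)" for r A by (intro continuous2_compose[OF f] continuous_intros)
 have "((%(r, s). integral {0..s} (f r)) has_derivative
   (%(dr, ds). dr *\<^sub>R integral {0..t} (f' t) + blinfun_apply (blinfun_scaleR_left (f t t)) ds)) (at (t, t) within UNIV \<times> {0<..})"
 proof (rule has_derivative_partialsI[where f="%r s. integral {0..s} (f r)" and fy="%r s. blinfun_scaleR_left (f r s)"])
  have "((%r. integral (cbox 0 t) (f r)) has_vector_derivative integral (cbox 0 t) (f' t)) (at t within UNIV)"
  proof (rule leibniz_rule_vector_derivative)
   show "((%r. f r s) has_vector_derivative f' r s) (at r within UNIV)" for r s using d by simp
   show "f r integrable_on cbox 0 t" for r unfolding cbox_interval by (intro integrable_continuous_interval c)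
   show "continuous_on (UNIV \<times> cbox 0 t) (%(r, s). f' r s)"
    unfolding case_prod_beta by (intro continuous2_compose[OF f'] continuous_intros)
  qed auto
  then show "((%r. integral {0..t} (f r)) has_derivative (%dr. dr *\<^sub>R integral {0..t} (f' t))) (at t within UNIV)"
   by (simp add: has_vector_derivative_def)
 next
  fix r s :: real assume s: "s \<in> {0<..}"
  have "((%s. integral {0..s} (f r)) has_vector_derivative f r s) (at s within {0..s + 1})"
   by (rule integral_has_vector_derivative[OF c]) (use s in auto)
  then have "((%s. integral {0..s} (f r)) has_vector_derivative f r s) (at s within {0<..<s + 1})"
   by (rule has_vector_derivative_within_subset) auto
  then have "((%s. integral {0..s} (f r)) has_vector_derivative f r s) (at s)"
   using s by (subst (asm) has_vector_derivative_within_open) auto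
  then show "((%s. integral {0..s} (f r)) has_derivative blinfun_apply (blinfun_scaleR_left (f r s))) (at s within {0<..})"
   unfolding has_vector_derivative_def by (auto intro: has_derivative_at_withinI)
 next
  have "continuous_on UNIV (%z. f (fst z) (snd z))" using f by (simp add: continuous2_def)
  then have "continuous (at (t, t)) (%z. f (fst z) (snd z))" by (simp add: continuous_on_eq_continuous_at)
  from bounded_linear.continuous[OF bounded_linear_blinfun_scaleR_left this]
  have "continuous (at (t, t)) (%z. blinfun_scaleR_left (f (fst z) (snd z)))" .
  then show "continuous (at (t, t) within UNIV \<times> {0<..}) (%(r, s). blinfun_scaleR_left (f r s))"
   unfolding case_prod_beta by (rule continuous_at_imp_continuous_at_within)
 qed (use t in auto)
 then have D: "((%z. integral {0..snd z} (f (fst z))) has_derivative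
   (%z. fst z *\<^sub>R integral {0..t} (f' t) + snd z *\<^sub>R f t t)) (at (t, t) within UNIV \<times> {0<..})"
  by (simp add: case_prod_unfold)
 have g: "((%r. (r, r)) has_derivative (%r. (r, r))) (at t within {0<..})"
  by (intro has_derivative_Pair has_derivative_ident)
 have "((%z. integral {0..snd z} (f (fst z))) has_derivative
   (%z. fst z *\<^sub>R integral {0..t} (f' t) + snd z *\<^sub>R f t t)) (at (t, t) within (%r. (r, r)) ` {0<..})"
  by (rule has_derivative_subset[OF D]) auto
 from diff_chain_within[OF g this]
 have "((%r. integral {0..r} (f r)) has_vector_derivative integral {0..t} (f' t) + f t t) (at t within {0<..})"
  by (simp add: has_vector_derivative_def o_def scaleR_add_right)
 then show ?thesis using t by (subst (asm) has_vector_derivative_within_open) (auto simp: add.commute)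
qed

text \<open>The fundamental Gaussian as a function of a complex width \<open>w\<close>; moving
  \<open>w\<close> along \<i> t gives the free Schroedinger evolution of mass \<mu>.\<close>

definition heat_factor :: "real => real => complex => complex" where
 "heat_factor \<mu> x w = exp (- (of_real \<mu> / (2 * w) * of_real (x\<^sup>2))) / csqrt w"

text \<open>This is the heat equation in complex time: the bracket is the second x-derivative of the
  Gaussian, and 1 / (2 \<mu>) the diffusion constant.\<close>

lemma heat_factor_deriv:
 assumes "w \<notin> \<real>\<^sub>\<le>\<^sub>0" "\<mu> \<noteq> 0"
 shows "(heat_factor \<mu> x has_field_derivative
  1 / (2 * of_real \<mu>) * ((4 * (of_real \<mu> / (2 * w))\<^sup>2 * of_real (x\<^sup>2) - 2 * (of_real \<mu> / (2 * w))) * heat_factor \<mu> x w)) (at w)"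
proof -
 have w: "w \<noteq> 0" using assms by auto
 define q where "q = csqrt w"
 have q: "q \<noteq> 0" "w = q * q" using w power2_csqrt[of w] by (auto simp: q_def power2_eq_square)
 have "((%w. - (of_real \<mu> / (2 * w) * of_real (x\<^sup>2))) has_field_derivative of_real \<mu> * of_real (x\<^sup>2) / (2 * w\<^sup>2)) (at w)"
  using w by (auto intro!: derivative_eq_intros simp: field_simps power2_eq_square)
 from DERIV_chain2[OF DERIV_exp this]
 have 1: "((%w. exp (- (of_real \<mu> / (2 * w) * of_real (x\<^sup>2)))) has_field_derivative
   exp (- (of_real \<mu> / (2 * w) * of_real (x\<^sup>2))) * (of_real \<mu> * of_real (x\<^sup>2) / (2 * w\<^sup>2))) (at w)" .
 have 2: "(csqrt has_field_derivative inverse (2 * csqrt w)) (at w)" using assms(1) by (rule has_field_derivative_csqrt)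
 have "csqrt w \<noteq> 0" using w by simp
 from DERIV_divide[OF 1 2 this]
 show ?thesis unfolding heat_factor_def[abs_def] q_def[symmetric]
  by (rule DERIV_cong) (use q assms(2) in \<open>simp add: field_simps power2_eq_square\<close>)
qed

text \<open>The substitution \<tau> = t \<theta> contributes the factor t. The quotient of square
  roots equals 1 at the release time, so that the source has amplitude B. The factor \<i> fixes the
  sign in \<i> G_t + G_xx / (2 \<mu>) = - S with source S, as w = exp (- 2 \<mu> u_3)
  requires.\<close>

definition duhamel_factor :: "real => (real => complex) => real => real => complex" where
 "duhamel_factor p B t \<theta> = of_real t * (\<i> * B (t * \<theta>) * csqrt (zeta p (t * \<theta>)) / csqrt (width p t (t * \<theta>)))"

definition duhamel_rate :: "real => real => real => real => complex" where
 "duhamel_rate p \<mu> t \<theta> = of_real \<mu> / (2 * width p t (t * \<theta>))"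

definition duhamel :: "real => real => (real => complex) => real => real => complex" where
 "duhamel p \<mu> B = gauss_int (duhamel_factor p B) (duhamel_rate p \<mu>) 0"

definition duhamel_x :: "real => real => (real => complex) => real => real => complex" where
 "duhamel_x p \<mu> B = gauss_int (%t \<theta>. - 2 * duhamel_rate p \<mu> t \<theta> * duhamel_factor p B t \<theta>) (duhamel_rate p \<mu>) 1"

definition duhamel_xx :: "real => real => (real => complex) => real => real => complex" where
 "duhamel_xx p \<mu> B t x =
   gauss_int (%t \<theta>. - 2 * duhamel_rate p \<mu> t \<theta> * duhamel_factor p B t \<theta>) (duhamel_rate p \<mu>) 0 t x +
   gauss_int (%t \<theta>. 4 * (duhamel_rate p \<mu> t \<theta>)\<^sup>2 * duhamel_factor p B t \<theta>) (duhamel_rate p \<mu>) 2 t x"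

context
 fixes p \<mu> :: real and B :: "real => complex"
 assumes p: "p \<ge> 1" and mu: "\<mu> > 0" and B: "continuous_on UNIV B"
begin

lemma continuous2_duhamel_factor: "continuous2 (duhamel_factor p B)" unfolding continuous2_def duhamel_factor_def
 by (intro continuous_intros continuous_on_compose2[OF B] continuous_csqrt_compose[OF p] continuous_zeta[OF p] continuous_width[OF p])
  (use width_nonzero[OF p] in auto)

lemma continuous2_duhamel_rate: "continuous2 (duhamel_rate p \<mu>)" unfolding continuous2_def duhamel_rate_def
 by (intro continuous_intros continuous_width[OF p]) (use width_nonzero[OF p] in auto)

lemma Re_duhamel_rate_pos: "Re (duhamel_rate p \<mu> t \<theta>) > 0"
 unfolding duhamel_rate_def using Re_width_pos[OF p] mu by (intro Re_of_real_divide_pos) auto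

lemma duhamel_regular: "regular T n (duhamel p \<mu> B)" unfolding duhamel_def
 by (rule gauss_int_regular[OF continuous2_duhamel_rate Re_duhamel_rate_pos continuous2_duhamel_factor])

lemma duhamel_0: "duhamel p \<mu> B 0 x = 0" by (simp add: duhamel_def gauss_int_def duhamel_factor_def)

lemma continuous2_duhamel_x: "continuous2 (%t \<theta>. - 2 * duhamel_rate p \<mu> t \<theta> * duhamel_factor p B t \<theta>)"
 and continuous2_duhamel_xx: "continuous2 (%t \<theta>. 4 * (duhamel_rate p \<mu> t \<theta>)\<^sup>2 * duhamel_factor p B t \<theta>)"
 unfolding continuous2_def
 by (intro continuous_intros continuous2_duhamel_rate[unfolded continuous2_def] continuous2_duhamel_factor[unfolded continuous2_def])+

lemma gauss_int_zero: "gauss_int (%t \<theta>. of_nat 0 * \<beta> t \<theta>) \<omega> j t x = 0" by (simp add: gauss_int_def)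

lemma duhamel_deriv_x: "(duhamel p \<mu> B t has_vector_derivative duhamel_x p \<mu> B t x) (at x)"
 using gauss_int_deriv[OF continuous2_duhamel_factor continuous2_duhamel_rate, of 0 t x]
 unfolding gauss_int_zero by (simp add: duhamel_def duhamel_x_def)

lemma duhamel_deriv_xx: "(duhamel_x p \<mu> B t has_vector_derivative duhamel_xx p \<mu> B t x) (at x)"
proof -
 have "(%t \<theta>. - 2 * duhamel_rate p \<mu> t \<theta> * (- 2 * duhamel_rate p \<mu> t \<theta> * duhamel_factor p B t \<theta>)) =
  (%t \<theta>. 4 * (duhamel_rate p \<mu> t \<theta>)\<^sup>2 * duhamel_factor p B t \<theta>)"
  by (simp add: power2_eq_square mult.assoc)
 moreover have "Suc 1 = 2" by simp
 moreover note gauss_int_deriv[OF continuous2_duhamel_x continuous2_duhamel_rate, of 1 t x]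
 ultimately show ?thesis unfolding duhamel_x_def duhamel_xx_def by (simp add: numeral_2_eq_2)
qed

lemma duhamel_continuous:
 "continuous_on A (%z. duhamel p \<mu> B (fst z) (snd z))" "continuous_on A (%z. duhamel_x p \<mu> B (fst z) (snd z))"
 "continuous_on A (%z. duhamel_xx p \<mu> B (fst z) (snd z))" unfolding duhamel_def duhamel_x_def duhamel_xx_def
 by (intro continuous_on_add gauss_int_continuous continuous2_duhamel_factor continuous2_duhamel_rate continuous2_duhamel_x continuous2_duhamel_xx)+

lemma duhamel_eq_integral:
 assumes "t \<ge> 0"
 shows "duhamel p \<mu> B t x = integral {0..t} (%\<tau>. \<i> * B \<tau> * csqrt (zeta p \<tau>) * heat_factor \<mu> x (width p t \<tau>))"
proof -
 have "continuous_on UNIV (%\<tau>. \<i> * B \<tau> * csqrt (zeta p \<tau>) * heat_factor \<mu> x (width p t \<tau>))"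
  unfolding heat_factor_def by (intro continuous_intros B continuous_csqrt_compose[OF p] continuous_zeta[OF p] continuous_width[OF p])
   (use width_nonzero[OF p] in auto)
 from integral_rescale[OF this assms] show ?thesis
  by (simp add: duhamel_def gauss_int_def duhamel_factor_def duhamel_rate_def heat_factor_def mult.assoc)
qed

lemma duhamel_deriv_t:
 assumes t: "t > 0"
 shows "((%t. duhamel p \<mu> B t x) has_vector_derivative
  \<i> * (B t * exp (- (of_real \<mu> / (2 * zeta p t) * of_real (x\<^sup>2)))) + \<i> * (of_real (1 / (2 * \<mu>)) * duhamel_xx p \<mu> B t x)) (at t)"
proof -
 let ?c = "%\<tau>. \<i> * B \<tau> * csqrt (zeta p \<tau>)"
 let ?f = "%t \<tau>. ?c \<tau> * heat_factor \<mu> x (width p t \<tau>)"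
 let ?h = "%w. 1 / (2 * of_real \<mu>) * ((4 * (of_real \<mu> / (2 * w))\<^sup>2 * of_real (x\<^sup>2) - 2 * (of_real \<mu> / (2 * w))) * heat_factor \<mu> x w)"
 let ?f' = "%t \<tau>. ?c \<tau> * (\<i> * ?h (width p t \<tau>))"
 have f: "continuous2 ?f" unfolding continuous2_def heat_factor_def
  by (intro continuous_intros continuous_on_compose2[OF B] continuous_csqrt_compose[OF p] continuous_zeta[OF p] continuous_width[OF p])
   (use width_nonzero[OF p] in auto)
 have f': "continuous2 ?f'" unfolding continuous2_def heat_factor_def
  by (intro continuous_intros continuous_on_compose2[OF B] continuous_csqrt_compose[OF p] continuous_zeta[OF p] continuous_width[OF p])
   (use width_nonzero[OF p] mu in auto)
 have d: "((%t. ?f t \<tau>) has_vector_derivative ?f' t \<tau>) (at t)" for t \<tau>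
 proof -
  have "((%t. width p t \<tau>) has_vector_derivative \<i>) (at t)" unfolding width_def
   by (rule has_vector_derivative_eq_rhs, (rule derivative_intros)+) (simp add: scaleR_conv_of_real)
  from field_vector_diff_chain_at[OF this heat_factor_deriv[OF width_nonzero(3)[OF p]]] mu
  have "((%t. heat_factor \<mu> x (width p t \<tau>)) has_vector_derivative \<i> * ?h (width p t \<tau>)) (at t)"
   by (simp add: o_def)
  then show ?thesis by (rule has_vector_derivative_mult_right)
 qed
 have "((%t. integral {0..t} (?f t)) has_vector_derivative ?f t t + integral {0..t} (?f' t)) (at t)"
  by (rule leibniz_diagonal[OF f f' d t])
 \<comment> \<open>At \<tau> = t the width is \<open>zeta p t\<close> and the square roots cancel:
   the boundary term is the source itself.\<close>
 moreover have "?f t t = \<i> * (B t * exp (- (of_real \<mu> / (2 * zeta p t) * of_real (x\<^sup>2))))"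
  using width_nonzero(2)[OF p, of t] by (simp add: heat_factor_def width_def)
 moreover have "integral {0..t} (?f' t) = \<i> * (of_real (1 / (2 * \<mu>)) * duhamel_xx p \<mu> B t x)"
 proof -
  have "integral {0..t} (?f' t) = integral {0..1} (%\<theta>. of_real t * ?f' t (t * \<theta>))"
   by (rule integral_rescale[symmetric]) (use t continuous2_compose[OF f', of UNIV "%_. t" "%x. x"] in \<open>auto intro: continuous_intros\<close>)
  also have "... = integral {0..1} (%\<theta>. (\<i> * of_real (1 / (2 * \<mu>))) *
    (- 2 * duhamel_rate p \<mu> t \<theta> * duhamel_factor p B t \<theta> * of_real (x ^ 0) * exp (- (duhamel_rate p \<mu> t \<theta> * of_real (x\<^sup>2))) +
     4 * (duhamel_rate p \<mu> t \<theta>)\<^sup>2 * duhamel_factor p B t \<theta> * of_real (x ^ 2) * exp (- (duhamel_rate p \<mu> t \<theta> * of_real (x\<^sup>2)))))"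
  proof (rule integral_cong)
   fix \<theta> :: real
   define w where "w = width p t (t * \<theta>)"
   have w: "csqrt w \<noteq> 0" using width_nonzero(1)[OF p] by (simp add: w_def)
   show "of_real t * ?f' t (t * \<theta>) = (\<i> * of_real (1 / (2 * \<mu>))) *
    (- 2 * duhamel_rate p \<mu> t \<theta> * duhamel_factor p B t \<theta> * of_real (x ^ 0) * exp (- (duhamel_rate p \<mu> t \<theta> * of_real (x\<^sup>2))) +
     4 * (duhamel_rate p \<mu> t \<theta>)\<^sup>2 * duhamel_factor p B t \<theta> * of_real (x ^ 2) * exp (- (duhamel_rate p \<mu> t \<theta> * of_real (x\<^sup>2))))"
    unfolding duhamel_rate_def duhamel_factor_def w_def[symmetric] heat_factor_def
    by (simp add: algebra_simps add_divide_distrib diff_divide_distrib)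
  qed
  also have "... = (\<i> * of_real (1 / (2 * \<mu>))) * duhamel_xx p \<mu> B t x"
   unfolding duhamel_xx_def gauss_int_def integral_mult_right by (subst Henstock_Kurzweil_Integration.integral_add)
    (intro gauss_int_integrable continuous2_duhamel_x continuous2_duhamel_xx continuous2_duhamel_rate refl)+
  finally show ?thesis by simp
 qed
 ultimately have "((%t. integral {0..t} (?f t)) has_vector_derivative
  \<i> * (B t * exp (- (of_real \<mu> / (2 * zeta p t) * of_real (x\<^sup>2)))) + \<i> * (of_real (1 / (2 * \<mu>)) * duhamel_xx p \<mu> B t x)) (at t)"
  by (simp only:)
 then show ?thesis
  by (rule has_vector_derivative_transform_within_open[where S="{0<..}"]) (use t in \<open>auto simp: duhamel_eq_integral\<close>)
qed

end

section \<open>Growth of the Duhamel term\<close>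

lemma csqrt_scale:
 assumes "t \<ge> 0" "w \<notin> \<real>\<^sub>\<le>\<^sub>0"
 shows "csqrt (of_real t * w) = of_real (sqrt t) * csqrt w"
proof (cases "t = 0")
 case False
 have "Re (csqrt w) > 0" using csqrt_principal[of w] assms(2)
  by (metis Re_csqrt complex_nonpos_Reals_iff csqrt_of_real_nonpos less_eq_real_def not_le power2_csqrt Re_power2 Im_power2 mult_zero_left mult_zero_right diff_0 neg_le_0_iff_le zero_le_power2 power_zero_numeral)
 then have "0 < Re (of_real (sqrt t) * csqrt w)" using assms(1) False by simp
 moreover have "(of_real (sqrt t) * csqrt w)\<^sup>2 = of_real t * w" using assms(1) by (simp add: power_mult_distrib flip: of_real_power)
 ultimately show ?thesis by (intro csqrt_unique) auto
qed simp

lemma integral_powr_unit: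
 fixes a :: real and b :: complex
 assumes "a > -1"
 shows "((%\<theta>. b * of_real (\<theta> powr a)) has_integral b / of_real (a + 1)) {0<..<1}"
proof -
 have "((%x. x powr a) has_integral (1 / (a + 1))) {0..1}" using has_integral_powr_from_0[OF assms, of 1] by simp
 from has_integral_mult_right[OF has_integral_linear[OF this bounded_linear_of_real], of b]
 show ?thesis by (simp add: has_integral_Icc_iff_Ioo o_def)
qed

text \<open>The amplitude B decays exactly like \<tau> to the power - e. The bound with
  \<open>CB\<close> limits the growth of the Duhamel term from above, the nonzero limit
  \<open>b\<close> from below.\<close>

locale forcing =
 fixes p \<mu> :: real and B :: "real => complex" and e CB :: real and b :: complex
 assumes p: "p \<ge> 1" and mu: "\<mu> > 0" and B: "continuous_on UNIV B"
  and e: "0 \<le> e" "e \<le> 1/2" and CB: "!!\<tau>. \<tau> \<ge> 0 ==> norm (B \<tau>) \<le> CB * (1 + \<tau>) powr (- e)"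
  and b: "((%\<tau>. of_real (\<tau> powr e) * B \<tau>) \<longlongrightarrow> b) at_top" "b \<noteq> 0"
begin

text \<open>The root of \<bar>\<zeta> / width\<bar> is at most of order ((1 + \<tau>) / (1 +
  t))^(1/2). Together with the decay of B this leaves (1 + \<tau>)^(1/2 - e), which is increasing as
  e is at most 1/2 and may be taken at \<tau> = t.\<close>

lemma factor_bound:
 obtains C where "C > 0" "!!t \<theta>. t \<ge> 0 ==> \<theta> \<in> {0..1} ==> norm (duhamel_factor p B t \<theta>) \<le> C * t * (1 + t) powr (- e)"
proof -
 define D where "D = 4 * p * (1 + 2 * p)"
 have D: "D > 0" using p by (simp add: D_def add_pos_nonneg)
 have CB0: "CB \<ge> 0" using CB[of 0] order_trans[OF norm_ge_zero[of "B 0"]] by simp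
 have "norm (duhamel_factor p B t \<theta>) \<le> ((CB + 1) * sqrt D) * t * (1 + t) powr (- e)" if t: "t \<ge> 0" and th: "\<theta> \<in> {0..1}" for t \<theta>
 proof -
  define \<tau> where "\<tau> = t * \<theta>"
  have tau: "0 \<le> \<tau>" "\<tau> \<le> t" using t th by (auto simp: \<tau>_def mult_left_le)
  have z: "sqrt (norm (zeta p \<tau>)) \<le> (1 + \<tau>) powr (1/2)" using norm_zeta_le[OF p tau(1)] tau by (simp add: powr_half_sqrt)
  have w: "(1 + t) / D \<le> norm (width p t \<tau>)" using norm_width_ge[OF p t tau(1)] by (simp add: D_def)
  have wp: "0 < (1 + t) / D" using t D by simp
  have "norm (B \<tau>) * sqrt (norm (zeta p \<tau>)) / sqrt (norm (width p t \<tau>)) \<le>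
    (CB * (1 + \<tau>) powr (- e)) * (1 + \<tau>) powr (1/2) / sqrt ((1 + t) / D)"
   using CB[OF tau(1)] z w wp CB0 by (intro frac_le mult_mono) auto
  also have "... = CB * (1 + \<tau>) powr (1/2 - e) * (sqrt D / sqrt (1 + t))"
  proof -
   have "(1 + \<tau>) powr (- e) * (1 + \<tau>) powr (1/2) = (1 + \<tau>) powr (1/2 - e)" by (simp flip: powr_add)
   then show ?thesis by (simp only: real_sqrt_divide divide_divide_eq_right times_divide_eq_right mult.assoc)
  qed
  also have "... \<le> (CB + 1) * (1 + t) powr (1/2 - e) * (sqrt D / sqrt (1 + t))"
   using tau e CB0 D t by (intro mult_mono powr_mono2) auto
  also have "... = (CB + 1) * sqrt D * (1 + t) powr (- e)"
  proof -
   have "(1 + t) powr (1/2 - e) = sqrt (1 + t) * (1 + t) powr (- e)"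
    using powr_add[of "1 + t" "1/2" "- e"] t by (simp add: powr_half_sqrt)
   moreover have "sqrt (1 + t) \<noteq> 0" using t by simp
   ultimately show ?thesis by simp
  qed
  finally have "t * (norm (B \<tau>) * sqrt (norm (zeta p \<tau>)) / sqrt (norm (width p t \<tau>))) \<le> t * ((CB + 1) * sqrt D * (1 + t) powr (- e))"
   using t by (intro mult_left_mono)
  moreover have "norm (duhamel_factor p B t \<theta>) = t * (norm (B \<tau>) * sqrt (norm (zeta p \<tau>)) / sqrt (norm (width p t \<tau>)))"
   unfolding duhamel_factor_def \<tau>_def[symmetric] using t by (simp add: norm_mult norm_divide)
  ultimately show ?thesis by (simp only: mult_ac)
 qed
 moreover have "(CB + 1) * sqrt D > 0" using CB0 D by simp
 ultimately show thesis using that by blast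
qed

text \<open>The Gaussians have modulus at most 1. The bound is valid down to t = 0, so it yields a
  lower estimate for every hitting time, not only for late ones.\<close>

lemma duhamel_upper:
 obtains C where "C > 0" "!!t x. t \<ge> 0 ==> norm (duhamel p \<mu> B t x) \<le> C * t powr (1 - e)"
proof -
 obtain C where C: "C > 0" "!!t \<theta>. t \<ge> 0 ==> \<theta> \<in> {0..1} ==> norm (duhamel_factor p B t \<theta>) \<le> C * t * (1 + t) powr (- e)"
  by (rule factor_bound) blast
 have "norm (duhamel p \<mu> B t x) \<le> C * t powr (1 - e)" if t: "t \<ge> 0" for t x
 proof (cases "t = 0")
  case False
  have "norm (integral {0..1} (%\<theta>. duhamel_factor p B t \<theta> * of_real (x ^ 0) * exp (- (duhamel_rate p \<mu> t \<theta> * of_real (x\<^sup>2))))) \<le> (C * t * (1 + t) powr (- e)) * (1 - 0)"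
  proof (rule integral_bound)
   show "continuous_on {0..1} (%\<theta>. duhamel_factor p B t \<theta> * of_real (x ^ 0) * exp (- (duhamel_rate p \<mu> t \<theta> * of_real (x\<^sup>2))))"
    by (intro continuous_intros continuous2_compose[OF continuous2_duhamel_factor[OF p mu B]] continuous2_compose[OF continuous2_duhamel_rate[OF p mu B]])
   fix \<theta> :: real assume th: "\<theta> \<in> {0..1}"
   have "0 \<le> Re (duhamel_rate p \<mu> t \<theta>) * x\<^sup>2" using Re_duhamel_rate_pos[OF p mu B, of t \<theta>] by simp
   then have "norm (exp (- (duhamel_rate p \<mu> t \<theta> * of_real (x\<^sup>2)))) \<le> 1" by (simp flip: of_real_power)
   from mult_mono[OF C(2)[OF t th] this]
   show "norm (duhamel_factor p B t \<theta> * of_real (x ^ 0) * exp (- (duhamel_rate p \<mu> t \<theta> * of_real (x\<^sup>2)))) \<le> C * t * (1 + t) powr (- e)"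
    using C(1) t by (simp add: norm_mult)
  qed simp
  also have "(C * t * (1 + t) powr (- e)) * (1 - 0) \<le> C * t * t powr (- e)"
   using C t e False by (auto intro!: mult_left_mono powr_mono2')
  also have "... = C * t powr (1 - e)" using t False by (simp add: powr_diff powr_minus field_simps)
  finally show ?thesis by (simp only: duhamel_def gauss_int_def)
 qed (simp add: duhamel_0[OF p mu B])
 then show thesis using C(1) that by blast
qed

text \<open>The resonance itself: \<zeta> / \<tau> and width / t both tend to \<i>, so the square
  roots of these quotients cancel in the limit and no oscillation in \<theta> remains.\<close>

lemma factor_limit:
 assumes th: "0 < \<theta>" "\<theta> < 1"
 shows "((%t. of_real (t powr (e - 1)) * duhamel_factor p B t \<theta>) \<longlongrightarrow> \<i> * b * of_real (\<theta> powr (1/2 - e))) at_top"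
proof -
 have sc: "filterlim (%t. t * \<theta>) at_top at_top"
  using th by (intro filterlim_at_top_mult_tendsto_pos[where c=\<theta>]) (auto simp: filterlim_ident mult.commute)
 have inv: "((%t. complex_of_real (1 / t)) \<longlongrightarrow> of_real 0) at_top"
  by (intro tendsto_of_real tendsto_divide_0[OF tendsto_const]) (simp add: filterlim_at_top_imp_at_infinity filterlim_ident)
 have z0: "((%\<tau>. zeta p \<tau> / of_real \<tau>) \<longlongrightarrow> \<i>) at_top"
 proof (rule Lim_transform_eventually)
  have "((%\<tau>. ((of_real (1 / \<tau>))\<^sup>2 + 1) / (of_real p * of_real (1 / \<tau>) - \<i>)) \<longlongrightarrow> ((of_real 0)\<^sup>2 + 1) / (of_real p * of_real 0 - \<i>)) at_top"
   by (intro tendsto_intros inv) auto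
  then show "((%\<tau>. ((of_real (1 / \<tau>))\<^sup>2 + 1) / (of_real p * of_real (1 / \<tau>) - \<i>)) \<longlongrightarrow> \<i>) at_top" by simp
  show "\<forall>\<^sub>F \<tau> in at_top. ((of_real (1 / \<tau>))\<^sup>2 + 1) / (of_real p * of_real (1 / \<tau>) - \<i>) = zeta p \<tau> / of_real \<tau>"
   using eventually_gt_at_top[of 0]
  proof eventually_elim
   case (elim \<tau>)
   have "zeta p \<tau> = 1 / (1 / zeta p \<tau>)" by simp
   then have 1: "zeta p \<tau> = of_real (1 + \<tau>\<^sup>2) / (of_real p - \<i> * of_real \<tau>)"
    unfolding inverse_zeta[OF p] by (simp only: divide_divide_eq_right mult_1_left)
   have 2: "(of_real (1 / \<tau>))\<^sup>2 + 1 = complex_of_real (1 + \<tau>\<^sup>2) / of_real \<tau> / of_real \<tau>"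
    using elim by (simp add: field_simps power2_eq_square)
   have 3: "of_real p * of_real (1 / \<tau>) - \<i> = (of_real p - \<i> * of_real \<tau>) / of_real \<tau>"
    using elim by (simp add: field_simps)
   show ?case unfolding 1 2 3 using elim by simp
  qed
 qed
 have z: "((%t. zeta p (t * \<theta>) / of_real (t * \<theta>)) \<longlongrightarrow> \<i>) at_top" by (rule filterlim_compose[OF z0 sc])
 have w: "((%t. width p t (t * \<theta>) / of_real t) \<longlongrightarrow> \<i>) at_top"
 proof (rule Lim_transform_eventually)
  show "((%t. of_real \<theta> * (zeta p (t * \<theta>) / of_real (t * \<theta>)) + \<i> * of_real (1 - \<theta>)) \<longlongrightarrow> \<i>) at_top"
  proof -
   have "((%t. of_real \<theta> * (zeta p (t * \<theta>) / of_real (t * \<theta>)) + \<i> * of_real (1 - \<theta>)) \<longlongrightarrow> of_real \<theta> * \<i> + \<i> * of_real (1 - \<theta>)) at_top"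
    by (intro tendsto_intros z)
   then show ?thesis by (simp add: algebra_simps)
  qed
  show "\<forall>\<^sub>F t in at_top. of_real \<theta> * (zeta p (t * \<theta>) / of_real (t * \<theta>)) + \<i> * of_real (1 - \<theta>) = width p t (t * \<theta>) / of_real t"
   using eventually_gt_at_top[of 0] by eventually_elim (use th in \<open>simp add: width_def field_simps\<close>)
 qed
 have i: "\<i> \<notin> \<real>\<^sub>\<le>\<^sub>0" by (simp add: complex_nonpos_Reals_iff)
 have cs: "((%t. csqrt (f t)) \<longlongrightarrow> csqrt \<i>) at_top" if "(f \<longlongrightarrow> \<i>) at_top" for f :: "real => complex"
  by (rule isCont_tendsto_compose[OF continuous_at_csqrt that]) (use i in auto)
 have bt: "((%t. of_real ((t * \<theta>) powr e) * B (t * \<theta>)) \<longlongrightarrow> b) at_top" by (rule filterlim_compose[OF b(1) sc])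
 have "((%t. \<i> * of_real (\<theta> powr (1/2 - e)) * (of_real ((t * \<theta>) powr e) * B (t * \<theta>)) *
   (csqrt (zeta p (t * \<theta>) / of_real (t * \<theta>)) / csqrt (width p t (t * \<theta>) / of_real t))) \<longlongrightarrow>
   \<i> * of_real (\<theta> powr (1/2 - e)) * b * (csqrt \<i> / csqrt \<i>)) at_top"
  by (intro tendsto_mult[OF tendsto_mult[OF tendsto_const bt]] tendsto_divide cs z w) (simp del: csqrt_ii)
 moreover have "csqrt \<i> / csqrt \<i> = 1" by (simp del: csqrt_ii)
 ultimately have L: "((%t. \<i> * of_real (\<theta> powr (1/2 - e)) * (of_real ((t * \<theta>) powr e) * B (t * \<theta>)) *
   (csqrt (zeta p (t * \<theta>) / of_real (t * \<theta>)) / csqrt (width p t (t * \<theta>) / of_real t))) \<longlongrightarrow>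
   \<i> * b * of_real (\<theta> powr (1/2 - e))) at_top" by (simp only: mult_ac mult_1_left mult_1_right)
 show ?thesis
 proof (rule Lim_transform_eventually[OF L])
  show "\<forall>\<^sub>F t in at_top. \<i> * of_real (\<theta> powr (1/2 - e)) * (of_real ((t * \<theta>) powr e) * B (t * \<theta>)) *
   (csqrt (zeta p (t * \<theta>) / of_real (t * \<theta>)) / csqrt (width p t (t * \<theta>) / of_real t)) =
   of_real (t powr (e - 1)) * duhamel_factor p B t \<theta>" using eventually_gt_at_top[of 0]
  proof eventually_elim
   case (elim t)
   define Z where "Z = zeta p (t * \<theta>)"
   define W where "W = width p t (t * \<theta>)"
   have Z: "Z / of_real (t * \<theta>) \<notin> \<real>\<^sub>\<le>\<^sub>0" and W: "W / of_real t \<notin> \<real>\<^sub>\<le>\<^sub>0"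
    using Re_zeta_pos[OF p, of "t * \<theta>"] Re_width_pos[OF p, of t "t * \<theta>"] elim th
    by (auto simp: Z_def W_def complex_nonpos_Reals_iff Re_divide_of_real not_le divide_le_0_iff mult_less_0_iff mult_le_0_iff)
   have cZ: "csqrt Z = of_real (sqrt (t * \<theta>)) * csqrt (Z / of_real (t * \<theta>))"
    using csqrt_scale[OF _ Z, of "t * \<theta>"] elim th by simp
   have cW: "csqrt W = of_real (sqrt t) * csqrt (W / of_real t)" using csqrt_scale[OF _ W, of t] elim by simp
   have s: "complex_of_real (t powr (e - 1)) * (of_real t * of_real (sqrt (t * \<theta>)) / of_real (sqrt t)) = of_real (\<theta> powr (1/2 - e)) * of_real ((t * \<theta>) powr e)"
   proof -
    have "t powr (e - 1) * (t * sqrt (t * \<theta>) / sqrt t) = \<theta> powr (1/2 - e) * (t * \<theta>) powr e"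
     using elim th by (simp add: real_sqrt_mult powr_mult powr_diff powr_half_sqrt)
    then show ?thesis by (metis of_real_divide of_real_mult)
   qed
   have "of_real (t powr (e - 1)) * duhamel_factor p B t \<theta> =
    \<i> * B (t * \<theta>) * (csqrt (Z / of_real (t * \<theta>)) / csqrt (W / of_real t)) *
    (of_real (t powr (e - 1)) * (of_real t * of_real (sqrt (t * \<theta>)) / of_real (sqrt t)))"
    unfolding duhamel_factor_def Z_def[symmetric] W_def[symmetric] cZ cW by (simp add: mult_ac)
   then show ?case unfolding s by (simp add: Z_def W_def mult_ac)
  qed
 qed
qed

text \<open>By dominated convergence the limit is \<i> b times the integral of \<theta>^(1/2 - e)
  over the unit interval, in particular nonzero.\<close>

lemma duhamel_limit:
 "((%t. of_real (t powr (e - 1)) * duhamel p \<mu> B t 0) \<longlongrightarrow> \<i> * b / of_real (1/2 - e + 1)) at_top"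
proof (rule tendsto_at_topI_sequentially)
 fix X :: "nat => real" assume X: "filterlim X at_top sequentially"
 \<comment> \<open>Replacing early terms by 1 makes the dominating bound valid for all n without
   affecting the limit.\<close>
 define Y where "Y = (%n. max 1 (X n))"
 have Y: "filterlim Y at_top sequentially" by (rule filterlim_at_top_mono[OF X]) (simp add: Y_def)
 obtain C where C: "C > 0" "!!t \<theta>. t \<ge> 0 ==> \<theta> \<in> {0..1} ==> norm (duhamel_factor p B t \<theta>) \<le> C * t * (1 + t) powr (- e)"
  by (rule factor_bound) blast
 have lim: "(%n. integral {0<..<1} (%\<theta>. of_real (Y n powr (e - 1)) * duhamel_factor p B (Y n) \<theta>)) \<longlonglongrightarrow>
   integral {0<..<1} (%\<theta>. \<i> * b * of_real (\<theta> powr (1/2 - e)))"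
 proof (rule dominated_convergence(2)[where h="%_. C"])
  show "(%\<theta>. of_real (Y n powr (e - 1)) * duhamel_factor p B (Y n) \<theta>) integrable_on {0<..<1}" for n
   unfolding integrable_on_open_interval_real
   by (intro integrable_continuous_interval continuous_intros continuous2_compose[OF continuous2_duhamel_factor[OF p mu B]])
  show "(%_. C) integrable_on {0<..<1::real}" unfolding integrable_on_open_interval_real by auto
  show "norm (of_real (Y n powr (e - 1)) * duhamel_factor p B (Y n) \<theta>) \<le> C" if "\<theta> \<in> {0<..<1}" for n \<theta>
  proof -
   have y: "Y n \<ge> 1" by (simp add: Y_def)
   have "norm (of_real (Y n powr (e - 1)) * duhamel_factor p B (Y n) \<theta>) \<le> Y n powr (e - 1) * (C * Y n * (1 + Y n) powr (- e))"
    using C(2)[of "Y n" \<theta>] y that by (auto simp: norm_mult intro!: mult_left_mono)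
   also have "... \<le> Y n powr (e - 1) * (C * Y n * Y n powr (- e))" using C(1) y e by (intro mult_left_mono powr_mono2') auto
   also have "... = C" using y by (simp add: powr_diff powr_minus field_simps)
   finally show ?thesis .
  qed
  show "(%n. of_real (Y n powr (e - 1)) * duhamel_factor p B (Y n) \<theta>) \<longlonglongrightarrow> \<i> * b * of_real (\<theta> powr (1/2 - e))" if "\<theta> \<in> {0<..<1}" for \<theta>
   by (rule filterlim_compose[OF factor_limit Y]) (use that in auto)
 qed
 have ex: "- 1 < 1 / 2 - e" using e by simp
 have "integral {0<..<1} (%\<theta>. of_real (t powr (e - 1)) * duhamel_factor p B t \<theta>) = of_real (t powr (e - 1)) * duhamel p \<mu> B t 0" for t
  by (simp add: duhamel_def gauss_int_def flip: integral_open_interval_real)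
 from lim[unfolded this integral_unique[OF integral_powr_unit[OF ex]]] have lim2: "(%n. of_real (Y n powr (e - 1)) * duhamel p \<mu> B (Y n) 0) \<longlonglongrightarrow> \<i> * b / of_real (1/2 - e + 1)" .
 show "(%n. of_real (X n powr (e - 1)) * duhamel p \<mu> B (X n) 0) \<longlonglongrightarrow> \<i> * b / of_real (1/2 - e + 1)"
 proof (rule Lim_transform_eventually[OF lim2])
  have "\<forall>\<^sub>F n in sequentially. X n \<ge> 1" using X by (simp add: filterlim_at_top)
  then show "\<forall>\<^sub>F n in sequentially. of_real (Y n powr (e - 1)) * duhamel p \<mu> B (Y n) 0 = of_real (X n powr (e - 1)) * duhamel p \<mu> B (X n) 0"
   by eventually_elim (simp add: Y_def max_def)
 qed
qed

lemma powr_power_eq: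
 assumes "real N * (1 - e) = 1" "t \<ge> 0"
 shows "(t powr (1 - e)) ^ N = t"
proof (cases "t = 0")
 case True
 have "N \<noteq> 0" using assms(1) by (cases N) auto
 then show ?thesis using True by (simp add: power_0_left)
next
 case False
 then have "(t powr (1 - e)) ^ N = t powr (real N * (1 - e))" using assms(2) by (simp add: powr_powr mult.commute flip: powr_realpow)
 then show ?thesis using assms False by simp
qed

text \<open>Raising to the power N = 1 / (1 - e) makes the growth linear in t, so hitting times can
  be compared without real exponents.\<close>

lemma duhamel_growth:
 assumes N: "real N * (1 - e) = 1"
 obtains C c t0 where "C > 0" "c > 0" "t0 > 0" "!!t x. t \<ge> 0 ==> norm (duhamel p \<mu> B t x) ^ N \<le> C * t"
  "!!t. t \<ge> t0 ==> c * t \<le> norm (duhamel p \<mu> B t 0) ^ N"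
proof -
 obtain C where C: "C > 0" "!!t x. t \<ge> 0 ==> norm (duhamel p \<mu> B t x) \<le> C * t powr (1 - e)" by (rule duhamel_upper) blast
 define l where "l = norm (\<i> * b / of_real (1/2 - e + 1))"
 have "1/2 - e + 1 \<noteq> 0" using e by simp
 then have "l > 0" using b(2) unfolding l_def zero_less_norm_iff divide_eq_0_iff of_real_eq_0_iff by simp
 have "((%t. norm (of_real (t powr (e - 1)) * duhamel p \<mu> B t 0)) \<longlongrightarrow> l) at_top"
  unfolding l_def by (rule tendsto_norm[OF duhamel_limit])
 from order_tendstoD(1)[OF this, of "l / 2"] \<open>l > 0\<close>
 have "\<forall>\<^sub>F t in at_top. l / 2 < norm (of_real (t powr (e - 1)) * duhamel p \<mu> B t 0)" by simp
 then obtain t1 where t1: "!!t. t \<ge> t1 ==> l / 2 < norm (of_real (t powr (e - 1)) * duhamel p \<mu> B t 0)"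
  by (auto simp: eventually_at_top_linorder)
 show thesis
 proof (rule that[of "C ^ N" "(l / 2) ^ N" "max 1 t1"])
  show "norm (duhamel p \<mu> B t x) ^ N \<le> C ^ N * t" if "t \<ge> 0" for t x
  proof -
   have "norm (duhamel p \<mu> B t x) ^ N \<le> (C * t powr (1 - e)) ^ N" using C(2)[OF that] by (intro power_mono) auto
   then show ?thesis by (simp add: power_mult_distrib powr_power_eq[OF N that])
  qed
  show "(l / 2) ^ N * t \<le> norm (duhamel p \<mu> B t 0) ^ N" if "max 1 t1 \<le> t" for t
  proof -
   have t: "t \<ge> 1" "t \<ge> t1" using that by auto
   have "l / 2 \<le> t powr (e - 1) * norm (duhamel p \<mu> B t 0)" using t1[OF t(2)] by (simp add: norm_mult)
   then have "l / 2 * t powr (1 - e) \<le> t powr (e - 1) * norm (duhamel p \<mu> B t 0) * t powr (1 - e)"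
    by (intro mult_right_mono) auto
   also have "... = norm (duhamel p \<mu> B t 0)" using t by (simp add: powr_diff field_simps)
   finally have "(l / 2 * t powr (1 - e)) ^ N \<le> norm (duhamel p \<mu> B t 0) ^ N"
    using \<open>l > 0\<close> by (intro power_mono) auto
   then have "(l / 2) ^ N * (t powr (1 - e)) ^ N \<le> norm (duhamel p \<mu> B t 0) ^ N" by (simp only: power_mult_distrib)
   then show ?thesis using powr_power_eq[OF N, of t] t by simp
  qed
 qed (use C \<open>l > 0\<close> in auto)
qed

text \<open>Spatial decay confines the points where the modulus is at least M to a compact set, on
  which the time has a minimum T. It is positive because G vanishes at time 0, and continuity from
  the left gives equality at T.\<close>

lemma first_hitting_time:
 assumes "M > 0" and hit: "t1 \<ge> 0" "norm (duhamel p \<mu> B t1 0) \<ge> M"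
 obtains T x where "0 < T" "T \<le> t1" "norm (duhamel p \<mu> B T x) = M"
  "!!t y. 0 \<le> t ==> t < T ==> norm (duhamel p \<mu> B t y) < M"
  "!!y. norm (duhamel p \<mu> B T y) \<le> M"
proof -
 let ?G = "duhamel p \<mu> B"
 have "decaying (t1 + 1) ?G" using duhamel_regular[OF p mu B, of "t1 + 1" 0] by simp
 then obtain C where C: "!!t x. t \<in> {0..t1} ==> norm (?G t x) \<le> C * (1 / (1 + x\<^sup>2))"
  using decayingD[of "t1 + 1" ?G t1] by (metis less_add_one)
 \<comment> \<open>For x of modulus beyond R the decay bound C / (1 + x^2) is below M.\<close>
 define R where "R = C / M + 1"
 have R: "norm (?G t x) < M" if "t \<in> {0..t1}" "\<bar>x\<bar> > R" for t x
 proof -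
  have C0: "C \<ge> 0" using order_trans[OF norm_ge_zero C[of 0 0]] hit(1) by simp
  have "R \<ge> 1" using C0 \<open>M > 0\<close> by (simp add: R_def)
  then have "\<bar>x\<bar> * 1 \<le> \<bar>x\<bar> * \<bar>x\<bar>" using that(2) by (intro mult_left_mono) auto
  then have "R < 1 + x\<^sup>2" using that(2) by (simp add: power2_eq_square)
  then have "C / M < 1 + x\<^sup>2" by (simp add: R_def)
  then have "C < M * (1 + x\<^sup>2)" using \<open>M > 0\<close> by (simp add: divide_less_eq mult.commute)
  then have "C * (1 / (1 + x\<^sup>2)) < M" by (simp add: divide_less_eq add_pos_nonneg)
  then show ?thesis using C[OF that(1), of x] by simp
 qed
 define S where "S = {z \<in> {0..t1} \<times> {- R..R}. M \<le> norm (?G (fst z) (snd z))}"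
 have cS: "compact S"
 proof -
  have "S = ({0..t1} \<times> {- R..R}) \<inter> {z. M \<le> norm (?G (fst z) (snd z))}" by (auto simp: S_def)
  moreover have "closed {z. M \<le> norm (?G (fst z) (snd z))}"
   by (intro closed_Collect_le continuous_intros duhamel_continuous[OF p mu B])
  ultimately show ?thesis by (simp add: compact_Int_closed compact_Times)
 qed
 have in_S: "(t, x) \<in> S" if "t \<in> {0..t1}" "M \<le> norm (?G t x)" for t x
  using R[OF that(1), of x] that by (cases "\<bar>x\<bar> > R") (auto simp: S_def abs_le_iff not_less)
 have "S \<noteq> {}" using in_S[of t1 0] hit by auto
 from continuous_attains_inf[OF cS this continuous_on_fst[OF continuous_on_id]]
 obtain z where z: "z \<in> S" "!!w. w \<in> S ==> fst z \<le> fst w" by blast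
 define T where "T = fst z"
 have T: "0 \<le> T" "T \<le> t1" "M \<le> norm (?G T (snd z))" using z(1) by (auto simp: S_def T_def)
 have "T \<noteq> 0" using T(3) \<open>M > 0\<close> by (auto simp: duhamel_0[OF p mu B])
 then have T0: "0 < T" using T by simp
 have less: "norm (?G t y) < M" if "0 \<le> t" "t < T" for t y using z(2)[OF in_S[of t y]] that T by (auto simp: T_def not_less[symmetric])
 have le: "norm (?G T y) \<le> M" for y
 proof (rule tendsto_upperbound)
  have "continuous_on UNIV (%t. norm (?G t y))"
   using continuous_on_compose2[OF duhamel_continuous(1)[OF p mu B, of UNIV] continuous_on_Pair[OF continuous_on_id continuous_on_const]]
   by (auto intro: continuous_on_norm)
  then have "isCont (%t. norm (?G t y)) T" by (simp add: continuous_on_eq_continuous_at)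
  then show "((%t. norm (?G t y)) \<longlongrightarrow> norm (?G T y)) (at_left T)"
   unfolding isCont_def by (rule filterlim_at_split[THEN iffD1, THEN conjunct1])
  show "\<forall>\<^sub>F t in at_left T. norm (?G t y) \<le> M"
   using eventually_at_left_real[OF T0] by eventually_elim (use less in \<open>auto intro: less_imp_le\<close>)
 qed simp
 show thesis by (rule that[OF T0 T(2) _ less le, of "snd z"]) (use T(3) le[of "snd z"] in auto)
qed

end

section \<open>The explicit solution\<close>

lemma bounded_linear_axis: "bounded_linear (%y::complex. axis i (c * y) :: complex ^ 'n)"
 unfolding linear_conv_bounded_linear[symmetric] by (intro linearI) (auto simp: vec_eq_iff axis_def algebra_simps)

lemma norm_axis: "norm (axis i y :: complex ^ 'n) = norm y"
proof -
 have "norm (axis i y :: complex ^ 'n) = sqrt (\<Sum>j\<in>UNIV. if j = i then (norm y)\<^sup>2 else 0)"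
  unfolding norm_vec_def L2_set_def axis_def by (intro arg_cong[where f=sqrt] sum.cong) auto
 then show ?thesis by simp
qed

definition base :: "real => complex" where
 "base t = 1 + \<i> * of_real t"

definition damp :: "real => complex" where
 "damp t = 1 / csqrt (base t)"

definition wave1 :: "real => complex => real => real => complex" where
 "wave1 m a = gauss (%t. a * damp t) (%t. of_real m / (2 * base t))"

text \<open>On Gaussians with this rate the constant amplitude - 2 a^2 solves the forced equation,
  and \<open>damp\<close> the free one. The combination vanishes at t = 0 and does not decay in
  amplitude.\<close>

definition wave2 :: "real => complex => real => real => complex" where
 "wave2 m a = gauss (%t. - 2 * a\<^sup>2 * (1 - damp t)) (%t. of_real m / base t)"

lemma Re_base: "Re (base t) = 1" by (simp add: base_def)

lemma base_nonzero: "base t \<noteq> 0" "base t \<notin> \<real>\<^sub>\<le>\<^sub>0"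
 using Re_base[of t] by (auto simp: complex_nonpos_Reals_iff)

lemma damp_squared: "(damp t)\<^sup>2 = 1 / base t" by (simp add: damp_def power_divide)

lemma base_deriv: "(base has_vector_derivative \<i>) (at t)"
 unfolding base_def by (rule has_vector_derivative_eq_rhs, (rule derivative_intros)+) (simp add: scaleR_conv_of_real)

lemma continuous_base: "continuous_on A base" unfolding base_def by (intro continuous_intros)

lemma continuous_damp: "continuous_on A damp" unfolding damp_def using base_nonzero
 by (intro continuous_on_divide continuous_on_const continuous_on_compose2[OF continuous_on_csqrt continuous_base]) auto

lemma inverse_base_deriv: "((%t. c / base t) has_vector_derivative - \<i> * c / (base t)\<^sup>2) (at t)"
proof -
 have "((%w. c / w) has_field_derivative - c / (base t)\<^sup>2) (at (base t))"
  using base_nonzero(1)[of t] by (auto intro!: derivative_eq_intros simp: power2_eq_square)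
 from field_vector_diff_chain_at[OF base_deriv this] show ?thesis by (simp add: o_def mult_ac)
qed

lemma damp_deriv: "(damp has_vector_derivative - (\<i> * damp t / (2 * base t))) (at t)"
proof -
 have c: "csqrt (base t) \<noteq> 0" using base_nonzero by simp
 have "((%w. 1 / csqrt w) has_field_derivative - (1 / (2 * csqrt (base t) * base t))) (at (base t))"
  by (rule DERIV_cong[OF DERIV_divide[OF DERIV_const has_field_derivative_csqrt[OF base_nonzero(2)] c]])
   (use power2_csqrt[of "base t"] in \<open>simp add: field_simps power2_eq_square\<close>)
 from field_vector_diff_chain_at[OF base_deriv this] show ?thesis by (simp add: o_def damp_def[abs_def] mult_ac)
qed

lemma Re_waves: assumes "m > 0" shows "Re (of_real m / (2 * base t)) > 0" "Re (of_real m / base t) > 0"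
 by (intro Re_of_real_divide_pos assms; simp add: Re_base)+

lemma wave1_regular: "m > 0 ==> regular T n (wave1 m a)" unfolding wave1_def using base_nonzero Re_waves
 by (intro gauss_regular continuous_intros continuous_damp continuous_base) auto

lemma wave2_regular: "m > 0 ==> regular T n (wave2 m a)" unfolding wave2_def using base_nonzero Re_waves
 by (intro gauss_regular continuous_intros continuous_damp continuous_base) auto

lemma wave1_distributional:
 assumes "m > 0"
 shows "schrodinger_distributional m T (wave1 m a) (%t x. 0)" unfolding wave1_def
proof (rule gauss_distributional)
 fix t x
 show "((%t. a * damp t) has_vector_derivative a * - (\<i> * damp t / (2 * base t))) (at t)"
  by (intro has_vector_derivative_mult_right damp_deriv)
 show "((%t. of_real m / (2 * base t)) has_vector_derivative - \<i> * (of_real m / 2) / (base t)\<^sup>2) (at t)"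
  using inverse_base_deriv[of "of_real m / 2" t] by simp
 have "\<i> * (a * - (\<i> * damp t / (2 * base t)) - - \<i> * (of_real m / 2) / (base t)\<^sup>2 * of_real (x\<^sup>2) * (a * damp t)) +
    of_real (1 / (2 * m)) * ((4 * (of_real m / (2 * base t))\<^sup>2 * of_real (x\<^sup>2) - 2 * (of_real m / (2 * base t))) * (a * damp t)) = 0"
  using base_nonzero(1)[of t] assms by (simp add: field_simps power2_eq_square)
 then show "0 = (\<i> * (a * - (\<i> * damp t / (2 * base t)) - - \<i> * (of_real m / 2) / (base t)\<^sup>2 * of_real (x\<^sup>2) * (a * damp t)) +
    of_real (1 / (2 * m)) * ((4 * (of_real m / (2 * base t))\<^sup>2 * of_real (x\<^sup>2) - 2 * (of_real m / (2 * base t))) * (a * damp t))) *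
   exp (- (of_real m / (2 * base t) * of_real (x\<^sup>2)))" by simp
qed (use base_nonzero in \<open>intro continuous_intros continuous_damp continuous_base; simp\<close>)+

lemma wave2_distributional:
 assumes "m > 0"
 shows "schrodinger_distributional (2 * m) T (wave2 m a) (%t x. (wave1 m a t x)\<^sup>2)" unfolding wave2_def
proof (rule gauss_distributional)
 fix t x
 have "((%t. - 2 * a\<^sup>2 * (1 - damp t)) has_vector_derivative - 2 * a\<^sup>2 * (0 - - (\<i> * damp t / (2 * base t)))) (at t)"
  by (intro has_vector_derivative_mult_right has_vector_derivative_diff has_vector_derivative_const damp_deriv)
 then show "((%t. - 2 * a\<^sup>2 * (1 - damp t)) has_vector_derivative - (\<i> * a\<^sup>2 * damp t / base t)) (at t)" by (simp add: mult_ac)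
 show "((%t. of_real m / base t) has_vector_derivative - \<i> * of_real m / (base t)\<^sup>2) (at t)" by (rule inverse_base_deriv)
 have "(wave1 m a t x)\<^sup>2 = a\<^sup>2 / base t * (exp (- (of_real m / (2 * base t) * of_real (x\<^sup>2))))\<^sup>2"
  by (simp add: wave1_def gauss_def power_mult_distrib damp_squared)
 also have "(exp (- (of_real m / (2 * base t) * of_real (x\<^sup>2))))\<^sup>2 = exp (- (of_real m / base t * of_real (x\<^sup>2)))"
  by (simp add: power2_eq_square flip: exp_add)
 also have "a\<^sup>2 / base t = \<i> * (- (\<i> * a\<^sup>2 * damp t / base t) - - \<i> * of_real m / (base t)\<^sup>2 * of_real (x\<^sup>2) * (- 2 * a\<^sup>2 * (1 - damp t))) +
    of_real (1 / (2 * (2 * m))) * ((4 * (of_real m / base t)\<^sup>2 * of_real (x\<^sup>2) - 2 * (of_real m / base t)) * (- 2 * a\<^sup>2 * (1 - damp t)))"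
  using base_nonzero(1)[of t] assms by (simp add: field_simps power2_eq_square)
 finally show "(wave1 m a t x)\<^sup>2 = (\<i> * (- (\<i> * a\<^sup>2 * damp t / base t) - - \<i> * of_real m / (base t)\<^sup>2 * of_real (x\<^sup>2) * (- 2 * a\<^sup>2 * (1 - damp t))) +
    of_real (1 / (2 * (2 * m))) * ((4 * (of_real m / base t)\<^sup>2 * of_real (x\<^sup>2) - 2 * (of_real m / base t)) * (- 2 * a\<^sup>2 * (1 - damp t)))) *
   exp (- (of_real m / base t * of_real (x\<^sup>2)))" .
qed (use base_nonzero in \<open>intro continuous_intros continuous_damp continuous_base; simp\<close>)+

text \<open>Upgrades a pointwise strict bound to a uniform one: a maximum is attained on a compact
  box, and outside it decay forces the value below M / 2.\<close>

lemma decaying_strict_bound: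
 assumes f: "decaying T f" and \<tau>: "\<tau> < T" and M: "M > 0" "!!t x. t \<in> {0..\<tau>} ==> norm (f t x) < M"
 shows "\<exists>\<rho><M. \<forall>t\<in>{0..\<tau>}. \<forall>x. norm (f t x) \<le> \<rho>"
proof (cases "0 \<le> \<tau>")
 case True
 obtain C where C: "C \<ge> 0" "!!t x. t \<in> {0..\<tau>} ==> norm (f t x) \<le> C * (1 / (1 + x\<^sup>2))"
  using decayingD[OF f \<tau>] by metis
 define R where "R = 2 * C / M + 1"
 have R1: "R \<ge> 1" using C(1) M(1) by (simp add: R_def)
 let ?S = "{0..\<tau>} \<times> {- R..R}"
 have S: "compact ?S" "?S \<noteq> {}" using True R1 by (auto intro: compact_Times)
 have "continuous_on ?S (%z. norm (f (fst z) (snd z)))"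
  by (intro continuous_on_norm continuous_on_subset[OF decaying_continuous[OF f]]) (use \<tau> in auto)
 from continuous_attains_sup[OF S this] obtain z where z: "z \<in> ?S" "!!w. w \<in> ?S ==> norm (f (fst w) (snd w)) \<le> norm (f (fst z) (snd z))"
  by blast
 have "norm (f t x) \<le> max (norm (f (fst z) (snd z))) (M / 2)" if t: "t \<in> {0..\<tau>}" for t x
 proof (cases "\<bar>x\<bar> \<le> R")
  case True
  then have "(t, x) \<in> ?S" using t by (auto simp: abs_le_iff)
  from z(2)[OF this] show ?thesis by simp
 next
  case False
  then have "\<bar>x\<bar> * 1 \<le> \<bar>x\<bar> * \<bar>x\<bar>" using R1 by (intro mult_left_mono) auto
  then have "R < 1 + x\<^sup>2" using False by (simp add: power2_eq_square)
  then have "2 * C / M < 1 + x\<^sup>2" by (simp add: R_def)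
  then have "2 * C < M * (1 + x\<^sup>2)" using M(1) by (simp add: divide_less_eq mult.commute)
  then have "C * (1 / (1 + x\<^sup>2)) \<le> M / 2" by (simp add: divide_le_eq add_pos_nonneg)
  from order_trans[OF C(2)[OF t] this] show ?thesis by (rule max.coboundedI2)
 qed
 moreover have "max (norm (f (fst z) (snd z))) (M / 2) < M" using M z(1) by auto
 ultimately show ?thesis by blast
next
 case False
 then show ?thesis using M(1) by (intro exI[of _ 0]) auto
qed

text \<open>\<open>source\<close> encodes the mass relation: the nonlinearity of the two waves is
  one Gaussian with rate \<mu> / (2 \<zeta>). \<open>phase\<close> says that \<Lambda>, of degree k,
  reaches every phase, so the zero of w can be placed at will.\<close>

locale resonance = forcing +
 fixes m :: real and Q :: "complex => complex => complex" and \<Lambda> :: "complex => complex" and k N :: nat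
 assumes m: "m > 0" and N: "real N * (1 - e) = 1" and Q: "quadratic_Lipschitz Q"
  and phase: "!!r c. r > 0 ==> norm c = 1 ==> \<exists>a. norm a = r \<and> \<Lambda> a = of_real (r ^ k) * c"
  and source: "!!a t x. Q (wave1 m a t x) (wave2 m a t x) = \<Lambda> a * (B t * exp (- (of_real \<mu> / (2 * zeta p t) * of_real (x\<^sup>2))))"
begin

abbreviation "G \<equiv> duhamel p \<mu> B"

definition wave3 :: "complex => real => real => complex" where
 "wave3 l t x = of_real (- 1 / (2 * \<mu>)) * Ln (1 + l * G t x)"

lemma wave3_regular:
 assumes "contracted T (%t x. l * G t x)"
 shows "regular T n (wave3 l)" unfolding wave3_def[abs_def]
 by (intro regular_bounded_linear[OF bounded_linear_mult_right] regular_Ln[OF assms] duhamel_regular[OF p mu B])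

text \<open>The weak derivative is taken of an auxiliary path \<open>W\<close>, because in
  \<open>is_solution\<close> it refers to a component of the vector solution, which has to be
  recognised as \<open>wave3\<close> first.\<close>

lemma wave3_distributional:
 assumes c: "contracted T (%t x. l * G t x)" and l: "l = \<Lambda> a"
  and W: "!!t. t \<in> {0<..<T} ==> W t = wave3 l t"
 shows "schrodinger_distributional \<mu> T (wave3 l) (%t x. (weak_deriv 1 (W t) x)\<^sup>2 +
  Q (wave1 m a t x) (wave2 m a t x) * (exp (of_real (2 * \<mu>) * wave3 l t x) / of_real (2 * \<mu>)))"
proof -
 define w where "w t x = 1 + l * G t x" for t x
 define S where "S t x = B t * exp (- (of_real \<mu> / (2 * zeta p t) * of_real (x\<^sup>2)))" for t x
 define Gt where "Gt t x = \<i> * S t x + \<i> * (of_real (1 / (2 * \<mu>)) * duhamel_xx p \<mu> B t x)" for t x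
 let ?Gx = "duhamel_x p \<mu> B" and ?Gxx = "duhamel_xx p \<mu> B"
 define \<nu> where "\<nu> = complex_of_real (- 1 / (2 * \<mu>))"
 have w: "w t x \<notin> \<real>\<^sub>\<le>\<^sub>0" "w t x \<noteq> 0" if "t \<in> {0..<T}" for t x
 proof -
  show *: "w t x \<notin> \<real>\<^sub>\<le>\<^sub>0" unfolding w_def by (rule one_plus_notin_nonpos[OF contracted_less_1[OF c that]])
  then show "w t x \<noteq> 0" by auto
 qed
 let ?vt = "%t x. \<nu> * (l * Gt t x / w t x)"
 let ?vx = "%t x. \<nu> * (l * ?Gx t x / w t x)"
 let ?vxx = "%t x. \<nu> * ((l * ?Gxx t x * w t x - l * ?Gx t x * (l * ?Gx t x)) / (w t x)\<^sup>2)"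
 have cw: "continuous_on A (%z. w (fst z) (snd z))" for A
  unfolding w_def by (intro continuous_intros duhamel_continuous[OF p mu B])
 have cS: "continuous_on A (%z. S (fst z) (snd z))" for A unfolding S_def
  by (intro continuous_intros continuous_on_compose2[OF B] continuous_zeta[OF p]) (use width_nonzero[OF p] in auto)
 have cG: "continuous_on A (%z. G (fst z) (snd z))" "continuous_on A (%z. ?Gx (fst z) (snd z))" "continuous_on A (%z. ?Gxx (fst z) (snd z))" for A
  using duhamel_continuous[OF p mu B] by auto
 have slice: "continuous_on UNIV (f t)" if "continuous_on UNIV (%z. f (fst z) (snd z))" for f :: "real => real => complex" and t
  using continuous_on_slices(1)[of UNIV UNIV "%z. f (fst z) (snd z)" t] that by simp
 have Ln_chain: "((%r. \<nu> * Ln (f r)) has_vector_derivative \<nu> * (f' / f r)) (at r)"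
  if "(f has_vector_derivative f') (at r)" "f r \<notin> \<real>\<^sub>\<le>\<^sub>0" for f f' and r :: real
  using field_vector_diff_chain_at[OF that(1) has_field_derivative_Ln[OF that(2)]]
  by (intro has_vector_derivative_mult_right) (simp add: o_def divide_inverse)
 have dwx: "(w t has_vector_derivative l * ?Gx t x) (at x)" for t x
  using has_vector_derivative_add[OF has_vector_derivative_const[of 1] has_vector_derivative_mult_right[OF duhamel_deriv_x[OF p mu B]], of l]
  unfolding w_def[abs_def] by simp
 have vx: "(wave3 l t has_vector_derivative ?vx t x) (at x)" if "t \<in> {0..<T}" for t x
  using Ln_chain[OF dwx w(1)[OF that]] by (simp add: wave3_def[abs_def] w_def[abs_def] \<nu>_def)
 have cvx: "continuous_on UNIV (?vx t)" if "t \<in> {0..<T}" for t using slice[OF cw, of t] slice[OF cG(2), of t] w(2)[OF that]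
  by (intro continuous_intros) auto
 have wd: "has_weak_deriv 1 (W t) (?vx t)" if t: "t \<in> {0<..<T}" for t
 proof -
  have t': "t \<in> {0..<T}" using t by simp
  have "continuous_on UNIV (wave3 l t)" by (rule decaying_continuous_x[OF regular_decaying[OF wave3_regular[OF c, of 0]] t'])
  then have "has_weak_deriv 0 (W t) (wave3 l t)" unfolding W[OF t] by (intro has_weak_deriv_0 continuous_imp_locally_integrable)
  from has_weak_deriv_Suc[OF this vx[OF t'] cvx[OF t']] show ?thesis by simp
 qed
 \<comment> \<open>The Cole-Hopf computation: the square of w_x / w in v_xx cancels the squared
   derivative, and exp (2 \<mu> v) = 1 / w matches the source of the equation for w.\<close>
 have eqn: "(?vx t x)\<^sup>2 + l * S t x * (exp (of_real (2 * \<mu>) * wave3 l t x) / of_real (2 * \<mu>)) =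
   \<i> * ?vt t x + of_real (1 / (2 * \<mu>)) * ?vxx t x" if t: "t \<in> {0..<T}" for t x
 proof -
  have "of_real (2 * \<mu>) * wave3 l t x = - Ln (w t x)" using mu by (simp add: wave3_def w_def)
  then have "exp (of_real (2 * \<mu>) * wave3 l t x) = 1 / w t x" using w(2)[OF t] by (simp add: exp_minus inverse_eq_divide)
  then show ?thesis using w(2)[OF t] mu by (simp add: Gt_def \<nu>_def power2_eq_square divide_simps) (simp add: algebra_simps)
 qed
 let ?F = "%t x. (weak_deriv 1 (W t) x)\<^sup>2 + l * S t x * (exp (of_real (2 * \<mu>) * wave3 l t x) / of_real (2 * \<mu>))"
 have "schrodinger_distributional \<mu> T (wave3 l) ?F"
 proof (rule classical_imp_distributional[where vt="?vt" and vx="?vx" and vxx="?vxx"])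
  fix t x assume t: "t \<in> {0<..<T}"
  then have t': "t \<in> {0..<T}" "t > 0" by auto
  have "((%r. w r x) has_vector_derivative l * Gt t x) (at t)"
   using has_vector_derivative_add[OF has_vector_derivative_const[of 1] has_vector_derivative_mult_right[OF duhamel_deriv_t[OF p mu B t'(2)]], of l x]
   unfolding w_def[abs_def] Gt_def S_def by simp
  from Ln_chain[OF this w(1)[OF t'(1)]] show "((%r. wave3 l r x) has_vector_derivative ?vt t x) (at t)"
   by (simp add: wave3_def[abs_def] w_def[abs_def] \<nu>_def)
  show "(wave3 l t has_vector_derivative ?vx t x) (at x)" by (rule vx[OF t'(1)])
  have iw: "((%x. inverse (w t x)) has_vector_derivative (l * ?Gx t x) * - (inverse (w t x) ^ Suc (Suc 0))) (at x)"
   using field_vector_diff_chain_at[OF dwx[of t x] DERIV_inverse[OF w(2)[OF t'(1)]]] by (simp add: o_def)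
  have "((%x. \<nu> * (l * ?Gx t x * inverse (w t x))) has_vector_derivative
    \<nu> * (l * ?Gx t x * ((l * ?Gx t x) * - (inverse (w t x) ^ Suc (Suc 0))) + l * ?Gxx t x * inverse (w t x))) (at x)"
   by (intro has_vector_derivative_mult_right has_vector_derivative_mult iw duhamel_deriv_xx[OF p mu B])
  moreover have "\<nu> * (l * ?Gx t x * ((l * ?Gx t x) * - (inverse (w t x) ^ Suc (Suc 0))) + l * ?Gxx t x * inverse (w t x)) = ?vxx t x"
   using w(2)[OF t'(1)] by (simp add: field_simps power2_eq_square)
  moreover have "(%x. \<nu> * (l * ?Gx t x * inverse (w t x))) = ?vx t" by (simp add: divide_inverse)
  ultimately show "(?vx t has_vector_derivative ?vxx t x) (at x)" by (simp only:)
 next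
  show "continuous_on ({0<..<T} \<times> UNIV) (%z. wave3 l (fst z) (snd z))"
   by (rule continuous_on_subset[OF decaying_continuous[OF regular_decaying[OF wave3_regular[OF c, of 0]]]]) auto
  show "continuous_on ({0<..<T} \<times> UNIV) (%z. ?vt (fst z) (snd z))"
   unfolding Gt_def by (intro continuous_intros cw cS cG) (use w(2) in auto)
  show "continuous_on ({0<..<T} \<times> UNIV) (%z. ?vxx (fst z) (snd z))"
   by (intro continuous_intros cw cS cG) (use w(2) in auto)
 next
  fix t assume t: "t \<in> {0<..<T}"
  then have t': "t \<in> {0..<T}" by auto
  show "AE x in lborel. ?F t x = \<i> * ?vt t x + of_real (1 / (2 * \<mu>)) * ?vxx t x"
   using weak_deriv_AE(2)[OF wd[OF t]] by eventually_elim (simp only: eqn[OF t'])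
  have "continuous_on UNIV (S t)" by (rule slice[OF cS])
  moreover have "continuous_on UNIV (wave3 l t)" by (rule decaying_continuous_x[OF regular_decaying[OF wave3_regular[OF c, of 0]] t'])
  ultimately have 1: "(%x. l * S t x * (exp (of_real (2 * \<mu>) * wave3 l t x) / of_real (2 * \<mu>))) \<in> borel_measurable lborel"
   using mu by (intro continuous_on_UNIV_measurable continuous_intros) auto
  have "weak_deriv 1 (W t) \<in> borel_measurable lborel"
   using weak_deriv_AE(1)[OF wd[OF t]] unfolding has_weak_deriv_def using locally_integrable_measurable by blast
  then have 2: "(%x. (weak_deriv 1 (W t) x)\<^sup>2) \<in> borel_measurable lborel" by measurable
  show "?F t \<in> borel_measurable lborel" using 1 2 by (rule borel_measurable_add[rotated])
 qed
 then show ?thesis unfolding source l[symmetric] S_def .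
qed

end

section \<open>Initial data, the full solution and its blow-up\<close>

context resonance
begin

definition profile :: "real => complex" where
 "profile x = exp (- (of_real (m / 2) * of_real (x\<^sup>2)))"

definition solution :: "complex => real => real => complex ^ 3" where
 "solution a t x = axis 1 (wave1 m a t x) + axis 2 (wave2 m a t x) + axis 3 (wave3 (\<Lambda> a) t x)"

lemma solution_component:
 "solution a t x $ 1 = wave1 m a t x" "solution a t x $ 2 = wave2 m a t x" "solution a t x $ 3 = wave3 (\<Lambda> a) t x"
 by (simp_all add: solution_def axis_def)

lemma solution_0: "solution a 0 x = axis 1 (a * profile x)"
proof -
 have b: "base 0 = 1" "damp 0 = 1" by (simp_all add: base_def damp_def)
 have "wave1 m a 0 x = a * profile x" "wave2 m a 0 x = 0" "wave3 l 0 x = 0" for l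
  by (simp_all add: wave1_def wave2_def wave3_def gauss_def profile_def b duhamel_0[OF p mu B])
 then show ?thesis by (simp add: solution_def) (simp add: vec_eq_iff axis_def)
qed

lemma bounded_linear_axis_id: "bounded_linear (axis i :: complex => complex ^ 3)" using bounded_linear_axis[of i 1] by simp

lemma solution_regular:
 assumes "contracted T (%t x. \<Lambda> a * G t x)"
 shows "regular T n (solution a)" unfolding solution_def[abs_def]
 by (intro regular_add regular_bounded_linear[OF bounded_linear_axis_id] wave1_regular wave2_regular wave3_regular assms m)

text \<open>The profile is the free Gaussian at time 0, so membership follows from the regularity of
  that path.\<close>

lemma profile_sobolev: "profile \<in> sobolev_space s"
proof -
 have "wave1 m 1 0 = profile" by (simp add: fun_eq_iff wave1_def gauss_def profile_def base_def damp_def)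
 moreover have "continuous_into_sobolev s 1 (wave1 m 1)" by (intro regular_continuous_into_sobolev wave1_regular m)
 then have "wave1 m 1 0 \<in> sobolev_space s" unfolding continuous_into_sobolev_def by simp
 ultimately show ?thesis by simp
qed

lemma initial_sobolev:
 "(%x. axis 1 (a * profile x) :: complex ^ 3) \<in> sobolev_space s"
 "sobolev_norm s (%x. axis 1 (a * profile x) :: complex ^ 3) = norm a * sobolev_norm s profile"
 using sobolev_norm_isometry[OF bounded_linear_axis[of "1 :: 3" a], of "norm a", OF _ profile_sobolev]
 by (simp_all add: norm_axis norm_mult)

text \<open>The profile is 1 at the origin, so the uniform bound excludes norm zero. Data are
  normalised by division by this norm.\<close>

lemma sobolev_norm_profile_pos:
 assumes "1 \<le> s"
 shows "sobolev_norm s profile > 0"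
proof -
 let ?f = "%x. axis 1 (1 * profile x) :: complex ^ 3"
 have "continuous_on UNIV (%x. ?f x $ 1)" by (simp add: axis_def profile_def) (intro continuous_intros; simp)
 from sobolev_norm_sup[OF initial_sobolev(1) assms this, of 0] initial_sobolev(2)[of s 1]
 show ?thesis by (simp add: axis_def profile_def)
qed

lemma solution_is_the_solution:
 assumes c: "contracted T (%t x. \<Lambda> a * G t x)" and s: "1 \<le> s"
 shows "is_the_solution m (2 * m) \<mu> Q s (%x. axis 1 (a * profile x)) T (solution a)"
proof -
 have "schrodinger_distributional \<mu> T (wave3 (\<Lambda> a)) (%t x. (weak_deriv 1 (%y. solution a t y $ 3) x)\<^sup>2 +
  Q (wave1 m a t x) (wave2 m a t x) * (exp (of_real (2 * \<mu>) * wave3 (\<Lambda> a) t x) / of_real (2 * \<mu>)))"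
  by (rule wave3_distributional[OF c refl]) (simp add: solution_component)
 then have sol: "is_solution m (2 * m) \<mu> Q s (%x. axis 1 (a * profile x)) T (solution a)"
  unfolding is_solution_def solution_component using regular_continuous_into_sobolev[OF solution_regular[OF c], of s]
   wave1_distributional[OF m, of T a] wave2_distributional[OF m, of T a] by (simp add: solution_0)
 show ?thesis unfolding is_the_solution_def using solution_unique[OF sol _ m _ mu s Q] sol m by auto
qed

text \<open>At the fixed point x the modulus of w tends to 0 as t tends to T, and the modulus of Ln
  w is at least - ln of it. The bound of point values by the Sobolev norm turns this into a true
  limit, not merely unboundedness.\<close>

lemma solution_blowup:
 assumes c: "contracted T (%t x. \<Lambda> a * G t x)" and T: "T > 0" and x: "\<Lambda> a * G T x = - 1" and s: "1 \<le> s"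
 shows "filterlim (%t. sobolev_norm s (solution a t)) at_top (at_left T)"
proof -
 define w where "w t = 1 + \<Lambda> a * G t x" for t
 have ev: "\<forall>\<^sub>F t in at_left T. t \<in> {0<..<T}" using eventually_at_left_real[OF T] .
 have w0: "w t \<noteq> 0" if "t \<in> {0<..<T}" for t
  using one_plus_notin_nonpos[OF contracted_less_1[OF c, of t x]] that by (auto simp: w_def)
 have "continuous_on UNIV (%t. G t x)"
  using continuous_on_slices(2)[of UNIV UNIV "%z. G (fst z) (snd z)" x] duhamel_continuous(1)[OF p mu B, of UNIV] by simp
 then have "continuous_on UNIV (%t. norm (w t))" unfolding w_def by (intro continuous_intros)
 then have "isCont (%t. norm (w t)) T" by (simp add: continuous_on_eq_continuous_at)
 then have "((%t. norm (w t)) \<longlongrightarrow> norm (w T)) (at_left T)"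
  unfolding isCont_def by (rule filterlim_at_split[THEN iffD1, THEN conjunct1])
 then have "((%t. norm (w t)) \<longlongrightarrow> 0) (at_left T)" using x by (simp add: w_def)
 moreover have "\<forall>\<^sub>F t in at_left T. norm (w t) > 0" using ev by eventually_elim (use w0 in auto)
 ultimately have "filterlim (%t. norm (w t)) (at_right 0) (at_left T)" by (simp add: filterlim_at)
 from filterlim_compose[OF ln_at_0 this] have "filterlim (%t. - ln (norm (w t))) at_top (at_left T)"
  by (simp add: filterlim_uminus_at_top)
 \<comment> \<open>The constant is 1 / (2 \<mu>) from the substitution times 1/2 from the bound of
   point values by the norm.\<close>
 then have lim: "filterlim (%t. 1 / (4 * \<mu>) * - ln (norm (w t))) at_top (at_left T)"
  by (rule filterlim_tendsto_pos_mult_at_top[OF tendsto_const, rotated]) (use mu in simp)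
 show ?thesis
 proof (rule filterlim_at_top_mono[OF lim])
  show "\<forall>\<^sub>F t in at_left T. 1 / (4 * \<mu>) * - ln (norm (w t)) \<le> sobolev_norm s (solution a t)" using ev
  proof eventually_elim
   case (elim t)
   then have t: "t \<in> {0..<T}" by auto
   have "solution a t \<in> sobolev_space s"
    using regular_continuous_into_sobolev[OF solution_regular[OF c], of s] t by (auto simp: continuous_into_sobolev_def)
   moreover have "continuous_on UNIV (%x. solution a t x $ 3)" unfolding solution_component
    by (rule decaying_continuous_x[OF regular_decaying[OF wave3_regular[OF c, of 0]] t])
   ultimately have "norm (solution a t x $ 3) \<le> 2 * sobolev_norm s (solution a t)" using s by (intro sobolev_norm_sup)
   moreover have "norm (solution a t x $ 3) = 1 / (2 * \<mu>) * norm (Ln (w t))"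
    using mu unfolding solution_component wave3_def by (simp add: norm_mult norm_divide w_def)
   moreover have "- ln (norm (w t)) \<le> norm (Ln (w t))" using abs_Re_le_cmod[of "Ln (w t)"] w0[OF elim] by simp
   then have "1 / (2 * \<mu>) * - ln (norm (w t)) \<le> 1 / (2 * \<mu>) * norm (Ln (w t))" using mu by (intro mult_left_mono) auto
   ultimately have "1 / (2 * \<mu>) * - ln (norm (w t)) \<le> 2 * sobolev_norm s (solution a t)" by linarith
   then show ?case by (simp add: field_simps)
  qed
 qed
qed

theorem blowup:
 assumes s: "1 \<le> s"
 shows "\<exists>\<kappa>>0. \<exists>K>0. \<forall>\<epsilon>\<in>{0<..1}. \<exists>\<phi>\<in>sobolev_space s. sobolev_norm s \<phi> = \<epsilon> \<and>
  (\<exists>T\<in>{\<kappa> / \<epsilon> ^ (k * N)<..<K / \<epsilon> ^ (k * N)}. \<exists>u. is_the_solution m (2 * m) \<mu> Q s \<phi> T u \<and>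
   filterlim (%t. sobolev_norm s (u t)) at_top (at_left T))"
proof -
 define S where "S = sobolev_norm s profile"
 have S: "S > 0" using sobolev_norm_profile_pos[OF s] by (simp add: S_def)
 obtain C c t0 where g: "C > 0" "c > 0" "t0 > 0" "!!t x. t \<ge> 0 ==> norm (G t x) ^ N \<le> C * t"
  "!!t. t \<ge> t0 ==> c * t \<le> norm (G t 0) ^ N" by (rule duhamel_growth[OF N]) blast
 have N0: "N > 0" using N by (cases N) auto
 \<comment> \<open>Half of the bound that the upper growth of G yields, to obtain a strict
   inequality.\<close>
 define \<kappa> where "\<kappa> = S ^ (k * N) / (2 * C)"
 \<comment> \<open>The lower growth of G holds only from t0 on, which matters when \<epsilon> is not
   small; since \<epsilon> is at most 1, t0 is absorbed into a multiple of the inverse power, and 1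
   makes the inequality strict.\<close>
 define K where "K = t0 + 1 + S ^ (k * N) / c"
 have pos: "\<kappa> > 0" "K > 0" using S g by (auto simp: \<kappa>_def K_def intro!: add_pos_pos)
 have "\<exists>\<phi>\<in>sobolev_space s. sobolev_norm s \<phi> = \<epsilon> \<and>
  (\<exists>T\<in>{\<kappa> / \<epsilon> ^ (k * N)<..<K / \<epsilon> ^ (k * N)}. \<exists>u. is_the_solution m (2 * m) \<mu> Q s \<phi> T u \<and>
   filterlim (%t. sobolev_norm s (u t)) at_top (at_left T))" if eps: "\<epsilon> \<in> {0<..1}" for \<epsilon>
 proof -
  define r where "r = \<epsilon> / S"
  \<comment> \<open>The level that \<bar>G\<bar> must reach for \<Lambda> a G to have modulus 1, as
    \<Lambda> a has modulus r^k.\<close>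
  define M where "M = 1 / r ^ k"
  have r: "r > 0" using eps S by (simp add: r_def)
  have M: "M > 0" using r by (simp add: M_def)
  have MN: "M ^ N = S ^ (k * N) / \<epsilon> ^ (k * N)" by (simp add: M_def r_def power_divide flip: power_mult)
  have ep: "0 < \<epsilon> ^ (k * N)" "\<epsilon> ^ (k * N) \<le> 1" using eps by (auto intro: power_le_one)
  define t1 where "t1 = max t0 (M ^ N / c)"
  have t1: "t1 \<ge> t0" "M ^ N / c \<le> t1" by (auto simp: t1_def)
  have "M ^ N \<le> c * t1" using t1(2) g(2) by (simp add: divide_le_eq mult.commute)
  also have "... \<le> norm (G t1 0) ^ N" by (rule g(5)[OF t1(1)])
  finally have "M \<le> norm (G t1 0)" using N0 M by (simp add: power_mono_iff)
  then obtain T x where T: "0 < T" "T \<le> t1" "norm (G T x) = M" "!!t y. 0 \<le> t ==> t < T ==> norm (G t y) < M"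
   using first_hitting_time[of M t1] M t1(1) g(3) by (metis less_eq_real_def order_trans)
  have GT: "G T x \<noteq> 0" using T(3) M by auto
  have "norm (- of_real M / G T x) = 1" using T(3) M GT by (simp add: norm_divide)
  \<comment> \<open>The phase is adjusted only after T and x are known. This is legitimate because
    G, and hence the hitting time, does not depend on a.\<close>
  from phase[OF r this] obtain a where a: "norm a = r" "\<Lambda> a = of_real (r ^ k) * (- of_real M / G T x)" by blast
  have Mr: "r ^ k * M = 1" using r by (simp add: M_def)
  have La: "\<Lambda> a = - 1 / G T x"
  proof -
   have "\<Lambda> a = - of_real (r ^ k * M) / G T x" unfolding a(2) by simp
   then show ?thesis unfolding Mr by simp
  qed
  have c: "contracted T (%t x. \<Lambda> a * G t x)" unfolding contracted_def
  proof (intro allI impI)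
   fix \<tau> assume \<tau>: "\<tau> < T"
   have "decaying T G" by (rule regular_decaying[OF duhamel_regular[OF p mu B, of T 0]])
   from decaying_strict_bound[OF this \<tau> M] T(4) \<tau>
   obtain \<rho> where \<rho>: "\<rho> < M" "\<forall>t\<in>{0..\<tau>}. \<forall>y. norm (G t y) \<le> \<rho>" by (metis atLeastAtMost_iff le_less_trans)
   have "norm (\<Lambda> a) = 1 / M" using T(3) by (simp add: La norm_divide)
   then have "norm (\<Lambda> a * G t y) \<le> \<rho> / M" if "t \<in> {0..\<tau>}" for t y
    using \<rho>(2) that M by (simp add: norm_mult divide_right_mono)
   moreover have "\<rho> / M < 1" using \<rho>(1) M by simp
   ultimately show "\<exists>\<rho><1. \<forall>t\<in>{0..\<tau>}. \<forall>x. norm (\<Lambda> a * G t x) \<le> \<rho>" by blast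
  qed
  have norm_phi: "sobolev_norm s (%x. axis 1 (a * profile x) :: complex ^ 3) = \<epsilon>"
   unfolding initial_sobolev(2) a(1) S_def[symmetric] r_def using S by simp
  have "\<kappa> / \<epsilon> ^ (k * N) < T"
  proof -
   have "M ^ N \<le> C * T" using g(4)[of T x] T by simp
   moreover have "\<kappa> / \<epsilon> ^ (k * N) = M ^ N / (2 * C)" by (simp add: \<kappa>_def MN)
   moreover have "M ^ N / (2 * C) < M ^ N / C" using M g(1) by (simp add: field_simps)
   moreover have "M ^ N / C \<le> T" using \<open>M ^ N \<le> C * T\<close> g(1) by (simp add: divide_le_eq mult.commute)
   ultimately show ?thesis by linarith
  qed
  moreover have "T < K / \<epsilon> ^ (k * N)"
  proof -
   have 1: "u \<le> u / \<epsilon> ^ (k * N)" if "u \<ge> 0" for u using ep that by (simp add: le_divide_eq mult_left_le)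
   have "K / \<epsilon> ^ (k * N) = t0 / \<epsilon> ^ (k * N) + 1 / \<epsilon> ^ (k * N) + M ^ N / c"
    by (simp add: K_def MN add_divide_distrib)
   moreover have "t1 \<le> t0 + M ^ N / c" using g M by (simp add: t1_def)
   ultimately show ?thesis using 1[of t0] 1[of 1] g(3) T(2) by linarith
  qed
  ultimately have "T \<in> {\<kappa> / \<epsilon> ^ (k * N)<..<K / \<epsilon> ^ (k * N)}" by simp
  moreover have "\<Lambda> a * G T x = - 1" using GT by (simp add: La)
  ultimately show ?thesis
   using initial_sobolev(1)[of a s] norm_phi solution_is_the_solution[OF c s] solution_blowup[OF c T(1) _ s, of x] by blast
 qed
 then show ?thesis using pos by blast
qed

end

section \<open>The four nonlinearities\<close>

lemma norm_damp: "norm (damp t) = 1 / sqrt (norm (base t))" by (simp add: damp_def norm_divide)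

lemma norm_damp_le: "norm (damp t) \<le> 1"
proof -
 have "1 \<le> sqrt (norm (base t))" using abs_Re_le_cmod[of "base t"] by (simp add: Re_base)
 then have "1 / sqrt (norm (base t)) \<le> 1 / 1" by (intro frac_le) auto
 then show ?thesis unfolding norm_damp div_by_1 .
qed

lemma norm_damp_le_powr:
 assumes "t \<ge> 0"
 shows "norm (damp t) \<le> sqrt 2 * (1 + t) powr (- (1/2))"
proof -
 have "1 + t \<le> norm (base t) + norm (base t)" using abs_Re_le_cmod[of "base t"] abs_Im_le_cmod[of "base t"] by (simp add: base_def)
 then have "sqrt ((1 + t) / 2) \<le> sqrt (norm (base t))" by simp
 then have "norm (damp t) \<le> 1 / sqrt ((1 + t) / 2)" unfolding norm_damp using assms by (intro frac_le) auto
 also have "... = sqrt 2 * (1 + t) powr (- (1/2))"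
 proof -
  have "(1 + t) powr (- (1/2)) = 1 / sqrt (1 + t)" using powr_half_sqrt[of "1 + t"] assms by (simp only: powr_minus_divide)
  then show ?thesis by (simp only: real_sqrt_divide divide_divide_eq_right mult_1_left times_divide_eq_right mult_1_right)
 qed
 finally show ?thesis .
qed

lemma damp_tendsto: "(damp \<longlongrightarrow> 0) at_top"
proof -
 have "((%t::real. sqrt 2 * (1 + t) powr (- (1/2))) \<longlongrightarrow> sqrt 2 * 0) at_top"
  by (intro tendsto_mult tendsto_const tendsto_neg_powr filterlim_tendsto_add_at_top[OF tendsto_const] filterlim_ident) simp
 then have lim: "((%t::real. sqrt 2 * (1 + t) powr (- (1/2))) \<longlongrightarrow> 0) at_top" by simp
 have "\<forall>\<^sub>F t in at_top. norm (damp t) \<le> sqrt 2 * (1 + t) powr (- (1/2))"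
  using eventually_ge_at_top[of 0] by eventually_elim (rule norm_damp_le_powr)
 then show ?thesis using lim by (rule Lim_null_comparison)
qed

lemma scaled_damp_tendsto: "((%t. of_real (t powr (1/2)) * damp t) \<longlongrightarrow> 1 / csqrt \<i>) at_top"
proof (rule Lim_transform_eventually)
 have inv: "((%t. complex_of_real (1 / t)) \<longlongrightarrow> of_real 0) at_top"
  by (intro tendsto_of_real tendsto_divide_0[OF tendsto_const]) (simp add: filterlim_at_top_imp_at_infinity filterlim_ident)
 have i: "\<i> \<notin> \<real>\<^sub>\<le>\<^sub>0" by (simp add: complex_nonpos_Reals_iff)
 have "((%t. of_real (1 / t) + \<i>) \<longlongrightarrow> of_real 0 + \<i>) at_top" by (intro tendsto_add tendsto_const inv)
 then have "((%t. of_real (1 / t) + \<i>) \<longlongrightarrow> \<i>) at_top" by simp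
 from isCont_tendsto_compose[OF continuous_at_csqrt[OF i] this]
 have "((%t. csqrt (of_real (1 / t) + \<i>)) \<longlongrightarrow> csqrt \<i>) at_top" .
 then show "((%t. 1 / csqrt (of_real (1 / t) + \<i>)) \<longlongrightarrow> 1 / csqrt \<i>) at_top"
  by (intro tendsto_divide tendsto_const) (simp_all del: csqrt_ii)
 show "\<forall>\<^sub>F t in at_top. 1 / csqrt (of_real (1 / t) + \<i>) = of_real (t powr (1/2)) * damp t"
  using eventually_gt_at_top[of 0]
 proof eventually_elim
  case (elim t)
  have n: "of_real (1 / t) + \<i> \<notin> \<real>\<^sub>\<le>\<^sub>0" by (simp add: complex_nonpos_Reals_iff)
  have "base t = of_real t * (of_real (1 / t) + \<i>)" using elim by (simp add: base_def field_simps)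
  then have "csqrt (base t) = of_real (sqrt t) * csqrt (of_real (1 / t) + \<i>)" using csqrt_scale[OF _ n, of t] elim by simp
  then show ?case using elim by (simp add: damp_def powr_half_sqrt)
 qed
qed

lemma inverse_base: "1 / base t = (1 - \<i> * of_real t) / of_real (1 + t\<^sup>2)"
proof -
 have "complex_of_real (1 + t\<^sup>2) \<noteq> 0" using zero_le_power2[of t] unfolding of_real_eq_0_iff by linarith
 then show ?thesis using base_nonzero(1)[of t] by (simp add: frac_eq_eq base_def algebra_simps power2_eq_square)
qed

lemma rate_eq: "p \<ge> 1 ==> of_real \<mu> / (2 * zeta p t) = of_real (\<mu> / 2) * ((of_real p - \<i> * of_real t) / of_real (1 + t\<^sup>2))"
 by (simp only: inverse_zeta[symmetric]) simp

lemma wave_rate_eq: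
 "of_real m / base t = of_real m * ((1 - \<i> * of_real t) / of_real (1 + t\<^sup>2))"
 "of_real m / (2 * base t) = of_real (m / 2) * ((1 - \<i> * of_real t) / of_real (1 + t\<^sup>2))"
 unfolding inverse_base[symmetric] by simp_all

lemma phase_exists:
 assumes "j > 0" "norm c = 1"
 shows "\<exists>\<theta>. cis \<theta> ^ j = c"
proof -
 have "cis (Arg c / real j) ^ j = cis (Arg c)" using assms(1) unfolding Complex.DeMoivre by simp
 moreover have "c \<noteq> 0" using assms(2) by auto
 then have "cis (Arg c) = c" using assms(2) cis_Arg[of c] by (simp add: sgn_eq)
 ultimately show ?thesis by metis
qed

lemma forcing_bounded:
 assumes "p \<ge> 1" "\<mu> > 0" "continuous_on UNIV B" "!!t. norm (B t) \<le> C" "(B \<longlongrightarrow> b) at_top" "b \<noteq> 0"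
 shows "forcing p \<mu> B 0 C b"
proof
 show "norm (B t) \<le> C * (1 + t) powr (- 0)" if "t \<ge> 0" for t using assms(4)[of t] that by simp
 show "((%t. of_real (t powr 0) * B t) \<longlongrightarrow> b) at_top" by (rule Lim_transform_eventually[OF assms(5)])
   (use eventually_gt_at_top[of 0] in \<open>eventually_elim; simp\<close>)
qed (use assms in auto)

lemma forcing_square:
 assumes "m > 0"
 shows "forcing 1 (4 * m) (%t. 4 * (1 - damp t)\<^sup>2) 0 16 4"
proof (rule forcing_bounded)
 have n: "norm (1 - damp t) \<le> 2" for t using norm_triangle_ineq4[of 1 "damp t"] norm_damp_le[of t] by simp
 show "norm (4 * (1 - damp t)\<^sup>2) \<le> 16" for t using power_mono[OF n, of t 2] by (simp add: norm_mult norm_power)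
 have "((%t. 4 * (1 - damp t)\<^sup>2) \<longlongrightarrow> 4 * (1 - 0)\<^sup>2) at_top" by (intro tendsto_intros damp_tendsto)
 then show "((%t. 4 * (1 - damp t)\<^sup>2) \<longlongrightarrow> 4) at_top" by simp
 show "continuous_on UNIV (%t. 4 * (1 - damp t)\<^sup>2)" by (intro continuous_intros continuous_damp)
qed (use assms in auto)

lemma forcing_modulus:
 assumes "m > 0"
 shows "forcing 2 (2 * m) (%t. - 4 * of_real (norm (1 - damp t)) * (1 - damp t)) 0 16 (- 4)"
proof (rule forcing_bounded)
 have n: "norm (1 - damp t) \<le> 2" for t using norm_triangle_ineq4[of 1 "damp t"] norm_damp_le[of t] by simp
 show "norm (- 4 * of_real (norm (1 - damp t)) * (1 - damp t)) \<le> 16" for t using mult_mono[OF n[of t] n[of t]] by (simp add: norm_mult)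
 have "((%t. - 4 * of_real (norm (1 - damp t)) * (1 - damp t)) \<longlongrightarrow> - 4 * of_real (norm (1 - 0 :: complex)) * (1 - 0)) at_top"
  by (intro tendsto_intros damp_tendsto)
 then show "((%t. - 4 * of_real (norm (1 - damp t)) * (1 - damp t)) \<longlongrightarrow> - 4) at_top" by simp
 show "continuous_on UNIV (%t. - 4 * of_real (norm (1 - damp t)) * (1 - damp t))" by (intro continuous_intros continuous_damp)
qed (use assms in auto)

text \<open>Both products with u_1 at once, plain and conjugated. The factor \<open>damp\<close>
  decays like t^(-1/2) and is responsible for e = 1/2.\<close>

lemma forcing_damped:
 assumes p: "p \<ge> 1" "\<mu> > 0" and h: "h = id \<or> h = cnj"
 shows "forcing p \<mu> (%t. - 2 * h (damp t) * (1 - damp t)) (1/2) (4 * sqrt 2) (- 2 * h (1 / csqrt \<i>))"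
proof
 have h': "bounded_linear h" "!!z. norm (h z) = norm z" "!!r z. h (of_real r * z) = of_real r * h z"
  using h by (auto simp: bounded_linear_cnj bounded_linear_ident id_def)
 have n: "norm (1 - damp t) \<le> 2" for t using norm_triangle_ineq4[of 1 "damp t"] norm_damp_le[of t] by simp
 show "norm (- 2 * h (damp t) * (1 - damp t)) \<le> 4 * sqrt 2 * (1 + t) powr (- (1/2))" if "t \<ge> 0" for t
  using mult_mono[OF norm_damp_le_powr[OF that] n[of t]] by (simp add: norm_mult h'(2))
 show "continuous_on UNIV (%t. - 2 * h (damp t) * (1 - damp t))"
  by (intro continuous_intros continuous_damp bounded_linear.continuous_on[OF h'(1)])
 have "((%t. - 2 * h (of_real (t powr (1/2)) * damp t) * (1 - damp t)) \<longlongrightarrow> - 2 * h (1 / csqrt \<i>) * (1 - 0)) at_top"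
  by (intro tendsto_intros damp_tendsto scaled_damp_tendsto bounded_linear.tendsto[OF h'(1)])
 then show "((%t. of_real (t powr (1/2)) * (- 2 * h (damp t) * (1 - damp t))) \<longlongrightarrow> - 2 * h (1 / csqrt \<i>)) at_top"
  unfolding h'(3) by (simp add: mult_ac del: csqrt_ii)
 have "norm (- 2 * h (1 / csqrt \<i>)) \<noteq> 0" unfolding norm_mult h'(2) by (simp del: csqrt_ii)
 then show "- 2 * h (1 / csqrt \<i>) \<noteq> 0" by (simp del: csqrt_ii)
qed (use p in auto)

lemma quadratic_Lipschitz_square2: "quadratic_Lipschitz (%z w. w\<^sup>2)" unfolding quadratic_Lipschitz_def
proof (intro conjI exI[of _ 1] allI)
 fix z w z' w' :: complex
 have "norm (w\<^sup>2 - w'\<^sup>2) = norm (w - w') * norm (w + w')" by (simp add: power2_eq_square algebra_simps flip: norm_mult)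
 also have "... \<le> (norm (z - z') + norm (w - w')) * (norm z + norm w + norm z' + norm w')"
 proof (rule mult_mono)
  show "norm (w + w') \<le> norm z + norm w + norm z' + norm w'"
   using norm_triangle_ineq[of w w'] norm_ge_zero[of z] norm_ge_zero[of z'] by linarith
 qed auto
 finally show "norm (w\<^sup>2 - w'\<^sup>2) \<le> 1 * ((norm (z - z') + norm (w - w')) * (norm z + norm w + norm z' + norm w'))" by simp
qed (auto intro!: continuous_intros)

lemma quadratic_Lipschitz_mult:
 assumes h: "h = id \<or> h = cnj"
 shows "quadratic_Lipschitz (%z w. h z * w)" unfolding quadratic_Lipschitz_def
proof (intro conjI exI[of _ 1] allI)
 have h': "continuous_on A (%z. h (f z))" if "continuous_on A f" for f :: "complex \<times> complex => complex" and A
  using h that by (auto intro: continuous_intros)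
 then show "continuous_on UNIV (%z. h (fst z) * snd z)"
  by (rule continuous_on_mult[OF _ continuous_on_snd[OF continuous_on_id]]) (rule continuous_on_fst[OF continuous_on_id])
 fix z w z' w' :: complex
 have e: "norm (h z - h z') = norm (z - z')" "norm (h z') = norm z'" using h by (auto simp flip: complex_cnj_diff)
 have "h z * w - h z' * w' = (h z - h z') * w + h z' * (w - w')" by (simp add: algebra_simps)
 then have "norm (h z * w - h z' * w') \<le> norm (z - z') * norm w + norm z' * norm (w - w')"
  using norm_triangle_ineq[of "(h z - h z') * w" "h z' * (w - w')"] by (simp add: norm_mult e)
 also have "... \<le> norm (z - z') * (norm z + norm w + norm z' + norm w') + (norm z + norm w + norm z' + norm w') * norm (w - w')"
  by (intro add_mono mult_left_mono mult_right_mono) auto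
 also have "... = 1 * ((norm (z - z') + norm (w - w')) * (norm z + norm w + norm z' + norm w'))" by (simp add: algebra_simps)
 finally show "norm (h z * w - h z' * w') \<le> 1 * ((norm (z - z') + norm (w - w')) * (norm z + norm w + norm z' + norm w'))" .
qed (use h in auto)

lemma quadratic_Lipschitz_modulus: "quadratic_Lipschitz (%z w. of_real (norm w) * w)" unfolding quadratic_Lipschitz_def
proof (intro conjI exI[of _ 1] allI)
 fix z w z' w' :: complex
 have "of_real (norm w) * w - of_real (norm w') * w' = of_real (norm w - norm w') * w + of_real (norm w') * (w - w')"
  by (simp add: algebra_simps)
 then have "norm (of_real (norm w) * w - of_real (norm w') * w') \<le> norm (of_real (norm w - norm w') * w) + norm (of_real (norm w') * (w - w'))"
  by (simp only: norm_triangle_ineq)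
 also have "... = \<bar>norm w - norm w'\<bar> * norm w + norm w' * norm (w - w')" by (simp only: norm_mult norm_of_real) simp
 also have "... \<le> norm (w - w') * norm w + norm w' * norm (w - w')"
  by (intro add_right_mono mult_right_mono norm_triangle_ineq3) simp
 also have "... = norm (w - w') * (norm w + norm w')" by (simp add: algebra_simps)
 also have "... \<le> (norm (z - z') + norm (w - w')) * (norm z + norm w + norm z' + norm w')"
  by (intro mult_mono) (auto intro: add_nonneg_nonneg)
 finally show "norm (of_real (norm w) * w - of_real (norm w') * w') \<le> 1 * ((norm (z - z') + norm (w - w')) * (norm z + norm w + norm z' + norm w'))" by simp
qed (auto intro!: continuous_intros)

section \<open>The resonance relations between the masses\<close>

lemma exp_neg_sum: "exp (- ((u + v) * y :: complex)) = exp (- (u * y)) * exp (- (v * y))" by (simp add: algebra_simps flip: exp_add)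

text \<open>With z = 1 + \<i> t, the rates add up to 2 m / z = 4 m / (2 z): mass 4 m and p = 1. The
  amplitude keeps order a^4, so N = 1.\<close>

lemma resonance_square:
 assumes m: "m > 0"
 shows "resonance 1 (4 * m) (%t. 4 * (1 - damp t)\<^sup>2) 0 16 4 m (%z w. w\<^sup>2) (%a. a ^ 4) 4 1"
proof (intro resonance.intro forcing_square[OF m] resonance_axioms.intro m quadratic_Lipschitz_square2)
 fix r :: real and c :: complex assume rc: "r > 0" "norm c = 1"
 obtain \<theta> where "cis \<theta> ^ 4 = c" using phase_exists[OF _ rc(2), of 4] by auto
 then show "\<exists>a. norm a = r \<and> a ^ 4 = of_real (r ^ 4) * c"
  using rc by (intro exI[of _ "of_real r * cis \<theta>"]) (simp add: norm_mult power_mult_distrib)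
next
 fix a t x
 have e: "of_real (4 * m) / (2 * zeta 1 t) = of_real m / base t + of_real m / base t"
  unfolding rate_eq[OF order_refl] wave_rate_eq of_real_1 distrib_right[symmetric] of_real_add[symmetric]
  by (intro arg_cong2[where f="(*)"] arg_cong[where f=of_real] refl) simp
 show "(wave2 m a t x)\<^sup>2 = a ^ 4 * (4 * (1 - damp t)\<^sup>2 * exp (- (of_real (4 * m) / (2 * zeta 1 t) * of_real (x\<^sup>2))))"
  unfolding e exp_neg_sum wave2_def gauss_def by algebra
qed simp

text \<open>With z = 1 + \<i> t, the rates add up to m / (2 z) + m / z = 3 m / (2 z): mass 3 m and p
  = 1.\<close>

lemma resonance_product:
 assumes m: "m > 0"
 shows "resonance 1 (3 * m) (%t. - 2 * id (damp t) * (1 - damp t)) (1/2) (4 * sqrt 2) (- 2 * id (1 / csqrt \<i>)) m (%z w. z * w) (%a. a ^ 3) 3 2"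
proof (intro resonance.intro forcing_damped resonance_axioms.intro m)
 show "quadratic_Lipschitz (%z w. z * w)" using quadratic_Lipschitz_mult[of id] by simp
 fix r :: real and c :: complex assume rc: "r > 0" "norm c = 1"
 obtain \<theta> where "cis \<theta> ^ 3 = c" using phase_exists[OF _ rc(2), of 3] by auto
 then show "\<exists>a. norm a = r \<and> a ^ 3 = of_real (r ^ 3) * c"
  using rc by (intro exI[of _ "of_real r * cis \<theta>"]) (simp add: norm_mult power_mult_distrib)
next
 fix a t x
 have e: "of_real (3 * m) / (2 * zeta 1 t) = of_real m / (2 * base t) + of_real m / base t"
  unfolding rate_eq[OF order_refl] wave_rate_eq of_real_1 distrib_right[symmetric] of_real_add[symmetric]
  by (intro arg_cong2[where f="(*)"] arg_cong[where f=of_real] refl) simp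
 show "wave1 m a t x * wave2 m a t x = a ^ 3 * (- 2 * id (damp t) * (1 - damp t) * exp (- (of_real (3 * m) / (2 * zeta 1 t) * of_real (x\<^sup>2))))"
  unfolding e exp_neg_sum wave1_def wave2_def gauss_def id_apply by algebra
qed (use m in auto)

text \<open>The rates add up to (m / 2) ((1 + \<i> t) + 2 (1 - \<i> t)) / (1 + t^2), whose numerator
  is 3 - \<i> t; hence mass m and p = 3. As cnj a times a^2 has the phase of a itself, no root has
  to be extracted.\<close>

lemma resonance_conjugate:
 assumes m: "m > 0"
 shows "resonance 3 m (%t. - 2 * cnj (damp t) * (1 - damp t)) (1/2) (4 * sqrt 2) (- 2 * cnj (1 / csqrt \<i>)) m (%z w. cnj z * w) (%a. cnj a * a\<^sup>2) 3 2"
proof (intro resonance.intro forcing_damped resonance_axioms.intro m)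
 show "quadratic_Lipschitz (%z w. cnj z * w)" using quadratic_Lipschitz_mult[of cnj] by simp
 fix r :: real and c :: complex assume rc: "r > 0" "norm c = 1"
 have "cnj c * c = 1" using rc(2) complex_norm_square[of c] by (simp add: mult.commute)
 then have "cnj (of_real r * c) * (of_real r * c)\<^sup>2 = of_real (r ^ 3) * c" by (simp add: power2_eq_square power3_eq_cube mult_ac)
 then show "\<exists>a. norm a = r \<and> cnj a * a\<^sup>2 = of_real (r ^ 3) * c"
  using rc by (intro exI[of _ "of_real r * c"]) (simp add: norm_mult)
next
 fix a t x
 have "cnj (of_real m / (2 * base t)) = of_real (m / 2) * ((1 + \<i> * of_real t) / of_real (1 + t\<^sup>2))"
  unfolding wave_rate_eq by simp
 moreover have "of_real (m / 2) * (of_real 3 - \<i> * of_real t) = of_real (m / 2) * (1 + \<i> * of_real t) + of_real m * (1 - \<i> * of_real t)"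
  by (simp add: field_simps)
 moreover have "(3::real) \<ge> 1" by simp
 ultimately have e: "of_real m / (2 * zeta 3 t) = cnj (of_real m / (2 * base t)) + of_real m / base t"
  by (simp only: rate_eq wave_rate_eq(1) times_divide_eq_right add_divide_distrib[symmetric])
 have "cnj (wave1 m a t x) = cnj a * cnj (damp t) * exp (- (cnj (of_real m / (2 * base t)) * of_real (x\<^sup>2)))"
  unfolding wave1_def gauss_def by (simp add: exp_cnj)
 then show "cnj (wave1 m a t x) * wave2 m a t x = cnj a * a\<^sup>2 * (- 2 * cnj (damp t) * (1 - damp t) * exp (- (of_real m / (2 * zeta 3 t) * of_real (x\<^sup>2))))"
  unfolding e exp_neg_sum wave2_def gauss_def by algebra
qed (use m in auto)

text \<open>The modulus contributes only the real part m / (1 + t^2) of the rate; with m (1 - \<i>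
  t) / (1 + t^2) this makes m (2 - \<i> t) / (1 + t^2), hence mass 2 m and p = 2.\<close>

lemma resonance_modulus:
 assumes m: "m > 0"
 shows "resonance 2 (2 * m) (%t. - 4 * of_real (norm (1 - damp t)) * (1 - damp t)) 0 16 (- 4) m
  (%z w. of_real (norm w) * w) (%a. of_real ((norm a)\<^sup>2) * a\<^sup>2) 4 1"
proof (intro resonance.intro forcing_modulus[OF m] resonance_axioms.intro m quadratic_Lipschitz_modulus)
 fix r :: real and c :: complex assume rc: "r > 0" "norm c = 1"
 obtain \<theta> where "cis \<theta> ^ 2 = c" using phase_exists[OF _ rc(2), of 2] by auto
 then show "\<exists>a. norm a = r \<and> of_real ((norm a)\<^sup>2) * a\<^sup>2 = of_real (r ^ 4) * c"
  using rc by (intro exI[of _ "of_real r * cis \<theta>"]) (simp add: norm_mult power_mult_distrib power4_eq_xxxx power2_eq_square)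
next
 fix a t x
 have R: "Re (of_real m / base t) = m / (1 + t\<^sup>2)" unfolding wave_rate_eq by (simp add: Re_divide_of_real)
 have "of_real (2 * m / 2) * (of_real 2 - \<i> * of_real t) = of_real m + of_real m * (1 - \<i> * of_real t)" by (simp add: field_simps)
 moreover have "(2::real) \<ge> 1" by simp
 ultimately have e: "of_real (2 * m) / (2 * zeta 2 t) = of_real (m / (1 + t\<^sup>2)) + of_real m / base t"
  by (simp only: rate_eq wave_rate_eq(1) of_real_divide[of m] times_divide_eq_right add_divide_distrib[symmetric])
 have "norm (wave2 m a t x) = 2 * (norm a)\<^sup>2 * norm (1 - damp t) * exp (- (m / (1 + t\<^sup>2) * x\<^sup>2))"
 proof -
  have "Re (u * of_real y) = Re u * y" for u y by simp
  then have "Re (- (of_real m / base t * of_real (x\<^sup>2))) = - (m / (1 + t\<^sup>2) * x\<^sup>2)" by (simp only: uminus_complex.sel R)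
  then show ?thesis unfolding wave2_def gauss_def norm_mult norm_exp_eq_Re by (simp add: norm_power)
 qed
 then have "of_real (norm (wave2 m a t x)) = 2 * of_real ((norm a)\<^sup>2) * of_real (norm (1 - damp t)) * exp (- (complex_of_real (m / (1 + t\<^sup>2)) * of_real (x\<^sup>2)))"
  by (simp add: exp_of_real[symmetric])
 then show "of_real (norm (wave2 m a t x)) * wave2 m a t x = of_real ((norm a)\<^sup>2) * a\<^sup>2 *
  (- 4 * of_real (norm (1 - damp t)) * (1 - damp t) * exp (- (of_real (2 * m) / (2 * zeta 2 t) * of_real (x\<^sup>2))))"
  unfolding e exp_neg_sum wave2_def gauss_def by algebra
qed simp

theorem theorem1:
  fixes m1 m2 m3 :: real
  assumes "m1 > 0" and "m2 > 0" and "m3 > 0"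
  shows "(m2 = 2 * m1 \<and> m3 = 4 * m1 \<longrightarrow>
      (\<forall>s\<ge>1. \<exists>\<kappa>>0. \<exists>K>0. \<forall>\<epsilon>\<in>{0<..1}.
        \<exists>\<phi>\<in>sobolev_space s. sobolev_norm s \<phi> = \<epsilon> \<and>
          (\<exists>T\<in>{\<kappa> / \<epsilon> ^ 4<..<K / \<epsilon> ^ 4}. \<exists>u.
             is_the_solution m1 m2 m3 (\<lambda>z w. w\<^sup>2) s \<phi> T u \<and>
             filterlim (\<lambda>t. sobolev_norm s (u t)) at_top (at_left T)))) \<and>
    (m2 = 2 * m1 \<and> m3 = 3 * m1 \<longrightarrow>
      (\<forall>s\<ge>1. \<exists>\<kappa>>0. \<exists>K>0. \<forall>\<epsilon>\<in>{0<..1}.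
        \<exists>\<phi>\<in>sobolev_space s. sobolev_norm s \<phi> = \<epsilon> \<and>
          (\<exists>T\<in>{\<kappa> / \<epsilon> ^ 6<..<K / \<epsilon> ^ 6}. \<exists>u.
             is_the_solution m1 m2 m3 (\<lambda>z w. z * w) s \<phi> T u \<and>
             filterlim (\<lambda>t. sobolev_norm s (u t)) at_top (at_left T)))) \<and>
    (m2 = 2 * m1 \<and> m3 = m1 \<longrightarrow>
      (\<forall>s\<ge>1. \<exists>\<kappa>>0. \<exists>K>0. \<forall>\<epsilon>\<in>{0<..1}.
        \<exists>\<phi>\<in>sobolev_space s. sobolev_norm s \<phi> = \<epsilon> \<and>
          (\<exists>T\<in>{\<kappa> / \<epsilon> ^ 6<..<K / \<epsilon> ^ 6}. \<exists>u.
             is_the_solution m1 m2 m3 (\<lambda>z w. cnj z * w) s \<phi> T u \<and>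
             filterlim (\<lambda>t. sobolev_norm s (u t)) at_top (at_left T)))) \<and>
    (m2 = 2 * m1 \<and> m3 = 2 * m1 \<longrightarrow>
      (\<exists>\<kappa>>0. \<exists>K>0. \<forall>\<epsilon>\<in>{0<..1}.
        \<exists>\<phi>\<in>sobolev_space 1. sobolev_norm 1 \<phi> = \<epsilon> \<and>
          (\<exists>T\<in>{\<kappa> / \<epsilon> ^ 4<..<K / \<epsilon> ^ 4}. \<exists>u.
             is_the_solution m1 m2 m3 (\<lambda>z w. of_real (cmod w) * w) 1 \<phi> T u \<and>
             filterlim (\<lambda>t. sobolev_norm 1 (u t)) at_top (at_left T))))"
proof -
  \<comment> \<open>The exponents k N: degree 4 with N = 1 for undamped sources, degree 3 with N = 2
    for those that contain u_1.\<close>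
  have e: "4 * 1 = (4::nat)" "3 * 2 = (6::nat)" by simp_all
  show ?thesis
    using resonance.blowup[OF resonance_square[OF assms(1)], unfolded e]
      resonance.blowup[OF resonance_product[OF assms(1)], unfolded e]
      resonance.blowup[OF resonance_conjugate[OF assms(1)], unfolded e]
      resonance.blowup[OF resonance_modulus[OF assms(1)] order_refl, unfolded e]
    by (intro conjI impI allI; elim conjE; simp only:)
qed

end
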